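(* Let $\Lambda=\Lambda(T) = KQ/I$ be the gentle algebra of a triangulation $T$ of a surface and let $M(v)$ and $M(w)$ be indecomposable string modules with corresponding arcs $\gamma_v$ and $\gamma_w$. Then $$\dim\operatorname{Ext}_\Lambda^4(M(v),M(w))=\begin{cases} 2 & \text{if } \gamma_v,\gamma_w \text{ are in Case 1},\\ 1 & \text{if } \gamma_v,\gamma_w \text{ are in Case 2},\\ 0 & \text{otherwise,}\end{cases}$$ where: Case 1: at both ends, in the orientation of the surface, $\gamma_w$ follows $\gamma_v$ in an internal triangle; Case 2: $\gamma_w$ follows $\gamma_v$ in an internal triangle only at one of the two ends of the arcs. In Case 1, the two arrow extensions given by the arrows $\alpha$ and $\alpha'$ (the arrows associated in the context to the two ends) induce a basis of $\operatorname{Ext}_\Lambda^4(M(v),M(w))$. In Case 2, a basis is induced by only one of them (the one at the end where $\gamma_w$ follows $\gamma_v$). Furthermore, $\operatorname{Ext}_\Lambda^{4+3k}(M(v),M(w))\cong \operatorname{Ext}_\Lambda^4(M(v), M(w))$ for all $k\ge 0$.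
   Context: $K$ is an algebraically closed field; paths are composed from left to right and modules are finitely generated right modules. $s(\alpha),t(\alpha)$ are the start and end of an arrow. Gentle algebra of a triangulation: let $T$ be an ideal triangulation of an oriented surface with boundary and marked points, all marked points lying on the (non-empty) boundary. $\Lambda(T)=KQ/I$, where the vertices of $Q=Q(T)$ are the arcs of $T$ (boundary segments not included), for each triangle of $T$ and each pair of its sides $i,j$ that are arcs of $T$ there is an arrow $i\to j$ whenever $j$ is the immediate successor of $i$ in the cyclic order on the sides of the triangle given by the orientation of the surface, and $I$ is generated by the compositions of any two consecutive arrows inside an internal triangle (a triangle all of whose sides are arcs of $T$). Strings: for an arrow $\alpha$, its formal inverse has $s(\alpha^{-1})=t(\alpha)$, $t(\alpha^{-1})=s(\alpha)$. A string is a word in arrows and inverse arrows, each letter starting where the previous one ends, with no letter followed by its inverse and such that no two consecutive arrows have product in $I$ and no two consecutive inverse arrows $\beta^{-1}\alpha^{-1}$ have $\alpha\beta\in I$; length $0$ strings are the trivial strings $e_u$ at vertices $u$. $M(w)$ is the string module of $w$; $M(w)\cong M(w^{-1})$. Arcs: an arc is a homotopy class of curves connecting marked points on the boundary. String modules $M(w)$ correspond to arcs $\gamma_w$ not in $T$ (and not boundary segments): $\gamma_w$, in minimal position with respect to $T$, crosses the arcs of $T$ in the order in which the corresponding vertices are traversed by $w$. At each of its two ends, $\gamma_w$ emanates from a corner of a triangle of $T$ and first crosses the side opposite to that corner. Local configuration at an end: let an internal triangle have sides $a,b,c$ with arrows $\alpha:a\to b$, $\beta:b\to c$, $\delta:c\to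 a$ of $Q$ inside it. We say that at a given end $\gamma_w$ follows $\gamma_v$ in the orientation of the surface in this internal triangle if (for a suitable labelling $a,b,c$) $\gamma_v$ emanates there from the corner opposite $a$ (crossing $a$ first) and $\gamma_w$ emanates from the corner opposite $b$ (crossing $b$ first); i.e. the corner of $\gamma_w$ is the immediate successor of the corner of $\gamma_v$ in the cyclic order of the corners (matched with their opposite sides). "At both ends" means: after choosing orientations of $\gamma_v,\gamma_w$ suitably, the condition holds for the pair of starting ends and for the pair of terminal ends; "only at one end" means it holds for only one such pair. The two internal triangles (and their vertices) need not be distinct. The arrows for the second end are denoted $\alpha',\beta',\delta'$. Arrow extensions: for an arrow $\delta$ put $R(\delta)=\delta\Lambda=M(p)$, where $p$ is the trivial string $e_{t(\delta)}$ if no arrow $\epsilon$ satisfies $\delta\epsilon\notin I$, and otherwise $p$ is the maximal direct string starting with the unique such $\epsilon$. If $w\alpha^{-1}p$ is a string (with $w$ oriented to end at the relevant end), there is a non-split exact sequence $0\to M(w)\to M(w\alpha^{-1}p)\to M(p)\to0$, called the arrow extension of $M(p)$ by $M(w)$ given by $\alpha$. Let $\Omega^1(X)$ be the kernel of the projective cover of $X$ and $\Omega^j=\Omega^1\Omega^{j-1}$. At an end where $\gamma_w$ follows $\gamma_v$, $R(\alpha)$ is a direct summand of $\Omega^1(M(v))$ and $R(\delta)\cong\Omega^2(R(\alpha))$ is a direct summand of $\Omega^3(M(v))$; the arrow extension of $R(\delta)$ by $M(w)$ given by $\alpha$ induces an element of $\operatorname{Ext}^4_\Lambda(M(v),M(w))\cong\operatorname{Ext}^1_\Lambda(\Omega^3(M(v)),M(w))$,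 and likewise for $\delta',\alpha'$ at the other end.
   Formalization: The dimension formula and the basis claims are proved assuming that no end of one arc is in the "follows" relation with both ends of the other; otherwise the printed dimensions 2 and 1 are wrong (the true value is 4 or 2). The isomorphism of Ext^{4+3k} with Ext^4 is unrestricted. *)

theory Defs
  imports
    "Jordan_Normal_Form.VS_Connect"
    "HOL-Algebra.QuotRing"
    "HOL-Computational_Algebra.Polynomial"
    "Graph_Theory.Arc_Walk"
begin

section \<open>Modules over a ring and Ext\<close>

text \<open>
  Right modules use the record type of HOL-Algebra modules: \<open>r \<odot>\<^bsub>M\<^esub> m\<close> stands for \<open>m \<cdot> r\<close>, so only
  the associativity axiom differs from the one for left modules.  Correspondingly,
  \<^const>\<open>LinearCombinations.module_hom\<close> (which does not require a commutative ring) is the set of right module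
  homomorphisms.
\<close>

locale right_module = R?: ring R + M?: abelian_group M
    for R :: "('r, 'a) ring_scheme" and M :: "('r, 'm, 'b) module_scheme" +
  assumes act_closed: "r \<in> carrier R \<Longrightarrow> m \<in> carrier M \<Longrightarrow> r \<odot>\<^bsub>M\<^esub> m \<in> carrier M"
    and act_l_distr: "r \<in> carrier R \<Longrightarrow> s \<in> carrier R \<Longrightarrow> m \<in> carrier M \<Longrightarrow>
      (r \<oplus>\<^bsub>R\<^esub> s) \<odot>\<^bsub>M\<^esub> m = r \<odot>\<^bsub>M\<^esub> m \<oplus>\<^bsub>M\<^esub> s \<odot>\<^bsub>M\<^esub> m"
    and act_r_distr: "r \<in> carrier R \<Longrightarrow> m \<in> carrier M \<Longrightarrow> n \<in> carrier M \<Longrightarrow>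
      r \<odot>\<^bsub>M\<^esub> (m \<oplus>\<^bsub>M\<^esub> n) = r \<odot>\<^bsub>M\<^esub> m \<oplus>\<^bsub>M\<^esub> r \<odot>\<^bsub>M\<^esub> n"
    and act_assoc: "r \<in> carrier R \<Longrightarrow> s \<in> carrier R \<Longrightarrow> m \<in> carrier M \<Longrightarrow>
      (r \<otimes>\<^bsub>R\<^esub> s) \<odot>\<^bsub>M\<^esub> m = s \<odot>\<^bsub>M\<^esub> (r \<odot>\<^bsub>M\<^esub> m)"
    and act_one: "m \<in> carrier M \<Longrightarrow> \<one>\<^bsub>R\<^esub> \<odot>\<^bsub>M\<^esub> m = m"

definition right_submodule :: "('r, 'a) ring_scheme \<Rightarrow> 'm set \<Rightarrow> ('r, 'm, 'b) module_scheme \<Rightarrow> bool" where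
  "right_submodule R U M \<longleftrightarrow> U \<subseteq> carrier M \<and> \<zero>\<^bsub>M\<^esub> \<in> U \<and> (\<forall>x\<in>U. \<forall>y\<in>U. x \<oplus>\<^bsub>M\<^esub> y \<in> U) \<and>
     (\<forall>r\<in>carrier R. \<forall>x\<in>U. r \<odot>\<^bsub>M\<^esub> x \<in> U)"

definition indecomposable :: "('r, 'a) ring_scheme \<Rightarrow> ('r, 'm, 'b) module_scheme \<Rightarrow> bool" where
  "indecomposable R M \<longleftrightarrow> carrier M \<noteq> {\<zero>\<^bsub>M\<^esub>} \<and>
     (\<forall>U V. right_submodule R U M \<longrightarrow> right_submodule R V M \<longrightarrow>
        U \<inter> V = {\<zero>\<^bsub>M\<^esub>} \<longrightarrow> U <+>\<^bsub>M\<^esub> V = carrier M \<longrightarrow> U = {\<zero>\<^bsub>M\<^esub>} \<or> V = {\<zero>\<^bsub>M\<^esub>})"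

definition free_module :: "('r, 'a) ring_scheme \<Rightarrow> nat \<Rightarrow> ('r, nat \<Rightarrow> 'r) module" where
  "free_module R n = \<lparr>carrier = {..<n} \<rightarrow>\<^sub>E carrier R,
     mult = (\<lambda>f g. \<lambda>i\<in>{..<n}. \<zero>\<^bsub>R\<^esub>), one = (\<lambda>i\<in>{..<n}. \<zero>\<^bsub>R\<^esub>), zero = (\<lambda>i\<in>{..<n}. \<zero>\<^bsub>R\<^esub>),
     add = (\<lambda>f g. \<lambda>i\<in>{..<n}. f i \<oplus>\<^bsub>R\<^esub> g i), smult = (\<lambda>r f. \<lambda>i\<in>{..<n}. f i \<otimes>\<^bsub>R\<^esub> r)\<rparr>"

text \<open>Finitely generated projective: a direct summand of some \<open>R\<^sup>n\<close>.\<close>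

definition fg_projective :: "('r, 'a) ring_scheme \<Rightarrow> ('r, 'm) module \<Rightarrow> bool" where
  "fg_projective R P \<longleftrightarrow> right_module R P \<and>
     (\<exists>n. \<exists>\<iota>\<in>LinearCombinations.module_hom R P (free_module R n). \<exists>\<pi>\<in>LinearCombinations.module_hom R (free_module R n) P.
        \<forall>x\<in>carrier P. \<pi> (\<iota> x) = x)"

text \<open>\<open>\<dots> \<rightarrow> P 1 \<rightarrow> P 0 \<rightarrow> M \<rightarrow> 0\<close> with differentials \<open>d n : P (n + 1) \<rightarrow> P n\<close> and augmentation \<open>e\<close>.\<close>

definition projective_resolution ::
    "('r, 'a) ring_scheme \<Rightarrow> ('r, 'm) module \<Rightarrow> (nat \<Rightarrow> ('r, 'p) module) \<Rightarrow>
     (nat \<Rightarrow> 'p \<Rightarrow> 'p) \<Rightarrow> ('p \<Rightarrow> 'm) \<Rightarrow> bool" where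
  "projective_resolution R M P d e \<longleftrightarrow>
     (\<forall>n. fg_projective R (P n)) \<and>
     e \<in> LinearCombinations.module_hom R (P 0) M \<and> e ` carrier (P 0) = carrier M \<and>
     (\<forall>n. d n \<in> LinearCombinations.module_hom R (P (Suc n)) (P n)) \<and>
     d 0 ` carrier (P 1) = a_kernel (P 0) M e \<and>
     (\<forall>n. d (Suc n) ` carrier (P (Suc (Suc n))) = a_kernel (P (Suc n)) (P n) (d n))"

text \<open>
  The module \<open>\<Omega>\<^sup>n\<^sup>+\<^sup>1(M)\<close>, as a submodule of \<open>P n\<close>; this is the iterated kernel of projective covers
  when the resolution is minimal.
\<close>

definition syzygy ::
    "('r, 'm) module \<Rightarrow> (nat \<Rightarrow> ('r, 'p) module) \<Rightarrow> (nat \<Rightarrow> 'p \<Rightarrow> 'p) \<Rightarrow> ('p \<Rightarrow> 'm) \<Rightarrow> nat \<Rightarrow>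
     ('r, 'p) module" where
  "syzygy M P d e n =
     (P n)\<lparr>carrier := (case n of 0 \<Rightarrow> a_kernel (P 0) M e
                              | Suc k \<Rightarrow> a_kernel (P (Suc k)) (P k) (d k))\<rparr>"

definition superfluous :: "('r, 'a) ring_scheme \<Rightarrow> 'm set \<Rightarrow> ('r, 'm, 'b) module_scheme \<Rightarrow> bool" where
  "superfluous R U M \<longleftrightarrow>
     (\<forall>V. right_submodule R V M \<longrightarrow> U <+>\<^bsub>M\<^esub> V = carrier M \<longrightarrow> V = carrier M)"

text \<open>Each \<open>P n\<close> is a projective cover of its image in the next term.\<close>

definition minimal_projective_resolution ::
    "('r, 'a) ring_scheme \<Rightarrow> ('r, 'm) module \<Rightarrow> (nat \<Rightarrow> ('r, 'p) module) \<Rightarrow>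
     (nat \<Rightarrow> 'p \<Rightarrow> 'p) \<Rightarrow> ('p \<Rightarrow> 'm) \<Rightarrow> bool" where
  "minimal_projective_resolution R M P d e \<longleftrightarrow> projective_resolution R M P d e \<and>
     (\<forall>n. superfluous R (carrier (syzygy M P d e n)) (P n))"

text \<open>
  \<open>Hom\<^sub>R(M, N)\<close> as a vector space, for an algebra \<open>R\<close> with structure map \<open>sc : K \<rightarrow> R\<close>.  The fields
  \<open>mult\<close> and \<open>one\<close>, present in every module record, carry no meaning here and below.
\<close>

definition hom_space ::
    "('r, 'a) ring_scheme \<Rightarrow> ('k \<Rightarrow> 'r) \<Rightarrow> ('r, 'p) module \<Rightarrow> ('r, 'm) module \<Rightarrow>
     ('k, 'p \<Rightarrow> 'm) module" where
  "hom_space R sc M N = \<lparr>carrier = LinearCombinations.module_hom R M N \<inter> extensional (carrier M),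
     mult = (\<lambda>f g. \<lambda>x\<in>carrier M. \<zero>\<^bsub>N\<^esub>), one = (\<lambda>x\<in>carrier M. \<zero>\<^bsub>N\<^esub>),
     zero = (\<lambda>x\<in>carrier M. \<zero>\<^bsub>N\<^esub>), add = (\<lambda>f g. \<lambda>x\<in>carrier M. f x \<oplus>\<^bsub>N\<^esub> g x),
     smult = (\<lambda>c f. \<lambda>x\<in>carrier M. sc c \<odot>\<^bsub>N\<^esub> f x)\<rparr>"

text \<open>The subquotient \<open>Z / B\<close> of a module \<open>V\<close>.\<close>

definition subquotient :: "('k, 'v) module \<Rightarrow> 'v set \<Rightarrow> 'v set \<Rightarrow> ('k, 'v set) module" where
  "subquotient V Z B = \<lparr>carrier = (\<lambda>z. B +>\<^bsub>V\<^esub> z) ` Z,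
     mult = (\<lambda>X Y. B), one = B, zero = B, add = set_add V,
     smult = (\<lambda>c X. \<Union>x\<in>X. B +>\<^bsub>V\<^esub> (c \<odot>\<^bsub>V\<^esub> x))\<rparr>"

definition cocycles ::
    "('r, 'a) ring_scheme \<Rightarrow> ('k \<Rightarrow> 'r) \<Rightarrow> (nat \<Rightarrow> ('r, 'p) module) \<Rightarrow> (nat \<Rightarrow> 'p \<Rightarrow> 'p) \<Rightarrow>
     ('r, 'm) module \<Rightarrow> nat \<Rightarrow> ('p \<Rightarrow> 'm) set" where
  "cocycles R sc P d N n =
     {f \<in> carrier (hom_space R sc (P n) N). \<forall>x\<in>carrier (P (Suc n)). f (d n x) = \<zero>\<^bsub>N\<^esub>}"

definition coboundaries ::
    "('r, 'a) ring_scheme \<Rightarrow> ('k \<Rightarrow> 'r) \<Rightarrow> (nat \<Rightarrow> ('r, 'p) module) \<Rightarrow> (nat \<Rightarrow> 'p \<Rightarrow> 'p) \<Rightarrow>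
     ('r, 'm) module \<Rightarrow> nat \<Rightarrow> ('p \<Rightarrow> 'm) set" where
  "coboundaries R sc P d N n = (case n of
       0 \<Rightarrow> {\<zero>\<^bsub>hom_space R sc (P 0) N\<^esub>}
     | Suc k \<Rightarrow> (\<lambda>h. \<lambda>x\<in>carrier (P (Suc k)). h (d k x)) ` carrier (hom_space R sc (P k) N))"

text \<open>\<open>Ext\<^sup>n(M, N)\<close>, computed from a projective resolution \<open>(P, d)\<close> of \<open>M\<close>.\<close>

definition Ext_space ::
    "('r, 'a) ring_scheme \<Rightarrow> ('k \<Rightarrow> 'r) \<Rightarrow> (nat \<Rightarrow> ('r, 'p) module) \<Rightarrow> (nat \<Rightarrow> 'p \<Rightarrow> 'p) \<Rightarrow>
     ('r, 'm) module \<Rightarrow> nat \<Rightarrow> ('k, ('p \<Rightarrow> 'm) set) module" where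
  "Ext_space R sc P d N n = subquotient (hom_space R sc (P n) N)
     (cocycles R sc P d N n) (coboundaries R sc P d N n)"

definition Ext_class ::
    "('r, 'a) ring_scheme \<Rightarrow> ('k \<Rightarrow> 'r) \<Rightarrow> (nat \<Rightarrow> ('r, 'p) module) \<Rightarrow> (nat \<Rightarrow> 'p \<Rightarrow> 'p) \<Rightarrow>
     ('r, 'm) module \<Rightarrow> nat \<Rightarrow> ('p \<Rightarrow> 'm) \<Rightarrow> ('p \<Rightarrow> 'm) set" where
  "Ext_class R sc P d N n \<xi> = coboundaries R sc P d N n +>\<^bsub>hom_space R sc (P n) N\<^esub> \<xi>"

text \<open>
  Let \<open>0 \<rightarrow> N \<rightarrow> E \<rightarrow> X \<rightarrow> 0\<close> be a short exact sequence with maps \<open>i\<close>, \<open>q\<close> and let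
  \<open>\<pi> : \<Omega>\<^sup>n\<^sup>+\<^sup>1(M) \<rightarrow> X\<close>.  The pullback of the sequence along \<open>\<pi>\<close> is an element of \<open>Ext\<^sup>1(\<Omega>\<^sup>n\<^sup>+\<^sup>1(M), N)\<close>,
  and \<open>Ext\<^sup>1(\<Omega>\<^sup>n\<^sup>+\<^sup>1(M), N) \<cong> Ext\<^sup>n\<^sup>+\<^sup>2(M, N)\<close>.  The corresponding cocycles \<open>\<xi>\<close> arise by lifting the map
  \<open>P (n + 1) \<rightarrow> \<Omega>\<^sup>n\<^sup>+\<^sup>1(M) \<rightarrow> X\<close> to \<open>g : P (n + 1) \<rightarrow> E\<close> and restricting \<open>g\<close> to \<open>\<Omega>\<^sup>n\<^sup>+\<^sup>2(M)\<close>, where it takes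
  values in \<open>N\<close>.  (The opposite sign convention would replace \<open>\<xi>\<close> by \<open>-\<xi>\<close>.)
\<close>

definition pullback_cocycle ::
    "('r, 'a) ring_scheme \<Rightarrow> ('k \<Rightarrow> 'r) \<Rightarrow> (nat \<Rightarrow> ('r, 'p) module) \<Rightarrow> (nat \<Rightarrow> 'p \<Rightarrow> 'p) \<Rightarrow>
     ('r, 'm) module \<Rightarrow> ('r, 'c) module \<Rightarrow> ('m \<Rightarrow> 'c) \<Rightarrow> ('c \<Rightarrow> 'x) \<Rightarrow> ('p \<Rightarrow> 'x) \<Rightarrow> nat \<Rightarrow>
     ('p \<Rightarrow> 'm) \<Rightarrow> bool" where
  "pullback_cocycle R sc P d N E i q \<pi> n \<xi> \<longleftrightarrow>
     \<xi> \<in> cocycles R sc P d N (n + 2) \<and>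
     (\<exists>g\<in>LinearCombinations.module_hom R (P (n + 1)) E.
        (\<forall>x\<in>carrier (P (n + 1)). q (g x) = \<pi> (d n x)) \<and>
        (\<forall>y\<in>carrier (P (n + 2)). i (\<xi> y) = g (d (n + 1) y)))"

definition has_dim :: "('k::field, 'v) module \<Rightarrow> nat \<Rightarrow> bool" where
  "has_dim V n \<longleftrightarrow> vectorspace class_ring V \<and> vectorspace.fin_dim class_ring V \<and>
     vectorspace.dim class_ring V = n"

definition is_basis :: "('k::field, 'v) module \<Rightarrow> 'v set \<Rightarrow> bool" where
  "is_basis V B \<longleftrightarrow> vectorspace class_ring V \<and> vectorspace.basis class_ring V B"

definition vs_isomorphic :: "('k::field, 'v) module \<Rightarrow> ('k, 'w) module \<Rightarrow> bool" where
  "vs_isomorphic V W \<longleftrightarrow>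
     (\<exists>f. linear_map class_ring V W f \<and> bij_betw f (carrier V) (carrier W))"


section \<open>Path algebras, strings and string modules\<close>

text \<open>
  A quiver is a multi-digraph; a path is its starting vertex together with the list of its arrows, in
  the order of traversal (so paths are composed from left to right).
\<close>

type_synonym ('v, 'a) path = "'v \<times> 'a list"

definition paths :: "('v, 'a) pre_digraph \<Rightarrow> ('v, 'a) path set" where
  "paths Q = {(u, p). \<exists>v. pre_digraph.awalk Q u p v}"

abbreviation path_end :: "('v, 'a) pre_digraph \<Rightarrow> 'v \<Rightarrow> 'a list \<Rightarrow> 'v" where
  "path_end Q u p \<equiv> last (pre_digraph.awalk_verts Q u p)"

definition path_algebra :: "('v, 'a) pre_digraph \<Rightarrow> (('v, 'a) path \<Rightarrow> 'k::field) ring" where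
  "path_algebra Q = \<lparr>carrier = {f. finite {p. f p \<noteq> 0} \<and> {p. f p \<noteq> 0} \<subseteq> paths Q},
     mult = (\<lambda>f g. \<lambda>(u, p). \<Sum>i\<le>length p. f (u, take i p) * g (path_end Q u (take i p), drop i p)),
     one = (\<lambda>(u, p). if u \<in> verts Q \<and> p = [] then 1 else 0),
     zero = (\<lambda>p. 0), add = (\<lambda>f g p. f p + g p)\<rparr>"

definition arrow_elem :: "('v, 'a) pre_digraph \<Rightarrow> 'a \<Rightarrow> ('v, 'a) path \<Rightarrow> 'k::field" where
  "arrow_elem Q a = (\<lambda>p. if p = (tail Q a, [a]) then 1 else 0)"

abbreviation arrow_prod :: "('v, 'a) pre_digraph \<Rightarrow> 'a \<Rightarrow> 'a \<Rightarrow> ('v, 'a) path \<Rightarrow> 'k::field" where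
  "arrow_prod Q a b \<equiv> arrow_elem Q a \<otimes>\<^bsub>path_algebra Q\<^esub> arrow_elem Q b"

text \<open>The structure map \<open>K \<rightarrow> KQ/I\<close>.\<close>

definition scalar ::
    "('v, 'a) pre_digraph \<Rightarrow> (('v, 'a) path \<Rightarrow> 'k::field) set \<Rightarrow> 'k \<Rightarrow> (('v, 'a) path \<Rightarrow> 'k) set" where
  "scalar Q I c = I +>\<^bsub>path_algebra Q\<^esub> (\<lambda>p. c * \<one>\<^bsub>path_algebra Q\<^esub> p)"

text \<open>A word is stored with its starting vertex, so that \<open>(u, [])\<close> is the trivial string at \<open>u\<close>.\<close>

datatype 'a letter = Arr 'a | Inv 'a

type_synonym ('v, 'a) word = "'v \<times> 'a letter list"

fun letter_start :: "('v, 'a) pre_digraph \<Rightarrow> 'a letter \<Rightarrow> 'v" where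
  "letter_start Q (Arr a) = tail Q a"
| "letter_start Q (Inv a) = head Q a"

fun letter_end :: "('v, 'a) pre_digraph \<Rightarrow> 'a letter \<Rightarrow> 'v" where
  "letter_end Q (Arr a) = head Q a"
| "letter_end Q (Inv a) = tail Q a"

fun letter_arrow :: "'a letter \<Rightarrow> 'a" where
  "letter_arrow (Arr a) = a"
| "letter_arrow (Inv a) = a"

fun inv_letter :: "'a letter \<Rightarrow> 'a letter" where
  "inv_letter (Arr a) = Inv a"
| "inv_letter (Inv a) = Arr a"

fun word_vertex :: "('v, 'a) pre_digraph \<Rightarrow> ('v, 'a) word \<Rightarrow> nat \<Rightarrow> 'v" where
  "word_vertex Q (u, ls) 0 = u"
| "word_vertex Q (u, ls) (Suc i) = letter_end Q (ls ! i)"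

definition inv_word :: "('v, 'a) pre_digraph \<Rightarrow> ('v, 'a) word \<Rightarrow> ('v, 'a) word" where
  "inv_word Q w = (word_vertex Q w (length (snd w)), rev (map inv_letter (snd w)))"

fun letters_compatible ::
    "('v, 'a) pre_digraph \<Rightarrow> (('v, 'a) path \<Rightarrow> 'k::field) set \<Rightarrow> 'a letter \<Rightarrow> 'a letter \<Rightarrow> bool" where
  "letters_compatible Q I (Arr a) (Arr b) \<longleftrightarrow> arrow_prod Q a b \<notin> I"
| "letters_compatible Q I (Inv b) (Inv a) \<longleftrightarrow> arrow_prod Q a b \<notin> I"
| "letters_compatible Q I (Arr a) (Inv b) \<longleftrightarrow> a \<noteq> b"
| "letters_compatible Q I (Inv a) (Arr b) \<longleftrightarrow> a \<noteq> b"

definition is_string ::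
    "('v, 'a) pre_digraph \<Rightarrow> (('v, 'a) path \<Rightarrow> 'k::field) set \<Rightarrow> ('v, 'a) word \<Rightarrow> bool" where
  "is_string Q I w \<longleftrightarrow> fst w \<in> verts Q \<and> letter_arrow ` set (snd w) \<subseteq> arcs Q \<and>
     (\<forall>i<length (snd w). letter_start Q (snd w ! i) = word_vertex Q w i) \<and>
     (\<forall>i. Suc i < length (snd w) \<longrightarrow> letters_compatible Q I (snd w ! i) (snd w ! Suc i))"

text \<open>
  The string module \<open>M(w)\<close> has a basis \<open>z\<^sub>0, \<dots>, z\<^sub>n\<close> indexed by the vertices traversed by \<open>w\<close>;
  an arrow \<open>a\<close> maps \<open>z\<^sub>i\<close> to \<open>z\<^sub>i\<^sub>+\<^sub>1\<close> if the letter between them is \<open>a\<close>, maps \<open>z\<^sub>i\<close> to \<open>z\<^sub>i\<^sub>-\<^sub>1\<close> if the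
  letter between them is \<open>a\<^sup>-\<^sup>1\<close>, and kills all other basis elements.
\<close>

definition arrow_move :: "'a letter list \<Rightarrow> 'a \<Rightarrow> nat \<Rightarrow> nat option" where
  "arrow_move ls a i =
     (if i < length ls \<and> ls ! i = Arr a then Some (Suc i)
      else if 0 < i \<and> i \<le> length ls \<and> ls ! (i - 1) = Inv a then Some (i - 1)
      else None)"

fun arrows_move :: "'a letter list \<Rightarrow> 'a list \<Rightarrow> nat \<Rightarrow> nat option" where
  "arrows_move ls [] i = Some i"
| "arrows_move ls (a # as) i = Option.bind (arrow_move ls a i) (arrows_move ls as)"

definition path_move :: "('v, 'a) pre_digraph \<Rightarrow> ('v, 'a) word \<Rightarrow> ('v, 'a) path \<Rightarrow> nat \<Rightarrow> nat option" where
  "path_move Q w p i = (if word_vertex Q w i = fst p then arrows_move (snd w) (snd p) i else None)"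

definition string_action ::
    "('v, 'a) pre_digraph \<Rightarrow> ('v, 'a) word \<Rightarrow> (('v, 'a) path \<Rightarrow> 'k::field) \<Rightarrow> (nat \<Rightarrow> 'k) \<Rightarrow> nat \<Rightarrow> 'k" where
  "string_action Q w x m j =
     (\<Sum>i\<le>length (snd w). \<Sum>p | x p \<noteq> 0. if path_move Q w p i = Some j then m i * x p else 0)"

text \<open>
  As a module over \<open>KQ/I\<close>: the residue class \<open>X\<close> acts as any of its representatives, which is
  well-defined for a monomial ideal \<open>I\<close> since \<open>w\<close> is a string.
\<close>

definition string_module ::
    "('v, 'a) pre_digraph \<Rightarrow> ('v, 'a) word \<Rightarrow> ((('v, 'a) path \<Rightarrow> 'k::field) set, nat \<Rightarrow> 'k) module" where
  "string_module Q w = \<lparr>carrier = {m. \<forall>i>length (snd w). m i = 0},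
     mult = (\<lambda>m n i. 0), one = (\<lambda>i. 0), zero = (\<lambda>i. 0), add = (\<lambda>m n i. m i + n i),
     smult = (\<lambda>X m. the_elem ((\<lambda>x. string_action Q w x m) ` X))\<rparr>"

text \<open>The string \<open>p\<close> with \<open>R(\<delta>) = \<delta>\<Lambda> = M(p)\<close>.\<close>

definition arrow_ideal_string ::
    "('v, 'a) pre_digraph \<Rightarrow> (('v, 'a) path \<Rightarrow> 'k::field) set \<Rightarrow> 'a \<Rightarrow> ('v, 'a) word \<Rightarrow> bool" where
  "arrow_ideal_string Q I \<delta> p \<longleftrightarrow>
     (if \<exists>\<epsilon>\<in>arcs Q. arrow_prod Q \<delta> \<epsilon> \<notin> I
      then \<exists>\<epsilon>\<in>arcs Q. \<exists>as. arrow_prod Q \<delta> \<epsilon> \<notin> I \<and>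
             p = (head Q \<delta>, map Arr (\<epsilon> # as)) \<and> is_string Q I p \<and>
             (\<forall>b. \<not> is_string Q I (head Q \<delta>, map Arr (\<epsilon> # as @ [b])))
      else p = (head Q \<delta>, []))"

text \<open>
  The arrow extension \<open>0 \<rightarrow> M(w) \<rightarrow> M(w'\<alpha>\<^sup>-\<^sup>1p) \<rightarrow> M(p) \<rightarrow> 0\<close> at the terminal end (\<open>t = True\<close>, \<open>w' = w\<close>)
  or at the starting end (\<open>t = False\<close>, \<open>w' = w\<^sup>-\<^sup>1\<close>) of \<open>w\<close>.  In the second case the inclusion involves
  the isomorphism from \<open>M(w)\<close> to the module of the inverse string, which reverses the standard basis.
\<close>

definition ext_string ::
    "('v, 'a) pre_digraph \<Rightarrow> ('v, 'a) word \<Rightarrow> bool \<Rightarrow> 'a \<Rightarrow> ('v, 'a) word \<Rightarrow> ('v, 'a) word" where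
  "ext_string Q w t \<alpha> p =
     (let w' = (if t then w else inv_word Q w) in (fst w', snd w' @ Inv \<alpha> # snd p))"

definition ext_incl :: "('v, 'a) word \<Rightarrow> bool \<Rightarrow> (nat \<Rightarrow> 'k::field) \<Rightarrow> nat \<Rightarrow> 'k" where
  "ext_incl w t m = (let n = length (snd w) in if t then m else (\<lambda>i. if i \<le> n then m (n - i) else 0))"

definition ext_proj :: "('v, 'a) word \<Rightarrow> (nat \<Rightarrow> 'k::field) \<Rightarrow> nat \<Rightarrow> 'k" where
  "ext_proj w m = (\<lambda>i. m (Suc (length (snd w)) + i))"

text \<open>
  \<open>c\<close> is an element of \<open>Ext\<^sup>4(M(v), M(w))\<close> induced by the arrow extension of \<open>R(\<delta>)\<close> by \<open>M(w)\<close> given by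
  \<open>\<alpha>\<close>, attached to the end \<open>t\<close> of \<open>w\<close>; here \<open>(P, d, e)\<close> is a projective resolution of \<open>M(v)\<close>, and
  \<open>\<pi>\<close> is a projection of \<open>\<Omega>\<^sup>3(M(v))\<close> onto a direct summand isomorphic to \<open>R(\<delta>)\<close>.
\<close>

definition arrow_extension_class ::
    "('v, 'a) pre_digraph \<Rightarrow> (('v, 'a) path \<Rightarrow> 'k::field) set \<Rightarrow> ('v, 'a) word \<Rightarrow> ('v, 'a) word \<Rightarrow>
     (nat \<Rightarrow> ((('v, 'a) path \<Rightarrow> 'k) set, 'p) module) \<Rightarrow> (nat \<Rightarrow> 'p \<Rightarrow> 'p) \<Rightarrow> ('p \<Rightarrow> nat \<Rightarrow> 'k) \<Rightarrow>
     'a \<Rightarrow> 'a \<Rightarrow> bool \<Rightarrow> ('p \<Rightarrow> nat \<Rightarrow> 'k) set \<Rightarrow> bool" where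
  "arrow_extension_class Q I v w P d e \<alpha> \<delta> t c \<longleftrightarrow>
     (let \<Lambda> = path_algebra Q Quot I; sc = scalar Q I;
          N = string_module Q w; \<Omega>3 = syzygy (string_module Q v) P d e 2
      in \<exists>p. arrow_ideal_string Q I \<delta> p \<and> is_string Q I (ext_string Q w t \<alpha> p) \<and>
          (\<exists>\<pi>\<in>LinearCombinations.module_hom \<Lambda> \<Omega>3 (string_module Q p). \<exists>\<sigma>\<in>LinearCombinations.module_hom \<Lambda> (string_module Q p) \<Omega>3.
             (\<forall>x\<in>carrier (string_module Q p). \<pi> (\<sigma> x) = x) \<and>
             (\<exists>\<xi>. pullback_cocycle \<Lambda> sc P d N (string_module Q (ext_string Q w t \<alpha> p))
                    (ext_incl w t) (ext_proj w) \<pi> 2 \<xi> \<and>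
                  c = Ext_class \<Lambda> sc P d N 4 \<xi>)))"


section \<open>Triangulated surfaces\<close>

text \<open>
  An ideal triangulation of an oriented surface is given by the sides of its triangles.
  \<open>next_side\<close> is the cyclic order on the sides of each triangle determined by the orientation;
  \<open>glue\<close> matches the two sides (of possibly equal triangles) that form an arc of the triangulation,
  and fixes the sides that are boundary segments.
\<close>

record 'd triangulation =
  sides :: "'d set"
  next_side :: "'d \<Rightarrow> 'd"
  glue :: "'d \<Rightarrow> 'd"

text \<open>
  The last condition says that every marked point lies on the boundary: \<open>next_side T (glue T s)\<close> is the
  next side, after \<open>s\<close>, that starts at the same marked point as \<open>s\<close>, so turning around that point one
  has to meet a boundary segment.
\<close>

definition ideal_triangulation :: "'d triangulation \<Rightarrow> bool" where
  "ideal_triangulation T \<longleftrightarrow> finite (sides T) \<and>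
     (\<forall>s\<in>sides T. next_side T s \<in> sides T \<and> next_side T s \<noteq> s \<and>
        next_side T (next_side T (next_side T s)) = s) \<and>
     (\<forall>s\<in>sides T. glue T s \<in> sides T \<and> glue T (glue T s) = s) \<and>
     (\<forall>s\<in>sides T. \<exists>n. let s' = ((\<lambda>r. next_side T (glue T r)) ^^ n) s in glue T s' = s')"

definition arc_sides :: "'d triangulation \<Rightarrow> 'd set" where
  "arc_sides T = {s \<in> sides T. glue T s \<noteq> s}"

definition arc_of_side :: "'d triangulation \<Rightarrow> 'd \<Rightarrow> 'd set" where
  "arc_of_side T s = {s, glue T s}"

text \<open>The side \<open>s\<close> belongs to an internal triangle.\<close>

definition internal :: "'d triangulation \<Rightarrow> 'd \<Rightarrow> bool" where
  "internal T s \<longleftrightarrow> s \<in> arc_sides T \<and> next_side T s \<in> arc_sides T \<and>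
     next_side T (next_side T s) \<in> arc_sides T"

text \<open>The arrow from the arc of a side \<open>s\<close> to the arc of \<open>next_side T s\<close> is named \<open>s\<close>.\<close>

definition quiver :: "'d triangulation \<Rightarrow> ('d set, 'd) pre_digraph" where
  "quiver T = \<lparr>verts = arc_of_side T ` arc_sides T,
     arcs = {s \<in> arc_sides T. next_side T s \<in> arc_sides T},
     tail = arc_of_side T, head = (\<lambda>s. arc_of_side T (next_side T s))\<rparr>"

definition gentle_ideal :: "'d triangulation \<Rightarrow> (('d set, 'd) path \<Rightarrow> 'k::field) set" where
  "gentle_ideal T = genideal (path_algebra (quiver T))
     {arrow_prod (quiver T) s (next_side T s) | s. internal T s}"

definition gentle_algebra :: "'d triangulation \<Rightarrow> (('d set, 'd) path \<Rightarrow> 'k::field) set ring" where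
  "gentle_algebra T = path_algebra (quiver T) Quot gentle_ideal T"

text \<open>
  An oriented curve between marked points that is in minimal position with respect to \<open>T\<close>, and
  not homotopic to an arc of \<open>T\<close> or a boundary segment, is given up to homotopy by its sequence
  \<open>\<gamma>\<close> of crossings: \<open>\<gamma> ! i\<close> is the side through which the curve leaves a triangle at its \<open>i\<close>-th
  crossing, and \<open>glue T (\<gamma> ! i)\<close> the side through which it enters the next one, which it leaves
  through one of the two other sides.  The curve starts at the corner opposite to \<open>hd \<gamma>\<close> and ends
  at the corner opposite to \<open>glue T (last \<gamma>)\<close>.
\<close>

definition is_arc :: "'d triangulation \<Rightarrow> 'd list \<Rightarrow> bool" where
  "is_arc T \<gamma> \<longleftrightarrow> \<gamma> \<noteq> [] \<and> set \<gamma> \<subseteq> arc_sides T \<and>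
     (\<forall>i. Suc i < length \<gamma> \<longrightarrow>
        \<gamma> ! Suc i \<in> {next_side T (glue T (\<gamma> ! i)), next_side T (next_side T (glue T (\<gamma> ! i)))})"

text \<open>
  \<open>\<gamma>\<close> crosses the arcs of \<open>T\<close> in the order of the vertices of \<open>w\<close>, passing between consecutive
  crossings through the triangle that contains the corresponding arrow of \<open>w\<close>.  For a trivial
  string both orientations of the arc satisfy this.
\<close>

definition arc_of_string :: "'d triangulation \<Rightarrow> ('d set, 'd) word \<Rightarrow> 'd list \<Rightarrow> bool" where
  "arc_of_string T w \<gamma> \<longleftrightarrow> is_arc T \<gamma> \<and> length \<gamma> = Suc (length (snd w)) \<and>
     arc_of_side T (hd \<gamma>) = fst w \<and>
     (\<forall>i<length (snd w). case snd w ! i of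
          Arr s \<Rightarrow> glue T (\<gamma> ! i) = s \<and> \<gamma> ! Suc i = next_side T s
        | Inv s \<Rightarrow> glue T (\<gamma> ! i) = next_side T s \<and> \<gamma> ! Suc i = s)"

text \<open>
  The side opposite to the corner from which \<open>\<gamma>\<close> emanates at its starting end (\<open>t = False\<close>) or
  at its terminal end (\<open>t = True\<close>).
\<close>

definition arc_end :: "'d triangulation \<Rightarrow> 'd list \<Rightarrow> bool \<Rightarrow> 'd" where
  "arc_end T \<gamma> t = (if t then glue T (last \<gamma>) else hd \<gamma>)"

text \<open>
  At the end \<open>t\<close> of \<open>\<gamma>v\<close> and the end \<open>t'\<close> of \<open>\<gamma>w\<close>, the arc \<open>\<gamma>w\<close> follows \<open>\<gamma>v\<close> in an internal triangle.
  The arrows \<open>\<alpha>\<close>, \<open>\<beta>\<close>, \<open>\<delta>\<close> of this triangle are then \<open>s\<close>, \<open>next_side T s\<close>, \<open>next_side T (next_side T s)\<close>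
  with \<open>s = arc_end T \<gamma>v t\<close>.
\<close>

definition follows_at :: "'d triangulation \<Rightarrow> 'd list \<Rightarrow> bool \<Rightarrow> 'd list \<Rightarrow> bool \<Rightarrow> bool" where
  "follows_at T \<gamma>v t \<gamma>w t' \<longleftrightarrow>
     internal T (arc_end T \<gamma>v t) \<and> arc_end T \<gamma>w t' = next_side T (arc_end T \<gamma>v t)"

text \<open>
  \<open>r\<close> is the relative orientation of the two arcs: for \<open>r = False\<close> the ends are compared as they
  stand, for \<open>r = True\<close> one of the two arcs is reversed.
\<close>

definition case1 :: "'d triangulation \<Rightarrow> 'd list \<Rightarrow> 'd list \<Rightarrow> bool" where
  "case1 T \<gamma>v \<gamma>w \<longleftrightarrow> (\<exists>r. \<forall>t. follows_at T \<gamma>v t \<gamma>w (t \<noteq> r))"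

definition case2 :: "'d triangulation \<Rightarrow> 'd list \<Rightarrow> 'd list \<Rightarrow> bool" where
  "case2 T \<gamma>v \<gamma>w \<longleftrightarrow> \<not> case1 T \<gamma>v \<gamma>w \<and> (\<exists>r. \<exists>!t. follows_at T \<gamma>v t \<gamma>w (t \<noteq> r))"

text \<open>
  Comparing the two arcs end by end presupposes that no end of one of them is matched with both
  ends of the other.  This can only fail if one of the arcs emanates at both of its ends from the same
  corner of the same triangle.  The dimension of \<open>Ext\<^sup>4\<close> is always the number of pairs of ends at
  which \<open>\<gamma>w\<close> follows \<open>\<gamma>v\<close>, which otherwise differs from the value given by the two cases above.
\<close>

definition ends_paired :: "'d triangulation \<Rightarrow> 'd list \<Rightarrow> 'd list \<Rightarrow> bool" where
  "ends_paired T \<gamma>v \<gamma>w \<longleftrightarrow>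
     (\<forall>t. \<not> (follows_at T \<gamma>v t \<gamma>w False \<and> follows_at T \<gamma>v t \<gamma>w True)) \<and>
     (\<forall>t. \<not> (follows_at T \<gamma>v False \<gamma>w t \<and> follows_at T \<gamma>v True \<gamma>w t))"

text \<open>The classes given by the arrow \<open>\<alpha>\<close> at the end \<open>t\<close> of \<open>\<gamma>v\<close> and the end \<open>t'\<close> of \<open>\<gamma>w\<close>.\<close>

definition induced_at ::
    "'d triangulation \<Rightarrow> ('d set, 'd) word \<Rightarrow> ('d set, 'd) word \<Rightarrow>
     (nat \<Rightarrow> ((('d set, 'd) path \<Rightarrow> 'k::field) set, 'p) module) \<Rightarrow> (nat \<Rightarrow> 'p \<Rightarrow> 'p) \<Rightarrow>
     ('p \<Rightarrow> nat \<Rightarrow> 'k) \<Rightarrow> 'd list \<Rightarrow> bool \<Rightarrow> bool \<Rightarrow> ('p \<Rightarrow> nat \<Rightarrow> 'k) set \<Rightarrow> bool" where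
  "induced_at T v w P d e \<gamma>v t t' c \<longleftrightarrow>
     (let \<alpha> = arc_end T \<gamma>v t; \<delta> = next_side T (next_side T \<alpha>)
      in arrow_extension_class (quiver T) (gentle_ideal T) v w P d e \<alpha> \<delta> t' c)"

end

theory Submission
  imports Defs
begin

text \<open>
  A string module \<open>M(v)\<close> has an explicit projective resolution of Koszul type.  Its term in degree
  \<open>n\<close> has a basis of pairs \<open>(i, y)\<close>, where \<open>i\<close> is a position on \<open>v\<close> and \<open>y\<close> is a path starting there
  whose first \<open>n\<close> arrows satisfy a relation at each step and whose later arrows form a nonzero path.
  For \<open>n \<ge> 2\<close> such a chain of relations runs around one internal triangle, so the resolution
  is generated by positions of \<open>v\<close> on sides \<open>s\<close> of internal triangles, and going once around the
  triangle gives the period three.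

  At a crossing with \<open>s\<close> the arc of \<open>v\<close> either passes the internal triangle on one of the two sides
  of the corner opposite to \<open>s\<close> or ends in that corner (lemma \<open>trichotomy\<close>).  Applied to both \<open>v\<close>
  and \<open>w\<close>, this shows that a cocycle of degree at least three with values in \<open>M(w)\<close> can be
  changed by a coboundary so that only its coefficients at pairs of ends remain, where \<open>w\<close> ends opposite
  to the side reached from the end of \<open>v\<close> after \<open>n\<close> steps around the triangle
  (\<open>cocycle_is_coboundary\<close>); these coefficients vanish on coboundaries and are arbitrary on cocycles.
  An arbitrary resolution is compared with the explicit one by chain maps and homotopies, so that the
  same coefficients are coordinates on \<open>Ext\<^sup>n\<close> (\<open>coordinates_Ext\<close>).  In degree four one step has
  been made beyond a full turn, hence the pairs of ends are those at which the arc of \<open>w\<close> follows the arc of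
  \<open>v\<close>, and they only depend on the degree modulo three.

  It remains to evaluate the coordinates on the class of an arrow extension \<open>E\<close> of \<open>M(p)\<close> by \<open>M(w)\<close>.
  By the shape of the string of \<open>E\<close>, all coordinates vanish except the one at the pair of ends in question,
  which equals the value of the projection \<open>\<pi> : \<Omega>\<^sup>3 \<rightarrow> M(p)\<close> on the generator belonging to the end
  of \<open>v\<close> (\<open>class_coordinates\<close>).  If that value were zero, \<open>\<pi>\<close> would extend to the projective module in which
  \<open>\<Omega>\<^sup>3\<close> lies, and the extension \<open>E\<close> would split, which the arrow \<open>\<alpha>\<close> prevents (\<open>generator_survives\<close>).
  Conversely the chain generated by the end of \<open>v\<close> provides a summand \<open>M(p)\<close> of \<open>\<Omega>\<^sup>3\<close> (\<open>summand_exists\<close>).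
\<close>

section \<open>Right modules and their homomorphisms\<close>

abbreviation rhom :: "('r, 'a) ring_scheme \<Rightarrow> ('r, 'm) module \<Rightarrow> ('r, 'n) module \<Rightarrow> ('m \<Rightarrow> 'n) set" where
  "rhom R M N \<equiv> LinearCombinations.module_hom R M N"

lemma rhomI:
  assumes "\<And>x. x \<in> carrier M \<Longrightarrow> f x \<in> carrier N"
    and "\<And>x y. x \<in> carrier M \<Longrightarrow> y \<in> carrier M \<Longrightarrow> f (x \<oplus>\<^bsub>M\<^esub> y) = f x \<oplus>\<^bsub>N\<^esub> f y"
    and "\<And>r x. r \<in> carrier R \<Longrightarrow> x \<in> carrier M \<Longrightarrow> f (r \<odot>\<^bsub>M\<^esub> x) = r \<odot>\<^bsub>N\<^esub> f x"
  shows "f \<in> rhom R M N"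
  unfolding LinearCombinations.module_hom_def using assms by blast

lemma rhom_closed: "f \<in> rhom R M N \<Longrightarrow> x \<in> carrier M \<Longrightarrow> f x \<in> carrier N"
  by (auto simp: LinearCombinations.module_hom_def)

lemma rhom_add: "f \<in> rhom R M N \<Longrightarrow> x \<in> carrier M \<Longrightarrow> y \<in> carrier M \<Longrightarrow> f (x \<oplus>\<^bsub>M\<^esub> y) = f x \<oplus>\<^bsub>N\<^esub> f y"
  by (auto simp: LinearCombinations.module_hom_def)

lemma rhom_act: "f \<in> rhom R M N \<Longrightarrow> r \<in> carrier R \<Longrightarrow> x \<in> carrier M \<Longrightarrow> f (r \<odot>\<^bsub>M\<^esub> x) = r \<odot>\<^bsub>N\<^esub> f x"
  by (auto simp: LinearCombinations.module_hom_def)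

lemma rhom_cong:
  assumes "f \<in> rhom R M N" "right_module R M" "\<And>x. x \<in> carrier M \<Longrightarrow> g x = f x"
  shows "g \<in> rhom R M N"
proof -
  interpret M: right_module R M by fact
  show ?thesis
    by (rule rhomI) (simp_all add: assms(3) rhom_closed[OF assms(1)] rhom_add[OF assms(1)] rhom_act[OF assms(1)] M.act_closed)
qed

lemma rhom_comp: "f \<in> rhom R M N \<Longrightarrow> g \<in> rhom R N L \<Longrightarrow> (\<lambda>x. g (f x)) \<in> rhom R M L"
  by (auto simp: LinearCombinations.module_hom_def Pi_def)

lemma rhom_id: "(\<lambda>x. x) \<in> rhom R M M"
  by (auto simp: LinearCombinations.module_hom_def)

lemma rhom_zero:
  assumes f: "f \<in> rhom R M N" and M: "abelian_group M" and N: "abelian_group N"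
  shows "f \<zero>\<^bsub>M\<^esub> = \<zero>\<^bsub>N\<^esub>"
proof -
  interpret M: abelian_group M by fact
  interpret N: abelian_group N by fact
  have "f \<zero>\<^bsub>M\<^esub> \<oplus>\<^bsub>N\<^esub> f \<zero>\<^bsub>M\<^esub> = f \<zero>\<^bsub>M\<^esub>"
    using rhom_add[OF f, of "\<zero>\<^bsub>M\<^esub>" "\<zero>\<^bsub>M\<^esub>"] by simp
  moreover have "f \<zero>\<^bsub>M\<^esub> \<in> carrier N" using rhom_closed[OF f] by simp
  ultimately show ?thesis by (metis N.add.l_cancel_one')
qed

lemma rhom_neg:
  assumes f: "f \<in> rhom R M N" and M: "abelian_group M" and N: "abelian_group N" and x: "x \<in> carrier M"
  shows "f (\<ominus>\<^bsub>M\<^esub> x) = \<ominus>\<^bsub>N\<^esub> f x"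
proof -
  interpret M: abelian_group M by fact
  interpret N: abelian_group N by fact
  have "f (\<ominus>\<^bsub>M\<^esub> x) \<oplus>\<^bsub>N\<^esub> f x = \<zero>\<^bsub>N\<^esub>"
    using rhom_add[OF f, of "\<ominus>\<^bsub>M\<^esub> x" x] x rhom_zero[OF f M N] by (simp add: M.l_neg)
  thus ?thesis using x rhom_closed[OF f] by (metis N.minus_equality M.a_inv_closed)
qed

lemma rhom_diff:
  assumes f: "f \<in> rhom R M N" and M: "abelian_group M" and N: "abelian_group N"
    and "x \<in> carrier M" "y \<in> carrier M"
  shows "f (x \<ominus>\<^bsub>M\<^esub> y) = f x \<ominus>\<^bsub>N\<^esub> f y"
proof -
  interpret M: abelian_group M by fact
  interpret N: abelian_group N by fact
  show ?thesis using assms(4,5) rhom_neg[OF f M N] rhom_add[OF f] by (simp add: a_minus_def)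
qed

context right_module
begin

lemma act_zero: "r \<in> carrier R \<Longrightarrow> r \<odot>\<^bsub>M\<^esub> \<zero>\<^bsub>M\<^esub> = \<zero>\<^bsub>M\<^esub>"
proof -
  assume r: "r \<in> carrier R"
  have "r \<odot>\<^bsub>M\<^esub> \<zero>\<^bsub>M\<^esub> \<oplus>\<^bsub>M\<^esub> r \<odot>\<^bsub>M\<^esub> \<zero>\<^bsub>M\<^esub> = r \<odot>\<^bsub>M\<^esub> \<zero>\<^bsub>M\<^esub>"
    using act_r_distr[OF r M.zero_closed M.zero_closed] by simp
  thus ?thesis using act_closed[OF r M.zero_closed] by (metis M.add.l_cancel_one')
qed

lemma zero_act: "m \<in> carrier M \<Longrightarrow> \<zero>\<^bsub>R\<^esub> \<odot>\<^bsub>M\<^esub> m = \<zero>\<^bsub>M\<^esub>"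
proof -
  assume m: "m \<in> carrier M"
  have "\<zero>\<^bsub>R\<^esub> \<odot>\<^bsub>M\<^esub> m \<oplus>\<^bsub>M\<^esub> \<zero>\<^bsub>R\<^esub> \<odot>\<^bsub>M\<^esub> m = \<zero>\<^bsub>R\<^esub> \<odot>\<^bsub>M\<^esub> m"
    using act_l_distr[OF R.zero_closed R.zero_closed m] by simp
  thus ?thesis using act_closed[OF R.zero_closed m] by (metis M.add.l_cancel_one')
qed

lemma act_neg: "r \<in> carrier R \<Longrightarrow> m \<in> carrier M \<Longrightarrow> r \<odot>\<^bsub>M\<^esub> (\<ominus>\<^bsub>M\<^esub> m) = \<ominus>\<^bsub>M\<^esub> (r \<odot>\<^bsub>M\<^esub> m)"
proof -
  assume r: "r \<in> carrier R" and m: "m \<in> carrier M"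
  have "r \<odot>\<^bsub>M\<^esub> (\<ominus>\<^bsub>M\<^esub> m) \<oplus>\<^bsub>M\<^esub> r \<odot>\<^bsub>M\<^esub> m = \<zero>\<^bsub>M\<^esub>"
    using act_r_distr[OF r M.a_inv_closed[OF m] m] act_zero[OF r] by (simp only: M.l_neg[OF m])
  from M.minus_equality[OF this] show ?thesis using r m by (simp only: act_closed M.a_inv_closed)
qed

lemma act_finsum:
  assumes "r \<in> carrier R" "finite J" "\<And>j. j \<in> J \<Longrightarrow> g j \<in> carrier M"
  shows "r \<odot>\<^bsub>M\<^esub> (\<Oplus>\<^bsub>M\<^esub>j\<in>J. g j) = (\<Oplus>\<^bsub>M\<^esub>j\<in>J. r \<odot>\<^bsub>M\<^esub> g j)"
  using assms(2,3)
proof (induction J)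
  case empty
  thus ?case using act_zero assms(1) by simp
next
  case (insert j J)
  have "r \<odot>\<^bsub>M\<^esub> (\<Oplus>\<^bsub>M\<^esub>j\<in>insert j J. g j) = r \<odot>\<^bsub>M\<^esub> (g j \<oplus>\<^bsub>M\<^esub> (\<Oplus>\<^bsub>M\<^esub>j\<in>J. g j))"
    using insert by (subst M.finsum_insert) auto
  also have "\<dots> = r \<odot>\<^bsub>M\<^esub> g j \<oplus>\<^bsub>M\<^esub> (\<Oplus>\<^bsub>M\<^esub>j\<in>J. r \<odot>\<^bsub>M\<^esub> g j)"
    using insert assms(1) by (subst act_r_distr) (auto intro!: M.finsum_closed)
  also have "\<dots> = (\<Oplus>\<^bsub>M\<^esub>j\<in>insert j J. r \<odot>\<^bsub>M\<^esub> g j)"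
    using insert assms(1) by (subst M.finsum_insert) (auto intro!: act_closed)
  finally show ?case .
qed

end

lemma rhom_finsum:
  assumes f: "f \<in> rhom R M N" and M: "abelian_group M" and N: "abelian_group N"
    and J: "finite J" "\<And>j. j \<in> J \<Longrightarrow> g j \<in> carrier M"
  shows "f (\<Oplus>\<^bsub>M\<^esub>j\<in>J. g j) = (\<Oplus>\<^bsub>N\<^esub>j\<in>J. f (g j))"
  using J
proof (induction J)
  case empty
  interpret M: abelian_group M by fact
  interpret N: abelian_group N by fact
  show ?case using rhom_zero[OF f M N] by simp
next
  case (insert j J)
  interpret M: abelian_group M by fact
  interpret N: abelian_group N by fact
  have "f (\<Oplus>\<^bsub>M\<^esub>j\<in>insert j J. g j) = f (g j \<oplus>\<^bsub>M\<^esub> (\<Oplus>\<^bsub>M\<^esub>j\<in>J. g j))"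
    using insert by (subst M.finsum_insert) auto
  also have "\<dots> = f (g j) \<oplus>\<^bsub>N\<^esub> (\<Oplus>\<^bsub>N\<^esub>j\<in>J. f (g j))"
    using insert by (subst rhom_add[OF f]) (auto intro!: M.finsum_closed)
  also have "\<dots> = (\<Oplus>\<^bsub>N\<^esub>j\<in>insert j J. f (g j))"
    using insert by (subst N.finsum_insert) (auto intro!: rhom_closed[OF f])
  finally show ?case .
qed

lemma rhom_plus:
  assumes f: "f \<in> rhom R M N" and g: "g \<in> rhom R M N" and N: "right_module R N"
  shows "(\<lambda>x. f x \<oplus>\<^bsub>N\<^esub> g x) \<in> rhom R M N"
proof -
  interpret N: right_module R N by fact
  note [simp] = rhom_closed[OF f] rhom_closed[OF g] rhom_add[OF f] rhom_add[OF g] rhom_act[OF f] rhom_act[OF g]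
  show ?thesis by (rule rhomI) (auto simp: N.M.a_ac N.act_r_distr)
qed

lemma rhom_minus:
  assumes f: "f \<in> rhom R M N" and N: "right_module R N"
  shows "(\<lambda>x. \<ominus>\<^bsub>N\<^esub> f x) \<in> rhom R M N"
proof -
  interpret N: right_module R N by fact
  note [simp] = rhom_closed[OF f] rhom_add[OF f] rhom_act[OF f]
  show ?thesis by (rule rhomI) (auto simp: N.M.minus_add N.act_neg)
qed

lemma rhom_sub:
  assumes f: "f \<in> rhom R M N" and g: "g \<in> rhom R M N" and N: "right_module R N"
  shows "(\<lambda>x. f x \<ominus>\<^bsub>N\<^esub> g x) \<in> rhom R M N"
  using rhom_plus[OF f rhom_minus[OF g N] N] unfolding a_minus_def .

text \<open>
  The functionals \<open>\<iota> j\<close> and generators \<open>g j\<close> are the coordinates of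
  a module as a direct summand of a free one.  In this form the notion does not mention the free
  module, and maps can be lifted by choosing the images of finitely many generators.
\<close>

definition dual_basis ::
    "('r, 'a) ring_scheme \<Rightarrow> ('r, 'm) module \<Rightarrow> nat \<Rightarrow> (nat \<Rightarrow> 'm \<Rightarrow> 'r) \<Rightarrow> (nat \<Rightarrow> 'm) \<Rightarrow> bool" where
  "dual_basis R X n \<iota> g \<longleftrightarrow>
     (\<forall>j<n. g j \<in> carrier X \<and> (\<forall>x\<in>carrier X. \<iota> j x \<in> carrier R) \<and>
        (\<forall>x\<in>carrier X. \<forall>y\<in>carrier X. \<iota> j (x \<oplus>\<^bsub>X\<^esub> y) = \<iota> j x \<oplus>\<^bsub>R\<^esub> \<iota> j y) \<and>
        (\<forall>r\<in>carrier R. \<forall>x\<in>carrier X. \<iota> j (r \<odot>\<^bsub>X\<^esub> x) = \<iota> j x \<otimes>\<^bsub>R\<^esub> r)) \<and>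
     (\<forall>x\<in>carrier X. (\<Oplus>\<^bsub>X\<^esub>j\<in>{..<n}. \<iota> j x \<odot>\<^bsub>X\<^esub> g j) = x)"

lemma dual_basis_hom:
  assumes db: "dual_basis R X n \<iota> g" and A: "right_module R A" and a: "\<And>j. j < n \<Longrightarrow> a j \<in> carrier A"
  shows "(\<lambda>x. \<Oplus>\<^bsub>A\<^esub>j\<in>{..<n}. \<iota> j x \<odot>\<^bsub>A\<^esub> a j) \<in> rhom R X A"
proof -
  interpret A: right_module R A by fact
  have c: "\<iota> j x \<in> carrier R" if "j < n" "x \<in> carrier X" for j x
    using db that by (auto simp: dual_basis_def)
  show ?thesis
  proof (rule rhomI)
    fix x assume x: "x \<in> carrier X"
    show "(\<Oplus>\<^bsub>A\<^esub>j\<in>{..<n}. \<iota> j x \<odot>\<^bsub>A\<^esub> a j) \<in> carrier A"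
      using c x a by (auto intro!: A.M.finsum_closed A.act_closed)
    fix y assume y: "y \<in> carrier X"
    have "(\<Oplus>\<^bsub>A\<^esub>j\<in>{..<n}. \<iota> j (x \<oplus>\<^bsub>X\<^esub> y) \<odot>\<^bsub>A\<^esub> a j) =
        (\<Oplus>\<^bsub>A\<^esub>j\<in>{..<n}. \<iota> j x \<odot>\<^bsub>A\<^esub> a j \<oplus>\<^bsub>A\<^esub> \<iota> j y \<odot>\<^bsub>A\<^esub> a j)"
      using db x y a c by (intro A.M.finsum_cong') (auto simp: dual_basis_def A.act_l_distr A.act_closed)
    also have "\<dots> = (\<Oplus>\<^bsub>A\<^esub>j\<in>{..<n}. \<iota> j x \<odot>\<^bsub>A\<^esub> a j) \<oplus>\<^bsub>A\<^esub> (\<Oplus>\<^bsub>A\<^esub>j\<in>{..<n}. \<iota> j y \<odot>\<^bsub>A\<^esub> a j)"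
      using c x y a by (intro A.M.finsum_addf) (auto intro!: A.act_closed)
    finally show "(\<Oplus>\<^bsub>A\<^esub>j\<in>{..<n}. \<iota> j (x \<oplus>\<^bsub>X\<^esub> y) \<odot>\<^bsub>A\<^esub> a j) = \<dots>" .
  next
    fix r x assume r: "r \<in> carrier R" and x: "x \<in> carrier X"
    have "(\<Oplus>\<^bsub>A\<^esub>j\<in>{..<n}. \<iota> j (r \<odot>\<^bsub>X\<^esub> x) \<odot>\<^bsub>A\<^esub> a j) = (\<Oplus>\<^bsub>A\<^esub>j\<in>{..<n}. r \<odot>\<^bsub>A\<^esub> (\<iota> j x \<odot>\<^bsub>A\<^esub> a j))"
      using db r x a c by (intro A.M.finsum_cong') (auto simp: dual_basis_def A.act_assoc A.act_closed)
    also have "\<dots> = r \<odot>\<^bsub>A\<^esub> (\<Oplus>\<^bsub>A\<^esub>j\<in>{..<n}. \<iota> j x \<odot>\<^bsub>A\<^esub> a j)"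
      using r x a c by (intro A.act_finsum[symmetric]) (auto intro!: A.act_closed)
    finally show "(\<Oplus>\<^bsub>A\<^esub>j\<in>{..<n}. \<iota> j (r \<odot>\<^bsub>X\<^esub> x) \<odot>\<^bsub>A\<^esub> a j) = \<dots>" .
  qed
qed

text \<open>
  It suffices to choose preimages of the finitely many values of \<open>f\<close> on the generators.
  Surjectivity of \<open>d\<close> is only required over the image of \<open>f\<close>, which is
  what exactness of a complex provides.
\<close>

lemma dual_basis_lift:
  assumes db: "dual_basis R X n \<iota> g" and X: "right_module R X" and A: "right_module R A" and B: "right_module R B"
    and f: "f \<in> rhom R X B" and d: "d \<in> rhom R A B" and im: "\<And>x. x \<in> carrier X \<Longrightarrow> f x \<in> d ` carrier A"
  shows "\<exists>h\<in>rhom R X A. \<forall>x\<in>carrier X. d (h x) = f x"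
proof -
  interpret X: right_module R X by fact
  interpret A: right_module R A by fact
  interpret B: right_module R B by fact
  have gX: "g j \<in> carrier X" if "j < n" for j using db that by (auto simp: dual_basis_def)
  have "\<forall>j. \<exists>a. j < n \<longrightarrow> a \<in> carrier A \<and> d a = f (g j)"
    using im gX by (metis imageE)
  then obtain a where a: "\<And>j. j < n \<Longrightarrow> a j \<in> carrier A \<and> d (a j) = f (g j)" by metis
  have c: "\<iota> j x \<in> carrier R" if "j < n" "x \<in> carrier X" for j x
    using db that by (auto simp: dual_basis_def)
  let ?h = "\<lambda>x. \<Oplus>\<^bsub>A\<^esub>j\<in>{..<n}. \<iota> j x \<odot>\<^bsub>A\<^esub> a j"
  have "d (?h x) = f x" if x: "x \<in> carrier X" for x
  proof -
    have "d (?h x) = (\<Oplus>\<^bsub>B\<^esub>j\<in>{..<n}. d (\<iota> j x \<odot>\<^bsub>A\<^esub> a j))"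
      using c a x by (intro rhom_finsum[OF d]) (auto intro!: A.act_closed A.M.abelian_group_axioms B.M.abelian_group_axioms)
    also have "\<dots> = (\<Oplus>\<^bsub>B\<^esub>j\<in>{..<n}. f (\<iota> j x \<odot>\<^bsub>X\<^esub> g j))"
      using c a x gX by (intro B.M.finsum_cong') (auto simp: rhom_act[OF d] rhom_act[OF f] intro!: B.act_closed rhom_closed[OF f] X.act_closed)
    also have "\<dots> = f (\<Oplus>\<^bsub>X\<^esub>j\<in>{..<n}. \<iota> j x \<odot>\<^bsub>X\<^esub> g j)"
      using c gX x by (intro rhom_finsum[OF f, symmetric]) (auto intro!: X.act_closed X.M.abelian_group_axioms B.M.abelian_group_axioms)
    also have "\<dots> = f x" using db x by (simp add: dual_basis_def)
    finally show ?thesis .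
  qed
  moreover have "?h \<in> rhom R X A" using a by (intro dual_basis_hom[OF db A]) auto
  ultimately show ?thesis by (intro bexI[of _ "?h"]) auto
qed

lemma fg_projective_dual_basis:
  assumes "fg_projective R P"
  shows "\<exists>n \<iota> g. dual_basis R P n \<iota> g"
proof -
  interpret P: right_module R P using assms by (simp add: fg_projective_def)
  from assms obtain n \<iota> \<pi> where \<iota>: "\<iota> \<in> rhom R P (free_module R n)" and \<pi>: "\<pi> \<in> rhom R (free_module R n) P"
    and id: "\<And>x. x \<in> carrier P \<Longrightarrow> \<pi> (\<iota> x) = x" by (auto simp: fg_projective_def)
  define e where "e j = (\<lambda>i\<in>{..<n}. if i = j then \<one>\<^bsub>R\<^esub> else \<zero>\<^bsub>R\<^esub>)" for j
  have e: "e j \<in> carrier (free_module R n)" for j by (auto simp: e_def free_module_def)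
  have z: "(\<lambda>i\<in>{..<n}. \<zero>\<^bsub>R\<^esub>) \<in> carrier (free_module R n)" by (auto simp: free_module_def)
  have "\<pi> (\<lambda>i\<in>{..<n}. \<zero>\<^bsub>R\<^esub>) \<oplus>\<^bsub>P\<^esub> \<pi> (\<lambda>i\<in>{..<n}. \<zero>\<^bsub>R\<^esub>) = \<pi> (\<lambda>i\<in>{..<n}. \<zero>\<^bsub>R\<^esub>)"
    using rhom_add[OF \<pi> z z] by (simp add: free_module_def cong: restrict_cong)
  hence pz: "\<pi> (\<lambda>i\<in>{..<n}. \<zero>\<^bsub>R\<^esub>) = \<zero>\<^bsub>P\<^esub>" using rhom_closed[OF \<pi> z] by (metis P.M.add.l_cancel_one')
  have part: "\<pi> (\<lambda>i\<in>{..<n}. if i < k then X i else \<zero>\<^bsub>R\<^esub>) = (\<Oplus>\<^bsub>P\<^esub>j\<in>{..<k}. X j \<odot>\<^bsub>P\<^esub> \<pi> (e j))"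
    if X: "\<And>i. i < n \<Longrightarrow> X i \<in> carrier R" and "k \<le> n" for X k
    using \<open>k \<le> n\<close>
  proof (induction k)
    case 0
    have "(\<lambda>i\<in>{..<n}. if i < 0 then X i else \<zero>\<^bsub>R\<^esub>) = (\<lambda>i\<in>{..<n}. \<zero>\<^bsub>R\<^esub>)" by simp
    thus ?case using pz by (simp only: lessThan_0 P.M.finsum_empty)
  next
    case (Suc k)
    let ?Y = "\<lambda>i\<in>{..<n}. if i < k then X i else \<zero>\<^bsub>R\<^esub>"
    have Y: "?Y \<in> carrier (free_module R n)" using X by (auto simp: free_module_def)
    have ek: "X k \<odot>\<^bsub>free_module R n\<^esub> e k \<in> carrier (free_module R n)"
      using X[of k] Suc.prems by (auto simp: free_module_def e_def)
    have "(\<lambda>i\<in>{..<n}. if i < Suc k then X i else \<zero>\<^bsub>R\<^esub>) = X k \<odot>\<^bsub>free_module R n\<^esub> e k \<oplus>\<^bsub>free_module R n\<^esub> ?Y"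
      using X Suc.prems by (auto simp: free_module_def e_def fun_eq_iff less_Suc_eq restrict_def)
    hence "\<pi> (\<lambda>i\<in>{..<n}. if i < Suc k then X i else \<zero>\<^bsub>R\<^esub>) = X k \<odot>\<^bsub>P\<^esub> \<pi> (e k) \<oplus>\<^bsub>P\<^esub> \<pi> ?Y"
      using rhom_add[OF \<pi> ek Y] rhom_act[OF \<pi> _ e, of "X k" k] X Suc.prems by simp
    also have "\<pi> ?Y = (\<Oplus>\<^bsub>P\<^esub>j\<in>{..<k}. X j \<odot>\<^bsub>P\<^esub> \<pi> (e j))" using Suc by (simp only: Suc_leD)
    also have "X k \<odot>\<^bsub>P\<^esub> \<pi> (e k) \<oplus>\<^bsub>P\<^esub> \<dots> = (\<Oplus>\<^bsub>P\<^esub>j\<in>insert k {..<k}. X j \<odot>\<^bsub>P\<^esub> \<pi> (e j))"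
      using Suc.prems X rhom_closed[OF \<pi> e]
      by (intro P.M.finsum_insert[symmetric]) (auto intro!: P.act_closed)
    finally show ?case by (simp only: lessThan_Suc)
  qed
  have "dual_basis R P n (\<lambda>j x. \<iota> x j) (\<lambda>j. \<pi> (e j))"
    unfolding dual_basis_def
  proof (intro conjI allI impI ballI)
    fix j assume j: "j < n"
    show "\<pi> (e j) \<in> carrier P" by (rule rhom_closed[OF \<pi> e])
    fix x assume x: "x \<in> carrier P"
    show "\<iota> x j \<in> carrier R" using rhom_closed[OF \<iota> x] j by (auto simp: free_module_def)
    show "\<iota> (x \<oplus>\<^bsub>P\<^esub> y) j = \<iota> x j \<oplus>\<^bsub>R\<^esub> \<iota> y j" if "y \<in> carrier P" for y
      using rhom_add[OF \<iota> x that] j by (simp add: free_module_def)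
    show "\<iota> (r \<odot>\<^bsub>P\<^esub> x) j = \<iota> x j \<otimes>\<^bsub>R\<^esub> r" if "r \<in> carrier R" for r
      using rhom_act[OF \<iota> that x] j by (simp add: free_module_def)
  next
    fix x assume x: "x \<in> carrier P"
    have c: "\<iota> x \<in> {..<n} \<rightarrow>\<^sub>E carrier R" using rhom_closed[OF \<iota> x] by (simp add: free_module_def)
    have "(\<lambda>i\<in>{..<n}. if i < n then \<iota> x i else \<zero>\<^bsub>R\<^esub>) = \<iota> x"
      using c by (auto simp: fun_eq_iff restrict_def PiE_def extensional_def)
    thus "(\<Oplus>\<^bsub>P\<^esub>j\<in>{..<n}. \<iota> x j \<odot>\<^bsub>P\<^esub> \<pi> (e j)) = x"
      using part[of "\<iota> x" n] c id[OF x] by (auto simp: PiE_def Pi_def)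
  qed
  thus ?thesis by blast
qed

section \<open>Projective resolutions and comparison maps\<close>

definition cycles ::
    "('r, 'm) module \<Rightarrow> (nat \<Rightarrow> ('r, 'p) module) \<Rightarrow> (nat \<Rightarrow> 'p \<Rightarrow> 'p) \<Rightarrow> ('p \<Rightarrow> 'm) \<Rightarrow> nat \<Rightarrow> 'p set" where
  "cycles M P d e n = (case n of 0 \<Rightarrow> {x \<in> carrier (P 0). e x = \<zero>\<^bsub>M\<^esub>}
                               | Suc k \<Rightarrow> {x \<in> carrier (P (Suc k)). d k x = \<zero>\<^bsub>P k\<^esub>})"

lemma cycles_subset: "cycles M P d e n \<subseteq> carrier (P n)"
  by (auto simp: cycles_def split: nat.splits)

text \<open>
  The condition that the given resolution and the explicit one share; they have terms of different
  types, so the comparison below has to be polymorphic in both.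
\<close>

definition resolves ::
    "('r, 'a) ring_scheme \<Rightarrow> ('r, 'm) module \<Rightarrow> (nat \<Rightarrow> ('r, 'p) module) \<Rightarrow>
     (nat \<Rightarrow> 'p \<Rightarrow> 'p) \<Rightarrow> ('p \<Rightarrow> 'm) \<Rightarrow> bool" where
  "resolves R M P d e \<longleftrightarrow> right_module R M \<and>
     (\<forall>n. right_module R (P n) \<and> (\<exists>m \<iota> g. dual_basis R (P n) m \<iota> g)) \<and>
     e \<in> rhom R (P 0) M \<and> e ` carrier (P 0) = carrier M \<and>
     (\<forall>n. d n \<in> rhom R (P (Suc n)) (P n) \<and> d n ` carrier (P (Suc n)) = cycles M P d e n)"

lemma carrier_syzygy: "carrier (syzygy M P d e n) = cycles M P d e n"
  by (auto simp: syzygy_def cycles_def a_kernel_def' split: nat.splits)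

lemma projective_resolution_resolves:
  assumes "projective_resolution R M P d e" "right_module R M"
  shows "resolves R M P d e"
  unfolding resolves_def
proof (intro conjI allI)
  fix n
  show "right_module R (P n)" "\<exists>m \<iota> g. dual_basis R (P n) m \<iota> g"
    using assms fg_projective_dual_basis[of R "P n"] by (simp_all add: projective_resolution_def fg_projective_def)
  show "d n ` carrier (P (Suc n)) = cycles M P d e n"
    using assms by (cases n) (auto simp: projective_resolution_def cycles_def a_kernel_def')
qed (use assms in \<open>auto simp: projective_resolution_def\<close>)

lemma chain_map_exists:
  assumes A: "resolves R M A dA eA" and B: "resolves R M B dB eB"
  shows "\<exists>f. (\<forall>n. f n \<in> rhom R (A n) (B n)) \<and> (\<forall>x\<in>carrier (A 0). eB (f 0 x) = eA x) \<and>
           (\<forall>n. \<forall>x\<in>carrier (A (Suc n)). dB n (f (Suc n) x) = f n (dA n x))"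
proof -
  have mM: "right_module R M" and mA: "\<And>n. right_module R (A n)" and mB: "\<And>n. right_module R (B n)"
    and dA: "\<And>n. dA n \<in> rhom R (A (Suc n)) (A n)" and dB: "\<And>n. dB n \<in> rhom R (B (Suc n)) (B n)"
    and eA: "eA \<in> rhom R (A 0) M" and eB: "eB \<in> rhom R (B 0) M" "eB ` carrier (B 0) = carrier M"
    and xA: "\<And>n. dA n ` carrier (A (Suc n)) = cycles M A dA eA n"
    and xB: "\<And>n. dB n ` carrier (B (Suc n)) = cycles M B dB eB n"
    and pA: "\<And>n. \<exists>m \<iota> g. dual_basis R (A n) m \<iota> g"
    using A B by (auto simp: resolves_def)
  have ab: "abelian_group (A n)" "abelian_group (B n)" for n
    using mA[of n] mB[of n] by (auto simp: right_module_def)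
  let ?P = "\<lambda>n f. f \<in> rhom R (A n) (B n) \<and> f ` cycles M A dA eA n \<subseteq> cycles M B dB eB n \<and>
      (n = 0 \<longrightarrow> (\<forall>x\<in>carrier (A 0). eB (f x) = eA x))"
  let ?Q = "\<lambda>n f g. \<forall>x\<in>carrier (A (Suc n)). dB n (g x) = f (dA n x)"
  have "\<exists>f. ?P 0 f"
  proof -
    obtain m \<iota> g where db: "dual_basis R (A 0) m \<iota> g" using pA by blast
    have "\<exists>f\<in>rhom R (A 0) (B 0). \<forall>x\<in>carrier (A 0). eB (f x) = eA x"
      using rhom_closed[OF eA] eB by (intro dual_basis_lift[OF db mA mB mM eA]) auto
    thus ?thesis by (auto simp: cycles_def dest: rhom_closed)
  qed
  moreover have "\<exists>g. ?P (Suc n) g \<and> ?Q n f g" if f: "?P n f" for n f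
  proof -
    obtain m \<iota> g where db: "dual_basis R (A (Suc n)) m \<iota> g" using pA by blast
    have "\<exists>g\<in>rhom R (A (Suc n)) (B (Suc n)). \<forall>x\<in>carrier (A (Suc n)). dB n (g x) = f (dA n x)"
    proof (rule dual_basis_lift[OF db mA mB mB rhom_comp[OF dA conjunct1[OF f]] dB])
      fix x assume "x \<in> carrier (A (Suc n))"
      hence "dA n x \<in> cycles M A dA eA n" using xA by blast
      thus "f (dA n x) \<in> dB n ` carrier (B (Suc n))" using f xB by blast
    qed
    then obtain g where g: "g \<in> rhom R (A (Suc n)) (B (Suc n))" "?Q n f g" by blast
    moreover have "g ` cycles M A dA eA (Suc n) \<subseteq> cycles M B dB eB (Suc n)"
      using g rhom_closed[OF g(1)] rhom_zero[OF conjunct1[OF f] ab] by (auto simp: cycles_def)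
    ultimately show ?thesis by (intro exI[of _ g]) simp
  qed
  ultimately have "\<exists>f. \<forall>n. ?P n (f n) \<and> ?Q n (f n) (f (Suc n))"
    by (rule dependent_nat_choice[of ?P ?Q])
  then obtain f where "\<forall>n. ?P n (f n) \<and> ?Q n (f n) (f (Suc n))" ..
  thus ?thesis by (intro exI[of _ f]) simp
qed

text \<open>
  The difference of \<open>f\<close> and the identity lifts the zero map, hence is null-homotopic.
  The homotopy is what allows cocycles on one resolution to be recovered from those on the other
  one.
\<close>

lemma null_homotopy_exists:
  assumes A: "resolves R M A d e"
    and f: "\<And>n. f n \<in> rhom R (A n) (A n)" "\<And>x. x \<in> carrier (A 0) \<Longrightarrow> e (f 0 x) = e x"
      "\<And>n x. x \<in> carrier (A (Suc n)) \<Longrightarrow> d n (f (Suc n) x) = f n (d n x)"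
  shows "\<exists>h. (\<forall>n. h n \<in> rhom R (A n) (A (Suc n))) \<and>
           (\<forall>n. \<forall>x\<in>carrier (A (Suc n)).
              f (Suc n) x = x \<oplus>\<^bsub>A (Suc n)\<^esub> (d (Suc n) (h (Suc n) x) \<oplus>\<^bsub>A (Suc n)\<^esub> h n (d n x)))"
proof -
  have mM: "right_module R M" and mA: "\<And>n. right_module R (A n)"
    and d: "\<And>n. d n \<in> rhom R (A (Suc n)) (A n)" and e: "e \<in> rhom R (A 0) M"
    and x: "\<And>n. d n ` carrier (A (Suc n)) = cycles M A d e n"
    and p: "\<And>n. \<exists>m \<iota> g. dual_basis R (A n) m \<iota> g"
    using A by (auto simp: resolves_def)
  have ab: "abelian_group (A n)" for n using mA[of n] by (auto simp: right_module_def)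
  have abM: "abelian_group M" using mM by (auto simp: right_module_def)
  have dc: "d n x \<in> cycles M A d e n" if "x \<in> carrier (A (Suc n))" for n x using x that by blast
  let ?P = "\<lambda>n h. h \<in> rhom R (A n) (A (Suc n)) \<and> (\<forall>y\<in>cycles M A d e n. d n (h y) = f n y \<ominus>\<^bsub>A n\<^esub> y)"
  let ?Q = "\<lambda>n h h'. \<forall>x\<in>carrier (A (Suc n)).
      d (Suc n) (h' x) = f (Suc n) x \<ominus>\<^bsub>A (Suc n)\<^esub> x \<ominus>\<^bsub>A (Suc n)\<^esub> h (d n x)"
  have "\<exists>h. ?P 0 h"
  proof -
    obtain m \<iota> g where db: "dual_basis R (A 0) m \<iota> g" using p by blast
    interpret A0: abelian_group "A 0" by (rule ab)
    interpret M: abelian_group M by (rule abM)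
    have "\<exists>h\<in>rhom R (A 0) (A (Suc 0)). \<forall>x\<in>carrier (A 0). d 0 (h x) = f 0 x \<ominus>\<^bsub>A 0\<^esub> x"
    proof (rule dual_basis_lift[OF db mA mA mA rhom_sub[OF f(1) rhom_id mA] d])
      fix y assume y: "y \<in> carrier (A 0)"
      have "e (f 0 y \<ominus>\<^bsub>A 0\<^esub> y) = \<zero>\<^bsub>M\<^esub>"
        using y rhom_closed[OF f(1) y] rhom_closed[OF e y]
        by (simp add: rhom_diff[OF e A0.abelian_group_axioms M.abelian_group_axioms] f(2))
      thus "f 0 y \<ominus>\<^bsub>A 0\<^esub> y \<in> d 0 ` carrier (A (Suc 0))"
        using y rhom_closed[OF f(1) y] by (simp add: x cycles_def)
    qed
    thus ?thesis by (auto simp: cycles_def)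
  qed
  moreover have "\<exists>h'. ?P (Suc n) h' \<and> ?Q n h h'" if h: "?P n h" for n h
  proof -
    interpret An: abelian_group "A n" by (rule ab)
    interpret A: abelian_group "A (Suc n)" by (rule ab)
    have hh: "h \<in> rhom R (A n) (A (Suc n))" by (rule conjunct1[OF h])
    obtain m \<iota> g where db: "dual_basis R (A (Suc n)) m \<iota> g" using p[of "Suc n"] by (elim exE)
    have "\<exists>h'\<in>rhom R (A (Suc n)) (A (Suc (Suc n))). ?Q n h h'"
    proof (rule dual_basis_lift[OF db mA mA mA rhom_sub[OF rhom_sub[OF f(1) rhom_id mA] rhom_comp[OF d hh] mA] d])
      fix y assume y: "y \<in> carrier (A (Suc n))"
      note c = y rhom_closed[OF f(1) y] rhom_closed[OF d y] rhom_closed[OF hh rhom_closed[OF d y]] rhom_closed[OF f(1) rhom_closed[OF d y]]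
      have "d n (f (Suc n) y \<ominus>\<^bsub>A (Suc n)\<^esub> y \<ominus>\<^bsub>A (Suc n)\<^esub> h (d n y)) = f n (d n y) \<ominus>\<^bsub>A n\<^esub> d n y \<ominus>\<^bsub>A n\<^esub> d n (h (d n y))"
        using c by (simp add: rhom_diff[OF d ab ab] f(3))
      also have "d n (h (d n y)) = f n (d n y) \<ominus>\<^bsub>A n\<^esub> d n y" using h dc[OF y] by blast
      also have "f n (d n y) \<ominus>\<^bsub>A n\<^esub> d n y \<ominus>\<^bsub>A n\<^esub> (f n (d n y) \<ominus>\<^bsub>A n\<^esub> d n y) = \<zero>\<^bsub>A n\<^esub>"
        using c by (simp add: a_minus_def An.r_neg)
      finally show "f (Suc n) y \<ominus>\<^bsub>A (Suc n)\<^esub> y \<ominus>\<^bsub>A (Suc n)\<^esub> h (d n y) \<in> d (Suc n) ` carrier (A (Suc (Suc n)))"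
        using c by (simp add: x cycles_def)
    qed
    then obtain h' where h': "h' \<in> rhom R (A (Suc n)) (A (Suc (Suc n)))" "?Q n h h'" by blast
    moreover have "d (Suc n) (h' y) = f (Suc n) y \<ominus>\<^bsub>A (Suc n)\<^esub> y" if "y \<in> cycles M A d e (Suc n)" for y
      using h'(2) that rhom_closed[OF f(1)] rhom_zero[OF hh ab ab]
      by (auto simp: cycles_def a_minus_def)
    ultimately show ?thesis by (intro exI[of _ h']) simp
  qed
  ultimately have "\<exists>h. \<forall>n. ?P n (h n) \<and> ?Q n (h n) (h (Suc n))"
    by (rule dependent_nat_choice[of ?P ?Q])
  then obtain h where h': "\<forall>n. ?P n (h n) \<and> ?Q n (h n) (h (Suc n))" ..
  note h = conjunct1[OF spec[OF h']] conjunct2[OF spec[OF h']]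
  have "f (Suc n) y = y \<oplus>\<^bsub>A (Suc n)\<^esub> (d (Suc n) (h (Suc n) y) \<oplus>\<^bsub>A (Suc n)\<^esub> h n (d n y))"
    if y: "y \<in> carrier (A (Suc n))" for n y
  proof -
    interpret A: abelian_group "A (Suc n)" by (rule ab)
    have hh: "h n \<in> rhom R (A n) (A (Suc n))" using h(1) by simp
    note c = y rhom_closed[OF f(1) y] rhom_closed[OF hh rhom_closed[OF d y]]
    have "d (Suc n) (h (Suc n) y) = f (Suc n) y \<ominus>\<^bsub>A (Suc n)\<^esub> y \<ominus>\<^bsub>A (Suc n)\<^esub> h n (d n y)"
      using h(2) y by blast
    hence "y \<oplus>\<^bsub>A (Suc n)\<^esub> (d (Suc n) (h (Suc n) y) \<oplus>\<^bsub>A (Suc n)\<^esub> h n (d n y)) =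
        y \<oplus>\<^bsub>A (Suc n)\<^esub> ((f (Suc n) y \<ominus>\<^bsub>A (Suc n)\<^esub> y \<ominus>\<^bsub>A (Suc n)\<^esub> h n (d n y)) \<oplus>\<^bsub>A (Suc n)\<^esub> h n (d n y))" by simp
    also have "\<dots> = f (Suc n) y"
      using c by (simp add: a_minus_def A.a_assoc A.l_neg) (simp add: A.a_lcomm[of y "f (Suc n) y"] A.r_neg)
    finally show ?thesis by simp
  qed
  thus ?thesis using h(1) by (intro exI[of _ h] conjI allI ballI) (rule conjunct1, assumption)
qed

section \<open>Subquotients with coordinates\<close>

text \<open>
  Linear coordinates on \<open>Z\<close> that have kernel \<open>B\<close> and take all values
  identify \<open>Z / B\<close> with the space of functions on \<open>X\<close>.
\<close>

locale coordinates =
  fixes V :: "('k::field, 'v) module" and Z B :: "'v set" and X :: "'x set" and \<Theta> :: "'v \<Rightarrow> 'x \<Rightarrow> 'k"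
  assumes finite_X: "finite X"
    and add: "\<And>y z. y \<in> Z \<Longrightarrow> z \<in> Z \<Longrightarrow> y \<oplus>\<^bsub>V\<^esub> z \<in> Z \<and> (\<forall>x\<in>X. \<Theta> (y \<oplus>\<^bsub>V\<^esub> z) x = \<Theta> y x + \<Theta> z x)"
    and scale: "\<And>c z. z \<in> Z \<Longrightarrow> c \<odot>\<^bsub>V\<^esub> z \<in> Z \<and> (\<forall>x\<in>X. \<Theta> (c \<odot>\<^bsub>V\<^esub> z) x = c * \<Theta> z x)"
    and subtract: "\<And>y z. y \<in> Z \<Longrightarrow> z \<in> Z \<Longrightarrow> \<exists>b\<in>Z. b \<oplus>\<^bsub>V\<^esub> y = z"
    and onto: "\<And>a. \<exists>z\<in>Z. \<forall>x\<in>X. \<Theta> z x = a x"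
    and null: "B = {z \<in> Z. \<forall>x\<in>X. \<Theta> z x = 0}"
begin

definition fibre :: "('x \<Rightarrow> 'k) \<Rightarrow> 'v set" where
  "fibre a = {z \<in> Z. \<forall>x\<in>X. \<Theta> z x = a x}"

abbreviation S where "S \<equiv> subquotient V Z B"

lemma fibre_eq_iff: "fibre a = fibre b \<longleftrightarrow> (\<forall>x\<in>X. a x = b x)"
proof
  assume *: "fibre a = fibre b"
  obtain z where "z \<in> fibre a" using onto[of a] by (auto simp: fibre_def)
  with * have "z \<in> fibre a" "z \<in> fibre b" by auto
  thus "\<forall>x\<in>X. a x = b x" by (auto simp: fibre_def)
qed (auto simp: fibre_def)

text \<open>
  The elements of the quotient are the fibres of the coordinates, so computations with cosets become
  computations with functions on \<open>X\<close>.
\<close>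

lemma coset_eq_fibre:
  assumes "z \<in> Z" shows "B +>\<^bsub>V\<^esub> z = fibre (\<Theta> z)"
proof (intro Set.set_eqI iffI)
  fix y assume "y \<in> B +>\<^bsub>V\<^esub> z"
  then obtain b where "b \<in> B" "y = b \<oplus>\<^bsub>V\<^esub> z" by (auto simp: a_r_coset_def')
  thus "y \<in> fibre (\<Theta> z)" using add[of b z] assms by (auto simp: null fibre_def)
next
  fix y assume y: "y \<in> fibre (\<Theta> z)"
  then obtain b where b: "b \<in> Z" "b \<oplus>\<^bsub>V\<^esub> z = y" using subtract[of z y] assms by (auto simp: fibre_def)
  have "b \<in> B" using b y add[OF b(1) assms] by (auto simp: null fibre_def)
  thus "y \<in> B +>\<^bsub>V\<^esub> z" using b by (auto simp: a_r_coset_def')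
qed

lemma carrier_S: "carrier S = range fibre"
proof -
  have "fibre a \<in> (\<lambda>z. B +>\<^bsub>V\<^esub> z) ` Z" for a
  proof -
    obtain z where "z \<in> Z" "\<forall>x\<in>X. \<Theta> z x = a x" using onto[of a] by auto
    thus ?thesis using coset_eq_fibre[of z] by (intro image_eqI[of _ _ z]) (auto simp: fibre_eq_iff)
  qed
  thus ?thesis by (auto simp: subquotient_def coset_eq_fibre)
qed

lemma zero_S: "\<zero>\<^bsub>S\<^esub> = fibre (\<lambda>x. 0)"
  by (simp add: subquotient_def null fibre_def)

lemma add_S: "fibre a \<oplus>\<^bsub>S\<^esub> fibre b = fibre (\<lambda>x. a x + b x)"
proof -
  have "fibre a <+>\<^bsub>V\<^esub> fibre b = fibre (\<lambda>x. a x + b x)"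
  proof (intro Set.set_eqI iffI)
    fix y assume "y \<in> fibre a <+>\<^bsub>V\<^esub> fibre b"
    then obtain p q where "p \<in> fibre a" "q \<in> fibre b" "y = p \<oplus>\<^bsub>V\<^esub> q" by (auto simp: set_add_def')
    thus "y \<in> fibre (\<lambda>x. a x + b x)" using add[of p q] by (auto simp: fibre_def)
  next
    fix y assume y: "y \<in> fibre (\<lambda>x. a x + b x)"
    obtain q where q: "q \<in> Z" "\<forall>x\<in>X. \<Theta> q x = b x" using onto[of b] by auto
    then obtain p where p: "p \<in> Z" "p \<oplus>\<^bsub>V\<^esub> q = y" using subtract[of q y] y by (auto simp: fibre_def)
    have "p \<in> fibre a" using add[OF p(1) q(1)] p q y by (auto simp: fibre_def)
    thus "y \<in> fibre a <+>\<^bsub>V\<^esub> fibre b" using p q by (auto simp: set_add_def' fibre_def)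
  qed
  thus ?thesis by (simp add: subquotient_def)
qed

lemma smult_S: "c \<odot>\<^bsub>S\<^esub> fibre a = fibre (\<lambda>x. c * a x)"
proof -
  have "B +>\<^bsub>V\<^esub> (c \<odot>\<^bsub>V\<^esub> z) = fibre (\<lambda>x. c * a x)" if "z \<in> fibre a" for z
    using that scale[of z c] coset_eq_fibre[of "c \<odot>\<^bsub>V\<^esub> z"] by (auto simp: fibre_def)
  moreover have "fibre a \<noteq> {}" using onto[of a] by (auto simp: fibre_def)
  ultimately show ?thesis by (auto simp: subquotient_def)
qed

lemma vectorspace_S: "vectorspace class_ring S"
  unfolding vectorspace_def
proof
  show "field (class_ring :: 'k ring)" by (rule class_field)
  have "abelian_group S"
  proof (rule abelian_groupI)
    fix x assume "x \<in> carrier S"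
    then obtain a where "x = fibre a" by (auto simp: carrier_S)
    thus "\<exists>y\<in>carrier S. y \<oplus>\<^bsub>S\<^esub> x = \<zero>\<^bsub>S\<^esub>"
      by (intro bexI[of _ "fibre (\<lambda>x. - a x)"]) (auto simp: carrier_S add_S zero_S)
  qed (auto simp: carrier_S add_S zero_S algebra_simps)
  moreover have "module_axioms class_ring S"
    by (rule module_axioms.intro) (auto simp: carrier_S add_S smult_S algebra_simps)
  moreover have "cring (class_ring :: 'k ring)" by (rule class_cring.is_cring)
  ultimately show "Module.module class_ring S" by (simp add: Module.module_def)
qed

lemma basis_S:
  assumes u: "\<And>i. i \<in> X \<Longrightarrow> u i \<in> Z" "\<And>i x. i \<in> X \<Longrightarrow> x \<in> X \<Longrightarrow> \<Theta> (u i) x \<noteq> 0 \<longleftrightarrow> x = i"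
  shows "is_basis S ((\<lambda>i. B +>\<^bsub>V\<^esub> u i) ` X)" "inj_on (\<lambda>i. B +>\<^bsub>V\<^esub> u i) X"
proof -
  let ?c = "\<lambda>i. B +>\<^bsub>V\<^esub> u i" and ?A = "(\<lambda>i. B +>\<^bsub>V\<^esub> u i) ` X"
  interpret S: vectorspace "class_ring :: 'k ring" S by (rule vectorspace_S)
  have c: "?c i = fibre (\<Theta> (u i))" if "i \<in> X" for i using coset_eq_fibre u that by blast
  show inj: "inj_on ?c X"
  proof (rule inj_onI)
    fix i j assume ij: "i \<in> X" "j \<in> X" "?c i = ?c j"
    hence "\<Theta> (u i) i = \<Theta> (u j) i" by (simp add: c fibre_eq_iff)
    thus "i = j" using u(2)[of i i] u(2)[of j i] ij by simp
  qed
  have A: "?A \<subseteq> carrier S" "finite ?A" using finite_X by (auto simp: carrier_S c)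
  have sum: "finsum S (\<lambda>v. f v \<odot>\<^bsub>S\<^esub> v) (?c ` Y) = fibre (\<lambda>x. \<Sum>i\<in>Y. f (?c i) * \<Theta> (u i) x)" if "Y \<subseteq> X" for Y f
    using finite_subset[OF that finite_X] that
  proof (induction Y)
    case empty
    show ?case by (simp add: zero_S)
  next
    case (insert y Y)
    have "finsum S (\<lambda>v. f v \<odot>\<^bsub>S\<^esub> v) (insert (?c y) (?c ` Y)) =
        f (?c y) \<odot>\<^bsub>S\<^esub> ?c y \<oplus>\<^bsub>S\<^esub> finsum S (\<lambda>v. f v \<odot>\<^bsub>S\<^esub> v) (?c ` Y)"
    proof (rule S.finsum_insert)
      show "finite (?c ` Y)" using insert by simp
      show "?c y \<notin> ?c ` Y" using insert inj_onD[OF inj, of y] by blast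
      show "(\<lambda>v. f v \<odot>\<^bsub>S\<^esub> v) \<in> ?c ` Y \<rightarrow> carrier S" "f (?c y) \<odot>\<^bsub>S\<^esub> ?c y \<in> carrier S"
        using insert.prems subsetD[OF insert.prems] by (auto simp: c smult_S carrier_S)
    qed
    also have "\<dots> = fibre (\<lambda>x. \<Sum>i\<in>insert y Y. f (?c i) * \<Theta> (u i) x)"
      using insert by (simp add: c smult_S add_S)
    finally show ?case by simp
  qed
  have lc: "S.lincomb f ?A = fibre (\<lambda>x. f (?c x) * \<Theta> (u x) x)" for f
  proof -
    have "(\<Sum>i\<in>X. f (?c i) * \<Theta> (u i) x) = f (?c x) * \<Theta> (u x) x" if "x \<in> X" for x
    proof -
      have "(\<Sum>i\<in>X. f (?c i) * \<Theta> (u i) x) = (\<Sum>i\<in>X. if i = x then f (?c x) * \<Theta> (u x) x else 0)"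
        using u(2) that by (intro sum.cong) auto
      thus ?thesis using that finite_X by simp
    qed
    thus ?thesis using sum[of X f] by (simp add: S.lincomb_def fibre_eq_iff)
  qed
  have "S.lin_indpt ?A"
  proof (rule S.finite_lin_indpt2[OF A(2,1)])
    fix a assume "S.lincomb a ?A = \<zero>\<^bsub>S\<^esub>"
    hence "\<forall>x\<in>X. a (?c x) * \<Theta> (u x) x = 0" by (simp add: lc zero_S fibre_eq_iff)
    thus "\<forall>v\<in>?A. a v = \<zero>\<^bsub>class_ring\<^esub>" using u(2) by auto
  qed
  moreover have "fibre b \<in> S.span ?A" for b
  proof -
    define a where "a v = (let i = inv_into X ?c v in b i / \<Theta> (u i) i)" for v
    have "S.lincomb a ?A = fibre b"
      unfolding lc using u(2) by (auto simp: a_def fibre_eq_iff inv_into_f_f[OF inj] Let_def)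
    thus ?thesis unfolding S.finite_span[OF A(2,1)] by (auto intro!: exI[of _ a])
  qed
  hence "S.gen_set ?A" using S.span_is_subset2[OF A(1)] by (auto simp: carrier_S)
  ultimately show "is_basis S ?A"
    using A(1) vectorspace_S by (simp add: is_basis_def S.basis_def)
qed

lemma has_dim_S: "has_dim S (card X)"
proof -
  interpret S: vectorspace "class_ring :: 'k ring" S by (rule vectorspace_S)
  have "\<forall>i. \<exists>z\<in>Z. \<forall>x\<in>X. \<Theta> z x = (if x = i then 1 else 0)" by (intro allI onto)
  then obtain u where u: "\<And>i. u i \<in> Z" "\<And>i x. x \<in> X \<Longrightarrow> \<Theta> (u i) x = (if x = i then 1 else 0)" by metis
  let ?A = "(\<lambda>i. B +>\<^bsub>V\<^esub> u i) ` X"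
  have b: "is_basis S ?A" "inj_on (\<lambda>i. B +>\<^bsub>V\<^esub> u i) X" using basis_S[of u] u by auto
  hence A: "S.basis ?A" "finite ?A" using finite_X by (auto simp: is_basis_def)
  have "S.fin_dim" using A unfolding S.fin_dim_def S.basis_def by blast
  moreover have "S.dim = card X" using S.dim_basis[OF A(2,1)] card_image[OF b(2)] by simp
  ultimately show ?thesis using vectorspace_S by (simp add: has_dim_def)
qed

end

lemma coordinates_isomorphic:
  assumes "coordinates V Z B X \<Theta>" "coordinates V' Z' B' X \<Theta>'"
  shows "vs_isomorphic (subquotient V Z B) (subquotient V' Z' B')"
proof -
  interpret A: coordinates V Z B X \<Theta> by fact
  interpret B: coordinates V' Z' B' X \<Theta>' by fact
  define f where "f = (\<lambda>s. B.fibre (SOME a. A.fibre a = s))"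
  have f: "f (A.fibre a) = B.fibre a" for a
  proof -
    have "A.fibre (SOME b. A.fibre b = A.fibre a) = A.fibre a" by (rule someI[where P = "\<lambda>b. A.fibre b = A.fibre a"]) (rule refl)
    thus ?thesis by (simp add: f_def A.fibre_eq_iff B.fibre_eq_iff)
  qed
  have "linear_map class_ring A.S B.S f"
    unfolding linear_map_def mod_hom_def mod_hom_axioms_def
  proof (intro conjI)
    show v: "vectorspace class_ring A.S" "vectorspace class_ring B.S" by (rule A.vectorspace_S B.vectorspace_S)+
    show "Module.module class_ring A.S" "Module.module class_ring B.S" using v by (simp_all add: vectorspace_def)
    show "f \<in> rhom class_ring A.S B.S"
      by (rule rhomI) (auto simp: A.carrier_S B.carrier_S f A.add_S B.add_S A.smult_S B.smult_S)
  qed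
  moreover have "bij_betw f (carrier A.S) (carrier B.S)"
  proof (rule bij_betw_imageI)
    show "inj_on f (carrier A.S)"
      by (auto simp: inj_on_def A.carrier_S f B.fibre_eq_iff) (auto simp: A.fibre_def)
    show "f ` carrier A.S = carrier B.S"
      by (simp add: A.carrier_S B.carrier_S image_image f)
  qed
  ultimately show ?thesis by (auto simp: vs_isomorphic_def)
qed

section \<open>Gentle algebras of triangulations\<close>

lemma sum_triangle_shift:
  fixes G :: "nat \<Rightarrow> nat \<Rightarrow> 'k::comm_monoid_add"
  shows "(\<Sum>i\<le>n. \<Sum>j\<le>i. G i j) = (\<Sum>j\<le>n. \<Sum>k\<le>n - j. G (j + k) j)"
  unfolding sum.Sigma[OF finite_atMost ballI[OF finite_atMost]]
  by (rule sum.reindex_bij_witness[of _ "\<lambda>(j, k). (j + k, j)" "\<lambda>(i, j). (j, i - j)"]) auto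

locale surface =
  fixes T :: "'d triangulation"
  assumes triangulation: "ideal_triangulation T"
begin

abbreviation "nx \<equiv> next_side T"
abbreviation "gl \<equiv> glue T"
abbreviation "arc \<equiv> arc_of_side T"
abbreviation "Q \<equiv> quiver T"

lemma finite_sides: "finite (sides T)"
  using triangulation by (simp add: ideal_triangulation_def)

lemma nx_side: "s \<in> sides T \<Longrightarrow> nx s \<in> sides T"
  and nx_neq: "s \<in> sides T \<Longrightarrow> nx s \<noteq> s"
  and nx3: "s \<in> sides T \<Longrightarrow> nx (nx (nx s)) = s"
  and gl_side: "s \<in> sides T \<Longrightarrow> gl s \<in> sides T"
  and gl_gl: "s \<in> sides T \<Longrightarrow> gl (gl s) = s"
  using triangulation by (auto simp: ideal_triangulation_def)

lemma reaches_boundary: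
  "s \<in> sides T \<Longrightarrow> \<exists>n. gl (((\<lambda>r. nx (gl r)) ^^ n) s) = ((\<lambda>r. nx (gl r)) ^^ n) s"
  using triangulation by (auto simp: ideal_triangulation_def Let_def)

lemma arc_sides_side: "s \<in> arc_sides T \<Longrightarrow> s \<in> sides T"
  by (simp add: arc_sides_def)

lemma gl_neq: "s \<in> arc_sides T \<Longrightarrow> gl s \<noteq> s"
  by (simp add: arc_sides_def)

lemma gl_arc: "s \<in> arc_sides T \<Longrightarrow> gl s \<in> arc_sides T"
  using gl_gl[of s] gl_side[of s] by (auto simp: arc_sides_def)

lemma arc_eq_iff: "a \<in> sides T \<Longrightarrow> b \<in> sides T \<Longrightarrow> arc a = arc b \<longleftrightarrow> a = b \<or> a = gl b"
  by (auto simp: arc_of_side_def doubleton_eq_iff gl_gl)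

lemma arcs_Q: "a \<in> arcs Q \<longleftrightarrow> a \<in> arc_sides T \<and> nx a \<in> arc_sides T"
  and tail_Q: "tail Q a = arc a" and head_Q: "head Q a = arc (nx a)"
  and verts_Q: "verts Q = arc ` arc_sides T"
  by (auto simp: quiver_def)

lemma arrow_side: "a \<in> arcs Q \<Longrightarrow> a \<in> sides T" "a \<in> arcs Q \<Longrightarrow> nx a \<in> sides T"
  by (auto simp: arcs_Q arc_sides_side)

lemma composable_iff:
  "a \<in> arcs Q \<Longrightarrow> b \<in> arcs Q \<Longrightarrow> head Q a = tail Q b \<longleftrightarrow> b = nx a \<or> b = gl (nx a)"
  using arc_eq_iff[of "nx a" b] gl_gl arrow_side[of a] arrow_side[of b] by (auto simp: tail_Q head_Q)

lemma internal_iff: "internal T a \<longleftrightarrow> a \<in> arcs Q \<and> nx a \<in> arcs Q"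
  by (auto simp: internal_def arcs_Q)

lemma internal_nx: "internal T a \<Longrightarrow> internal T (nx a)"
  using nx3[of a] by (auto simp: internal_def arc_sides_side)

lemma internal_side: "internal T a \<Longrightarrow> a \<in> sides T"
  by (simp add: internal_def arc_sides_side)

lemma nx_neq_gl: "a \<in> arcs Q \<Longrightarrow> nx a \<noteq> gl (nx a)"
  using gl_neq[of "nx a"] by (auto simp: arcs_Q)

lemma finite_verts: "finite (verts Q)"
  using finite_sides by (auto simp: verts_Q arc_sides_def intro: finite_subset)

lemma finite_arcs: "finite (arcs Q)"
  using finite_sides arrow_side by (auto intro: finite_subset[of _ "sides T"])

lemma tail_verts: "a \<in> arcs Q \<Longrightarrow> tail Q a \<in> verts Q" and head_verts: "a \<in> arcs Q \<Longrightarrow> head Q a \<in> verts Q"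
  by (auto simp: arcs_Q tail_Q head_Q verts_Q)

definition pend :: "'d set \<Rightarrow> 'd list \<Rightarrow> 'd set" where
  "pend u p = (if p = [] then u else head Q (last p))"

lemma pend_Nil [simp]: "pend u [] = u" and pend_Cons: "pend u (a # p) = pend (head Q a) p"
  and pend_snoc [simp]: "pend u (p @ [a]) = head Q a"
  by (simp_all add: pend_def)

lemma pend_append: "pend u (p @ q) = pend (pend u p) q"
  by (simp add: pend_def)

lemma path_end_eq: "path_end Q u p = pend u p"
proof (induction p arbitrary: u)
  case (Cons a p)
  have "pre_digraph.awalk_verts Q (head Q a) p \<noteq> []"
    by (cases p) (simp_all add: pre_digraph.awalk_verts.simps)
  with Cons show ?case by (simp add: pre_digraph.awalk_verts.simps pend_Cons)
qed (simp add: pre_digraph.awalk_verts.simps)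

abbreviation composable :: "'d list \<Rightarrow> bool" where
  "composable \<equiv> successively (\<lambda>a b. head Q a = tail Q b)"

lemma paths_iff:
  "(u, p) \<in> paths Q \<longleftrightarrow> u \<in> verts Q \<and> set p \<subseteq> arcs Q \<and> composable p \<and> (p \<noteq> [] \<longrightarrow> tail Q (hd p) = u)"
proof -
  have "(\<exists>v. pre_digraph.cas Q u p v) \<longleftrightarrow> composable p \<and> (p \<noteq> [] \<longrightarrow> tail Q (hd p) = u)"
  proof (induction p arbitrary: u)
    case (Cons a p)
    thus ?case by (cases p) (auto simp: pre_digraph.cas.simps)
  qed (auto simp: pre_digraph.cas.simps)
  thus ?thesis by (auto simp: paths_def pre_digraph.awalk_def)
qed

lemma paths_append:
  "(u, p @ q) \<in> paths Q \<longleftrightarrow> (u, p) \<in> paths Q \<and> (pend u p, q) \<in> paths Q"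
proof -
  have "head Q (last p) \<in> verts Q" if "set p \<subseteq> arcs Q" "p \<noteq> []" for p
    using that last_in_set[OF that(2)] by (intro head_verts) auto
  moreover have "tail Q (hd p) \<in> verts Q" if "set p \<subseteq> arcs Q" "p \<noteq> []" for p
    using that hd_in_set[OF that(2)] by (intro tail_verts) auto
  ultimately show ?thesis
    by (cases "p = []"; cases "q = []") (auto simp: paths_iff pend_def successively_append_iff)
qed

lemma pend_verts: "(u, p) \<in> paths Q \<Longrightarrow> pend u p \<in> verts Q"
  using paths_append[of u p "[]"] paths_iff[of "pend u p" "[]"] by simp

text \<open>
  Of the two arrows that can follow an arrow \<open>a\<close>, one stays in the same triangle and
  one lies across the arc at which \<open>a\<close> ends.  The paths that always cross turn around
  one marked point, and they are the nonzero paths of the algebra.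
\<close>

definition turning :: "'d list \<Rightarrow> bool" where
  "turning = successively (\<lambda>a b. b = gl (nx a))"

lemma turning_Nil [simp]: "turning []" and turning_single [simp]: "turning [a]"
  by (simp_all add: turning_def)

lemma turning_append:
  "turning (p @ q) \<longleftrightarrow> turning p \<and> turning q \<and> (p \<noteq> [] \<and> q \<noteq> [] \<longrightarrow> hd q = gl (nx (last p)))"
  by (auto simp: turning_def successively_append_iff)

lemma turning_Cons: "turning (a # q) \<longleftrightarrow> turning q \<and> (q \<noteq> [] \<longrightarrow> hd q = gl (nx a))"
  by (auto simp: turning_def successively_Cons)

end

locale gentle = surface T for T :: "'d triangulation" +
  fixes I :: "(('d set, 'd) path \<Rightarrow> 'k::field) set"
  assumes I_def: "I = gentle_ideal T"
begin

abbreviation A :: "(('d set, 'd) path \<Rightarrow> 'k) ring" where "A \<equiv> path_algebra Q"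
abbreviation \<Lambda> :: "(('d set, 'd) path \<Rightarrow> 'k) set ring" where "\<Lambda> \<equiv> A Quot I"

lemma carrier_A: "f \<in> carrier A \<longleftrightarrow> finite {p. f p \<noteq> 0} \<and> (\<forall>p. f p \<noteq> 0 \<longrightarrow> p \<in> paths Q)"
  by (auto simp: path_algebra_def)

lemma mult_A: "(f \<otimes>\<^bsub>A\<^esub> g) (u, p) = (\<Sum>i\<le>length p. f (u, take i p) * g (pend u (take i p), drop i p))"
  by (simp add: path_algebra_def path_end_eq)

lemma one_A: "\<one>\<^bsub>A\<^esub> (u, p) = (if u \<in> verts Q \<and> p = [] then 1 else 0)"
  and zero_A: "\<zero>\<^bsub>A\<^esub> = (\<lambda>p. 0)" and add_A: "f \<oplus>\<^bsub>A\<^esub> g = (\<lambda>p. f p + g p)"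
  by (simp_all add: path_algebra_def)

lemma mult_closed_A:
  assumes f: "f \<in> carrier A" and g: "g \<in> carrier A" shows "f \<otimes>\<^bsub>A\<^esub> g \<in> carrier A"
proof -
  let ?S = "(\<lambda>(p, q). (fst p, snd p @ snd q)) ` ({p. f p \<noteq> 0} \<times> {p. g p \<noteq> 0})"
  have *: "\<exists>i. f (u, take i p) \<noteq> 0 \<and> g (pend u (take i p), drop i p) \<noteq> 0"
    if nz: "(f \<otimes>\<^bsub>A\<^esub> g) (u, p) \<noteq> 0" for u p
  proof (rule ccontr)
    assume "\<not> ?thesis"
    hence "(f \<otimes>\<^bsub>A\<^esub> g) (u, p) = 0" unfolding mult_A by (intro sum.neutral) auto
    thus False using nz by simp
  qed
  have "{p. (f \<otimes>\<^bsub>A\<^esub> g) p \<noteq> 0} \<subseteq> ?S"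
  proof
    fix x assume "x \<in> {p. (f \<otimes>\<^bsub>A\<^esub> g) p \<noteq> 0}"
    then obtain u p where x: "x = (u, p)" "(f \<otimes>\<^bsub>A\<^esub> g) (u, p) \<noteq> 0" by (cases x) auto
    from *[OF x(2)] obtain i where "f (u, take i p) \<noteq> 0" "g (pend u (take i p), drop i p) \<noteq> 0" by blast
    thus "x \<in> ?S" using x
      by (intro image_eqI[of _ _ "((u, take i p), (pend u (take i p), drop i p))"]) auto
  qed
  moreover have "finite ?S" using f g by (auto simp: carrier_A)
  moreover have "p \<in> paths Q" if "(f \<otimes>\<^bsub>A\<^esub> g) p \<noteq> 0" for p
  proof -
    obtain u r where p: "p = (u, r)" by (cases p)
    from *[of u r] that p obtain i where "f (u, take i r) \<noteq> 0" "g (pend u (take i r), drop i r) \<noteq> 0" by auto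
    hence "(u, take i r) \<in> paths Q" "(pend u (take i r), drop i r) \<in> paths Q" using f g by (auto simp: carrier_A)
    thus ?thesis using paths_append[of u "take i r" "drop i r"] p by simp
  qed
  ultimately show ?thesis unfolding carrier_A by (blast intro: finite_subset)
qed

lemma mult_assoc_A: "(f \<otimes>\<^bsub>A\<^esub> g) \<otimes>\<^bsub>A\<^esub> h = f \<otimes>\<^bsub>A\<^esub> (g \<otimes>\<^bsub>A\<^esub> h)"
proof
  fix x :: "('d set, 'd) path"
  obtain u p where x: "x = (u, p)" by (cases x)
  let ?n = "length p"
  have "((f \<otimes>\<^bsub>A\<^esub> g) \<otimes>\<^bsub>A\<^esub> h) (u, p) = (\<Sum>i\<le>?n. \<Sum>j\<le>i. f (u, take j p) *
      g (pend u (take j p), drop j (take i p)) * h (pend u (take i p), drop i p))"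
    by (simp add: mult_A sum_distrib_right min_def cong: sum.cong) (intro sum.cong refl, auto)
  also have "\<dots> = (\<Sum>j\<le>?n. \<Sum>k\<le>?n - j. f (u, take j p) *
      g (pend u (take j p), drop j (take (j + k) p)) * h (pend u (take (j + k) p), drop (j + k) p))"
    by (rule sum_triangle_shift)
  also have "\<dots> = (f \<otimes>\<^bsub>A\<^esub> (g \<otimes>\<^bsub>A\<^esub> h)) (u, p)"
    by (simp add: mult_A sum_distrib_left mult.assoc take_add pend_append drop_take add.commute)
  finally show "((f \<otimes>\<^bsub>A\<^esub> g) \<otimes>\<^bsub>A\<^esub> h) x = (f \<otimes>\<^bsub>A\<^esub> (g \<otimes>\<^bsub>A\<^esub> h)) x" by (simp add: x)
qed

lemma one_closed_A: "\<one>\<^bsub>A\<^esub> \<in> carrier A"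
proof -
  have "{p. \<one>\<^bsub>A\<^esub> p \<noteq> (0::'k)} \<subseteq> (\<lambda>u. (u, [])) ` verts Q" by (auto simp: one_A split: if_splits)
  hence "finite {p. \<one>\<^bsub>A\<^esub> p \<noteq> (0::'k)}" using finite_verts by (meson finite_imageI finite_subset)
  thus ?thesis by (auto simp: carrier_A one_A paths_iff split: if_splits)
qed

lemma l_one_A: assumes f: "f \<in> carrier A" shows "\<one>\<^bsub>A\<^esub> \<otimes>\<^bsub>A\<^esub> f = f"
proof
  fix x :: "('d set, 'd) path"
  obtain u p where x: "x = (u, p)" by (cases x)
  have "(\<one>\<^bsub>A\<^esub> \<otimes>\<^bsub>A\<^esub> f) (u, p) = (\<Sum>i\<le>length p. if i = 0 then (if u \<in> verts Q then f (u, p) else 0) else 0)"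
    unfolding mult_A by (intro sum.cong) (auto simp: one_A)
  also have "\<dots> = f (u, p)" using f by (auto simp: carrier_A paths_iff)
  finally show "(\<one>\<^bsub>A\<^esub> \<otimes>\<^bsub>A\<^esub> f) x = f x" by (simp add: x)
qed

lemma r_one_A: assumes f: "f \<in> carrier A" shows "f \<otimes>\<^bsub>A\<^esub> \<one>\<^bsub>A\<^esub> = f"
proof
  fix x :: "('d set, 'd) path"
  obtain u p where x: "x = (u, p)" by (cases x)
  have "(f \<otimes>\<^bsub>A\<^esub> \<one>\<^bsub>A\<^esub>) (u, p) = (\<Sum>i\<le>length p. if i = length p then (if pend u p \<in> verts Q then f (u, p) else 0) else 0)"
    unfolding mult_A by (intro sum.cong) (auto simp: one_A)
  also have "\<dots> = f (u, p)" using f pend_verts[of u p] by (auto simp: carrier_A)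
  finally show "(f \<otimes>\<^bsub>A\<^esub> \<one>\<^bsub>A\<^esub>) x = f x" by (simp add: x)
qed

lemma add_closed_A:
  assumes "f \<in> carrier A" "g \<in> carrier A" shows "(\<lambda>p. f p + g p) \<in> carrier A"
proof -
  have "{p. f p + g p \<noteq> 0} \<subseteq> {p. f p \<noteq> 0} \<union> {p. g p \<noteq> 0}" by auto
  with assms show ?thesis unfolding carrier_A by (blast intro: finite_subset)
qed

lemma scale_closed_A: "f \<in> carrier A \<Longrightarrow> (\<lambda>p. c * f p) \<in> carrier A"
  by (auto simp: carrier_A intro: finite_subset[of _ "{p. f p \<noteq> 0}"])

lemma zero_closed_A: "(\<lambda>p. 0) \<in> carrier A"
  by (auto simp: carrier_A)

lemma ring_A: "ring A"
proof (rule ringI)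
  show "abelian_group A"
  proof (rule abelian_groupI)
    fix f assume f: "f \<in> carrier A"
    show "\<exists>g\<in>carrier A. g \<oplus>\<^bsub>A\<^esub> f = \<zero>\<^bsub>A\<^esub>"
      using scale_closed_A[OF f, of "-1"] by (intro bexI[of _ "\<lambda>p. - f p"]) (simp_all add: add_A zero_A)
  qed (simp_all add: add_A zero_A add_closed_A zero_closed_A algebra_simps)
  show "Group.monoid A"
    by (rule monoidI) (simp_all add: mult_closed_A one_closed_A mult_assoc_A l_one_A r_one_A)
qed (auto simp: add_A mult_A fun_eq_iff algebra_simps sum.distrib)

sublocale A: ring A by (rule ring_A)

definition single :: "('d set, 'd) path \<Rightarrow> ('d set, 'd) path \<Rightarrow> 'k" where
  "single q = (\<lambda>p. if p = q then 1 else 0)"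

lemma single_closed: "q \<in> paths Q \<Longrightarrow> single q \<in> carrier A"
  by (auto simp: carrier_A single_def)

lemma single_mult:
  assumes "pend u p = v" shows "single (u, p) \<otimes>\<^bsub>A\<^esub> single (v, q) = single (u, p @ q)"
proof
  fix x :: "('d set, 'd) path"
  obtain u' r where x: "x = (u', r)" by (cases x)
  have "(single (u, p) \<otimes>\<^bsub>A\<^esub> single (v, q)) (u', r) =
      (\<Sum>i\<le>length r. if i = length p then (if u' = u \<and> r = p @ q then 1 else 0) else 0)"
    unfolding mult_A
  proof (intro sum.cong refl)
    fix i assume "i \<in> {..length r}"
    have "take i r = p \<and> drop i r = q \<longleftrightarrow> i = length p \<and> r = p @ q"
    proof
      assume "take i r = p \<and> drop i r = q"
      moreover have "length (take i r) = i" using \<open>i \<in> {..length r}\<close> by simp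
      ultimately show "i = length p \<and> r = p @ q" using append_take_drop_id[of i r] by simp
    qed auto
    note split = this
    show "single (u, p) (u', take i r) * single (v, q) (pend u' (take i r), drop i r) =
        (if i = length p then (if u' = u \<and> r = p @ q then 1 else 0) else 0)"
    proof (cases "i = length p \<and> r = p @ q")
      case True
      thus ?thesis using assms by (simp add: single_def)
    next
      case False
      hence "take i r \<noteq> p \<or> drop i r \<noteq> q" using split by blast
      hence "single (u, p) (u', take i r) * single (v, q) (pend u' (take i r), drop i r) = 0"
        by (auto simp: single_def)
      moreover have "(if i = length p then (if u' = u \<and> r = p @ q then 1 else 0) else 0) = (0 :: 'k)"
        using False by auto
      ultimately show ?thesis by (simp only:)
    qed
  qed
  also have "\<dots> = single (u, p @ q) (u', r)" by (auto simp: single_def)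
  finally show "(single (u, p) \<otimes>\<^bsub>A\<^esub> single (v, q)) x = single (u, p @ q) x" by (simp add: x)
qed

lemma arrow_prod_eq:
  "arrow_prod Q a b = (if head Q a = tail Q b then single (tail Q a, [a, b]) else (\<lambda>p. 0))"
proof (cases "head Q a = tail Q b")
  case True
  have *: "arrow_elem Q c = single (tail Q c, [c])" for c by (simp add: arrow_elem_def single_def)
  show ?thesis using True single_mult[of "tail Q a" "[a]" "tail Q b" "[b]"] by (simp add: * pend_def)
next
  case False
  have "arrow_prod Q a b x = (0::'k)" for x
  proof -
    obtain u p where x: "x = (u, p)" by (cases x)
    show ?thesis unfolding x mult_A using False
      by (intro sum.neutral) (auto simp: arrow_elem_def pend_def)
  qed
  thus ?thesis using False by auto
qed

text \<open>
  The functions supported on paths that contain a relation.  Equality with the ideal generated by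
  the relations makes membership decidable by inspection of coefficients.
\<close>

definition J :: "(('d set, 'd) path \<Rightarrow> 'k) set" where
  "J = {f \<in> carrier A. \<forall>u p. turning p \<longrightarrow> f (u, p) = 0}"

lemma ideal_J: "ideal J A"
proof (rule idealI)
  show "subgroup J (add_monoid A)"
  proof
    fix f assume f: "f \<in> J"
    have "inv\<^bsub>add_monoid A\<^esub> f = \<ominus>\<^bsub>A\<^esub> f" by (simp add: a_inv_def)
    also have "\<dots> = (\<lambda>p. - f p)"
      using f scale_closed_A[of f "-1"] by (intro A.minus_equality) (auto simp: add_A zero_A J_def)
    finally show "inv\<^bsub>add_monoid A\<^esub> f \<in> J" using f scale_closed_A[of f "-1"] by (auto simp: J_def)
  qed (auto simp: J_def add_A zero_A add_closed_A zero_closed_A)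
  fix f g assume f: "f \<in> J" and g: "g \<in> carrier A"
  have t: "turning (take i p)" "turning (drop i p)" if "turning p" for i p
    using that turning_append[of "take i p" "drop i p"] by auto
  show "g \<otimes>\<^bsub>A\<^esub> f \<in> J" "f \<otimes>\<^bsub>A\<^esub> g \<in> J"
    using f g t by (auto simp: J_def mult_A intro!: sum.neutral)
qed (rule ring_A)

lemma arrow_prod_closed: "a \<in> arcs Q \<Longrightarrow> b \<in> arcs Q \<Longrightarrow> arrow_prod Q a b \<in> carrier A"
  by (auto simp: arrow_prod_eq zero_closed_A paths_iff tail_verts intro!: single_closed)

lemma ideal_I: "ideal I A"
  unfolding I_def gentle_ideal_def
  by (rule A.genideal_ideal) (auto simp: internal_iff intro!: arrow_prod_closed)

sublocale I: ideal I A by (rule ideal_I)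

lemma relation_in_I: "internal T a \<Longrightarrow> arrow_prod Q a (nx a) \<in> I"
proof -
  assume a: "internal T a"
  have "{arrow_prod Q s (nx s) :: ('d set, 'd) path \<Rightarrow> 'k | s. internal T s} \<subseteq> carrier A"
    by (auto simp: internal_iff intro!: arrow_prod_closed)
  from A.genideal_self[OF this] a show ?thesis unfolding I_def gentle_ideal_def by blast
qed

lemma I_subset_J: "I \<subseteq> J"
  unfolding I_def gentle_ideal_def
proof (rule A.genideal_minimal[OF ideal_J], safe)
  fix a assume a: "internal T a"
  hence "a \<in> arcs Q" "nx a \<in> arcs Q" by (auto simp: internal_iff)
  moreover have "\<not> turning [a, nx a]" using nx_neq_gl[OF \<open>a \<in> arcs Q\<close>] by (simp add: turning_def)
  ultimately show "arrow_prod Q a (nx a) \<in> J"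
    using arrow_prod_closed by (auto simp: J_def arrow_prod_eq single_def)
qed

text \<open>
  Where the path does not turn it contains two consecutive arrows of one triangle, which is then
  internal, so the path factors through a relation.
\<close>

lemma single_in_I:
  assumes p: "(u, p) \<in> paths Q" "\<not> turning p"
  shows "single (u, p) \<in> I"
proof -
  have "\<exists>q a b r. p = q @ a # b # r \<and> b \<noteq> gl (nx a)"
    using p(2) unfolding turning_def
  proof (induction p)
    case (Cons a p)
    show ?case
    proof (cases p)
      case Nil
      thus ?thesis using Cons by simp
    next
      case p': (Cons b p')
      show ?thesis
      proof (cases "b = gl (nx a)")
        case True
        then obtain q a' b' r where "p = q @ a' # b' # r \<and> b' \<noteq> gl (nx a')" using Cons p' by auto
        thus ?thesis by (intro exI[of _ "a # q"] exI) auto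
      next
        case False
        thus ?thesis using p' by (intro exI[of _ "[]"] exI) auto
      qed
    qed
  qed simp
  then obtain q a b r where pq: "p = q @ [a, b] @ r" "b \<noteq> gl (nx a)" by auto
  let ?v = "pend u q" and ?w = "head Q b"
  have path: "(u, q) \<in> paths Q" "(?v, [a, b]) \<in> paths Q" "(?w, r) \<in> paths Q"
    using p(1) unfolding pq paths_append by (auto simp: pend_def)
  have ab: "a \<in> arcs Q" "b \<in> arcs Q" "head Q a = tail Q b" "tail Q a = ?v"
    using path(2) by (auto simp: paths_iff)
  hence "b = nx a" using pq composable_iff[of a b] by blast
  hence "arrow_prod Q a b \<in> I" using relation_in_I[of a] ab by (simp add: internal_iff)
  hence "single (?v, [a, b]) \<in> I" using ab by (simp add: arrow_prod_eq)
  hence "single (u, q) \<otimes>\<^bsub>A\<^esub> (single (?v, [a, b]) \<otimes>\<^bsub>A\<^esub> single (?w, r)) \<in> I"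
    using path single_closed by (intro I.I_l_closed I.I_r_closed) auto
  moreover have "single (?v, [a, b]) \<otimes>\<^bsub>A\<^esub> single (?w, r) = single (?v, [a, b] @ r)"
    by (rule single_mult) (simp add: pend_def)
  moreover have "single (u, q) \<otimes>\<^bsub>A\<^esub> single (?v, [a, b] @ r) = single (u, p)"
    unfolding pq by (rule single_mult) simp
  ultimately show ?thesis by simp
qed

lemma scale_in_I: assumes f: "f \<in> I" shows "(\<lambda>p. c * f p) \<in> I"
proof -
  have "(\<lambda>p. c * \<one>\<^bsub>A\<^esub> p) \<otimes>\<^bsub>A\<^esub> f = (\<lambda>p. c * (\<one>\<^bsub>A\<^esub> \<otimes>\<^bsub>A\<^esub> f) p)"
    by (auto simp: mult_A fun_eq_iff sum_distrib_left mult.assoc)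
  also have "\<dots> = (\<lambda>p. c * f p)" using I.a_subset f by (simp add: l_one_A subsetD)
  finally show ?thesis
    using I.I_l_closed[OF f scale_closed_A[OF one_closed_A, of c]] by simp
qed

lemma I_eq_J: "I = J"
proof
  show "J \<subseteq> I"
  proof
    fix f assume "f \<in> J"
    hence "finite {p. f p \<noteq> 0}" "\<And>u p. f (u, p) \<noteq> 0 \<Longrightarrow> (u, p) \<in> paths Q \<and> \<not> turning p"
      by (auto simp: J_def carrier_A)
    thus "f \<in> I"
    proof (induction "{p. f p \<noteq> 0}" arbitrary: f rule: finite_induct)
      case empty
      hence "f = \<zero>\<^bsub>A\<^esub>" by (auto simp: zero_A)
      thus ?case by simp
    next
      case (insert q S)
      let ?g = "\<lambda>p. if p = q then 0 else f p"
      have "S = {p. ?g p \<noteq> 0}" using insert.hyps by auto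
      hence "?g \<in> I" using insert.prems by (intro insert.hyps(3)) (auto split: if_splits)
      moreover have "f q \<noteq> 0" using insert.hyps by auto
      hence "(\<lambda>p. f q * single q p) \<in> I"
        using insert.prems[of "fst q" "snd q"] single_in_I[of "fst q" "snd q"] by (intro scale_in_I) simp
      ultimately have "?g \<oplus>\<^bsub>A\<^esub> (\<lambda>p. f q * single q p) \<in> I" by (rule I.a_closed)
      moreover have "?g \<oplus>\<^bsub>A\<^esub> (\<lambda>p. f q * single q p) = f" by (auto simp: add_A single_def)
      ultimately show ?case by simp
    qed
  qed
qed (rule I_subset_J)

lemma mem_I: "f \<in> I \<longleftrightarrow> f \<in> carrier A \<and> (\<forall>u p. turning p \<longrightarrow> f (u, p) = 0)"
  by (simp only: I_eq_J J_def mem_Collect_eq)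

lemma I_vanish: "f \<in> I \<Longrightarrow> turning p \<Longrightarrow> f (u, p) = 0"
  by (simp only: mem_I)

lemma I_closed: "f \<in> I \<Longrightarrow> f \<in> carrier A"
  by (simp only: mem_I)

lemma I_memI: "f \<in> carrier A \<Longrightarrow> (\<And>u p. turning p \<Longrightarrow> f (u, p) = 0) \<Longrightarrow> f \<in> I"
  by (rule mem_I[THEN iffD2]) blast

lemma arrow_prod_in_I_iff:
  assumes "a \<in> arcs Q" "b \<in> arcs Q"
  shows "arrow_prod Q a b \<in> I \<longleftrightarrow> b \<noteq> gl (nx a)"
proof
  assume *: "arrow_prod Q a b \<in> I"
  show "b \<noteq> gl (nx a)"
  proof
    assume b: "b = gl (nx a)"
    hence "arrow_prod Q a b (tail Q a, [a, b]) = (1::'k)"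
      using composable_iff[OF assms] by (simp add: arrow_prod_eq single_def)
    moreover have "turning [a, b]" using b by (simp add: turning_def)
    ultimately show False using I_vanish[OF *, of "[a, b]" "tail Q a"] by simp
  qed
next
  assume b: "b \<noteq> gl (nx a)"
  hence "\<not> turning [a, b]" by (simp add: turning_def)
  hence "arrow_prod Q a b (u, p) = (0::'k)" if "turning p" for u p
    unfolding arrow_prod_eq using that by (auto simp: single_def)
  thus "arrow_prod Q a b \<in> I"
    by (rule I_memI[OF arrow_prod_closed[OF assms]])
qed

lemma ring_\<Lambda>: "ring \<Lambda>" by (rule I.quotient_is_ring)

sublocale \<Lambda>: ring \<Lambda> by (rule ring_\<Lambda>)

definition cl :: "(('d set, 'd) path \<Rightarrow> 'k) \<Rightarrow> (('d set, 'd) path \<Rightarrow> 'k) set" where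
  "cl x = I +>\<^bsub>A\<^esub> x"

lemma carrier_\<Lambda>: "carrier \<Lambda> = cl ` carrier A"
  by (auto simp: FactRing_def A_RCOSETS_def' cl_def)

lemma cl_closed: "x \<in> carrier A \<Longrightarrow> cl x \<in> carrier \<Lambda>"
  by (simp add: carrier_\<Lambda>)

lemma cl_mult: "x \<in> carrier A \<Longrightarrow> y \<in> carrier A \<Longrightarrow> cl x \<otimes>\<^bsub>\<Lambda>\<^esub> cl y = cl (x \<otimes>\<^bsub>A\<^esub> y)"
  by (simp add: FactRing_def cl_def I.rcoset_mult_add)

lemma cl_add: "x \<in> carrier A \<Longrightarrow> y \<in> carrier A \<Longrightarrow> cl x \<oplus>\<^bsub>\<Lambda>\<^esub> cl y = cl (\<lambda>p. x p + y p)"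
  by (simp add: FactRing_def cl_def I.a_rcos_sum flip: add_A)

lemma cl_one: "\<one>\<^bsub>\<Lambda>\<^esub> = cl \<one>\<^bsub>A\<^esub>"
  by (simp add: FactRing_def cl_def)

lemma mem_cl: "x \<in> carrier A \<Longrightarrow> y \<in> cl x \<longleftrightarrow> y \<in> carrier A \<and> (\<forall>u p. turning p \<longrightarrow> y (u, p) = x (u, p))"
proof
  assume x: "x \<in> carrier A" and "y \<in> cl x"
  then obtain i where "i \<in> I" "y = i \<oplus>\<^bsub>A\<^esub> x" by (auto simp: cl_def a_r_coset_def')
  thus "y \<in> carrier A \<and> (\<forall>u p. turning p \<longrightarrow> y (u, p) = x (u, p))"
    using x I_closed[of i] I_vanish[of i] add_closed_A[of i x] by (simp add: add_A)
next
  assume x: "x \<in> carrier A" and y: "y \<in> carrier A \<and> (\<forall>u p. turning p \<longrightarrow> y (u, p) = x (u, p))"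
  have "(\<lambda>p. y p + - 1 * x p) \<in> carrier A" using x y by (intro add_closed_A scale_closed_A) auto
  hence "(\<lambda>p. y p + - 1 * x p) \<in> I" using y by (intro I_memI) auto
  moreover have "y = (\<lambda>p. y p + - 1 * x p) \<oplus>\<^bsub>A\<^esub> x" by (simp add: add_A)
  ultimately show "y \<in> cl x" by (auto simp: cl_def a_r_coset_def')
qed

lemma cl_eqI: 
  assumes "x \<in> carrier A" "y \<in> carrier A" "\<And>u p. (u, p) \<in> paths Q \<Longrightarrow> turning p \<Longrightarrow> x (u, p) = y (u, p)"
  shows "cl x = cl y"
proof -
  have "x (u, p) = y (u, p)" if "turning p" for u p
  proof (cases "(u, p) \<in> paths Q")
    case False
    have "x (u, p) = 0" "y (u, p) = 0" using assms(1,2) False unfolding carrier_A by blast+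
    thus ?thesis by simp
  qed (use assms(3) that in blast)
  thus ?thesis by (auto simp: mem_cl assms(1,2) intro!: Set.set_eqI)
qed

end

section \<open>Modules with a monomial basis\<close>

fun moves :: "('a \<Rightarrow> 'b \<Rightarrow> 'b option) \<Rightarrow> 'a list \<Rightarrow> 'b \<Rightarrow> 'b option" where
  "moves mv [] b = Some b"
| "moves mv (a # r) b = Option.bind (mv a b) (moves mv r)"

lemma moves_append: "moves mv (p @ q) b = Option.bind (moves mv p b) (moves mv q)"
proof (induction p arbitrary: b)
  case (Cons a p)
  thus ?case by (cases "mv a b") auto
qed simp

text \<open>
  Modules with a basis that every arrow maps to basis elements or to zero.  String modules are of
  this form (\<open>string_module_eq\<close>), and so are the terms of their resolutions.
\<close>

definition mono_module ::
    "'b set \<Rightarrow> ('b \<Rightarrow> 'v) \<Rightarrow> ('a \<Rightarrow> 'b \<Rightarrow> 'b option) \<Rightarrow> ((('v, 'a) path \<Rightarrow> 'k::field) set, 'b \<Rightarrow> 'k) module" where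
  "mono_module B vt mv = \<lparr>carrier = {m. \<forall>b. b \<notin> B \<longrightarrow> m b = 0},
     mult = (\<lambda>m n i. 0), one = (\<lambda>i. 0), zero = (\<lambda>i. 0), add = (\<lambda>m n i. m i + n i),
     smult = (\<lambda>X m. the_elem ((\<lambda>x c. \<Sum>b\<in>B. \<Sum>p | x p \<noteq> 0.
       if (if vt b = fst p then moves mv (snd p) b else None) = Some c then m b * x p else 0) ` X))\<rparr>"

definition lin :: "'b set \<Rightarrow> ('b \<Rightarrow> 'c \<Rightarrow> 'k::field) \<Rightarrow> ('b \<Rightarrow> 'k) \<Rightarrow> 'c \<Rightarrow> 'k" where
  "lin B k m = (\<lambda>c. \<Sum>b\<in>B. m b * k b c)"

definition delta :: "'b \<Rightarrow> 'b \<Rightarrow> 'k::field" where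
  "delta b = (\<lambda>c. if c = b then 1 else 0)"

definition odelta :: "'b option \<Rightarrow> 'b \<Rightarrow> 'k::field" where
  "odelta b = (\<lambda>c. if b = Some c then 1 else 0)"

lemma odelta_simps [simp]: "odelta None = (\<lambda>c. 0)" "odelta (Some b) = delta b"
  by (auto simp: odelta_def delta_def)

lemma delta_self [simp]: "delta b b = 1"
  by (simp add: delta_def)

lemma lin_delta: "finite B \<Longrightarrow> b \<in> B \<Longrightarrow> lin B k (delta b) = k b"
proof
  fix c assume "finite B" "b \<in> B"
  have "lin B k (delta b) c = (\<Sum>b'\<in>B. if b' = b then k b c else 0)"
    unfolding lin_def by (intro sum.cong) (auto simp: delta_def)
  thus "lin B k (delta b) c = k b c" using \<open>finite B\<close> \<open>b \<in> B\<close> by simp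
qed

lemma lin_cong: "(\<And>b. b \<in> B \<Longrightarrow> k b = l b) \<Longrightarrow> lin B k m = lin B l m"
  by (simp add: lin_def cong: sum.cong)

lemma lin_self: "finite B \<Longrightarrow> (\<And>b. b \<notin> B \<Longrightarrow> m b = 0) \<Longrightarrow> lin B delta m = m"
proof
  fix c assume "finite B" "\<And>b. b \<notin> B \<Longrightarrow> m b = 0"
  have "lin B delta m c = (\<Sum>b\<in>B. if b = c then m c else 0)"
    unfolding lin_def by (intro sum.cong) (auto simp: delta_def)
  thus "lin B delta m c = m c" using \<open>finite B\<close> \<open>\<And>b. b \<notin> B \<Longrightarrow> m b = 0\<close> by simp
qed

lemma lin_lin: "lin C l (lin B k m) = lin B (\<lambda>b. lin C l (k b)) m"
proof
  fix d
  have "lin C l (lin B k m) d = (\<Sum>c\<in>C. \<Sum>b\<in>B. m b * k b c * l c d)"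
    by (simp add: lin_def sum_distrib_right)
  also have "\<dots> = (\<Sum>b\<in>B. \<Sum>c\<in>C. m b * k b c * l c d)" by (rule sum.swap)
  also have "\<dots> = lin B (\<lambda>b. lin C l (k b)) m d" by (simp add: lin_def sum_distrib_left mult.assoc)
  finally show "lin C l (lin B k m) d = lin B (\<lambda>b. lin C l (k b)) m d" .
qed

lemma lin_add: "lin B k (\<lambda>b. m b + n b) = (\<lambda>c. lin B k m c + lin B k n c)"
  by (simp add: lin_def distrib_right sum.distrib)

lemma lin_scale: "lin B k (\<lambda>b. x * m b) = (\<lambda>c. x * lin B k m c)"
  by (simp add: lin_def sum_distrib_left mult.assoc)

lemma sum_splittings:
  fixes G :: "'a list \<Rightarrow> 'a list \<Rightarrow> 'k::comm_monoid_add"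
  assumes fin: "finite P" "finite R" and G: "\<And>p r. \<not> (p \<in> P \<and> r \<in> R) \<Longrightarrow> G p r = 0"
  shows "(\<Sum>s\<in>(\<lambda>(p, r). p @ r) ` (P \<times> R). \<Sum>i\<le>length s. G (take i s) (drop i s)) = (\<Sum>p\<in>P. \<Sum>r\<in>R. G p r)"
proof -
  let ?S = "SIGMA s:(\<lambda>(p, r). p @ r) ` (P \<times> R). {..length s}" and ?f = "\<lambda>(s, i). (take i s, drop i s)"
  have finS: "finite ?S" using fin by auto
  have "inj_on ?f ?S"
  proof (rule inj_onI)
    fix x y assume xy: "x \<in> ?S" "y \<in> ?S" "?f x = ?f y"
    obtain s i t j where x: "x = (s, i)" "y = (t, j)" by (cases x, cases y)
    have *: "take i s = take j t" "drop i s = drop j t" using xy(3) x by auto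
    have "i \<le> length s" "j \<le> length t" using xy(1,2) x by auto
    hence "i = j" using arg_cong[OF *(1), of length] by simp
    moreover have "s = t" using * append_take_drop_id[of i s] append_take_drop_id[of j t] by simp
    ultimately show "x = y" using x by simp
  qed
  hence "(\<Sum>x\<in>?S. case ?f x of (p, r) \<Rightarrow> G p r) = (\<Sum>x\<in>?f ` ?S. case x of (p, r) \<Rightarrow> G p r)"
    by (simp add: sum.reindex)
  also have "\<dots> = (\<Sum>(p, r)\<in>P \<times> R. G p r)"
  proof (rule sum.mono_neutral_right)
    show "P \<times> R \<subseteq> ?f ` ?S"
    proof
      fix x assume "x \<in> P \<times> R"
      thus "x \<in> ?f ` ?S" by (intro image_eqI[of _ _ "(fst x @ snd x, length (fst x))"]) force+
    qed
  qed (use finS G in auto)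
  finally show ?thesis using fin by (simp add: sum.Sigma sum.cartesian_product split_def)
qed

locale monomial = gentle T I for T :: "'d triangulation" and I :: "(('d set, 'd) path \<Rightarrow> 'k::field) set" +
  fixes B :: "'b set" and vt :: "'b \<Rightarrow> 'd set" and mv :: "'d \<Rightarrow> 'b \<Rightarrow> 'b option"
  assumes finite_B: "finite B"
    and vt_verts: "\<And>b. b \<in> B \<Longrightarrow> vt b \<in> verts Q"
    and mv_B: "\<And>a b c. b \<in> B \<Longrightarrow> mv a b = Some c \<Longrightarrow> c \<in> B \<and> a \<in> arcs Q \<and> tail Q a = vt b \<and> vt c = head Q a"
    and mv_rel: "\<And>a b c. b \<in> B \<Longrightarrow> mv a b = Some c \<Longrightarrow> internal T a \<Longrightarrow> mv (nx a) c = None"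
begin

definition M :: "((('d set, 'd) path \<Rightarrow> 'k) set, 'b \<Rightarrow> 'k) module" where
  "M = mono_module B vt mv"

lemma carrier_M: "m \<in> carrier M \<longleftrightarrow> (\<forall>b. b \<notin> B \<longrightarrow> m b = 0)"
  and zero_M: "\<zero>\<^bsub>M\<^esub> = (\<lambda>b. 0)" and add_M: "m \<oplus>\<^bsub>M\<^esub> n = (\<lambda>b. m b + n b)"
  by (auto simp: M_def mono_module_def)

lemma moves_props:
  "b \<in> B \<Longrightarrow> moves mv r b = Some c \<Longrightarrow> c \<in> B \<and> (vt b, r) \<in> paths Q \<and> turning r \<and> vt c = pend (vt b) r"
proof (induction r arbitrary: b)
  case Nil
  thus ?case by (auto simp: paths_iff vt_verts)
next
  case (Cons a r)
  then obtain b' where b': "mv a b = Some b'" "moves mv r b' = Some c" by (auto simp: bind_eq_Some_conv)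
  note a = mv_B[OF Cons.prems(1) b'(1)]
  have IH: "c \<in> B" "(vt b', r) \<in> paths Q" "turning r" "vt c = pend (vt b') r" using Cons.IH[of b'] a b' by auto
  have "hd r = gl (nx a)" if r: "r \<noteq> []"
  proof -
    have hr: "hd r \<in> arcs Q" "tail Q (hd r) = head Q a" using IH r a by (auto simp: paths_iff)
    obtain r' where r': "r = hd r # r'" using r by (cases r) auto
    hence "mv (hd r) b' \<noteq> None" using b'(2) by (metis bind.simps(1) moves.simps(2) option.distinct(1))
    hence "hd r \<noteq> nx a" using mv_rel[OF Cons.prems(1) b'(1)] hr a by (auto simp: internal_iff)
    thus ?thesis using composable_iff[of a "hd r"] hr a by auto
  qed
  moreover have "(vt b, [a] @ r) \<in> paths Q"
    unfolding paths_append using IH a vt_verts[OF Cons.prems(1)] by (simp add: paths_iff pend_def)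
  ultimately show ?case using IH a by (auto simp: turning_Cons pend_Cons)
qed

text \<open>
  The matrix of the action of an element of the path algebra; the sum ranges over the finitely many
  paths in its support.
\<close>

definition rep :: "(('d set, 'd) path \<Rightarrow> 'k) \<Rightarrow> 'b \<Rightarrow> 'b \<Rightarrow> 'k" where
  "rep x b c = (\<Sum>r\<in>snd ` {p. x p \<noteq> 0}. if moves mv r b = Some c then x (vt b, r) else 0)"

lemma in_snd: "(u, r) \<in> S \<Longrightarrow> r \<in> snd ` S"
  by force

lemma rep_superset:
  assumes "finite R" "\<And>r. x (vt b, r) \<noteq> 0 \<Longrightarrow> r \<in> R" "x \<in> carrier A"
  shows "rep x b c = (\<Sum>r\<in>R. if moves mv r b = Some c then x (vt b, r) else 0)"
proof -
  let ?R = "snd ` {p. x p \<noteq> 0}"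
  have "finite ?R" using assms(3) by (simp add: carrier_A)
  moreover have "r \<in> ?R" if "x (vt b, r) \<noteq> 0" for r using that by (intro in_snd[of "vt b"]) simp
  ultimately have "(\<Sum>r\<in>?R. if moves mv r b = Some c then x (vt b, r) else 0) =
      (\<Sum>r\<in>R \<union> ?R. if moves mv r b = Some c then x (vt b, r) else 0)"
    using assms(1) by (intro sum.mono_neutral_left) auto
  also have "\<dots> = (\<Sum>r\<in>R. if moves mv r b = Some c then x (vt b, r) else 0)"
    using assms(1,2) \<open>finite ?R\<close> by (intro sum.mono_neutral_right) auto
  finally show ?thesis by (simp add: rep_def)
qed

lemma rep_cong:
  assumes "x \<in> carrier A" "y \<in> carrier A" "b \<in> B" "\<And>u p. turning p \<Longrightarrow> x (u, p) = y (u, p)"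
  shows "rep x b c = rep y b c"
proof -
  let ?R = "snd ` ({p. x p \<noteq> 0} \<union> {p. y p \<noteq> 0})"
  have R: "finite ?R" "\<And>r. x (vt b, r) \<noteq> 0 \<Longrightarrow> r \<in> ?R" "\<And>r. y (vt b, r) \<noteq> 0 \<Longrightarrow> r \<in> ?R"
    using assms(1,2) by (simp add: carrier_A) (rule in_snd[of "vt b"], simp)+
  have "rep x b c = (\<Sum>r\<in>?R. if moves mv r b = Some c then x (vt b, r) else 0)"
    by (rule rep_superset[OF R(1) _ assms(1)]) (rule R(2))
  moreover have "rep y b c = (\<Sum>r\<in>?R. if moves mv r b = Some c then y (vt b, r) else 0)"
    by (rule rep_superset[OF R(1) _ assms(2)]) (rule R(3))
  moreover have "(if moves mv r b = Some c then x (vt b, r) else 0) = (if moves mv r b = Some c then y (vt b, r) else 0)" for r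
    using moves_props[OF assms(3), of r c] assms(4)[of r "vt b"] by simp
  ultimately show ?thesis by simp
qed

lemma rep_add:
  assumes "x \<in> carrier A" "y \<in> carrier A"
  shows "rep (\<lambda>p. x p + y p) b c = rep x b c + rep y b c"
proof -
  let ?R = "snd ` ({p. x p \<noteq> 0} \<union> {p. y p \<noteq> 0})"
  have R: "finite ?R" "\<And>r. x (vt b, r) \<noteq> 0 \<Longrightarrow> r \<in> ?R" "\<And>r. y (vt b, r) \<noteq> 0 \<Longrightarrow> r \<in> ?R"
    "\<And>r. x (vt b, r) + y (vt b, r) \<noteq> 0 \<Longrightarrow> r \<in> ?R"
    using assms(1,2) by (simp add: carrier_A) (rule in_snd[of "vt b"], auto)+
  have "rep x b c = (\<Sum>r\<in>?R. if moves mv r b = Some c then x (vt b, r) else 0)"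
    by (rule rep_superset[OF R(1) _ assms(1)]) (rule R(2))
  moreover have "rep y b c = (\<Sum>r\<in>?R. if moves mv r b = Some c then y (vt b, r) else 0)"
    by (rule rep_superset[OF R(1) _ assms(2)]) (rule R(3))
  moreover have "rep (\<lambda>p. x p + y p) b c = (\<Sum>r\<in>?R. if moves mv r b = Some c then x (vt b, r) + y (vt b, r) else 0)"
    by (rule rep_superset[OF R(1) _ add_closed_A[OF assms]]) (rule R(4))
  ultimately show ?thesis by (simp only: sum.distrib[symmetric]) (intro sum.cong refl, simp)
qed

text \<open>
  The splittings of the paths in the product correspond to the intermediate basis elements.
\<close>

lemma rep_mult:
  assumes x: "x \<in> carrier A" and y: "y \<in> carrier A" and b: "b \<in> B"
  shows "rep (x \<otimes>\<^bsub>A\<^esub> y) b c = (\<Sum>b'\<in>B. rep x b b' * rep y b' c)"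
proof -
  let ?P = "snd ` {p. x p \<noteq> 0}" and ?R = "snd ` {p. y p \<noteq> 0}"
  have fin: "finite ?P" "finite ?R" using x y by (auto simp: carrier_A)
  have sub: "p \<in> ?P" if "x (u, p) \<noteq> 0" for u p using that by (intro in_snd[of u]) simp
  have sub': "p \<in> ?R" if "y (u, p) \<noteq> 0" for u p using that by (intro in_snd[of u]) simp
  let ?G = "\<lambda>p r. if moves mv (p @ r) b = Some c then x (vt b, p) * y (pend (vt b) p, r) else 0"
  have "rep (x \<otimes>\<^bsub>A\<^esub> y) b c = (\<Sum>s\<in>(\<lambda>(p, r). p @ r) ` (?P \<times> ?R).
      if moves mv s b = Some c then (x \<otimes>\<^bsub>A\<^esub> y) (vt b, s) else 0)"
  proof (rule rep_superset)
    fix r assume "(x \<otimes>\<^bsub>A\<^esub> y) (vt b, r) \<noteq> 0"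
    then obtain i where "x (vt b, take i r) * y (pend (vt b) (take i r), drop i r) \<noteq> 0"
      unfolding mult_A by (meson sum.not_neutral_contains_not_neutral)
    hence "take i r \<in> ?P" "drop i r \<in> ?R" using sub sub' by auto
    thus "r \<in> (\<lambda>(p, r). p @ r) ` (?P \<times> ?R)" by (intro image_eqI[of _ _ "(take i r, drop i r)"]) simp_all
  qed (use fin x y in \<open>auto intro: mult_closed_A\<close>)
  also have "\<dots> = (\<Sum>s\<in>(\<lambda>(p, r). p @ r) ` (?P \<times> ?R). \<Sum>i\<le>length s. ?G (take i s) (drop i s))"
    by (intro sum.cong refl) (auto simp: mult_A)
  also have "\<dots> = (\<Sum>p\<in>?P. \<Sum>r\<in>?R. ?G p r)"
  proof (rule sum_splittings[OF fin])
    fix p r assume "\<not> (p \<in> ?P \<and> r \<in> ?R)"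
    hence "x (vt b, p) = 0 \<or> y (pend (vt b) p, r) = 0" using sub sub' by blast
    thus "?G p r = 0" by auto
  qed
  also have "\<dots> = (\<Sum>p\<in>?P. \<Sum>b'\<in>B. (if moves mv p b = Some b' then x (vt b, p) else 0) * rep y b' c)"
  proof (intro sum.cong refl)
    fix p
    show "(\<Sum>r\<in>?R. ?G p r) = (\<Sum>b'\<in>B. (if moves mv p b = Some b' then x (vt b, p) else 0) * rep y b' c)"
    proof (cases "moves mv p b")
      case (Some d)
      note d = moves_props[OF b Some]
      have "(\<Sum>b'\<in>B. (if moves mv p b = Some b' then x (vt b, p) else 0) * rep y b' c) =
          (\<Sum>b'\<in>B. if b' = d then x (vt b, p) * rep y d c else 0)"
        by (intro sum.cong) (auto simp: Some)
      also have "\<dots> = x (vt b, p) * rep y d c" using d finite_B by simp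
      also have "\<dots> = (\<Sum>r\<in>?R. ?G p r)"
        using d by (simp add: rep_def sum_distrib_left moves_append Some) (intro sum.cong, auto)
      finally show ?thesis by simp
    qed (simp add: moves_append)
  qed
  also have "\<dots> = (\<Sum>b'\<in>B. rep x b b' * rep y b' c)"
    by (subst sum.swap) (simp add: rep_def sum_distrib_right)
  finally show ?thesis .
qed

lemma rep_single:
  assumes "b \<in> B"
  shows "rep (single (u, p)) b c = (if vt b = u \<and> moves mv p b = Some c then 1 else 0)"
  unfolding rep_def single_def by (simp add: image_def)

lemma rep_one: "b \<in> B \<Longrightarrow> rep (\<lambda>p. z * \<one>\<^bsub>A\<^esub> p) b c = (if c = b then z else 0)"
proof -
  assume b: "b \<in> B"
  have "rep (\<lambda>p. z * \<one>\<^bsub>A\<^esub> p) b c = (\<Sum>r\<in>{[]}. if moves mv r b = Some c then z * \<one>\<^bsub>A\<^esub> (vt b, r) else 0)"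
    by (rule rep_superset) (auto simp: one_A intro: scale_closed_A one_closed_A split: if_splits)
  thus ?thesis using vt_verts[OF b] by (auto simp: one_A)
qed

lemma act_M:
  assumes x: "x \<in> carrier A"
  shows "cl x \<odot>\<^bsub>M\<^esub> m = lin B (rep x) m"
proof -
  let ?a = "\<lambda>x c. \<Sum>b\<in>B. \<Sum>p | x p \<noteq> 0.
       if (if vt b = fst p then moves mv (snd p) b else None) = Some c then m b * x p else (0::'k)"
  have *: "?a y = lin B (rep y) m" if y: "y \<in> carrier A" for y
  proof
    fix c
    have "(\<Sum>p | y p \<noteq> 0. if (if vt b = fst p then moves mv (snd p) b else None) = Some c then m b * y p else 0)
        = m b * rep y b c" for b
    proof -
      let ?S = "{p. y p \<noteq> 0}" 
      have fin: "finite ?S" using y by (simp add: carrier_A)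
      have "(\<Sum>p\<in>?S. if (if vt b = fst p then moves mv (snd p) b else None) = Some c then m b * y p else 0)
        = (\<Sum>p\<in>{p\<in>?S. fst p = vt b}. if moves mv (snd p) b = Some c then m b * y p else 0)"
        using fin by (intro sum.mono_neutral_cong_right) (auto split: if_splits)
      also have "\<dots> = (\<Sum>r\<in>snd ` {p\<in>?S. fst p = vt b}. if moves mv r b = Some c then m b * y (vt b, r) else 0)"
        by (subst sum.reindex) (auto simp: inj_on_def intro!: sum.cong)
      also have "\<dots> = m b * (\<Sum>r\<in>snd ` {p\<in>?S. fst p = vt b}. if moves mv r b = Some c then y (vt b, r) else 0)"
        unfolding sum_distrib_left by (intro sum.cong) auto
      also have "(\<Sum>r\<in>snd ` {p\<in>?S. fst p = vt b}. if moves mv r b = Some c then y (vt b, r) else 0) = rep y b c"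
      proof (rule rep_superset[symmetric])
        show "r \<in> snd ` {p\<in>?S. fst p = vt b}" if "y (vt b, r) \<noteq> 0" for r
          using that by (intro in_snd[of "vt b"]) simp
      qed (use fin y in auto)
      finally show ?thesis .
    qed
    thus "?a y c = lin B (rep y) m c" by (simp add: lin_def)
  qed
  have "?a ` cl x = {lin B (rep x) m}"
  proof -
    have "?a y = lin B (rep x) m" if y: "y \<in> cl x" for y
    proof -
      have yA: "y \<in> carrier A" using y x by (simp add: mem_cl)
      have "lin B (rep y) m = lin B (rep x) m"
        using y x by (intro lin_cong ext rep_cong) (auto simp: mem_cl)
      with *[OF yA] show ?thesis by (rule trans)
    qed
    hence "?a ` cl x = (\<lambda>_. lin B (rep x) m) ` cl x"
      by (rule image_cong[OF refl])
    also have "\<dots> = {lin B (rep x) m}" using x by (intro image_constant[of x]) (simp add: mem_cl)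
    finally show ?thesis .
  qed
  thus ?thesis by (simp add: M_def mono_module_def)
qed

lemma rep_closed: "b \<in> B \<Longrightarrow> c \<notin> B \<Longrightarrow> rep x b c = 0"
  unfolding rep_def using moves_props[of b] by (intro sum.neutral) auto

lemma lin_rep_closed: "lin B (rep x) m \<in> carrier M"
  by (auto simp: carrier_M lin_def rep_closed intro!: sum.neutral)

lemma act_scalar: "m \<in> carrier M \<Longrightarrow> cl (\<lambda>p. z * \<one>\<^bsub>A\<^esub> p) \<odot>\<^bsub>M\<^esub> m = (\<lambda>b. z * m b)"
proof
  fix c assume m: "m \<in> carrier M"
  have "(cl (\<lambda>p. z * \<one>\<^bsub>A\<^esub> p) \<odot>\<^bsub>M\<^esub> m) c = lin B (rep (\<lambda>p. z * \<one>\<^bsub>A\<^esub> p)) m c"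
    by (simp add: act_M scale_closed_A one_closed_A)
  also have "\<dots> = (\<Sum>b\<in>B. if b = c then z * m c else 0)"
    unfolding lin_def by (intro sum.cong) (auto simp: rep_one)
  finally show "(cl (\<lambda>p. z * \<one>\<^bsub>A\<^esub> p) \<odot>\<^bsub>M\<^esub> m) c = z * m c"
    using finite_B m by (simp add: carrier_M)
qed

lemma right_module_M: "right_module \<Lambda> M"
proof -
  have ab: "abelian_group M"
  proof (rule abelian_groupI)
    fix m assume "m \<in> carrier M"
    thus "\<exists>n\<in>carrier M. n \<oplus>\<^bsub>M\<^esub> m = \<zero>\<^bsub>M\<^esub>"
      by (intro bexI[of _ "\<lambda>b. - m b"]) (auto simp: carrier_M add_M zero_M)
  qed (auto simp: carrier_M add_M zero_M algebra_simps)
  have "right_module_axioms \<Lambda> M"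
  proof
    fix r m assume "r \<in> carrier \<Lambda>" and m: "m \<in> carrier M"
    then obtain x where x: "x \<in> carrier A" "r = cl x" by (auto simp: carrier_\<Lambda>)
    show "r \<odot>\<^bsub>M\<^esub> m \<in> carrier M" by (simp add: x act_M lin_rep_closed)
    show "r \<odot>\<^bsub>M\<^esub> (m \<oplus>\<^bsub>M\<^esub> n) = r \<odot>\<^bsub>M\<^esub> m \<oplus>\<^bsub>M\<^esub> r \<odot>\<^bsub>M\<^esub> n" for n
      by (simp add: x act_M add_M lin_add)
    fix s assume "s \<in> carrier \<Lambda>"
    then obtain y where y: "y \<in> carrier A" "s = cl y" by (auto simp: carrier_\<Lambda>)
    show "(r \<oplus>\<^bsub>\<Lambda>\<^esub> s) \<odot>\<^bsub>M\<^esub> m = r \<odot>\<^bsub>M\<^esub> m \<oplus>\<^bsub>M\<^esub> s \<odot>\<^bsub>M\<^esub> m"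
      using x y by (simp add: cl_add act_M add_closed_A add_M)
        (simp add: lin_def rep_add distrib_left sum.distrib)
    have "lin B (rep (x \<otimes>\<^bsub>A\<^esub> y)) m = lin B (\<lambda>b. lin B (rep y) (rep x b)) m"
      using x y by (intro lin_cong ext) (simp add: lin_def rep_mult)
    thus "(r \<otimes>\<^bsub>\<Lambda>\<^esub> s) \<odot>\<^bsub>M\<^esub> m = s \<odot>\<^bsub>M\<^esub> (r \<odot>\<^bsub>M\<^esub> m)"
      using x y by (simp add: cl_mult act_M mult_closed_A lin_lin)
  next
    fix m assume "m \<in> carrier M"
    thus "\<one>\<^bsub>\<Lambda>\<^esub> \<odot>\<^bsub>M\<^esub> m = m" using act_scalar[of m 1] by (simp add: cl_one)
  qed
  thus ?thesis using ring_\<Lambda> ab by (simp add: right_module_def)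
qed

sublocale M: right_module \<Lambda> M by (rule right_module_M)

lemma delta_closed: "b \<in> B \<Longrightarrow> delta b \<in> carrier M"
  by (auto simp: carrier_M delta_def)

definition aact :: "'d \<Rightarrow> ('b \<Rightarrow> 'k) \<Rightarrow> 'b \<Rightarrow> 'k" where
  "aact a = lin B (\<lambda>b. odelta (mv a b))"

lemma aact_delta: "b \<in> B \<Longrightarrow> aact a (delta b) = odelta (mv a b)"
  by (simp add: aact_def lin_delta finite_B)

lemma aact_eq_act:
  assumes "a \<in> arcs Q"
  shows "aact a m = cl (single (tail Q a, [a])) \<odot>\<^bsub>M\<^esub> m"
proof -
  have "(tail Q a, [a]) \<in> paths Q" using assms by (simp add: paths_iff tail_verts)
  hence "cl (single (tail Q a, [a])) \<odot>\<^bsub>M\<^esub> m = lin B (rep (single (tail Q a, [a]))) m"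
    by (simp add: act_M single_closed)
  also have "\<dots> = lin B (\<lambda>b. odelta (mv a b)) m"
  proof (rule lin_cong, rule ext)
    fix b c assume b: "b \<in> B"
    show "rep (single (tail Q a, [a])) b c = odelta (mv a b) c"
      using mv_B[OF b, of a] by (cases "mv a b") (auto simp: rep_single[OF b] delta_def)
  qed
  finally show ?thesis by (simp add: aact_def)
qed

end

locale two_monomial = M: monomial T I B vt mv + N: monomial T I C wt nv
  for T :: "'d triangulation" and I :: "(('d set, 'd) path \<Rightarrow> 'k::field) set"
    and B :: "'b set" and vt :: "'b \<Rightarrow> 'd set" and mv :: "'d \<Rightarrow> 'b \<Rightarrow> 'b option"
    and C :: "'c set" and wt :: "'c \<Rightarrow> 'd set" and nv :: "'d \<Rightarrow> 'c \<Rightarrow> 'c option"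
begin

abbreviation "L \<equiv> M.\<Lambda>"

text \<open>
  Since paths are products of arrows, compatibility with vertices and arrows is enough.
\<close>

lemma lin_hom:
  assumes k: "\<And>b. b \<in> B \<Longrightarrow> k b \<in> carrier N.M" "\<And>b c. b \<in> B \<Longrightarrow> k b c \<noteq> 0 \<Longrightarrow> wt c = vt b"
    and a: "\<And>a b. b \<in> B \<Longrightarrow> a \<in> arcs M.Q \<Longrightarrow> tail M.Q a = vt b \<Longrightarrow>
      N.aact a (k b) = (case mv a b of None \<Rightarrow> (\<lambda>c. 0) | Some b' \<Rightarrow> k b')"
  shows "lin B k \<in> rhom L M.M N.M"
proof -
  have path: "(\<Sum>c\<in>C. k b c * odelta (moves nv r c) d) = (\<Sum>b'\<in>B. odelta (moves mv r b) b' * k b' d)"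
    if b: "b \<in> B" for b r d
    using b
  proof (induction r arbitrary: b)
    case Nil
    have "(\<Sum>c\<in>C. k b c * delta c d) = lin C delta (k b) d" by (simp add: lin_def)
    also have "\<dots> = k b d" using k(1)[OF Nil] by (subst lin_self) (auto simp: N.finite_B N.carrier_M)
    also have "k b d = lin B k (delta b) d" using Nil by (simp add: lin_delta M.finite_B)
    finally show ?case by (simp add: lin_def)
  next
    case (Cons a r)
    have "(\<Sum>c\<in>C. k b c * odelta (moves nv (a # r) c) d) = lin C (\<lambda>c. odelta (moves nv r c)) (N.aact a (k b)) d"
    proof -
      have "lin C (\<lambda>c. odelta (moves nv r c)) (odelta (nv a c)) = odelta (moves nv (a # r) c)" if "c \<in> C" for c
        using N.mv_B[OF that, of a] by (cases "nv a c") (auto simp: lin_delta N.finite_B, auto simp: lin_def)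
      hence "lin C (\<lambda>c. lin C (\<lambda>c. odelta (moves nv r c)) (odelta (nv a c))) (k b) = lin C (\<lambda>c. odelta (moves nv (a # r) c)) (k b)"
        by (intro lin_cong) blast
      thus ?thesis by (simp add: N.aact_def lin_lin) (simp add: lin_def)
    qed
    also have "\<dots> = (\<Sum>b'\<in>B. odelta (moves mv (a # r) b) b' * k b' d)"
    proof (cases "a \<in> arcs M.Q \<and> tail M.Q a = vt b")
      case True
      note * = a[OF Cons.prems conjunct1[OF True] conjunct2[OF True]]
      show ?thesis
      proof (cases "mv a b")
        case None
        thus ?thesis by (simp add: * lin_def)
      next
        case (Some b')
        thus ?thesis using Cons.IH[of b'] M.mv_B[OF Cons.prems Some] by (simp add: * lin_def)
      qed
    next
      case False
      have "N.aact a (k b) = (\<lambda>c. 0)"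
      proof
        fix c'
        have "k b c * odelta (nv a c) c' = 0" if "c \<in> C" for c
          using N.mv_B[OF that, of a] k(2)[OF Cons.prems, of c] False by (cases "nv a c") auto
        thus "N.aact a (k b) c' = 0" by (simp add: N.aact_def lin_def)
      qed
      moreover have "mv a b = None" using M.mv_B[OF Cons.prems, of a] False by (cases "mv a b") auto
      ultimately show ?thesis by (simp add: lin_def)
    qed
    finally show ?case .
  qed
  have inter: "lin C (N.rep x) (k b) = lin B k (M.rep x b)" if b: "b \<in> B" and x: "x \<in> carrier M.A" for b x
  proof
    fix d
    let ?R = "snd ` {p. x p \<noteq> 0}"
    have fin: "finite ?R" using x by (simp add: M.carrier_A)
    have "lin C (N.rep x) (k b) d = (\<Sum>c\<in>C. \<Sum>r\<in>?R. x (vt b, r) * (k b c * odelta (moves nv r c) d))"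
      unfolding lin_def
    proof (intro sum.cong refl)
      fix c assume c: "c \<in> C"
      show "k b c * N.rep x c d = (\<Sum>r\<in>?R. x (vt b, r) * (k b c * odelta (moves nv r c) d))"
        using k(2)[OF b, of c] by (cases "k b c = 0") (auto simp: N.rep_def odelta_def sum_distrib_left intro!: sum.cong)
    qed
    also have "\<dots> = (\<Sum>r\<in>?R. x (vt b, r) * (\<Sum>c\<in>C. k b c * odelta (moves nv r c) d))"
      by (simp only: sum_distrib_left) (rule sum.swap)
    also have "\<dots> = (\<Sum>r\<in>?R. x (vt b, r) * (\<Sum>b'\<in>B. odelta (moves mv r b) b' * k b' d))"
      by (simp only: path[OF b])
    also have "\<dots> = (\<Sum>b'\<in>B. \<Sum>r\<in>?R. x (vt b, r) * (odelta (moves mv r b) b' * k b' d))"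
      by (simp only: sum_distrib_left) (rule sum.swap)
    also have "\<dots> = lin B k (M.rep x b) d"
      unfolding lin_def M.rep_def by (auto simp: odelta_def sum_distrib_right intro!: sum.cong)
    finally show "lin C (N.rep x) (k b) d = lin B k (M.rep x b) d" .
  qed
  show ?thesis
  proof (rule rhomI)
    fix m assume "m \<in> carrier M.M"
    show "lin B k m \<in> carrier N.M" using k(1) by (auto simp: N.carrier_M lin_def intro!: sum.neutral)
    show "lin B k (m \<oplus>\<^bsub>M.M\<^esub> n) = lin B k m \<oplus>\<^bsub>N.M\<^esub> lin B k n" for n
      by (simp add: M.add_M N.add_M lin_add)
    fix r assume "r \<in> carrier L"
    then obtain x where x: "x \<in> carrier M.A" "r = M.cl x" by (auto simp: M.carrier_\<Lambda>)
    have "lin B k (lin B (M.rep x) m) = lin C (N.rep x) (lin B k m)"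
      unfolding lin_lin using inter x by (intro lin_cong) simp
    thus "lin B k (r \<odot>\<^bsub>M.M\<^esub> m) = r \<odot>\<^bsub>N.M\<^esub> lin B k m"
      using x by (simp add: M.act_M N.act_M)
  qed
qed

lemma partial_map_hom:
  assumes g: "\<And>b c. b \<in> B \<Longrightarrow> g b = Some c \<Longrightarrow> c \<in> C \<and> wt c = vt b"
    and a: "\<And>a b. b \<in> B \<Longrightarrow> a \<in> arcs M.Q \<Longrightarrow> tail M.Q a = vt b \<Longrightarrow>
      Option.bind (g b) (nv a) = Option.bind (mv a b) g"
  shows "lin B (\<lambda>b. odelta (g b)) \<in> rhom L M.M N.M"
proof (rule lin_hom)
  fix b assume b: "b \<in> B"
  show "odelta (g b) \<in> carrier N.M" using g[OF b] by (auto simp: N.carrier_M odelta_def)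
  show "wt c = vt b" if "odelta (g b) c \<noteq> (0::'k)" for c
    using g[OF b, of c] that by (auto simp: odelta_def split: if_splits)
  fix a assume "a \<in> arcs M.Q" "tail M.Q a = vt b"
  note * = a[OF b this]
  show "N.aact a (odelta (g b)) = (case mv a b of None \<Rightarrow> (\<lambda>c. 0) | Some b' \<Rightarrow> odelta (g b'))"
  proof (cases "g b")
    case None
    thus ?thesis using * by (auto simp: N.aact_def lin_def split: option.splits)
  next
    case (Some c)
    thus ?thesis using * g[OF b Some] by (auto simp: N.aact_delta split: option.splits)
  qed
qed

context
  fixes f assumes f: "f \<in> rhom L M.M N.M"
begin

lemma hom_scale: "m \<in> carrier M.M \<Longrightarrow> f (\<lambda>b. z * m b) = (\<lambda>c. z * f m c)"
  using rhom_act[OF f, of "M.cl (\<lambda>p. z * \<one>\<^bsub>M.A\<^esub> p)" m] rhom_closed[OF f]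
    M.cl_closed[OF M.scale_closed_A[OF M.one_closed_A, of z]]
  by (simp add: M.act_scalar N.act_scalar)

lemma hom_add: "m \<in> carrier M.M \<Longrightarrow> n \<in> carrier M.M \<Longrightarrow> f (\<lambda>b. m b + n b) = (\<lambda>c. f m c + f n c)"
  using rhom_add[OF f] by (simp add: M.add_M N.add_M)

lemma hom_zero: "f (\<lambda>b. 0) = (\<lambda>c. 0)"
  using rhom_zero[OF f M.M.M.abelian_group_axioms N.M.M.abelian_group_axioms] by (simp add: M.zero_M N.zero_M)

lemma hom_eq_lin: assumes m: "m \<in> carrier M.M" shows "f m = lin B (\<lambda>b. f (delta b)) m"
proof -
  have "f (\<lambda>c. \<Sum>b\<in>Y. m b * delta b c) = (\<lambda>d. \<Sum>b\<in>Y. m b * f (delta b) d)" if "Y \<subseteq> B" for Y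
    using finite_subset[OF that M.finite_B] that
  proof (induction Y)
    case empty
    thus ?case by (simp add: hom_zero)
  next
    case (insert y Y)
    have c: "(\<lambda>c. m y * delta y c) \<in> carrier M.M" "(\<lambda>c. \<Sum>b\<in>Y. m b * delta b c) \<in> carrier M.M"
      using insert.prems by (auto simp: M.carrier_M delta_def intro!: sum.neutral)
    show ?case using insert hom_add[OF c] hom_scale[OF M.delta_closed, of y "m y"] by simp
  qed
  from this[of B] lin_self[of B m] show ?thesis using m by (simp add: lin_def M.finite_B M.carrier_M)
qed

lemma hom_aact: "a \<in> arcs M.Q \<Longrightarrow> m \<in> carrier M.M \<Longrightarrow> f (M.aact a m) = N.aact a (f m)"
proof -
  assume a: "a \<in> arcs M.Q" and m: "m \<in> carrier M.M"
  have "M.single (tail M.Q a, [a]) \<in> carrier M.A"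
    using a by (intro M.single_closed) (simp add: M.paths_iff M.tail_verts)
  thus ?thesis using a m rhom_act[OF f M.cl_closed m] by (simp add: M.aact_eq_act N.aact_eq_act)
qed

lemma hom_vertex: assumes b: "b \<in> B" and c: "f (delta b) c \<noteq> 0" shows "wt c = vt b"
proof -
  let ?e = "M.single (vt b, [])"
  have e: "?e \<in> carrier M.A" using M.vt_verts[OF b] by (intro M.single_closed) (simp add: M.paths_iff)
  have "M.cl ?e \<odot>\<^bsub>M.M\<^esub> delta b = M.rep ?e b"
    using b by (simp add: M.act_M[OF e] lin_delta M.finite_B)
  also have "\<dots> = delta b" by (rule ext) (simp add: M.rep_single[OF b] delta_def eq_commute)
  finally have "M.cl ?e \<odot>\<^bsub>M.M\<^esub> delta b = delta b" .
  hence "f (delta b) = lin C (N.rep ?e) (f (delta b))"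
    using rhom_act[OF f M.cl_closed[OF e] M.delta_closed[OF b]] by (simp add: N.act_M[OF e])
  hence "lin C (N.rep ?e) (f (delta b)) c \<noteq> 0" using c by simp
  then obtain c' where "c' \<in> C" "N.rep ?e c' c \<noteq> 0"
    unfolding lin_def by (auto elim!: sum.not_neutral_contains_not_neutral)
  thus ?thesis by (auto simp: N.rep_single split: if_splits)
qed

end

lemma hom_eqI:
  assumes "f \<in> rhom L M.M N.M" "g \<in> rhom L M.M N.M" "\<And>b. b \<in> B \<Longrightarrow> f (delta b) = g (delta b)" "m \<in> carrier M.M"
  shows "f m = g m"
  using hom_eq_lin[OF assms(1,4)] hom_eq_lin[OF assms(2,4)] lin_cong[of B "\<lambda>b. f (delta b)" "\<lambda>b. g (delta b)" m] assms(3)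
  by simp

end

section \<open>String modules\<close>

context surface
begin

lemma turning_nth: "turning p \<longleftrightarrow> (\<forall>k. Suc k < length p \<longrightarrow> p ! Suc k = gl (nx (p ! k)))"
  by (simp add: turning_def successively_conv_nth)

text \<open>
  A path that turns around a marked point ends at the boundary after at most as many steps as there
  are sides, which is where it matters that every marked point lies on the boundary.
\<close>

lemma turning_length_bounded: "\<exists>L. \<forall>p. turning p \<and> set p \<subseteq> arcs Q \<longrightarrow> length p \<le> L"
proof -
  let ?r = "\<lambda>s. nx (gl s)"
  have "\<forall>s. \<exists>n. s \<in> sides T \<longrightarrow> gl ((?r ^^ n) s) = (?r ^^ n) s" using reaches_boundary by blast
  then obtain n where n: "\<And>s. s \<in> sides T \<Longrightarrow> gl ((?r ^^ n s) s) = (?r ^^ n s) s" by metis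
  have "length p \<le> Max (insert 0 (n ` sides T))" if p: "turning p" "set p \<subseteq> arcs Q" for p
  proof (cases "p = []")
    case False
    let ?b = "nx (p ! 0)"
    have b: "?b \<in> sides T" using p(2) False by (intro arrow_side(2)) (metis length_greater_0_conv nth_mem subsetD)
    have step: "k < length p \<Longrightarrow> nx (p ! k) = (?r ^^ k) ?b" for k
    proof (induction k)
      case (Suc k)
      thus ?case using p(1) by (simp add: turning_nth)
    qed simp
    have "\<not> n ?b < length p"
    proof
      assume l: "n ?b < length p"
      hence "p ! n ?b \<in> arcs Q" using p(2) by (metis nth_mem subsetD)
      hence "gl (nx (p ! n ?b)) \<noteq> nx (p ! n ?b)" using gl_neq by (auto simp: arcs_Q)
      thus False using step[OF l] n[OF b] by simp
    qed
    hence "length p \<le> n ?b" by simp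
    also have "\<dots> \<le> Max (insert 0 (n ` sides T))" using b finite_sides by (intro Max_ge) auto
    finally show ?thesis .
  qed simp
  thus ?thesis by blast
qed

text \<open>
  A closed turning path could be repeated indefinitely.
\<close>

lemma turning_no_repetition:
  assumes "turning (a # q @ [a])" "set (a # q) \<subseteq> arcs Q"
  shows False
proof -
  obtain L where L: "\<And>p. turning p \<Longrightarrow> set p \<subseteq> arcs Q \<Longrightarrow> length p \<le> L" using turning_length_bounded by blast
  define c where "c = a # q"
  have "turning (c @ [a])" using assms(1) by (simp add: c_def)
  hence t: "turning c" "gl (nx (last c)) = a" unfolding turning_append by (simp_all add: c_def)
  have "turning (concat (replicate m c))" for m
  proof (induction m)
    case (Suc m)
    have "hd (concat (replicate m c)) = a" if "concat (replicate m c) \<noteq> []"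
      using that by (cases m) (simp_all add: c_def)
    hence "turning (c @ concat (replicate m c))"
      unfolding turning_append using Suc t by simp
    thus ?case by simp
  qed simp
  hence "turning (concat (replicate m (a # q)))" for m by (simp add: c_def)
  moreover have "set (concat (replicate m (a # q))) \<subseteq> arcs Q" for m using assms(2) by (induction m) auto
  moreover have "length (concat (replicate m (a # q))) \<ge> m" for m by (induction m) auto
  ultimately have "Suc L \<le> L" using L le_trans by blast
  thus False by simp
qed

end

lemma arrows_move_eq_moves: "arrows_move ls r i = moves (arrow_move ls) r i"
proof (induction r arbitrary: i)
  case (Cons a r)
  thus ?case by (cases "arrow_move ls a i") auto
qed simp

lemma string_module_eq:
  "string_module Q w = mono_module {..length (snd w)} (word_vertex Q w) (arrow_move (snd w))"
  unfolding string_module_def mono_module_def string_action_def path_move_def arrows_move_eq_moves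
  by (simp add: not_le)

locale string = gentle T I for T :: "'d triangulation" and I :: "(('d set, 'd) path \<Rightarrow> 'k::field) set" +
  fixes v :: "('d set, 'd) word"
  assumes is_string: "is_string (quiver T) I v"
begin

abbreviation "len \<equiv> length (snd v)"
abbreviation "letters \<equiv> snd v"
abbreviation "vx \<equiv> word_vertex Q v"
abbreviation "am \<equiv> arrow_move (snd v)"

lemma letter_arcs: "i < len \<Longrightarrow> letter_arrow (letters ! i) \<in> arcs Q"
  using is_string nth_mem[of i letters] unfolding is_string_def by blast

lemma letter_start_vx: "i < len \<Longrightarrow> letter_start Q (letters ! i) = vx i"
  using is_string by (simp add: is_string_def)

lemma letter_end_vx: "letter_end Q (letters ! i) = vx (Suc i)"
  by (cases v) simp

lemma compatible: "Suc i < len \<Longrightarrow> letters_compatible Q I (letters ! i) (letters ! Suc i)"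
  using is_string by (simp add: is_string_def)

lemma vx_verts: "i \<le> len \<Longrightarrow> vx i \<in> verts Q"
proof (cases i)
  case 0
  thus ?thesis using is_string by (cases v) (simp add: is_string_def)
next
  case (Suc j)
  assume "i \<le> len"
  thus ?thesis unfolding Suc letter_end_vx[symmetric] using letter_arcs[of j] Suc
    by (cases "letters ! j") (simp_all add: head_verts tail_verts)
qed

lemma am_cases:
  assumes "am a i = Some j"
  obtains "i < len" "letters ! i = Arr a" "j = Suc i" | "i = Suc j" "j < len" "letters ! j = Inv a"
  using assms by (cases i) (auto simp: arrow_move_def split: if_splits)

lemma am_props: "am a i = Some j \<Longrightarrow> i \<le> len \<and> j \<le> len \<and> a \<in> arcs Q \<and> tail Q a = vx i \<and> vx j = head Q a"
proof (elim am_cases)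
  assume "i < len" "letters ! i = Arr a" "j = Suc i"
  thus ?thesis using letter_arcs[of i] letter_start_vx[of i] letter_end_vx[of i] by simp
next
  assume "i = Suc j" "j < len" "letters ! j = Inv a"
  thus ?thesis using letter_arcs[of j] letter_start_vx[of j] letter_end_vx[of j] by simp
qed

lemma am_rel: "am a i = Some j \<Longrightarrow> internal T a \<Longrightarrow> am (nx a) j = None"
proof -
  assume a: "am a i = Some j" "internal T a"
  hence arcs: "a \<in> arcs Q" "nx a \<in> arcs Q" by (simp_all add: internal_iff)
  have prod: "arrow_prod Q a (nx a) \<in> I" using arrow_prod_in_I_iff[OF arcs] nx_neq_gl[OF arcs(1)] by simp
  have "nx a \<noteq> a" using nx_neq arrow_side(1)[OF arcs(1)] by blast
  show ?thesis
  proof (rule ccontr)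
    assume "am (nx a) j \<noteq> None"
    then obtain k where k: "am (nx a) j = Some k" by blast
    from a(1) show False
    proof (cases rule: am_cases)
      case 1
      from k show False
      proof (cases rule: am_cases)
        case 1
        thus False using \<open>j = Suc i\<close> \<open>letters ! i = Arr a\<close> compatible[of i] prod by simp
      next
        case 2
        thus False using \<open>j = Suc i\<close> \<open>letters ! i = Arr a\<close> by simp
      qed
    next
      case 2
      from k show False
      proof (cases rule: am_cases)
        case 1
        thus False using 2 by simp
      next
        case 2
        thus False using \<open>letters ! j = Inv a\<close> \<open>j < len\<close> compatible[of k] prod by simp
      qed
    qed
  qed
qed

lemma am_inj: "am a i = Some k \<Longrightarrow> am a j = Some k \<Longrightarrow> i = j"
proof -
  assume a: "am a i = Some k" "am a j = Some k"
  have *: False if "letters ! p = Arr a" "letters ! Suc p = Inv a" "Suc p < len" for p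
    using compatible[of p] that by simp
  from a(1) show "i = j"
    using a(2) * by (auto elim!: am_cases)
qed

sublocale S: monomial T I "{..len}" vx am
  by unfold_locales (auto simp: vx_verts dest: am_props am_rel)

lemma string_module_S: "string_module Q v = S.M"
  by (simp add: string_module_eq S.M_def)

text \<open>
  The basis of the term of degree \<open>n\<close>: a position on the string, a chain of
  \<open>n\<close> arrows with a relation at each step, and a nonzero path continuing it.  Nothing
  is required of the step from the chain to the path, so one and the same pair may occur in two
  consecutive degrees.
\<close>

definition BF :: "nat \<Rightarrow> (nat \<times> 'd list) set" where
  "BF n = {(i, y). i \<le> len \<and> (vx i, y) \<in> paths Q \<and> n \<le> length y \<and>
      (\<forall>k. Suc k < n \<longrightarrow> y ! Suc k = nx (y ! k)) \<and>
      (\<forall>k. n \<le> k \<longrightarrow> Suc k < length y \<longrightarrow> y ! Suc k = gl (nx (y ! k)))}"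

definition vF :: "nat \<times> 'd list \<Rightarrow> 'd set" where
  "vF b = pend (vx (fst b)) (snd b)"

definition mF :: "nat \<Rightarrow> 'd \<Rightarrow> nat \<times> 'd list \<Rightarrow> (nat \<times> 'd list) option" where
  "mF n a b = (if (fst b, snd b @ [a]) \<in> BF n then Some (fst b, snd b @ [a]) else None)"

lemma BF_D:
  assumes "(i, y) \<in> BF n"
  shows "i \<le> len" "(vx i, y) \<in> paths Q" "n \<le> length y" "\<And>k. Suc k < n \<Longrightarrow> y ! Suc k = nx (y ! k)"
    "\<And>k. n \<le> k \<Longrightarrow> Suc k < length y \<Longrightarrow> y ! Suc k = gl (nx (y ! k))"
  using assms by (auto simp: BF_def)

lemma path_step:
  assumes "(vx i, y) \<in> paths Q" "Suc k < length y"
  shows "y ! k \<in> arcs Q" "y ! Suc k \<in> arcs Q" "y ! Suc k = nx (y ! k) \<or> y ! Suc k = gl (nx (y ! k))"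
    "\<not> (y ! Suc k = nx (y ! k) \<and> y ! Suc k = gl (nx (y ! k)))"
proof -
  show a: "y ! k \<in> arcs Q" "y ! Suc k \<in> arcs Q"
    using assms nth_mem[of k y] nth_mem[of "Suc k" y] by (auto simp: paths_iff)
  have "head Q (y ! k) = tail Q (y ! Suc k)"
    using assms by (auto simp: paths_iff successively_conv_nth)
  thus "y ! Suc k = nx (y ! k) \<or> y ! Suc k = gl (nx (y ! k))" using composable_iff[OF a] by simp
  show "\<not> (y ! Suc k = nx (y ! k) \<and> y ! Suc k = gl (nx (y ! k)))" using nx_neq_gl[OF a(1)] by metis
qed

lemma finite_BF: "finite (BF n)"
proof -
  obtain L where L: "\<And>p. turning p \<Longrightarrow> set p \<subseteq> arcs Q \<Longrightarrow> length p \<le> L" using turning_length_bounded by blast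
  have "BF n \<subseteq> {..len} \<times> {y. set y \<subseteq> arcs Q \<and> length y \<le> n + L}"
  proof
    fix b assume b: "b \<in> BF n"
    obtain i y where iy: "b = (i, y)" by (cases b)
    note d = BF_D[OF b[unfolded iy]]
    have y: "set y \<subseteq> arcs Q" using d(2) by (simp add: paths_iff)
    have "turning (drop n y)" unfolding turning_nth using d(5) by simp
    moreover have "set (drop n y) \<subseteq> arcs Q" using y set_drop_subset[of n y] by blast
    ultimately have "length (drop n y) \<le> L" by (rule L)
    thus "b \<in> {..len} \<times> {y. set y \<subseteq> arcs Q \<and> length y \<le> n + L}" using iy d(1) y by simp
  qed
  thus ?thesis using finite_lists_length_le[OF finite_arcs, of "n + L"] by (auto intro: finite_subset)
qed

lemma BF_butlast: "(i, y @ [a]) \<in> BF n \<Longrightarrow> n \<le> length y \<Longrightarrow> (i, y) \<in> BF n"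
proof -
  assume b: "(i, y @ [a]) \<in> BF n" and n: "n \<le> length y"
  have "y ! Suc k = nx (y ! k)" if "Suc k < n" for k
    using BF_D(4)[OF b that] that n by (simp add: nth_append)
  moreover have "y ! Suc k = gl (nx (y ! k))" if "n \<le> k" "Suc k < length y" for k
    using BF_D(5)[OF b that(1)] that by (simp add: nth_append)
  ultimately show ?thesis using BF_D(1,2)[OF b] n by (simp add: BF_def paths_append)
qed

lemma monomial_F: "monomial T I (BF n) vF (mF n)"
proof unfold_locales
  show "finite (BF n)" by (rule finite_BF)
  fix b assume b: "b \<in> BF n"
  obtain i y where iy: "b = (i, y)" by (cases b)
  note d = BF_D[OF b[unfolded iy]]
  show "vF b \<in> verts Q" using pend_verts[OF d(2)] by (simp add: vF_def iy)
  fix a c assume "mF n a b = Some c"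
  hence c: "c = (i, y @ [a])" "(i, y @ [a]) \<in> BF n" by (auto simp: mF_def iy split: if_splits)
  have "(pend (vx i) y, [a]) \<in> paths Q" using BF_D(2)[OF c(2)] paths_append by blast
  thus "c \<in> BF n \<and> a \<in> arcs Q \<and> tail Q a = vF b \<and> vF c = head Q a"
    using c by (auto simp: vF_def iy paths_iff)
  assume a: "internal T a"
  have "(i, (y @ [a]) @ [nx a]) \<notin> BF n"
  proof
    assume "(i, (y @ [a]) @ [nx a]) \<in> BF n"
    from BF_D(5)[OF this d(3)] have "nx a = gl (nx a)" by (simp add: nth_append)
    thus False using nx_neq_gl[of a] a by (simp add: internal_iff)
  qed
  thus "mF n (nx a) c = None" by (simp add: mF_def c(1))
qed

sublocale F: monomial T I "BF n" vF "mF n" for n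
  by (rule monomial_F)

lemma moves_F: "b \<in> BF n \<Longrightarrow> moves (mF n) r b = (if (fst b, snd b @ r) \<in> BF n then Some (fst b, snd b @ r) else None)"
proof (induction r rule: rev_induct)
  case (snoc a r)
  show ?case
  proof (cases "(fst b, snd b @ r) \<in> BF n")
    case True
    thus ?thesis using snoc by (simp add: moves_append mF_def)
  next
    case False
    have "n \<le> length (snd b @ r)" using BF_D(3)[of "fst b" "snd b" n] snoc.prems by simp
    hence "(fst b, snd b @ r @ [a]) \<notin> BF n" using False BF_butlast[of "fst b" "snd b @ r" a n] by auto
    thus ?thesis using snoc False by (simp add: moves_append)
  qed
qed simp

end

section \<open>A projective resolution of a string module\<close>

lemma (in two_monomial) hom_comb:
  assumes f: "f \<in> rhom L M.M N.M" and g: "g \<in> rhom L M.M N.M"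
  shows "(\<lambda>m c. f m c + z * g m c) \<in> rhom L M.M N.M"
proof (rule rhomI)
  fix m assume m: "m \<in> carrier M.M"
  note fg = rhom_closed[OF f m] rhom_closed[OF g m]
  show "(\<lambda>c. f m c + z * g m c) \<in> carrier N.M" using fg by (simp add: N.carrier_M)
  show "(\<lambda>c. f (m \<oplus>\<^bsub>M.M\<^esub> n) c + z * g (m \<oplus>\<^bsub>M.M\<^esub> n) c) = (\<lambda>c. f m c + z * g m c) \<oplus>\<^bsub>N.M\<^esub> (\<lambda>c. f n c + z * g n c)"
    if "n \<in> carrier M.M" for n
    using rhom_add[OF f m that] rhom_add[OF g m that] by (simp add: N.add_M algebra_simps)
  fix r assume "r \<in> carrier L"
  then obtain x where x: "x \<in> carrier M.A" "r = M.cl x" by (auto simp: M.carrier_\<Lambda>)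
  have "(\<lambda>c. f (r \<odot>\<^bsub>M.M\<^esub> m) c + z * g (r \<odot>\<^bsub>M.M\<^esub> m) c) =
      (\<lambda>c. lin C (N.rep x) (f m) c + z * lin C (N.rep x) (g m) c)"
    using rhom_act[OF f M.cl_closed[OF x(1)] m] rhom_act[OF g M.cl_closed[OF x(1)] m] x
    by (simp add: N.act_M)
  also have "\<dots> = lin C (N.rep x) (\<lambda>c. f m c + z * g m c)"
    by (simp only: lin_add lin_scale)
  finally show "(\<lambda>c. f (r \<odot>\<^bsub>M.M\<^esub> m) c + z * g (r \<odot>\<^bsub>M.M\<^esub> m) c) = r \<odot>\<^bsub>N.M\<^esub> (\<lambda>c. f m c + z * g m c)"
    using x by (simp add: N.act_M)
qed

lemma lin_null: "(\<And>b. b \<in> B \<Longrightarrow> k b = (\<lambda>c. 0)) \<Longrightarrow> lin B k m = (\<lambda>c. 0)"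
  by (simp add: lin_def)

lemma lin_zero [simp]: "lin B k (\<lambda>b. 0) = (\<lambda>c. 0)"
  by (simp add: lin_def)

context string
begin

abbreviation FM :: "nat \<Rightarrow> ((('d set, 'd) path \<Rightarrow> 'k) set, nat \<times> 'd list \<Rightarrow> 'k) module" where
  "FM n \<equiv> monomial.M (BF n) vF (mF n)"

lemma FF: "two_monomial T I (BF m) vF (mF m) (BF n) vF (mF n)"
  by (intro two_monomial.intro monomial_F)

lemma FS: "two_monomial T I (BF m) vF (mF m) {..len} vx am"
  by (intro two_monomial.intro monomial_F S.monomial_axioms)

definition pF :: "nat \<times> 'd list \<Rightarrow> (nat \<times> 'd list) option" where
  "pF b = (case snd b of [] \<Rightarrow> None | a # y \<Rightarrow> map_option (\<lambda>j. (j, y)) (am a (fst b)))"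

text \<open>
  The differential either lets the first arrow of the chain act on the string module, or, with a
  sign, moves the last arrow of the chain to the path that follows it.  In the second case the pair
  is unchanged as a pair, and the summand is present if it still qualifies in the lower degree.
\<close>

definition kF :: "nat \<Rightarrow> nat \<times> 'd list \<Rightarrow> nat \<times> 'd list \<Rightarrow> 'k" where
  "kF n b = (\<lambda>c. odelta (pF b) c + (- 1) ^ Suc n * (if b \<in> BF n then delta b c else 0))"

definition dF :: "nat \<Rightarrow> (nat \<times> 'd list \<Rightarrow> 'k) \<Rightarrow> nat \<times> 'd list \<Rightarrow> 'k" where
  "dF n = lin (BF (Suc n)) (kF n)"

definition eF :: "(nat \<times> 'd list \<Rightarrow> 'k) \<Rightarrow> nat \<Rightarrow> 'k" where
  "eF = lin (BF 0) (\<lambda>b. odelta (moves am (snd b) (fst b)))"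

lemma all_nat_split: "(\<forall>k. P k) \<longleftrightarrow> P 0 \<and> (\<forall>k. P (Suc k))"
  by (metis not0_implies_Suc)

lemma BF_Cons:
  assumes "am a i = Some j"
  shows "(i, a # z) \<in> BF (Suc n) \<longleftrightarrow> (j, z) \<in> BF n \<and> (n > 0 \<longrightarrow> z ! 0 = nx a)"
proof -
  note p = am_props[OF assms]
  have "(vx i, [a] @ z) \<in> paths Q \<longleftrightarrow> (vx j, z) \<in> paths Q"
    unfolding paths_append using p by (simp add: paths_iff vx_verts pend_def)
  moreover have "(\<forall>k. Suc k < Suc n \<longrightarrow> (a # z) ! Suc k = nx ((a # z) ! k)) \<longleftrightarrow>
      (n > 0 \<longrightarrow> z ! 0 = nx a) \<and> (\<forall>k. Suc k < n \<longrightarrow> z ! Suc k = nx (z ! k))"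
    by (subst all_nat_split) simp
  moreover have "(\<forall>k. Suc n \<le> k \<longrightarrow> Suc k < length (a # z) \<longrightarrow> (a # z) ! Suc k = gl (nx ((a # z) ! k))) \<longleftrightarrow>
      (\<forall>k. n \<le> k \<longrightarrow> Suc k < length z \<longrightarrow> z ! Suc k = gl (nx (z ! k)))"
    by (subst all_nat_split) simp
  ultimately show ?thesis using p unfolding BF_def by auto
qed

lemma BF_Suc_Cons: "b \<in> BF (Suc n) \<Longrightarrow> \<exists>i a y. b = (i, a # y)"
  by (cases b; cases "snd b") (auto simp: BF_def)

lemma pF_Some: "pF b = Some c \<longleftrightarrow> (\<exists>a. snd b = a # snd c \<and> am a (fst b) = Some (fst c))"
  by (auto simp: pF_def split: list.splits)

lemma BF_not_both: "b \<in> BF (Suc (Suc n)) \<Longrightarrow> b \<notin> BF n"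
proof
  assume a: "b \<in> BF (Suc (Suc n))" "b \<in> BF n"
  obtain i y where b: "b = (i, y)" by (cases b)
  have m: "(i, y) \<in> BF (Suc (Suc n))" "(i, y) \<in> BF n" using a b by simp_all
  have l: "Suc n < length y" using BF_D(3)[OF m(1)] by simp
  have "y ! Suc n = nx (y ! n) \<and> y ! Suc n = gl (nx (y ! n))"
    using BF_D(4)[OF m(1), of n] BF_D(5)[OF m(2), of n] l by blast
  thus False using path_step(4)[OF BF_D(2)[OF m(1)] l] by blast
qed

text \<open>
  The step after the chain is either a relation, and then the chain can be prolonged by one arrow,
  or it is not, and then its last arrow can be given up.
\<close>

lemma BF_either: "b \<in> BF (Suc n) \<Longrightarrow> b \<in> BF n \<or> b \<in> BF (Suc (Suc n))"
proof -
  assume a: "b \<in> BF (Suc n)"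
  obtain i y where b: "b = (i, y)" by (cases b)
  note d = BF_D[OF a[unfolded b]]
  have *: "(i, y) \<in> BF n" if that: "Suc n < length y \<longrightarrow> y ! Suc n = gl (nx (y ! n))"
  proof -
    have "y ! Suc k = gl (nx (y ! k))" if "n \<le> k" "Suc k < length y" for k
      using d(5)[of k] that \<open>Suc n < length y \<longrightarrow> y ! Suc n = gl (nx (y ! n))\<close> by (cases "k = n") simp_all
    thus ?thesis unfolding BF_def using d(1-4) by simp
  qed
  show ?thesis
  proof (cases "Suc n < length y \<and> y ! Suc n = nx (y ! n)")
    case True
    hence "(i, y) \<in> BF (Suc (Suc n))" unfolding BF_def using d by (simp add: less_Suc_eq Suc_le_eq) auto
    thus ?thesis using b by simp
  next
    case False
    thus ?thesis using * b path_step(3)[OF d(2), of n] by blast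
  qed
qed

lemma BF_0: "(i, y) \<in> BF 0 \<longleftrightarrow> i \<le> len \<and> (vx i, y) \<in> paths Q \<and> turning y"
  by (auto simp: BF_def turning_nth)

lemma moves_BF_0: "i \<le> len \<Longrightarrow> moves am y i = Some j \<Longrightarrow> (i, y) \<in> BF 0"
  using S.moves_props[of i y j] by (simp add: BF_0)

lemma pF_closed: "b \<in> BF (Suc n) \<Longrightarrow> pF b = Some c \<Longrightarrow> c \<in> BF n \<and> vF c = vF b"
proof -
  assume b: "b \<in> BF (Suc n)" "pF b = Some c"
  obtain i y j z where iy: "b = (i, y)" "c = (j, z)" by (cases b, cases c)
  then obtain a where a: "y = a # z" "am a i = Some j" using b by (auto simp: pF_Some)
  show ?thesis using b iy a BF_Cons[OF a(2), of z n] am_props[OF a(2)] by (simp add: vF_def pend_Cons)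
qed

lemma dF_hom: "dF n \<in> rhom \<Lambda> (FM (Suc n)) (FM n)"
proof -
  interpret X: two_monomial T I "BF (Suc n)" vF "mF (Suc n)" "BF n" vF "mF n" by (rule FF)
  let ?q = "\<lambda>b. if b \<in> BF n then Some b else None"
  have h1: "lin (BF (Suc n)) (\<lambda>b. odelta (pF b)) \<in> rhom \<Lambda> (FM (Suc n)) (FM n)"
  proof (rule X.partial_map_hom)
    show "c \<in> BF n \<and> vF c = vF b" if "b \<in> BF (Suc n)" "pF b = Some c" for b c
      using pF_closed that by blast
    fix a b assume b: "b \<in> BF (Suc n)"
    then obtain i c y where iy: "b = (i, c # y)" using BF_Suc_Cons by blast
    show "Option.bind (pF b) (mF n a) = Option.bind (mF (Suc n) a b) pF"
    proof (cases "am c i")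
      case None
      thus ?thesis by (simp add: iy pF_def mF_def)
    next
      case (Some j)
      have "(i, c # (y @ [a])) \<in> BF (Suc n) \<longleftrightarrow> (j, y @ [a]) \<in> BF n"
        unfolding BF_Cons[OF Some] using b BF_Cons[OF Some, of y n] BF_D(3)[of j y n]
        by (auto simp: iy nth_append)
      thus ?thesis using Some by (simp add: iy pF_def mF_def)
    qed
  qed
  have h2: "lin (BF (Suc n)) (\<lambda>b. odelta (?q b)) \<in> rhom \<Lambda> (FM (Suc n)) (FM n)"
  proof (rule X.partial_map_hom)
    fix a b assume b: "b \<in> BF (Suc n)"
    obtain i y where iy: "b = (i, y)" by (cases b)
    note d = BF_D[OF b[unfolded iy]]
    have "(i, y @ [a]) \<in> BF (Suc n) \<and> (i, y) \<in> BF n" if x: "(i, y @ [a]) \<in> BF n"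
    proof -
      have "(i, y @ [a]) \<in> BF (Suc n)"
        unfolding BF_def using BF_D(1,2)[OF x] d(3,4) BF_D(5)[OF x] by (auto simp: nth_append)
      thus ?thesis using BF_butlast[OF x] d(3) by simp
    qed
    thus "Option.bind (?q b) (mF n a) = Option.bind (mF (Suc n) a b) ?q"
      by (auto simp: iy mF_def)
  qed (auto split: if_splits)
  have "dF n = (\<lambda>m c. lin (BF (Suc n)) (\<lambda>b. odelta (pF b)) m c + (- 1) ^ Suc n * lin (BF (Suc n)) (\<lambda>b. odelta (?q b)) m c)"
    unfolding dF_def kF_def lin_def sum_distrib_left sum.distrib[symmetric]
    by (intro ext sum.cong) (auto simp: algebra_simps)
  show ?thesis unfolding \<open>dF n = _\<close> by (rule X.hom_comb[OF h1 h2])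
qed

lemma eF_hom: "eF \<in> rhom \<Lambda> (FM 0) S.M"
proof -
  interpret X: two_monomial T I "BF 0" vF "mF 0" "{..len}" vx am by (rule FS)
  show ?thesis unfolding eF_def
  proof (rule X.partial_map_hom)
    fix b c assume b: "b \<in> BF 0" "moves am (snd b) (fst b) = Some c"
    thus "c \<in> {..len} \<and> vx c = vF b" using S.moves_props[of "fst b" "snd b" c] BF_D(1)[of "fst b" "snd b" 0]
      by (simp add: vF_def)
  next
    fix a b assume b: "b \<in> BF 0"
    obtain i y where iy: "b = (i, y)" by (cases b)
    have e: "Option.bind (moves am y i) (am a) = moves am (y @ [a]) i"
      by (cases "moves am y i") (simp_all add: moves_append, cases "am a (the (moves am y i))", simp_all)
    show "Option.bind (moves am (snd b) (fst b)) (am a) = Option.bind (mF 0 a b) (\<lambda>b. moves am (snd b) (fst b))"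
      using moves_BF_0[of i "y @ [a]"] BF_D(1)[OF b[unfolded iy]]
      by (cases "moves am (y @ [a]) i") (auto simp: iy mF_def e)
  qed
qed

lemma dF_delta: "b \<in> BF (Suc n) \<Longrightarrow> dF n (delta b) = kF n b"
  by (simp add: dF_def lin_delta finite_BF)

lemma eF_delta: "b \<in> BF 0 \<Longrightarrow> eF (delta b) = odelta (moves am (snd b) (fst b))"
  by (simp add: eF_def lin_delta finite_BF)

lemma dF_add: "dF n (\<lambda>b. m b + z * m' b) = (\<lambda>c. dF n m c + z * dF n m' c)"
  by (simp only: dF_def lin_add lin_scale)

lemma eF_add: "eF (\<lambda>b. m b + z * m' b) = (\<lambda>c. eF m c + z * eF m' c)"
  by (simp only: eF_def lin_add lin_scale)

lemma dF_kF: assumes b: "b \<in> BF (Suc (Suc n))" shows "dF n (kF (Suc n) b) = (\<lambda>c. 0)"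
proof -
  obtain i a z where iz: "b = (i, a # z)" using BF_Suc_Cons[OF b] by blast
  let ?s = "(- 1) ^ Suc (Suc n) :: 'k"
  have k: "dF n (kF (Suc n) b) = (\<lambda>c. dF n (odelta (pF b)) c + ?s * dF n (\<lambda>c. if b \<in> BF (Suc n) then delta b c else 0) c)"
    by (simp only: kF_def dF_add)
  have nb: "b \<notin> BF n" using BF_not_both[OF b] .
  show ?thesis
  proof (cases "am a i")
    case None
    hence "pF b = None" by (simp add: iz pF_def)
    hence "dF n (delta b) = (\<lambda>c. 0)" if "b \<in> BF (Suc n)"
      using that nb by (simp add: dF_delta kF_def)
    thus ?thesis using \<open>pF b = None\<close> unfolding k by (cases "b \<in> BF (Suc n)") (simp_all add: dF_def)
  next
    case (Some j)
    have p: "pF b = Some (j, z)" using Some by (simp add: iz pF_def)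
    have jz: "(j, z) \<in> BF (Suc n)" "z ! 0 = nx a" using b BF_Cons[OF Some, of z "Suc n"] by (auto simp: iz)
    obtain z' where z': "z = nx a # z'" using jz BF_Suc_Cons[OF jz(1)] by auto
    have "set z \<subseteq> arcs Q" using BF_D(2)[OF jz(1)] by (simp add: paths_iff)
    hence "internal T a" using am_props[OF Some] z' by (simp add: internal_iff)
    hence "pF (j, z) = None" using am_rel[OF Some] by (simp add: pF_def z')
    hence 1: "dF n (odelta (pF b)) = (\<lambda>c. (- 1) ^ Suc n * (if (j, z) \<in> BF n then delta (j, z) c else 0))"
      by (simp add: p dF_delta[OF jz(1)] kF_def)
    have "b \<in> BF (Suc n) \<longleftrightarrow> (j, z) \<in> BF n" using BF_Cons[OF Some, of z n] jz(2) by (simp add: iz)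
    moreover have "dF n (delta b) = delta (j, z)" if "b \<in> BF (Suc n)"
      using that nb p by (simp add: dF_delta kF_def)
    ultimately have 2: "dF n (\<lambda>c. if b \<in> BF (Suc n) then delta b c else 0) = (\<lambda>c. if (j, z) \<in> BF n then delta (j, z) c else 0)"
      by (cases "b \<in> BF (Suc n)") (simp_all add: dF_def)
    show ?thesis unfolding k 1 2 by auto
  qed
qed

lemma eF_kF: assumes b: "b \<in> BF (Suc 0)" shows "eF (kF 0 b) = (\<lambda>c. 0)"
proof -
  obtain i a z where iz: "b = (i, a # z)" using BF_Suc_Cons[OF b] by blast
  have i: "i \<le> len" using b iz BF_D(1) by blast
  have k: "eF (kF 0 b) = (\<lambda>c. eF (odelta (pF b)) c + (- 1) ^ Suc 0 * eF (\<lambda>c. if b \<in> BF 0 then delta b c else 0) c)"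
    by (simp only: kF_def eF_add)
  have m: "moves am (a # z) i = None" if "b \<notin> BF 0"
    using moves_BF_0[OF i, of "a # z"] that by (cases "moves am (a # z) i") (auto simp: iz)
  have 2: "eF (\<lambda>c. if b \<in> BF 0 then delta b c else 0) = odelta (moves am (a # z) i)"
    using m by (cases "b \<in> BF 0") (simp_all add: eF_delta, simp_all add: iz eF_def)
  show ?thesis
  proof (cases "am a i")
    case None
    thus ?thesis unfolding k 2 by (simp add: iz pF_def eF_def)
  next
    case (Some j)
    have "(j, z) \<in> BF 0" using b BF_Cons[OF Some, of z 0] by (auto simp: iz)
    thus ?thesis unfolding k 2 using Some by (simp add: iz pF_def eF_delta)
  qed
qed

lemma dF_dF: "dF n (dF (Suc n) m) = (\<lambda>c. 0)"
proof -
  have "dF n (dF (Suc n) m) = lin (BF (Suc (Suc n))) (\<lambda>b. dF n (kF (Suc n) b)) m"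
    unfolding dF_def by (rule lin_lin)
  thus ?thesis using dF_kF by (simp add: lin_null)
qed

lemma eF_dF: "eF (dF 0 m) = (\<lambda>c. 0)"
proof -
  have "eF (dF 0 m) = lin (BF (Suc 0)) (\<lambda>b. eF (kF 0 b)) m"
    unfolding dF_def eF_def by (rule lin_lin)
  thus ?thesis using eF_kF by (simp add: lin_null)
qed

lemma dF_apply:
  "dF n m c = (\<Sum>b\<in>BF (Suc n). m b * odelta (pF b) c) + (- 1) ^ Suc n * (if c \<in> BF (Suc n) \<and> c \<in> BF n then m c else 0)"
proof -
  define s where "s = ((- 1) ^ Suc n :: 'k)"
  have "(\<Sum>b\<in>BF (Suc n). m b * (s * (if b \<in> BF n then delta b c else 0))) =
      (\<Sum>b\<in>BF (Suc n). if b = c then s * (if c \<in> BF n then m c else 0) else 0)"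
    by (intro sum.cong) (auto simp: delta_def)
  also have "\<dots> = s * (if c \<in> BF (Suc n) \<and> c \<in> BF n then m c else 0)" by (simp add: finite_BF)
  finally show ?thesis unfolding dF_def lin_def kF_def s_def[symmetric] distrib_left sum.distrib by (rule arg_cong)
qed

lemma cycle_vanishes:
  assumes Y: "Y \<in> carrier (FM (Suc 0))" "dF 0 Y = (\<lambda>c. 0)"
    and jy: "(j, y) \<in> BF (Suc 0)" "(j, y) \<in> BF 0" "am (hd y) j \<noteq> None"
  shows "Y (j, y) = 0"
proof -
  define L where "L = Max (length ` snd ` BF (Suc 0))"
  have L: "length (snd b) \<le> L" if "b \<in> BF (Suc 0)" for b
    unfolding L_def using that by (intro Max_ge) (simp_all add: finite_BF)
  show ?thesis
    using jy
  proof (induction "L - length y" arbitrary: j y rule: less_induct)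
    case less
    have "Y b * odelta (pF b) (j, y) = 0" if b: "b \<in> BF (Suc 0)" for b
    proof (cases "pF b = Some (j, y)")
      case True
      obtain l x where lx: "b = (l, x)" by (cases b)
      then obtain c where c: "x = c # y" "am c l = Some j" using True by (auto simp: pF_Some)
      have y: "y \<noteq> []" using BF_D(3)[OF less.prems(1)] by auto
      have st: "hd y = nx c \<or> hd y = gl (nx c)" "c \<in> arcs Q" "hd y \<in> arcs Q"
        using path_step[OF BF_D(2)[OF b[unfolded lx c(1)]], of 0] y by (auto simp: hd_conv_nth)
      have "hd y \<noteq> nx c"
      proof
        assume h: "hd y = nx c"
        hence "internal T c" using st by (simp add: internal_iff)
        thus False using am_rel[OF c(2)] less.prems(3) h by simp
      qed
      hence g: "hd y = gl (nx c)" using st by simp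
      have b0: "(l, c # y) \<in> BF 0"
        using less.prems(2) g BF_D(1,2)[OF b[unfolded lx c(1)]] by (simp add: BF_0 turning_Cons)
      have "L - length (c # y) < L - length y" using L[OF b] lx c by simp
      from less.hyps[OF this] have "Y (l, c # y) = 0" using b lx c b0 by simp
      thus ?thesis by (simp add: lx c)
    qed (simp add: odelta_def)
    hence "(\<Sum>b\<in>BF (Suc 0). Y b * odelta (pF b) (j, y)) = 0" by simp
    moreover have "dF 0 Y (j, y) = 0" using Y(2) by simp
    ultimately show ?case using less.prems(1,2) unfolding dF_apply by simp
  qed
qed

text \<open>
  A basis element of the middle term also belongs to exactly one of the two neighbouring terms.  Up
  to sign, and up to the summand in which the first arrow acts, the differential is the identity on
  the shared elements, so that basis elements cancel in pairs.
\<close>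

lemma exact_Suc:
  assumes Y: "Y \<in> carrier (FM (Suc m))" "dF m Y = (\<lambda>c. 0)"
  shows "\<exists>Z\<in>carrier (FM (Suc (Suc m))). dF (Suc m) Z = Y"
proof -
  let ?n = "Suc m"
  define Z where "Z b = (if b \<in> BF (Suc ?n) \<and> b \<in> BF ?n then (- 1) ^ Suc ?n * Y b else 0)" for b
  have Z: "Z \<in> carrier (FM (Suc ?n))" by (simp add: F.carrier_M Z_def)
  have "dF ?n Z c = Y c" for c
  proof (cases "c \<in> BF ?n")
    case False
    have "dF ?n Z c = 0" using rhom_closed[OF dF_hom Z] False unfolding F.carrier_M by blast
    moreover have "Y c = 0" using Y(1) False unfolding F.carrier_M by blast
    ultimately show ?thesis by simp
  next
    case c: True
    obtain i y where iy: "c = (i, y)" by (cases c)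
    show ?thesis
    proof (cases "c \<in> BF (Suc ?n)")
      case True
      have "Z b * odelta (pF b) c = 0" for b
      proof (cases "pF b = Some c \<and> b \<in> BF ?n")
        case b: True
        obtain j x where jx: "b = (j, x)" by (cases b)
        then obtain a where a: "x = a # y" "am a j = Some i" using b iy by (auto simp: pF_Some)
        have "(i, y) \<in> BF m" using b jx a BF_Cons[OF a(2), of y m] by simp
        thus ?thesis using BF_not_both[of c m] True iy by simp
      qed (auto simp: odelta_def Z_def)
      hence "(\<Sum>b\<in>BF (Suc ?n). Z b * odelta (pF b) c) = 0" by simp
      thus ?thesis using c True unfolding dF_apply by (simp add: Z_def flip: power_add mult.assoc)
    next
      case False
      hence cm: "c \<in> BF m" using BF_either[OF c] by blast
      have van: "Y b * odelta (pF b) c = 0" if b: "b \<in> BF ?n" "b \<notin> BF (Suc ?n)" for b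
      proof (cases "pF b = Some c")
        case True
        obtain j x where jx: "b = (j, x)" by (cases b)
        then obtain a where a: "x = a # y" "am a j = Some i" using True iy by (auto simp: pF_Some)
        have ne: "y ! 0 \<noteq> nx a" using b c iy jx a BF_Cons[OF a(2), of y ?n] by auto
        moreover have "m > 0 \<longrightarrow> y ! 0 = nx a" using b jx a BF_Cons[OF a(2), of y m] by simp
        ultimately have m: "m = 0" by blast
        have y: "y \<noteq> []" using BF_D(3)[of i y ?n] c iy by auto
        have "hd y = gl (nx a)"
          using path_step(3)[OF BF_D(2)[OF b(1)[unfolded jx a(1)]], of 0] y ne by (auto simp: hd_conv_nth)
        hence "b \<in> BF 0" using cm m iy jx a BF_D(1,2)[OF b(1)[unfolded jx]] by (simp add: BF_0 turning_Cons)
        hence "Y b = 0" using cycle_vanishes[of Y j x] Y b m jx a by simp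
        thus ?thesis by simp
      qed (simp add: odelta_def)
      have "(\<Sum>b\<in>BF (Suc ?n). Z b * odelta (pF b) c) = (\<Sum>b\<in>BF (Suc ?n) \<inter> BF ?n. (- 1) ^ Suc ?n * (Y b * odelta (pF b) c))"
        by (intro sum.mono_neutral_cong_right) (auto simp: finite_BF Z_def)
      also have "\<dots> = (\<Sum>b\<in>BF ?n. (- 1) ^ Suc ?n * (Y b * odelta (pF b) c))"
        using van by (intro sum.mono_neutral_left) (auto simp: finite_BF)
      also have "\<dots> = (- 1) ^ Suc ?n * (\<Sum>b\<in>BF ?n. Y b * odelta (pF b) c)"
        by (simp only: sum_distrib_left)
      also have "(\<Sum>b\<in>BF ?n. Y b * odelta (pF b) c) = - ((- 1) ^ ?n * Y c)"
        using fun_cong[OF Y(2), of c] c cm unfolding dF_apply by (simp add: eq_neg_iff_add_eq_0)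
      finally show ?thesis using False unfolding dF_apply by (simp flip: power_add mult.assoc)
    qed
  qed
  thus ?thesis using Z by blast
qed

lemma exact_0:
  assumes Y: "Y \<in> carrier (FM 0)" "eF Y = (\<lambda>c. 0)"
  shows "\<exists>Z\<in>carrier (FM (Suc 0)). dF 0 Z = Y"
proof -
  let ?s = "\<lambda>b. map_option (\<lambda>j. (j, [])) (moves am (snd b) (fst b))"
  have "\<exists>z\<in>carrier (FM (Suc 0)). dF 0 z = (\<lambda>c. delta b c - odelta (?s b) c)" if "b \<in> BF 0" for b
  proof -
    obtain i y where iy: "b = (i, y)" by (cases b)
    have "(i, y) \<in> BF 0 \<Longrightarrow> \<exists>z\<in>carrier (FM (Suc 0)). dF 0 z = (\<lambda>c. delta (i, y) c - odelta (?s (i, y)) c)"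
    proof (induction y arbitrary: i)
      case Nil
      show ?case by (intro bexI[of _ "\<lambda>c. 0"]) (simp_all add: dF_def F.carrier_M)
    next
      case (Cons a y)
      have b1: "(i, a # y) \<in> BF (Suc 0)" using Cons.prems unfolding BF_def by auto
      have d: "dF 0 (delta (i, a # y)) = (\<lambda>c. odelta (pF (i, a # y)) c - delta (i, a # y) c)"
        using Cons.prems by (simp add: dF_delta[OF b1] kF_def)
      show ?case
      proof (cases "am a i")
        case None
        have "dF 0 (\<lambda>c. 0 + - 1 * delta (i, a # y) c) = (\<lambda>c. delta (i, a # y) c)"
          unfolding dF_add d using None by (simp add: pF_def) (simp add: dF_def)
        thus ?thesis using None F.delta_closed[OF b1]
          by (intro bexI[of _ "\<lambda>c. 0 + - 1 * delta (i, a # y) c"]) (simp_all add: F.carrier_M)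
      next
        case (Some j)
        have "(j, y) \<in> BF 0" using b1 BF_Cons[OF Some, of y 0] by simp
        from Cons.IH[OF this] obtain z where z: "z \<in> carrier (FM (Suc 0))"
          "dF 0 z = (\<lambda>c. delta (j, y) c - odelta (?s (j, y)) c)" by blast
        have "dF 0 (\<lambda>c. z c + - 1 * delta (i, a # y) c) = (\<lambda>c. delta (i, a # y) c - odelta (?s (i, a # y)) c)"
          unfolding dF_add d z(2) using Some by (simp add: pF_def)
        thus ?thesis using z(1) F.delta_closed[OF b1]
          by (intro bexI[of _ "\<lambda>c. z c + - 1 * delta (i, a # y) c"]) (simp_all add: F.carrier_M)
      qed
    qed
    thus ?thesis using that iy by simp
  qed
  hence "\<forall>b\<in>BF 0. \<exists>z. z \<in> carrier (FM (Suc 0)) \<and> dF 0 z = (\<lambda>c. delta b c - odelta (?s b) c)"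
    unfolding Bex_def by (intro ballI)
  from bchoice[OF this] obtain z
    where z: "\<forall>b\<in>BF 0. z b \<in> carrier (FM (Suc 0)) \<and> dF 0 (z b) = (\<lambda>c. delta b c - odelta (?s b) c)" ..
  let ?Z = "lin (BF 0) z Y"
  have "?Z \<in> carrier (FM (Suc 0))" using z by (auto simp: F.carrier_M lin_def intro!: sum.neutral)
  moreover have "dF 0 ?Z = Y"
  proof
    fix c :: "nat \<times> 'd list"
    have "dF 0 ?Z = lin (BF 0) (\<lambda>b. dF 0 (z b)) Y" unfolding dF_def by (rule lin_lin)
    also have "\<dots> = lin (BF 0) (\<lambda>b c. delta b c - odelta (?s b) c) Y" using z by (intro lin_cong) blast
    finally have "dF 0 ?Z c = lin (BF 0) delta Y c - (\<Sum>b\<in>BF 0. Y b * odelta (?s b) c)"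
      by (simp add: lin_def right_diff_distrib sum_subtractf)
    also have "lin (BF 0) delta Y = Y" using Y(1) by (intro lin_self) (auto simp: finite_BF F.carrier_M)
    also have "(\<Sum>b\<in>BF 0. Y b * odelta (?s b) c) = (if snd c = [] then eF Y (fst c) else 0)"
      unfolding eF_def lin_def by (cases c) (auto simp: odelta_def intro!: sum.cong sum.neutral)
    finally show "dF 0 ?Z c = Y c" using Y(2) by simp
  qed
  ultimately show ?thesis by blast
qed

lemma eF_surj: "eF ` carrier (FM 0) = carrier S.M"
proof
  show "eF ` carrier (FM 0) \<subseteq> carrier S.M" using rhom_closed[OF eF_hom] by blast
  show "carrier S.M \<subseteq> eF ` carrier (FM 0)"
  proof
    fix m assume m: "m \<in> carrier S.M"
    let ?z = "\<lambda>i. delta (i, []) :: nat \<times> 'd list \<Rightarrow> 'k"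
    have i: "(i, []) \<in> BF 0" if "i \<le> len" for i using that vx_verts by (simp add: BF_0 paths_iff)
    have "lin {..len} ?z m \<in> carrier (FM 0)"
      using i by (auto simp: F.carrier_M lin_def delta_def intro!: sum.neutral)
    moreover have "eF (lin {..len} ?z m) = lin {..len} (\<lambda>i. eF (?z i)) m"
      unfolding eF_def by (rule lin_lin)
    moreover have "lin {..len} (\<lambda>i. eF (?z i)) m = lin {..len} delta m"
      using i by (intro lin_cong) (simp add: eF_delta)
    moreover have "lin {..len} delta m = m" using m by (intro lin_self) (auto simp: S.carrier_M)
    ultimately show "m \<in> eF ` carrier (FM 0)" by (metis image_eqI)
  qed
qed

lemma dF_image: "dF n ` carrier (FM (Suc n)) = cycles S.M FM dF eF n"
proof (cases n)
  case 0
  show ?thesis unfolding 0 cycles_def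
    using rhom_closed[OF dF_hom[of 0]] eF_dF exact_0 by (auto simp: S.zero_M image_iff) metis
next
  case (Suc m)
  show ?thesis unfolding Suc cycles_def
    using rhom_closed[OF dF_hom[of "Suc m"]] dF_dF[of m] exact_Suc[of _ m] by (auto simp: F.zero_M image_iff) metis
qed

end

lemma (in monomial) finsum_M:
  assumes "finite U" "\<And>j. j \<in> U \<Longrightarrow> f j \<in> carrier M"
  shows "(\<Oplus>\<^bsub>M\<^esub>j\<in>U. f j) = (\<lambda>c. \<Sum>j\<in>U. f j c)"
  using assms
proof (induction U)
  case empty
  show ?case by (simp add: zero_M)
next
  case (insert j U)
  have "(\<Oplus>\<^bsub>M\<^esub>j\<in>insert j U. f j) = f j \<oplus>\<^bsub>M\<^esub> (\<Oplus>\<^bsub>M\<^esub>j\<in>U. f j)"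
    using insert.hyps insert.prems by (intro M.M.finsum_insert) auto
  thus ?case using insert by (simp add: add_M)
qed

context string
begin

text \<open>
  Chains that are not continued by a path; every term is a direct sum of the projective modules that
  they generate.
\<close>

definition gens :: "nat \<Rightarrow> (nat \<times> 'd list) set" where
  "gens n = {b \<in> BF n. length (snd b) = n}"

text \<open>
  The coordinate functional belonging to the generator \<open>g\<close>: it reads off the
  coefficients of the paths that continue \<open>g\<close>.
\<close>

definition coordF :: "nat \<Rightarrow> nat \<times> 'd list \<Rightarrow> (nat \<times> 'd list \<Rightarrow> 'k) \<Rightarrow> ('d set, 'd) path \<Rightarrow> 'k" where
  "coordF n g Y = (\<lambda>(u, p). if u = vF g \<and> (fst g, snd g @ p) \<in> BF n then Y (fst g, snd g @ p) else 0)"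

lemma coordF_closed:
  assumes g: "g \<in> gens n" shows "coordF n g Y \<in> carrier A"
proof -
  have "{p. coordF n g Y p \<noteq> 0} \<subseteq> (\<lambda>b. (vF g, drop n (snd b))) ` BF n"
  proof
    fix x assume "x \<in> {p. coordF n g Y p \<noteq> 0}"
    moreover obtain u p where "x = (u, p)" by (cases x)
    ultimately show "x \<in> (\<lambda>b. (vF g, drop n (snd b))) ` BF n" using g
      by (intro image_eqI[of _ _ "(fst g, snd g @ p)"]) (auto simp: coordF_def gens_def split: if_splits)
  qed
  hence "finite {p. coordF n g Y p \<noteq> 0}" by (rule finite_subset) (simp add: finite_BF)
  moreover have "x \<in> paths Q" if "coordF n g Y x \<noteq> 0" for x
  proof -
    obtain u p where x: "x = (u, p)" by (cases x)
    hence "u = vF g" "(fst g, snd g @ p) \<in> BF n" using that by (auto simp: coordF_def split: if_splits)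
    thus ?thesis using BF_D(2)[of "fst g" "snd g @ p" n] x by (simp add: paths_append vF_def)
  qed
  ultimately show ?thesis by (simp add: carrier_A)
qed

lemma gens_extend:
  assumes g: "g \<in> gens n" and p: "(vF g, p) \<in> paths Q" "turning p"
  shows "(fst g, snd g @ p) \<in> BF n"
proof -
  obtain i y where iy: "g = (i, y)" by (cases g)
  have gB: "(i, y) \<in> BF n" "length y = n" using g iy by (auto simp: gens_def)
  have "(y @ p) ! Suc k = gl (nx ((y @ p) ! k))" if "n \<le> k" "Suc k < length (y @ p)" for k
    using that p(2) gB(2) unfolding turning_nth by (simp add: nth_append Suc_diff_le)
  moreover have "(y @ p) ! Suc k = nx ((y @ p) ! k)" if "Suc k < n" for k
    using that BF_D(4)[OF gB(1)] gB(2) by (simp add: nth_append)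
  ultimately show ?thesis
    using BF_D(1,2)[OF gB(1)] p(1) gB(2) by (auto simp: iy BF_def paths_append vF_def)
qed

lemma rep_F:
  assumes b: "b \<in> BF n" and c: "c \<in> BF n" and "x \<in> carrier A"
  shows "F.rep n x b c = (if \<exists>r. c = (fst b, snd b @ r) then x (vF b, drop (length (snd b)) (snd c)) else 0)"
proof -
  let ?R = "snd ` {p. x p \<noteq> 0}" and ?r = "drop (length (snd b)) (snd c)"
  have fin: "finite ?R" using assms(3) by (simp add: carrier_A)
  show ?thesis
  proof (cases "\<exists>r. c = (fst b, snd b @ r)")
    case True
    have eq: "moves (mF n) r b = Some c \<longleftrightarrow> r = ?r" for r using True c by (auto simp: moves_F[OF b])
    have "F.rep n x b c = (\<Sum>r\<in>?R. if r = ?r then x (vF b, ?r) else 0)"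
      unfolding F.rep_def eq by (intro sum.cong) auto
    also have "\<dots> = x (vF b, ?r)" using fin S.in_snd[of "vF b" ?r "{p. x p \<noteq> 0}"] by auto
    finally show ?thesis using True by simp
  next
    case False
    have "moves (mF n) r b \<noteq> Some c" for r using False by (auto simp: moves_F[OF b] split: if_splits)
    hence "F.rep n x b c = 0" by (simp add: F.rep_def)
    thus ?thesis using False by simp
  qed
qed

lemma coordF_act:
  assumes g: "g \<in> gens n" and x: "x \<in> carrier A" and Y: "Y \<in> carrier (FM n)"
  shows "cl (coordF n g (lin (BF n) (F.rep n x) Y)) = cl (coordF n g Y \<otimes>\<^bsub>A\<^esub> x)"
proof (rule cl_eqI)
  show "coordF n g (lin (BF n) (F.rep n x) Y) \<in> carrier A" "coordF n g Y \<otimes>\<^bsub>A\<^esub> x \<in> carrier A"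
    using coordF_closed[OF g] x by (auto intro: mult_closed_A)
  fix u p assume p: "(u, p) \<in> paths Q" "turning p"
  show "coordF n g (lin (BF n) (F.rep n x) Y) (u, p) = (coordF n g Y \<otimes>\<^bsub>A\<^esub> x) (u, p)"
  proof (cases "u = vF g")
    case False
    thus ?thesis by (simp add: coordF_def mult_A)
  next
    case u: True
    let ?c = "(fst g, snd g @ p)" and ?b = "\<lambda>l. (fst g, snd g @ take l p)"
    have c: "?c \<in> BF n" using gens_extend[OF g] p u by simp
    have ln: "length (snd g) = n" using g by (simp add: gens_def)
    have path: "(vF g, take l p) \<in> paths Q" "turning (take l p)" for l
      using p u paths_append[of "vF g" "take l p" "drop l p"] turning_append[of "take l p" "drop l p"] by auto
    have b: "?b l \<in> BF n" for l using gens_extend[OF g path] .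
    have inj: "inj_on ?b {..length p}" by (auto simp: inj_on_def dest!: arg_cong[of _ _ length])
    have van: "F.rep n x b ?c = 0" if bb: "b \<in> BF n" "b \<notin> ?b ` {..length p}" for b
    proof (rule ccontr)
      assume "F.rep n x b ?c \<noteq> 0"
      hence "\<exists>r. ?c = (fst b, snd b @ r)"
        unfolding rep_F[OF bb(1) c x] by argo
      then obtain r where r: "?c = (fst b, snd b @ r)" ..
      have nb: "n \<le> length (snd b)" using BF_D(3)[of "fst b" "snd b" n] bb(1) by simp
      have e: "snd g @ p = snd b @ r" using r by simp
      have "snd b = take (length (snd b)) (snd g @ p)" unfolding e by simp
      also have "\<dots> = snd g @ take (length (snd b) - n) p" using nb ln by simp
      finally have "b = ?b (length (snd b) - n)" using r by (intro prod_eqI) simp_all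
      moreover have "length (snd b) - n \<le> length p" using arg_cong[OF e, of length] ln by simp
      ultimately show False using bb(2) by blast
    qed
    have "coordF n g (lin (BF n) (F.rep n x) Y) (u, p) = (\<Sum>b\<in>BF n. Y b * F.rep n x b ?c)"
      using u c by (simp add: coordF_def lin_def)
    also have "\<dots> = (\<Sum>b\<in>?b ` {..length p}. Y b * F.rep n x b ?c)"
      using b van by (intro sum.mono_neutral_right) (auto simp: finite_BF)
    also have "\<dots> = (\<Sum>l\<le>length p. Y (?b l) * F.rep n x (?b l) ?c)"
      by (simp add: sum.reindex[OF inj])
    also have "\<dots> = (\<Sum>l\<le>length p. coordF n g Y (u, take l p) * x (pend u (take l p), drop l p))"
    proof (intro sum.cong refl)
      fix l assume l: "l \<in> {..length p}"
      have ex: "\<exists>r. ?c = (fst (?b l), snd (?b l) @ r)" by (intro exI[of _ "drop l p"]) simp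
      have "drop (length (snd (?b l))) (snd ?c) = drop l p" using l by simp
      hence "F.rep n x (?b l) ?c = x (vF (?b l), drop l p)"
        using trans[OF rep_F[OF b c x] if_P[OF ex]] by (simp only:)
      moreover have "vF (?b l) = pend u (take l p)" by (simp add: u vF_def pend_append)
      ultimately show "Y (?b l) * F.rep n x (?b l) ?c = coordF n g Y (u, take l p) * x (pend u (take l p), drop l p)"
        using b[of l] u by (simp add: coordF_def)
    qed
    also have "\<dots> = (coordF n g Y \<otimes>\<^bsub>A\<^esub> x) (u, p)" by (simp add: mult_A)
    finally show ?thesis .
  qed
qed

lemma coordF_delta:
  assumes g: "g \<in> gens n" and g': "g' \<in> gens n"
  shows "coordF n g (delta g') = (if g = g' then single (vF g, []) else (\<lambda>p. 0))"
proof
  fix x :: "('d set, 'd) path"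
  obtain u p where x: "x = (u, p)" by (cases x)
  have "(fst g, snd g @ p) = g' \<longleftrightarrow> g = g' \<and> p = []"
    using g g' by (cases g; cases g') (auto simp: gens_def)
  moreover have "(fst g, snd g) \<in> BF n" using g by (simp add: gens_def)
  ultimately show "coordF n g (delta g') x = (if g = g' then single (vF g, []) else (\<lambda>p. 0)) x"
    by (auto simp: coordF_def delta_def single_def x)
qed

lemma finite_gens: "finite (gens n)"
  by (rule finite_subset[OF _ finite_BF[of n]]) (auto simp: gens_def)

lemma dual_basis_F:
  "\<exists>N h. bij_betw h {..<N} (gens n) \<and>
     dual_basis \<Lambda> (FM n) N (\<lambda>j Y. cl (coordF n (h j) Y)) (\<lambda>j. delta (h j))"
proof -
  obtain h where "bij_betw h {0..<card (gens n)} (gens n)"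
    using ex_bij_betw_nat_finite[OF finite_gens] by blast
  hence h: "bij_betw h {..<card (gens n)} (gens n)" by (simp add: lessThan_atLeast0)
  let ?N = "card (gens n)"
  have hg: "h j \<in> gens n" if "j < ?N" for j using bij_betwE[OF h] that by blast
  have "dual_basis \<Lambda> (FM n) ?N (\<lambda>j Y. cl (coordF n (h j) Y)) (\<lambda>j. delta (h j))"
    unfolding dual_basis_def
  proof (intro conjI allI impI ballI)
    fix j assume j: "j < ?N"
    show "delta (h j) \<in> carrier (FM n)" using hg[OF j] by (intro F.delta_closed) (simp add: gens_def)
    fix Y assume Y: "Y \<in> carrier (FM n)"
    show "cl (coordF n (h j) Y) \<in> carrier \<Lambda>" using coordF_closed[OF hg[OF j]] by (rule cl_closed)
    show "cl (coordF n (h j) (Y \<oplus>\<^bsub>FM n\<^esub> Z)) = cl (coordF n (h j) Y) \<oplus>\<^bsub>\<Lambda>\<^esub> cl (coordF n (h j) Z)" for Z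
    proof -
      have "coordF n (h j) (Y \<oplus>\<^bsub>FM n\<^esub> Z) = (\<lambda>p. coordF n (h j) Y p + coordF n (h j) Z p)"
        by (auto simp: coordF_def F.add_M)
      thus ?thesis using cl_add coordF_closed[OF hg[OF j]] by simp
    qed
    fix r assume "r \<in> carrier \<Lambda>"
    then obtain x where "x \<in> carrier A" "r = cl x" by (auto simp: carrier_\<Lambda>)
    thus "cl (coordF n (h j) (r \<odot>\<^bsub>FM n\<^esub> Y)) = cl (coordF n (h j) Y) \<otimes>\<^bsub>\<Lambda>\<^esub> r"
      using coordF_act[OF hg[OF j] _ Y] coordF_closed[OF hg[OF j]] by (simp add: F.act_M cl_mult)
  next
    fix Y assume Y: "Y \<in> carrier (FM n)"
    have trm: "cl (coordF n g Y) \<odot>\<^bsub>FM n\<^esub> delta g = F.rep n (coordF n g Y) g" if g: "g \<in> gens n" for g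
      using coordF_closed[OF g] g by (simp add: F.act_M lin_delta finite_BF gens_def)
    have "(\<Oplus>\<^bsub>FM n\<^esub>j\<in>{..<?N}. cl (coordF n (h j) Y) \<odot>\<^bsub>FM n\<^esub> delta (h j)) =
        (\<lambda>c. \<Sum>j<?N. (cl (coordF n (h j) Y) \<odot>\<^bsub>FM n\<^esub> delta (h j)) c)"
    proof (rule F.finsum_M)
      fix j assume "j \<in> {..<?N}"
      hence "h j \<in> gens n" using hg by simp
      thus "cl (coordF n (h j) Y) \<odot>\<^bsub>FM n\<^esub> delta (h j) \<in> carrier (FM n)"
        using coordF_closed by (simp add: F.act_M F.lin_rep_closed)
    qed simp
    also have "\<dots> = (\<lambda>c. \<Sum>j<?N. F.rep n (coordF n (h j) Y) (h j) c)"
      using trm hg by (intro ext sum.cong) auto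
    also have "\<dots> = Y"
    proof
      fix c :: "nat \<times> 'd list"
      have "(\<Sum>j<?N. F.rep n (coordF n (h j) Y) (h j) c) = (\<Sum>g\<in>gens n. F.rep n (coordF n g Y) g c)"
        by (rule sum.reindex_bij_betw[OF h])
      also have "\<dots> = Y c"
      proof (cases "c \<in> BF n")
        case False
        hence "F.rep n (coordF n g Y) g c = 0" if "g \<in> gens n" for g
          using that by (intro F.rep_closed) (auto simp: gens_def)
        moreover have "Y c = 0" using Y False unfolding F.carrier_M by blast
        ultimately show ?thesis by simp
      next
        case c: True
        obtain i y where iy: "c = (i, y)" by (cases c)
        let ?g = "(i, take n y)"
        note d = BF_D[OF c[unfolded iy]]
        have "(i, take n y) \<in> BF n"
          using d paths_append[of "vx i" "take n y" "drop n y"] by (auto simp: BF_def)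
        hence g0: "?g \<in> gens n" using d(3) by (simp add: gens_def)
        have "F.rep n (coordF n g Y) g c = (if g = ?g then Y c else 0)" if g: "g \<in> gens n" for g
        proof -
          have gB: "g \<in> BF n" "length (snd g) = n" using g by (auto simp: gens_def)
          have "(\<exists>r. c = (fst g, snd g @ r)) \<longleftrightarrow> g = ?g"
          proof
            assume "\<exists>r. c = (fst g, snd g @ r)"
            thus "g = ?g" using gB iy by (cases g) auto
          next
            assume "g = ?g"
            thus "\<exists>r. c = (fst g, snd g @ r)" using iy by (intro exI[of _ "drop n y"]) simp
          qed
          moreover have "coordF n ?g Y (vF ?g, drop n y) = Y c" using c iy by (simp add: coordF_def)
          ultimately show ?thesis using rep_F[OF gB(1) c coordF_closed[OF g]] gB(2) iy by auto
        qed
        hence "(\<Sum>g\<in>gens n. F.rep n (coordF n g Y) g c) = (\<Sum>g\<in>gens n. if g = ?g then Y c else 0)"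
          by (intro sum.cong) auto
        thus ?thesis using g0 finite_gens by simp
      qed
      finally show "(\<Sum>j<?N. F.rep n (coordF n (h j) Y) (h j) c) = Y c" .
    qed
    finally show "(\<Oplus>\<^bsub>FM n\<^esub>j\<in>{..<?N}. cl (coordF n (h j) Y) \<odot>\<^bsub>FM n\<^esub> delta (h j)) = Y" .
  qed
  thus ?thesis using h by blast
qed

lemma resolves_F: "resolves \<Lambda> S.M FM dF eF"
  unfolding resolves_def
proof (intro conjI allI)
  show "\<exists>m \<iota> g. dual_basis \<Lambda> (FM n) m \<iota> g" for n using dual_basis_F[of n] by blast
qed (simp_all add: S.right_module_M F.right_module_M eF_hom eF_surj dF_hom dF_image)

lemma free_hom:
  assumes N: "right_module \<Lambda> N"
    and a: "\<And>g. g \<in> gens n \<Longrightarrow> a g \<in> carrier N" "\<And>g. g \<in> gens n \<Longrightarrow> cl (single (vF g, [])) \<odot>\<^bsub>N\<^esub> a g = a g"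
  shows "\<exists>f\<in>rhom \<Lambda> (FM n) N. \<forall>g\<in>gens n. f (delta g) = a g"
proof -
  interpret N: right_module \<Lambda> N by fact
  obtain K h where h: "bij_betw h {..<K} (gens n)"
    and db: "dual_basis \<Lambda> (FM n) K (\<lambda>j Y. cl (coordF n (h j) Y)) (\<lambda>j. delta (h j))"
    using dual_basis_F[of n] by blast
  have hg: "h j \<in> gens n" if "j < K" for j using bij_betwE[OF h] that by blast
  let ?f = "\<lambda>Y. \<Oplus>\<^bsub>N\<^esub>j\<in>{..<K}. cl (coordF n (h j) Y) \<odot>\<^bsub>N\<^esub> a (h j)"
  have f: "?f \<in> rhom \<Lambda> (FM n) N" using a(1) hg by (intro dual_basis_hom[OF db N]) blast
  have "?f (delta g) = a g" if g: "g \<in> gens n" for g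
  proof -
    have "g \<in> h ` {..<K}" using bij_betw_imp_surj_on[OF h] g by simp
    then obtain l where l: "l < K" "h l = g" by auto
    have z: "cl (\<lambda>p. 0) = \<zero>\<^bsub>\<Lambda>\<^esub>"
    proof -
      have "cl (\<lambda>p. 0) = I" by (rule Set.set_eqI) (simp add: mem_cl[OF zero_closed_A] mem_I)
      thus ?thesis by (simp add: FactRing_def)
    qed
    have "cl (coordF n (h j) (delta g)) \<odot>\<^bsub>N\<^esub> a (h j) = (if l = j then a g else \<zero>\<^bsub>N\<^esub>)" if j: "j < K" for j
    proof -
      have "h j = g \<longleftrightarrow> l = j" using h l j by (auto simp: bij_betw_def inj_on_def)
      thus ?thesis
        using coordF_delta[OF hg[OF j] g] a hg[OF j] l N.zero_act[OF a(1)[OF hg[OF j]]] by (auto simp: z)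
    qed
    hence "?f (delta g) = (\<Oplus>\<^bsub>N\<^esub>j\<in>{..<K}. if l = j then a g else \<zero>\<^bsub>N\<^esub>)"
      using a(1)[OF g] by (intro N.M.finsum_cong') auto
    also have "\<dots> = a g" using N.M.finsum_singleton[of l "{..<K}" "\<lambda>_. a g"] l a(1)[OF g] by simp
    finally show ?thesis .
  qed
  thus ?thesis using f by (intro bexI[of _ ?f]) auto
qed

end

section \<open>Ends of arcs and cocycles\<close>

lemma (in monomial) unit_act:
  assumes m: "m \<in> carrier M" "\<And>b. m b \<noteq> 0 \<Longrightarrow> vt b = u" and u: "u \<in> verts Q"
  shows "cl (single (u, [])) \<odot>\<^bsub>M\<^esub> m = m"
proof -
  have e: "single (u, []) \<in> carrier A" using u by (intro single_closed) (simp add: paths_iff)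
  have "lin B (rep (single (u, []))) m = lin B delta m"
    unfolding lin_def
  proof (intro ext sum.cong refl)
    fix b c assume b: "b \<in> B"
    show "m b * rep (single (u, [])) b c = m b * delta b c"
      using m(2)[of b] by (cases "m b = 0") (auto simp: rep_single[OF b] delta_def)
  qed
  also have "\<dots> = m" using m(1) by (intro lin_self finite_B) (auto simp: carrier_M)
  finally show ?thesis by (simp add: act_M[OF e])
qed

context string
begin

lemma hom_eq_gens:
  assumes N: "two_monomial T I (BF n) vF (mF n) C wt nv"
    and f: "f \<in> rhom \<Lambda> (FM n) (monomial.M C wt nv)" and g: "g \<in> rhom \<Lambda> (FM n) (monomial.M C wt nv)"
    and eq: "\<And>b. b \<in> gens n \<Longrightarrow> f (delta b) = g (delta b)" and m: "m \<in> carrier (FM n)"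
  shows "f m = g m"
proof -
  interpret X: two_monomial T I "BF n" vF "mF n" C wt nv by (rule N)
  have "(i, y) \<in> BF n \<Longrightarrow> f (delta (i, y)) = g (delta (i, y))" for i y
  proof (induction y rule: rev_induct)
    case Nil
    thus ?case using eq[of "(i, [])"] BF_D(3)[of i "[]" n] by (simp add: gens_def)
  next
    case (snoc a y)
    show ?case
    proof (cases "n \<le> length y")
      case True
      have b: "(i, y) \<in> BF n" by (rule BF_butlast[OF snoc.prems True])
      have a: "a \<in> arcs Q" using BF_D(2)[OF snoc.prems] by (simp add: paths_iff)
      have "delta (i, y @ [a]) = F.aact n a (delta (i, y))"
        using snoc.prems by (simp add: F.aact_delta[OF b] mF_def)
      thus ?thesis using X.hom_aact[OF f a F.delta_closed[OF b]] X.hom_aact[OF g a F.delta_closed[OF b]] snoc.IH[OF b]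
        by simp
    next
      case False
      hence "length (y @ [a]) = n" using BF_D(3)[OF snoc.prems] by simp
      thus ?thesis using snoc.prems by (intro eq) (simp add: gens_def)
    qed
  qed
  thus ?thesis by (intro X.hom_eqI[OF f g _ m]) auto
qed

lemma am_Arr: "i < len \<Longrightarrow> letters ! i = Arr a \<Longrightarrow> am a i = Some (Suc i)"
  by (simp add: arrow_move_def)

lemma am_Inv: "i < len \<Longrightarrow> letters ! i = Inv a \<Longrightarrow> am a (Suc i) = Some i"
  using compatible[of i] by (auto simp: arrow_move_def)

lemma aact_hit: "am a j = Some c \<Longrightarrow> S.aact a m c = m j"
proof -
  assume j: "am a j = Some c"
  have "S.aact a m c = (\<Sum>i\<le>len. if i = j then m j else 0)"
    unfolding S.aact_def lin_def
  proof (intro sum.cong refl)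
    fix i
    have "am a i = Some c \<longleftrightarrow> i = j" using am_inj[OF _ j] j by blast
    thus "m i * odelta (am a i) c = (if i = j then m j else 0)" by (simp add: odelta_def)
  qed
  thus ?thesis using am_props[OF j] by simp
qed

lemma aact_miss: "(\<And>j. am a j = Some c \<Longrightarrow> m j = 0) \<Longrightarrow> S.aact a m c = 0"
  unfolding S.aact_def lin_def by (intro sum.neutral) (auto simp: odelta_def)

end

context surface
begin

abbreviation nxn :: "nat \<Rightarrow> 'd \<Rightarrow> 'd" where "nxn n s \<equiv> (nx ^^ n) s"

lemma nxn_internal: "internal T s \<Longrightarrow> internal T (nxn n s)"
  by (induction n) (simp_all add: internal_nx)

lemma nxn_Suc: "nxn (Suc n) s = nxn n (nx s)"
  by (simp only: funpow_Suc_right comp_def)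

lemma internal_nx3: "internal T s \<Longrightarrow> nx (nx (nx s)) = s"
  by (simp add: nx3 internal_side)

lemma nxn_3: "internal T s \<Longrightarrow> nxn (3 + n) s = nxn n s"
  using internal_nx3[of s] by (simp add: numeral_3_eq_3 del: funpow.simps add: funpow_Suc_right)

lemma nxn_3k: "internal T s \<Longrightarrow> nxn (n + 3 * k) s = nxn n s"
proof (induction k)
  case (Suc k)
  thus ?case using nxn_3[of s "n + 3 * k"] by (simp add: algebra_simps)
qed simp

text \<open>
  The arrows met when running through \<open>n\<close> consecutive sides of a triangle, starting at
  \<open>s\<close>.
\<close>

definition kap :: "nat \<Rightarrow> 'd \<Rightarrow> 'd list" where
  "kap n s = map (\<lambda>k. nxn k s) [0..<n]"

lemma length_kap [simp]: "length (kap n s) = n"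
  and nth_kap: "k < n \<Longrightarrow> kap n s ! k = nxn k s"
  and kap_snoc: "kap (Suc n) s = kap n s @ [nxn n s]"
  by (simp_all add: kap_def)

lemma kap_Cons: "kap (Suc n) s = s # kap n (nx s)"
proof (induction n)
  case (Suc n)
  show ?case using Suc by (simp only: kap_snoc[of "Suc n"] kap_snoc[of n "nx s"] nxn_Suc append_Cons)
qed (simp add: kap_def)

end

locale arc_string = string T I v for T :: "'d triangulation" and I :: "(('d set, 'd) path \<Rightarrow> 'k::field) set"
    and v :: "('d set, 'd) word" +
  fixes \<gamma> :: "'d list"
  assumes arc: "arc_of_string T v \<gamma>"
begin

abbreviation epos :: "bool \<Rightarrow> nat" where "epos t \<equiv> (if t then len else 0)"
abbreviation eside :: "bool \<Rightarrow> 'd" where "eside \<equiv> arc_end T \<gamma>"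

lemma length_arc: "length \<gamma> = Suc len"
  using arc by (simp add: arc_of_string_def)

lemma arc_sides: "i \<le> len \<Longrightarrow> \<gamma> ! i \<in> arc_sides T"
proof -
  assume "i \<le> len"
  hence "\<gamma> ! i \<in> set \<gamma>" using length_arc by (intro nth_mem) simp
  thus ?thesis using arc by (auto simp: arc_of_string_def is_arc_def)
qed

lemma letter_Arr: "i < len \<Longrightarrow> letters ! i = Arr s \<Longrightarrow> gl (\<gamma> ! i) = s \<and> \<gamma> ! Suc i = nx s"
  and letter_Inv: "i < len \<Longrightarrow> letters ! i = Inv s \<Longrightarrow> gl (\<gamma> ! i) = nx s \<and> \<gamma> ! Suc i = s"
  using arc by (auto simp: arc_of_string_def split: letter.splits)

lemma arc_vx: "i \<le> len \<Longrightarrow> arc_of_side T (\<gamma> ! i) = vx i"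
proof (cases i)
  case 0
  have "hd \<gamma> = \<gamma> ! 0" using length_arc by (intro hd_conv_nth) auto
  thus ?thesis using arc 0 by (cases v) (simp add: arc_of_string_def)
next
  case (Suc k)
  assume i: "i \<le> len"
  show ?thesis
  proof (cases "letters ! k")
    case (Arr s)
    thus ?thesis using letter_Arr[of k s] i Suc letter_end_vx[of k] by (simp add: head_Q)
  next
    case (Inv s)
    thus ?thesis using letter_Inv[of k s] i Suc letter_end_vx[of k] by (simp add: tail_Q)
  qed
qed

lemma eside_False: "eside False = \<gamma> ! 0" and eside_True: "eside True = gl (\<gamma> ! len)"
proof -
  have "\<gamma> \<noteq> []" using length_arc by auto
  thus "eside False = \<gamma> ! 0" "eside True = gl (\<gamma> ! len)"
    using length_arc by (simp_all add: arc_end_def hd_conv_nth last_conv_nth)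
qed

lemma arc_gl: "s \<in> sides T \<Longrightarrow> arc_of_side T (gl s) = arc_of_side T s"
  by (auto simp: arc_of_side_def gl_gl)

lemma eside_arc: "eside t \<in> arc_sides T" and arc_eside: "arc_of_side T (eside t) = vx (epos t)"
  using arc_sides[of 0] arc_sides[of len] arc_vx[of 0] arc_vx[of len] arc_sides_side
  by (cases t; simp add: eside_False eside_True gl_arc arc_gl)+

lemma no_self_glue: "i \<le> len \<Longrightarrow> gl (\<gamma> ! i) \<noteq> \<gamma> ! i"
  by (rule gl_neq[OF arc_sides])

lemma end_unique: "epos t = epos t' \<Longrightarrow> eside t = eside t' \<Longrightarrow> t = t'"
proof (rule ccontr)
  assume "epos t = epos t'" "eside t = eside t'" "t \<noteq> t'"
  hence "len = 0 \<and> eside False = eside True" by (cases t; cases t') simp_all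
  thus False using no_self_glue[of 0] eside_False eside_True by (metis le0)
qed

lemma end_not_D: "am (eside t) (epos t) = None"
proof (rule ccontr)
  assume "am (eside t) (epos t) \<noteq> None"
  then obtain j where j: "am (eside t) (epos t) = Some j" by blast
  show False
  proof (cases t)
    case True
    have "am (eside True) len = Some j" using j True by simp
    thus False
    proof (cases rule: am_cases)
      case 2
      have "\<gamma> ! len = eside True" using conjunct2[OF letter_Inv[OF 2(2,3)]] 2(1) by (simp only:)
      thus False using no_self_glue[of len] unfolding eside_True by (metis order_refl)
    qed simp
  next
    case False
    have "am (eside False) 0 = Some j" using j False by simp
    thus False
    proof (cases rule: am_cases)
      case 1
      have "gl (\<gamma> ! 0) = eside False" using conjunct1[OF letter_Arr[OF 1(1,2)]] by (simp only:)
      thus False using no_self_glue[of 0] unfolding eside_False by (metis le0)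
    qed simp
  qed
qed

lemma D_not_end: "am s i = Some j \<Longrightarrow> \<not> (\<exists>t. i = epos t \<and> s = eside t)"
proof
  assume j: "am s i = Some j" and "\<exists>t. i = epos t \<and> s = eside t"
  then obtain t where "i = epos t" "s = eside t" by (elim exE conjE)
  hence "am s i = None" using end_not_D[of t] by (simp only:)
  thus False using j by simp
qed

lemma D_not_I:
  assumes "am s i = Some j" "internal T s" shows "\<not> (\<exists>k. am (nx (nx s)) k = Some i)"
proof
  assume "\<exists>k. am (nx (nx s)) k = Some i"
  then obtain k where "am (nx (nx s)) k = Some i" ..
  from am_rel[OF this internal_nx[OF internal_nx[OF assms(2)]]] show False
    using assms(1) internal_nx3[OF assms(2)] by simp
qed

lemma end_not_I: "nx a = eside t \<Longrightarrow> am a j \<noteq> Some (epos t)"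
proof
  assume a: "nx a = eside t" and j: "am a j = Some (epos t)"
  show False
  proof (cases t)
    case True
    have "am a j = Some len" using j True by simp
    thus False
    proof (cases rule: am_cases)
      case 1
      have "\<gamma> ! len = eside True" using conjunct2[OF letter_Arr[OF 1(1,2)]] 1(3) a True by (simp only:)
      thus False using no_self_glue[of len] unfolding eside_True by (metis order_refl)
    qed simp
  next
    case False
    have "am a j = Some 0" using j False by simp
    thus False
    proof (cases rule: am_cases)
      case 2
      have "gl (\<gamma> ! 0) = eside False" using conjunct1[OF letter_Inv[OF 2(2,3)]] 2(1) a False by (simp only:)
      thus False using no_self_glue[of 0] unfolding eside_False by (metis le0)
    qed simp
  qed
qed

text \<open>
  The arc crosses \<open>s\<close> and so enters or leaves the triangle of \<open>s\<close> there.
  In this triangle it cuts off one of the two corners adjacent to \<open>s\<close>, and then the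
  string contains the corresponding arrow, or it ends in the corner opposite to \<open>s\<close>.
\<close>

lemma trichotomy:
  assumes s: "internal T s" and i: "i \<le> len" "arc_of_side T s = vx i"
  obtains (D) j where "am s i = Some j" | (I) j where "am (nx (nx s)) j = Some i" | (E) t where "i = epos t" "s = eside t"
proof -
  have "s = \<gamma> ! i \<or> s = gl (\<gamma> ! i)"
    using arc_eq_iff[of s "\<gamma> ! i"] internal_side[OF s] arc_sides_side[OF arc_sides[OF i(1)]] arc_vx[OF i(1)] i(2)
    by simp
  thus thesis
  proof
    assume si: "s = \<gamma> ! i"
    show thesis
    proof (cases i)
      case 0
      thus thesis using E[of False] si eside_False by simp
    next
      case (Suc k)
      hence k: "k < len" using i by simp
      show thesis
      proof (cases "letters ! k")
        case (Arr a)
        hence "s = nx a" using letter_Arr[OF k] si Suc by simp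
        moreover have "a \<in> arcs Q" using letter_arcs[OF k] Arr by simp
        ultimately have "nx (nx s) = a" using nx3 arrow_side by simp
        thus thesis using I[of k] am_Arr[OF k Arr] Suc by simp
      next
        case (Inv a)
        thus thesis using D[of k] am_Inv[OF k Inv] letter_Inv[OF k Inv] si Suc by simp
      qed
    qed
  next
    assume si: "s = gl (\<gamma> ! i)"
    show thesis
    proof (cases "i = len")
      case True
      thus thesis using E[of True] si eside_True by simp
    next
      case False
      hence k: "i < len" using i by simp
      show thesis
      proof (cases "letters ! i")
        case (Arr a)
        thus thesis using D[of "Suc i"] am_Arr[OF k Arr] letter_Arr[OF k Arr] si by simp
      next
        case (Inv a)
        hence "s = nx a" using letter_Inv[OF k] si by simp
        moreover have "a \<in> arcs Q" using letter_arcs[OF k] Inv by simp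
        ultimately have "nx (nx s) = a" using nx3 arrow_side by simp
        thus thesis using I[of "Suc i"] am_Inv[OF k Inv] by simp
      qed
    qed
  qed
qed

end

context string
begin

lemma kap_gens:
  assumes "internal T s" "i \<le> len" "arc_of_side T s = vx i"
  shows "(i, kap n s) \<in> gens n" "vF (i, kap n s) = arc_of_side T (nxn n s)"
proof -
  have int: "internal T (nxn k s)" for k by (rule nxn_internal[OF assms(1)])
  have path: "(vx i, kap n s) \<in> paths Q \<and> pend (vx i) (kap n s) = arc_of_side T (nxn n s)"
  proof (induction n)
    case 0
    thus ?case using assms vx_verts[OF assms(2)] by (simp add: kap_def paths_iff)
  next
    case (Suc n)
    have "nxn n s \<in> arcs Q" using int[of n] by (simp add: internal_iff)
    hence "(arc_of_side T (nxn n s), [nxn n s]) \<in> paths Q"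
      using tail_verts[of "nxn n s"] by (simp add: paths_iff tail_Q)
    thus ?case using Suc unfolding kap_snoc paths_append by (simp add: head_Q)
  qed
  show "vF (i, kap n s) = arc_of_side T (nxn n s)" using path by (simp add: vF_def)
  show "(i, kap n s) \<in> gens n" using path assms(2) by (simp add: gens_def BF_def nth_kap)
qed

text \<open>
  Two consecutive arrows with a relation lie in an internal triangle and determine it.
\<close>

lemma gens_kap:
  assumes g: "g \<in> gens n" and n: "n \<ge> 2"
  obtains i s where "g = (i, kap n s)" "internal T s" "i \<le> len" "arc_of_side T s = vx i"
proof -
  obtain i y where iy: "g = (i, y)" by (cases g)
  have y: "(i, y) \<in> BF n" "length y = n" using g iy by (auto simp: gens_def)
  note d = BF_D[OF y(1)]
  have yk: "k < n \<Longrightarrow> y ! k = nxn k (y ! 0)" for k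
  proof (induction k)
    case (Suc k)
    thus ?case using d(4)[of k] by simp
  qed simp
  have "y = kap n (y ! 0)"
  proof (rule nth_equalityI)
    fix k assume "k < length y"
    hence "k < n" using y(2) by simp
    thus "y ! k = kap n (y ! 0) ! k" using yk[of k] nth_kap[of k n "y ! 0"] by metis
  qed (simp add: y(2))
  moreover have "internal T (y ! 0)"
  proof -
    have l: "Suc 0 < length y" using y(2) n by simp
    have "y ! Suc 0 = nx (y ! 0)" using n by (intro d(4)) simp
    thus ?thesis using path_step(1,2)[OF d(2) l] by (simp only: internal_iff)
  qed
  moreover have "arc_of_side T (y ! 0) = vx i"
  proof -
    have "y \<noteq> []" using y(2) n by auto
    thus ?thesis using d(2) by (simp add: paths_iff tail_Q hd_conv_nth)
  qed
  ultimately show thesis using that[of i "y ! 0"] iy d(1) by simp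
qed

lemma dF_kap:
  assumes s: "internal T s" "i \<le> len" "arc_of_side T s = vx i"
  shows "dF n (delta (i, kap (Suc n) s)) = (\<lambda>c. odelta (map_option (\<lambda>j. (j, kap n (nx s))) (am s i)) c +
      (- 1) ^ Suc n * F.aact n (nxn n s) (delta (i, kap n s)) c)"
proof -
  have g: "(i, kap (Suc n) s) \<in> BF (Suc n)" "(i, kap n s) \<in> BF n" using kap_gens[OF s] by (auto simp: gens_def)
  have "nxn n s \<in> arcs Q" using nxn_internal[OF s(1)] by (simp add: internal_iff)
  hence "(vF (i, kap n s), [nxn n s]) \<in> paths Q"
    unfolding kap_gens(2)[OF s] using tail_verts[of "nxn n s"] by (simp add: paths_iff tail_Q)
  from gens_extend[OF kap_gens(1)[OF s] this] have x: "(i, kap n s @ [nxn n s]) \<in> BF n" by simp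
  hence a: "F.aact n (nxn n s) (delta (i, kap n s)) = delta (i, kap (Suc n) s)"
    by (simp add: F.aact_delta[OF g(2)] mF_def kap_snoc)
  have "(i, kap (Suc n) s) \<in> BF n" using x by (simp add: kap_snoc)
  moreover have p: "pF (i, kap (Suc n) s) = map_option (\<lambda>j. (j, kap n (nx s))) (am s i)"
    by (simp add: pF_def kap_Cons)
  ultimately show ?thesis unfolding dF_delta[OF g(1)] kF_def a p by (simp only: if_True)
qed

lemma hom_dF_kap:
  assumes N: "two_monomial T I (BF n) vF (mF n) C wt nv"
    and h: "h \<in> rhom \<Lambda> (FM n) (monomial.M C wt nv)" and s: "internal T s" "i \<le> len" "arc_of_side T s = vx i"
  shows "h (dF n (delta (i, kap (Suc n) s))) j =
     (case am s i of None \<Rightarrow> 0 | Some i' \<Rightarrow> h (delta (i', kap n (nx s))) j) +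
     (- 1) ^ Suc n * monomial.aact C nv (nxn n s) (h (delta (i, kap n s))) j"
proof -
  interpret X: two_monomial T I "BF n" vF "mF n" C wt nv by (rule N)
  let ?z = "(- 1) ^ Suc n :: 'k" and ?a = "nxn n s"
  have a: "?a \<in> arcs Q" using nxn_internal[OF s(1)] by (simp add: internal_iff)
  have g: "delta (i, kap n s) \<in> carrier (FM n)"
    using kap_gens(1)[OF s] by (intro F.delta_closed) (simp add: gens_def)
  have ga: "F.aact n ?a (delta (i, kap n s)) \<in> carrier (FM n)"
    unfolding F.aact_eq_act[OF a] using a g
    by (intro F.M.act_closed cl_closed single_closed) (simp_all add: paths_iff tail_verts)
  have o: "odelta (map_option (\<lambda>j. (j, kap n (nx s))) (am s i)) \<in> carrier (FM n)"
  proof (cases "am s i")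
    case (Some i')
    hence "(i', kap n (nx s)) \<in> gens n"
      using am_props[OF Some] by (intro kap_gens internal_nx s) (simp_all add: head_Q)
    thus ?thesis using Some by (auto simp: gens_def intro!: F.delta_closed)
  qed (simp add: F.carrier_M)
  have zga: "(\<lambda>c. ?z * F.aact n ?a (delta (i, kap n s)) c) \<in> carrier (FM n)"
    using ga unfolding F.carrier_M by simp
  have "h (dF n (delta (i, kap (Suc n) s))) =
     (\<lambda>j. h (odelta (map_option (\<lambda>j. (j, kap n (nx s))) (am s i))) j +
       ?z * h (F.aact n ?a (delta (i, kap n s))) j)"
    by (simp only: dF_kap[OF s] X.hom_add[OF h o zga] X.hom_scale[OF h ga])
  moreover have "h (F.aact n ?a (delta (i, kap n s))) = monomial.aact C nv ?a (h (delta (i, kap n s)))"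
    by (rule X.hom_aact[OF h a g])
  ultimately show ?thesis using X.hom_zero[OF h] by (simp split: option.splits)
qed

end

locale pair = V: arc_string T I v \<gamma>v + W: arc_string T I w \<gamma>w
  for T :: "'d triangulation" and I :: "(('d set, 'd) path \<Rightarrow> 'k::field) set" and v w \<gamma>v \<gamma>w
begin

abbreviation "\<Lambda> \<equiv> V.\<Lambda>"
abbreviation "N \<equiv> W.S.M"

lemma FN: "two_monomial T I (V.BF n) V.vF (V.mF n) {..W.len} W.vx W.am"
  by (intro two_monomial.intro V.monomial_F W.S.monomial_axioms)

lemma coef_dF:
  assumes "h \<in> rhom \<Lambda> (V.FM n) N" "internal T s" "i \<le> V.len" "arc_of_side T s = V.vx i"
  shows "h (V.dF n (delta (i, V.kap (Suc n) s))) j =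
     (case V.am s i of None \<Rightarrow> 0 | Some i' \<Rightarrow> h (delta (i', V.kap n (V.nx s))) j) +
     (- 1) ^ Suc n * W.S.aact (V.nxn n s) (h (delta (i, V.kap n s))) j"
  by (rule V.hom_dF_kap[OF FN assms])

text \<open>
  At an end of \<open>v\<close> the first summand of the differential is absent, and at the matching
  end of \<open>w\<close> no basis element is moved to that position by the arrow in the second
  summand.
\<close>

lemma coboundary_vanishes:
  assumes h: "h \<in> rhom \<Lambda> (V.FM n) N" and t: "internal T (V.eside t)" and t': "W.eside t' = V.nxn (Suc n) (V.eside t)"
  shows "h (V.dF n (delta (V.epos t, V.kap (Suc n) (V.eside t)))) (W.epos t') = 0"
proof -
  have "W.S.aact (V.nxn n (V.eside t)) m (W.epos t') = 0" for m
    using W.end_not_I[of "V.nxn n (V.eside t)" t'] t' by (intro W.aact_miss) simp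
  thus ?thesis
    using coef_dF[OF h t _ V.arc_eside, of "W.epos t'"] V.end_not_D[of t] by simp
qed

text \<open>
  The coefficients of a cocycle are indexed by a position of \<open>v\<close> at a side
  \<open>s\<close> and a position of \<open>w\<close> at the side reached from \<open>s\<close>.
  According to the trichotomy at both positions, a coefficient is forced to vanish or to match
  another one by the cocycle condition, is removed by a coboundary, or belongs to a pair of ends.
\<close>

lemma cocycle_is_coboundary:
  assumes n: "n \<ge> 2" and f: "f \<in> rhom \<Lambda> (V.FM (Suc n)) N"
    and cocycle: "\<And>m. m \<in> carrier (V.FM (Suc (Suc n))) \<Longrightarrow> f (V.dF (Suc n) m) = (\<lambda>j. 0)"
    and ends: "\<And>t t'. internal T (V.eside t) \<Longrightarrow> W.eside t' = V.nxn (Suc n) (V.eside t) \<Longrightarrow>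
      f (delta (V.epos t, V.kap (Suc n) (V.eside t))) (W.epos t') = 0"
  shows "\<exists>h\<in>rhom \<Lambda> (V.FM n) N. \<forall>m\<in>carrier (V.FM (Suc n)). f m = h (V.dF n m)"
proof -
  interpret X: two_monomial T I "V.BF n" V.vF "V.mF n" "{..W.len}" W.vx W.am by (rule FN)
  interpret Y: two_monomial T I "V.BF (Suc n)" V.vF "V.mF (Suc n)" "{..W.len}" W.vx W.am by (rule FN)
  define C where "C s i = f (delta (i, V.kap (Suc n) s))" for s i
  have inB: "(i, V.kap m s) \<in> V.BF m" if "internal T s" "i \<le> V.len" "arc_of_side T s = V.vx i" for m s i
    using V.kap_gens(1)[OF that, of m] by (simp add: V.gens_def)
  have C_vertex: "j \<le> W.len \<and> W.vx j = arc_of_side T (V.nxn (Suc n) s)"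
    if "internal T s" "i \<le> V.len" "arc_of_side T s = V.vx i" "C s i j \<noteq> 0" for s i j
    using Y.hom_vertex[OF f inB[OF that(1-3)], of j] that(4) V.kap_gens(2)[OF that(1-3), of "Suc n"]
      rhom_closed[OF f V.F.delta_closed[OF inB[OF that(1-3)]]]
    unfolding W.S.carrier_M C_def by auto
  have Z: "(case V.am s i of None \<Rightarrow> 0 | Some i' \<Rightarrow> C (V.nx s) i' j) +
     (- 1) ^ Suc (Suc n) * W.S.aact (V.nxn (Suc n) s) (C s i) j = 0"
    if "internal T s" "i \<le> V.len" "arc_of_side T s = V.vx i" for s i j
    using coef_dF[OF f that, of j] cocycle[OF V.F.delta_closed[OF inB[OF that]]] unfolding C_def by simp
  define H where "H i s = (\<lambda>j. if \<exists>i'. V.am (V.nx (V.nx s)) i' = Some i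
      then C (V.nx (V.nx s)) (THE i'. V.am (V.nx (V.nx s)) i' = Some i) j
      else if \<exists>t. i = V.epos t \<and> s = V.eside t
      then (- 1) ^ Suc n * (case W.am (V.nxn n s) j of None \<Rightarrow> 0 | Some j' \<Rightarrow> C s i j') else 0)" for i s
  have H_I: "H i s = C (V.nx (V.nx s)) i'" if i': "V.am (V.nx (V.nx s)) i' = Some i" for i s i'
  proof -
    have "(THE i'. V.am (V.nx (V.nx s)) i' = Some i) = i'" using i' V.am_inj by (intro the_equality) blast+
    moreover have "\<exists>i'. V.am (V.nx (V.nx s)) i' = Some i" using i' by blast
    ultimately show ?thesis unfolding H_def by (intro ext) (simp only: if_True)
  qed
  have not_I: "V.am (V.nx (V.nx (V.eside t))) i' \<noteq> Some (V.epos t)" if "internal T (V.eside t)" for t i'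
    by (rule V.end_not_I) (rule V.internal_nx3[OF that])
  have H_E: "H (V.epos t) (V.eside t) = (\<lambda>j. (- 1) ^ Suc n *
      (case W.am (V.nxn n (V.eside t)) j of None \<Rightarrow> 0 | Some j' \<Rightarrow> C (V.eside t) (V.epos t) j'))"
    if "internal T (V.eside t)" for t
  proof -
    have "\<exists>t'. V.epos t = V.epos t' \<and> V.eside t = V.eside t'" by blast
    moreover have "\<not> (\<exists>i'. V.am (V.nx (V.nx (V.eside t))) i' = Some (V.epos t))" using not_I[OF that] by blast
    ultimately show ?thesis unfolding H_def by (intro ext) (simp only: if_True if_False)
  qed
  have H_vertex: "j \<le> W.len \<and> W.vx j = arc_of_side T (V.nxn n s)"
    if s: "internal T s" "i \<le> V.len" "arc_of_side T s = V.vx i" and nz: "H i s j \<noteq> 0" for i s j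
    using s
  proof (cases rule: V.trichotomy[case_names D I E])
    case (I i')
    let ?p = "V.nx (V.nx s)"
    note p = V.am_props[OF I]
    have "C ?p i' j \<noteq> 0" using nz H_I[OF I] by simp
    hence "j \<le> W.len \<and> W.vx j = arc_of_side T (V.nxn (Suc n) ?p)"
      using p by (intro C_vertex[of ?p i']) (auto intro!: V.internal_nx s simp: V.tail_Q)
    thus ?thesis by (simp only: V.nxn_Suc V.internal_nx3[OF s(1)])
  next
    case (E t)
    have "W.am (V.nxn n s) j \<noteq> None" using nz H_E[of t] E s(1) by (auto split: option.splits)
    then obtain j' where "W.am (V.nxn n s) j = Some j'" by blast
    thus ?thesis using W.am_props[of "V.nxn n s" j j'] by (simp add: V.tail_Q)
  next
    case (D i')
    have "H i s j = 0" unfolding H_def using V.D_not_I[OF D s(1)] V.D_not_end[OF D] by (simp only: if_False)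
    thus ?thesis using nz by simp
  qed
  have "\<exists>h\<in>rhom \<Lambda> (V.FM n) N. \<forall>g\<in>V.gens n. h (delta g) = H (fst g) (hd (snd g))"
  proof (rule V.free_hom[OF W.S.right_module_M])
    fix g assume "g \<in> V.gens n"
    then obtain i s where g: "g = (i, V.kap n s)" "internal T s" "i \<le> V.len" "arc_of_side T s = V.vx i"
      using V.gens_kap n by blast
    have hd: "hd (snd g) = s" using n by (cases n) (simp_all add: g(1) V.kap_Cons)
    show c: "H (fst g) (hd (snd g)) \<in> carrier N"
      using H_vertex[OF g(2-4)] hd unfolding W.S.carrier_M by (auto simp: g(1))
    have "V.vF g \<in> verts V.Q" using \<open>g \<in> V.gens n\<close> by (intro V.F.vt_verts[of _ n]) (simp add: V.gens_def)
    thus "V.cl (V.single (V.vF g, [])) \<odot>\<^bsub>N\<^esub> H (fst g) (hd (snd g)) = H (fst g) (hd (snd g))"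
      using c H_vertex[OF g(2-4)] hd V.kap_gens(2)[OF g(2-4), of n] by (intro W.S.unit_act) (auto simp: g(1))
  qed
  then obtain h where h: "h \<in> rhom \<Lambda> (V.FM n) N" and hg: "\<And>g. g \<in> V.gens n \<Longrightarrow> h (delta g) = H (fst g) (hd (snd g))"
    by blast
  have hH: "h (delta (i, V.kap n s)) = H i s" if "internal T s" "i \<le> V.len" "arc_of_side T s = V.vx i" for i s
    using hg[OF V.kap_gens(1)[OF that]] n by (cases n) (simp_all add: V.kap_Cons)
  have "f m = h (V.dF n m)" if m: "m \<in> carrier (V.FM (Suc n))" for m
  proof (rule V.hom_eq_gens[OF FN f rhom_comp[OF V.dF_hom h] _ m])
    fix g assume "g \<in> V.gens (Suc n)"
    then obtain i s where g: "g = (i, V.kap (Suc n) s)" and s: "internal T s" "i \<le> V.len" "arc_of_side T s = V.vx i"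
      using V.gens_kap[of g "Suc n"] n by auto
    show "f (delta g) = h (V.dF n (delta g))"
    proof
      fix j
      have rhs: "h (V.dF n (delta g)) j = (case V.am s i of None \<Rightarrow> 0 | Some i' \<Rightarrow> H i' (V.nx s) j) +
          (- 1) ^ Suc n * W.S.aact (V.nxn n s) (H i s) j"
      proof -
        have "h (delta (i', V.kap n (V.nx s))) = H i' (V.nx s)" if "V.am s i = Some i'" for i'
          using V.am_props[OF that] by (intro hH V.internal_nx s) (simp_all add: V.head_Q)
        thus ?thesis unfolding g coef_dF[OF h s] by (simp add: hH[OF s] split: option.splits)
      qed
      have "C s i j = h (V.dF n (delta g)) j"
        using s
      proof (cases rule: V.trichotomy[case_names D I E])
        case (D i')
        have "H i' (V.nx s) = C s i" using H_I[of "V.nx s" i i'] V.internal_nx3[OF s(1)] D by simp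
        moreover have "H i s = (\<lambda>j. 0)"
        proof -
          show ?thesis unfolding H_def using V.D_not_I[OF D s(1)] V.D_not_end[OF D] by (simp only: if_False)
        qed
        ultimately show ?thesis unfolding rhs using D by (simp add: W.S.aact_def)
      next
        case (I i')
        let ?p = "V.nx (V.nx s)"
        note p = V.am_props[OF I]
        have ip: "internal T ?p" by (intro V.internal_nx s)
        have np: "V.nx ?p = s" by (rule V.internal_nx3[OF s(1)])
        have "V.am s i = None" using V.am_rel[OF I ip] np by simp
        moreover have "V.nxn (Suc n) ?p = V.nxn n s" by (simp only: V.nxn_Suc np)
        moreover have "C s i j + (- 1) ^ Suc (Suc n) * W.S.aact (V.nxn (Suc n) ?p) (C ?p i') j = 0"
          using Z[OF ip, of i' j] p I np by (simp add: V.tail_Q)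
        ultimately show ?thesis unfolding rhs using H_I[OF I] by (simp add: eq_neg_iff_add_eq_0)
      next
        case (E t)
        let ?a = "V.nxn n s"
        have ia: "internal T ?a" by (rule V.nxn_internal[OF s(1)])
        have ai: "V.am s i = None" using E V.end_not_D by simp
        have HE: "H i s = (\<lambda>j. (- 1) ^ Suc n * (case W.am ?a j of None \<Rightarrow> 0 | Some j' \<Rightarrow> C s i j'))"
          using H_E[of t] s(1) unfolding E(1,2) by (simp only:)
        show ?thesis
        proof (cases "\<exists>j'. W.am ?a j' = Some j")
          case True
          then obtain j' where j': "W.am ?a j' = Some j" by blast
          show ?thesis unfolding rhs W.aact_hit[OF j'] HE by (simp add: ai j' flip: mult.assoc power_add)
        next
          case False
          have "W.S.aact ?a (H i s) j = 0" using False by (intro W.aact_miss) blast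
          moreover have "C s i j = 0"
          proof (rule ccontr)
            assume nz: "C s i j \<noteq> 0"
            note j = C_vertex[OF s nz]
            have "internal T (V.nxn (Suc n) s)" by (rule V.nxn_internal[OF s(1)])
            thus False using j[THEN conjunct1] j[THEN conjunct2, symmetric]
            proof (cases rule: W.trichotomy[case_names D I E])
              case (D j')
              have "W.S.aact (V.nxn (Suc n) s) (C s i) j' = 0" using Z[OF s, of j'] ai by simp
              thus False using W.aact_hit[OF D] nz by simp
            next
              case (I j')
              thus False using False V.internal_nx3[OF ia] by simp
            next
              case (E t')
              thus False using ends[of t t'] nz \<open>i = V.epos t\<close> \<open>s = V.eside t\<close> s(1) by (simp add: C_def)
            qed
          qed
          ultimately show ?thesis unfolding rhs by (simp add: ai)
        qed
      qed
      thus "f (delta g) j = h (V.dF n (delta g)) j" by (simp add: C_def g)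
    qed
  qed
  thus ?thesis using h by blast
qed

end

section \<open>Coordinates on the higher extension groups\<close>

lemma (in monomial) rhom_comb:
  assumes f: "f \<in> rhom \<Lambda> A' M" and g: "g \<in> rhom \<Lambda> A' M"
  shows "(\<lambda>x j. f x j + z * g x j) \<in> rhom \<Lambda> A' M"
proof (rule rhomI)
  fix x assume x: "x \<in> carrier A'"
  note fg = rhom_closed[OF f x] rhom_closed[OF g x]
  show "(\<lambda>j. f x j + z * g x j) \<in> carrier M" using fg by (simp add: carrier_M)
  show "(\<lambda>j. f (x \<oplus>\<^bsub>A'\<^esub> y) j + z * g (x \<oplus>\<^bsub>A'\<^esub> y) j) = (\<lambda>j. f x j + z * g x j) \<oplus>\<^bsub>M\<^esub> (\<lambda>j. f y j + z * g y j)"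
    if "y \<in> carrier A'" for y
    using rhom_add[OF f x that] rhom_add[OF g x that] by (simp add: add_M algebra_simps)
  fix r assume r: "r \<in> carrier \<Lambda>"
  then obtain a where a: "a \<in> carrier A" "r = cl a" by (auto simp: carrier_\<Lambda>)
  show "(\<lambda>j. f (r \<odot>\<^bsub>A'\<^esub> x) j + z * g (r \<odot>\<^bsub>A'\<^esub> x) j) = r \<odot>\<^bsub>M\<^esub> (\<lambda>j. f x j + z * g x j)"
    unfolding rhom_act[OF f r x] rhom_act[OF g r x] unfolding a(2) act_M[OF a(1)] by (simp only: lin_add lin_scale)
qed

lemma (in monomial) rhom_null: "(\<lambda>x j. 0) \<in> rhom \<Lambda> A' M"
proof (rule rhomI)
  fix r x assume "r \<in> carrier \<Lambda>"
  then obtain a where "a \<in> carrier A" "r = cl a" by (auto simp: carrier_\<Lambda>)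
  thus "(\<lambda>j. 0) = r \<odot>\<^bsub>M\<^esub> (\<lambda>j. 0)" by (simp add: act_M)
qed (simp_all add: carrier_M add_M)

text \<open>
  The given resolution \<open>P\<close> of \<open>M(v)\<close> together with comparison maps to and
  from the explicit one and homotopies from the two composites to the identity.
\<close>

locale compared = pair T I v w \<gamma>v \<gamma>w
  for T :: "'d triangulation" and I :: "(('d set, 'd) path \<Rightarrow> 'k::field) set" and v w \<gamma>v \<gamma>w +
  fixes P :: "nat \<Rightarrow> ((('d set, 'd) path \<Rightarrow> 'k) set, 'p) module" and d e \<phi> \<psi> hP hF
  assumes res: "resolves \<Lambda> V.S.M P d e"
    and \<phi>: "\<And>n. \<phi> n \<in> rhom \<Lambda> (P n) (V.FM n)"
      "\<And>n x. x \<in> carrier (P (Suc n)) \<Longrightarrow> V.dF n (\<phi> (Suc n) x) = \<phi> n (d n x)"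
    and \<psi>: "\<And>n. \<psi> n \<in> rhom \<Lambda> (V.FM n) (P n)"
      "\<And>n m. m \<in> carrier (V.FM (Suc n)) \<Longrightarrow> d n (\<psi> (Suc n) m) = \<psi> n (V.dF n m)"
    and hP: "\<And>n. hP n \<in> rhom \<Lambda> (P n) (P (Suc n))"
      "\<And>n x. x \<in> carrier (P (Suc n)) \<Longrightarrow> \<psi> (Suc n) (\<phi> (Suc n) x) =
         x \<oplus>\<^bsub>P (Suc n)\<^esub> (d (Suc n) (hP (Suc n) x) \<oplus>\<^bsub>P (Suc n)\<^esub> hP n (d n x))"
    and hF: "\<And>n. hF n \<in> rhom \<Lambda> (V.FM n) (V.FM (Suc n))"
      "\<And>n m. m \<in> carrier (V.FM (Suc n)) \<Longrightarrow> \<phi> (Suc n) (\<psi> (Suc n) m) =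
         m \<oplus>\<^bsub>V.FM (Suc n)\<^esub> (V.dF (Suc n) (hF (Suc n) m) \<oplus>\<^bsub>V.FM (Suc n)\<^esub> hF n (V.dF n m))"

lemma (in pair) comparison:
  assumes res: "resolves \<Lambda> V.S.M P d e"
  shows "\<exists>\<phi> \<psi> hP hF. compared T I v w \<gamma>v \<gamma>w P d e \<phi> \<psi> hP hF"
proof -
  obtain \<phi> where *: "(\<forall>n. \<phi> n \<in> rhom \<Lambda> (P n) (V.FM n)) \<and> (\<forall>x\<in>carrier (P 0). V.eF (\<phi> 0 x) = e x) \<and>
      (\<forall>n. \<forall>x\<in>carrier (P (Suc n)). V.dF n (\<phi> (Suc n) x) = \<phi> n (d n x))"
    using chain_map_exists[OF res V.resolves_F] ..
  note \<phi> = conjunct1[OF *] conjunct1[OF conjunct2[OF *]] conjunct2[OF conjunct2[OF *]]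
  obtain \<psi> where *: "(\<forall>n. \<psi> n \<in> rhom \<Lambda> (V.FM n) (P n)) \<and> (\<forall>x\<in>carrier (V.FM 0). e (\<psi> 0 x) = V.eF x) \<and>
      (\<forall>n. \<forall>x\<in>carrier (V.FM (Suc n)). d n (\<psi> (Suc n) x) = \<psi> n (V.dF n x))"
    using chain_map_exists[OF V.resolves_F res] ..
  note \<psi> = conjunct1[OF *] conjunct1[OF conjunct2[OF *]] conjunct2[OF conjunct2[OF *]]
  have d: "d n \<in> rhom \<Lambda> (P (Suc n)) (P n)" for n using res by (simp add: resolves_def)
  have c: "\<phi> n x \<in> carrier (V.FM n)" if "x \<in> carrier (P n)" for n x using rhom_closed[OF spec[OF \<phi>(1)] that] .
  have c': "\<psi> n x \<in> carrier (P n)" if "x \<in> carrier (V.FM n)" for n x using rhom_closed[OF spec[OF \<psi>(1)] that] .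
  have "\<exists>h. (\<forall>n. h n \<in> rhom \<Lambda> (P n) (P (Suc n))) \<and> (\<forall>n. \<forall>x\<in>carrier (P (Suc n)). \<psi> (Suc n) (\<phi> (Suc n) x) =
      x \<oplus>\<^bsub>P (Suc n)\<^esub> (d (Suc n) (h (Suc n) x) \<oplus>\<^bsub>P (Suc n)\<^esub> h n (d n x)))"
  proof (rule null_homotopy_exists[OF res])
    show "(\<lambda>x. \<psi> n (\<phi> n x)) \<in> rhom \<Lambda> (P n) (P n)" for n
      by (rule rhom_comp[OF spec[OF \<phi>(1)] spec[OF \<psi>(1)]])
    show "e (\<psi> 0 (\<phi> 0 x)) = e x" if "x \<in> carrier (P 0)" for x
      using \<psi>(2) \<phi>(2) c[OF that] that by simp
    show "d n (\<psi> (Suc n) (\<phi> (Suc n) x)) = \<psi> n (\<phi> n (d n x))" if "x \<in> carrier (P (Suc n))" for n x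
      using \<psi>(3) \<phi>(3) c[OF that] that by simp
  qed
  then obtain hP where *: "(\<forall>n. hP n \<in> rhom \<Lambda> (P n) (P (Suc n))) \<and>
    (\<forall>n. \<forall>x\<in>carrier (P (Suc n)). \<psi> (Suc n) (\<phi> (Suc n) x) =
      x \<oplus>\<^bsub>P (Suc n)\<^esub> (d (Suc n) (hP (Suc n) x) \<oplus>\<^bsub>P (Suc n)\<^esub> hP n (d n x)))" ..
  note hP = conjunct1[OF *] conjunct2[OF *]
  have "\<exists>h. (\<forall>n. h n \<in> rhom \<Lambda> (V.FM n) (V.FM (Suc n))) \<and> (\<forall>n. \<forall>x\<in>carrier (V.FM (Suc n)). \<phi> (Suc n) (\<psi> (Suc n) x) =
      x \<oplus>\<^bsub>V.FM (Suc n)\<^esub> (V.dF (Suc n) (h (Suc n) x) \<oplus>\<^bsub>V.FM (Suc n)\<^esub> h n (V.dF n x)))"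
  proof (rule null_homotopy_exists[OF V.resolves_F])
    show "(\<lambda>x. \<phi> n (\<psi> n x)) \<in> rhom \<Lambda> (V.FM n) (V.FM n)" for n
      by (rule rhom_comp[OF spec[OF \<psi>(1)] spec[OF \<phi>(1)]])
    show "V.eF (\<phi> 0 (\<psi> 0 x)) = V.eF x" if "x \<in> carrier (V.FM 0)" for x
      using \<psi>(2) \<phi>(2) c'[OF that] that by simp
    show "V.dF n (\<phi> (Suc n) (\<psi> (Suc n) x)) = \<phi> n (\<psi> n (V.dF n x))" if "x \<in> carrier (V.FM (Suc n))" for n x
      using \<psi>(3) \<phi>(3) c'[OF that] that by simp
  qed
  then obtain hF where *: "(\<forall>n. hF n \<in> rhom \<Lambda> (V.FM n) (V.FM (Suc n))) \<and>
    (\<forall>n. \<forall>x\<in>carrier (V.FM (Suc n)). \<phi> (Suc n) (\<psi> (Suc n) x) =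
      x \<oplus>\<^bsub>V.FM (Suc n)\<^esub> (V.dF (Suc n) (hF (Suc n) x) \<oplus>\<^bsub>V.FM (Suc n)\<^esub> hF n (V.dF n x)))" ..
  note hF = conjunct1[OF *] conjunct2[OF *]
  have "compared T I v w \<gamma>v \<gamma>w P d e \<phi> \<psi> hP hF"
    unfolding compared_def compared_axioms_def
    using pair_axioms res \<phi>(1,3) \<psi>(1,3) hP hF by (intro conjI allI impI) simp_all
  thus ?thesis by (intro exI)
qed

context compared
begin

abbreviation "sc \<equiv> scalar V.Q I"
abbreviation "Z n \<equiv> cocycles \<Lambda> sc P d N n"
abbreviation "B n \<equiv> coboundaries \<Lambda> sc P d N n"

lemma P_module: "right_module \<Lambda> (P n)" and d_hom: "d n \<in> rhom \<Lambda> (P (Suc n)) (P n)"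
  and d_image: "d n ` carrier (P (Suc n)) = cycles V.S.M P d e n"
  and P_dual_basis: "\<exists>m \<iota> g. dual_basis \<Lambda> (P n) m \<iota> g"
  using res by (auto simp: resolves_def)

lemma P_abelian: "abelian_group (P n)"
  using P_module[of n] by (simp add: right_module_def)

lemma dd: "x \<in> carrier (P (Suc (Suc n))) \<Longrightarrow> d n (d (Suc n) x) = \<zero>\<^bsub>P n\<^esub>"
  using d_image[of "Suc n"] by (auto simp: cycles_def)

lemma N_abelian: "abelian_group N"
  using W.S.right_module_M by (simp add: right_module_def)

lemma mem_Z: "f \<in> Z n \<longleftrightarrow> f \<in> rhom \<Lambda> (P n) N \<and> f \<in> extensional (carrier (P n)) \<and>
    (\<forall>x\<in>carrier (P (Suc n)). f (d n x) = (\<lambda>j. 0))"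
  by (auto simp: cocycles_def hom_space_def W.S.zero_M)

lemma Z_comb:
  assumes f: "f \<in> Z n" and g: "g \<in> Z n"
  shows "(\<lambda>x\<in>carrier (P n). \<lambda>j. f x j + z * g x j) \<in> Z n"
  unfolding mem_Z
proof (intro conjI ballI)
  have fg: "f \<in> rhom \<Lambda> (P n) N" "g \<in> rhom \<Lambda> (P n) N" using f g by (auto simp: mem_Z)
  show "(\<lambda>x\<in>carrier (P n). \<lambda>j. f x j + z * g x j) \<in> rhom \<Lambda> (P n) N"
    by (rule rhom_cong[OF W.S.rhom_comb[OF fg] P_module]) simp
  fix x assume "x \<in> carrier (P (Suc n))"
  thus "(\<lambda>x\<in>carrier (P n). \<lambda>j. f x j + z * g x j) (d n x) = (\<lambda>j. 0)"
    using f g rhom_closed[OF d_hom] by (simp add: mem_Z)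
qed simp

lemma Z_null: "(\<lambda>x\<in>carrier (P n). \<lambda>j. 0) \<in> Z n"
  unfolding mem_Z using rhom_closed[OF d_hom] by (auto intro!: rhom_cong[OF W.S.rhom_null P_module])

lemma Z_add: "f \<oplus>\<^bsub>hom_space \<Lambda> sc (P n) N\<^esub> g = (\<lambda>x\<in>carrier (P n). \<lambda>j. f x j + 1 * g x j)"
  by (auto simp: hom_space_def W.S.add_M)

lemma Z_scale: "f \<in> Z n \<Longrightarrow> c \<odot>\<^bsub>hom_space \<Lambda> sc (P n) N\<^esub> f =
    (\<lambda>x\<in>carrier (P n). \<lambda>j. (\<lambda>x\<in>carrier (P n). \<lambda>j. 0) x j + c * f x j)"
proof -
  assume f: "f \<in> Z n"
  have "sc c \<odot>\<^bsub>N\<^esub> f x = (\<lambda>j. c * f x j)" if "x \<in> carrier (P n)" for x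
    using W.S.act_scalar[of "f x" c] f that rhom_closed[of f \<Lambda> "P n" N x] by (simp add: mem_Z scalar_def V.cl_def)
  thus ?thesis by (auto simp: hom_space_def fun_eq_iff restrict_def)
qed

definition gen :: "nat \<Rightarrow> bool \<Rightarrow> nat \<times> 'd list \<Rightarrow> 'k" where
  "gen n t = delta (V.epos t, V.kap n (V.eside t))"

definition X :: "nat \<Rightarrow> (bool \<times> bool) set" where
  "X n = {(t, t'). internal T (V.eside t) \<and> W.eside t' = V.nxn n (V.eside t)}"

text \<open>
  The coefficient of a cocycle on an arbitrary resolution at a pair of ends, read through the
  comparison map from the explicit resolution.
\<close>

definition \<Theta> :: "nat \<Rightarrow> ('p \<Rightarrow> nat \<Rightarrow> 'k) \<Rightarrow> bool \<times> bool \<Rightarrow> 'k" where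
  "\<Theta> n f = (\<lambda>(t, t'). f (\<psi> n (gen n t)) (W.epos t'))"

lemma epos_le: "V.epos t \<le> V.len" "W.epos t' \<le> W.len"
  by simp_all

lemma gen_gens: "internal T (V.eside t) \<Longrightarrow> (V.epos t, V.kap n (V.eside t)) \<in> V.gens n"
  by (rule V.kap_gens(1)[OF _ epos_le(1) V.arc_eside])

lemma gen_closed: "internal T (V.eside t) \<Longrightarrow> gen n t \<in> carrier (V.FM n)"
  using gen_gens[of t n] unfolding gen_def by (intro V.F.delta_closed) (simp add: V.gens_def)

lemma to_F: "f \<in> rhom \<Lambda> (P n) N \<Longrightarrow> (\<lambda>m. f (\<psi> n m)) \<in> rhom \<Lambda> (V.FM n) N"
  by (rule rhom_comp[OF \<psi>(1)])

lemma cocycle_F: "f \<in> Z n \<Longrightarrow> m \<in> carrier (V.FM (Suc n)) \<Longrightarrow> f (\<psi> n (V.dF n m)) = (\<lambda>j. 0)"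
  using \<psi>(2)[of m n] rhom_closed[OF \<psi>(1), of m "Suc n"] by (simp add: mem_Z flip: \<psi>(2))

lemma coboundary_mem:
  assumes "h \<in> rhom \<Lambda> (P n) N"
  shows "(\<lambda>x\<in>carrier (P (Suc n)). h (d n x)) \<in> B (Suc n)"
proof -
  have "restrict h (carrier (P n)) \<in> carrier (hom_space \<Lambda> sc (P n) N)"
    using rhom_cong[OF assms P_module, of "restrict h (carrier (P n))"] by (simp add: hom_space_def)
  moreover have "(\<lambda>x\<in>carrier (P (Suc n)). h (d n x)) =
      (\<lambda>x\<in>carrier (P (Suc n)). restrict h (carrier (P n)) (d n x))"
    using rhom_closed[OF d_hom] by (auto simp: restrict_def fun_eq_iff)
  ultimately show ?thesis unfolding coboundaries_def nat.case by (rule rev_image_eqI[where f = "\<lambda>h. \<lambda>x\<in>carrier (P (Suc n)). h (d n x)"])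
qed

lemma coboundary_D:
  assumes "f \<in> B (Suc n)"
  obtains h where "h \<in> rhom \<Lambda> (P n) N" "f = (\<lambda>x\<in>carrier (P (Suc n)). h (d n x))"
  using assms by (auto simp: coboundaries_def hom_space_def)

lemma X_cases: "(t, t') \<in> X n \<Longrightarrow> internal T (V.eside t) \<and> W.eside t' = V.nxn n (V.eside t)"
  by (simp add: X_def)

text \<open>
  A cocycle with vanishing coordinates is a coboundary on the explicit resolution; the homotopy on
  the given resolution corrects this to a coboundary there.
\<close>

lemma B_eq:
  assumes n: "n \<ge> 2"
  shows "B (Suc n) = {f \<in> Z (Suc n). \<forall>x\<in>X (Suc n). \<Theta> (Suc n) f x = 0}"
proof (intro Set.set_eqI iffI)
  fix f assume "f \<in> B (Suc n)"
  then obtain h where h: "h \<in> rhom \<Lambda> (P n) N" "f = (\<lambda>x\<in>carrier (P (Suc n)). h (d n x))" by (rule coboundary_D)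
  have "f \<in> rhom \<Lambda> (P (Suc n)) N"
    using h by (intro rhom_cong[OF rhom_comp[OF d_hom h(1)] P_module]) simp
  moreover have "f (d (Suc n) x) = (\<lambda>j. 0)" if "x \<in> carrier (P (Suc (Suc n)))" for x
    using rhom_closed[OF d_hom that] dd[OF that] rhom_zero[OF h(1) P_abelian N_abelian] by (simp add: h(2) W.S.zero_M)
  ultimately have "f \<in> Z (Suc n)" using h(2) by (simp add: mem_Z)
  moreover have "\<Theta> (Suc n) f x = 0" if "x \<in> X (Suc n)" for x
  proof -
    obtain t t' where x: "x = (t, t')" by (cases x)
    have t: "internal T (V.eside t)" "W.eside t' = V.nxn (Suc n) (V.eside t)" using X_cases that x by auto
    have "f (\<psi> (Suc n) (gen (Suc n) t)) = h (\<psi> n (V.dF n (gen (Suc n) t)))"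
      using rhom_closed[OF \<psi>(1) gen_closed[OF t(1)]] \<psi>(2)[OF gen_closed[OF t(1)]] by (simp add: h(2))
    thus ?thesis using coboundary_vanishes[OF to_F[OF h(1)] t] by (simp add: x \<Theta>_def gen_def)
  qed
  ultimately show "f \<in> {f \<in> Z (Suc n). \<forall>x\<in>X (Suc n). \<Theta> (Suc n) f x = 0}" by blast
next
  fix f assume f: "f \<in> {f \<in> Z (Suc n). \<forall>x\<in>X (Suc n). \<Theta> (Suc n) f x = 0}"
  hence fr: "f \<in> rhom \<Lambda> (P (Suc n)) N" and fZ: "f \<in> Z (Suc n)" by (auto simp: mem_Z)
  have "\<exists>h\<in>rhom \<Lambda> (V.FM n) N. \<forall>m\<in>carrier (V.FM (Suc n)). f (\<psi> (Suc n) m) = h (V.dF n m)"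
  proof (rule cocycle_is_coboundary[OF n to_F[OF fr]])
    fix t t' assume "internal T (V.eside t)" "W.eside t' = V.nxn (Suc n) (V.eside t)"
    hence "(t, t') \<in> X (Suc n)" by (simp add: X_def)
    thus "f (\<psi> (Suc n) (delta (V.epos t, V.kap (Suc n) (V.eside t)))) (W.epos t') = 0"
      using f by (auto simp: \<Theta>_def gen_def)
  qed (rule cocycle_F[OF fZ])
  then obtain h where h: "h \<in> rhom \<Lambda> (V.FM n) N"
    "\<And>m. m \<in> carrier (V.FM (Suc n)) \<Longrightarrow> f (\<psi> (Suc n) m) = h (V.dF n m)" by blast
  let ?k = "\<lambda>y j. h (\<phi> n y) j + - 1 * f (hP n y) j"
  have k: "?k \<in> rhom \<Lambda> (P n) N"
    by (rule W.S.rhom_comb[OF rhom_comp[OF \<phi>(1) h(1)] rhom_comp[OF hP(1) fr]])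
  have "f = (\<lambda>x\<in>carrier (P (Suc n)). ?k (d n x))"
  proof (rule extensionalityI[of _ "carrier (P (Suc n))"])
    show "f \<in> extensional (carrier (P (Suc n)))" using fZ by (simp add: mem_Z)
    fix x assume x: "x \<in> carrier (P (Suc n))"
    interpret Pn: abelian_group "P (Suc n)" by (rule P_abelian)
    note c = rhom_closed[OF hP(1) x] rhom_closed[OF d_hom x]
    note c' = rhom_closed[OF d_hom c(1)] rhom_closed[OF hP(1) c(2)]
    have "f (\<psi> (Suc n) (\<phi> (Suc n) x)) = (\<lambda>j. f x j + (f (d (Suc n) (hP (Suc n) x)) j + f (hP n (d n x)) j))"
      unfolding hP(2)[OF x] using x c c' by (simp add: rhom_add[OF fr] W.S.add_M)
    moreover have "f (d (Suc n) (hP (Suc n) x)) = (\<lambda>j. 0)" using fZ c(1) by (simp add: mem_Z)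
    moreover have "f (\<psi> (Suc n) (\<phi> (Suc n) x)) = h (\<phi> n (d n x))"
      using h(2)[OF rhom_closed[OF \<phi>(1) x]] \<phi>(2)[OF x] by simp
    ultimately have "h (\<phi> n (d n x)) = (\<lambda>j. f x j + f (hP n (d n x)) j)" by simp
    thus "f x = (\<lambda>x\<in>carrier (P (Suc n)). ?k (d n x)) x" using x by simp
  qed simp
  thus "f \<in> B (Suc n)" using coboundary_mem[OF k] by simp
qed

text \<open>
  Prescribe the values on the generators at the ends and zero on all others.  This is a cocycle by
  the behaviour of strings at their ends, and the homotopy on the explicit resolution does not
  change its coordinates.
\<close>

lemma onto:
  "\<exists>f\<in>Z (Suc n). \<forall>x\<in>X (Suc n). \<Theta> (Suc n) f x = a x"
proof -
  interpret F: two_monomial T I "V.BF (Suc n)" V.vF "V.mF (Suc n)" "{..W.len}" W.vx W.am by (rule FN)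
  define CC where "CC = (\<lambda>g j. \<Sum>x\<in>X (Suc n). if (V.epos (fst x), V.kap (Suc n) (V.eside (fst x))) = g \<and> W.epos (snd x) = j then a x else 0)"
  have C: "\<exists>t t'. (t, t') \<in> X (Suc n) \<and> (V.epos t, V.kap (Suc n) (V.eside t)) = g \<and> W.epos t' = j" if nz: "CC g j \<noteq> 0" for g j
  proof -
    obtain x where "x \<in> X (Suc n)" "(if (V.epos (fst x), V.kap (Suc n) (V.eside (fst x))) = g \<and> W.epos (snd x) = j then a x else 0) \<noteq> 0"
      by (rule sum.not_neutral_contains_not_neutral[OF nz[unfolded CC_def]])
    thus ?thesis by (intro exI[of _ "fst x"] exI[of _ "snd x"]) (simp split: if_split_asm)
  qed
  have C_hd: "hd (snd g) = V.eside t" if "(V.epos t, V.kap (Suc n) (V.eside t)) = g" for g t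
    using that by (auto simp: V.kap_Cons)
  have "\<exists>f\<in>rhom \<Lambda> (V.FM (Suc n)) N. \<forall>g\<in>V.gens (Suc n). f (delta g) = CC g"
  proof (rule V.free_hom[OF W.S.right_module_M])
    fix g assume g: "g \<in> V.gens (Suc n)"
    have *: "j \<le> W.len \<and> W.vx j = V.vF g" if nz: "CC g j \<noteq> 0" for j
    proof -
      obtain t t' where t: "(t, t') \<in> X (Suc n)" "(V.epos t, V.kap (Suc n) (V.eside t)) = g" "W.epos t' = j"
        using C[OF nz] by (elim exE conjE)
      have "V.vF g = arc_of_side T (V.nxn (Suc n) (V.eside t))"
        using V.kap_gens(2)[OF _ epos_le(1) V.arc_eside, of t "Suc n"] X_cases[OF t(1)] t(2) by blast
      thus ?thesis using X_cases[OF t(1)] W.arc_eside[of t'] t(3) epos_le(2)[of t'] by simp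
    qed
    have 0: "CC g j = 0" if "j \<notin> {..W.len}" for j
    proof (rule ccontr)
      assume "CC g j \<noteq> 0"
      from *[OF this] that show False by simp
    qed
    show c: "CC g \<in> carrier N" unfolding W.S.carrier_M using 0 by blast
    show "V.cl (V.single (V.vF g, [])) \<odot>\<^bsub>N\<^esub> CC g = CC g"
    proof (rule W.S.unit_act[OF c])
      show "W.vx j = V.vF g" if "CC g j \<noteq> 0" for j using *[OF that] by (rule conjunct2)
      show "V.vF g \<in> verts V.Q" using g by (intro V.F.vt_verts[of _ "Suc n"]) (simp add: V.gens_def)
    qed
  qed
  then obtain f0 where f0: "f0 \<in> rhom \<Lambda> (V.FM (Suc n)) N" "\<And>g. g \<in> V.gens (Suc n) \<Longrightarrow> f0 (delta g) = CC g" by blast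
  have coc: "f0 (V.dF (Suc n) m) = (\<lambda>j. 0)" if m: "m \<in> carrier (V.FM (Suc (Suc n)))" for m
  proof (rule V.hom_eq_gens[OF FN rhom_comp[OF V.dF_hom f0(1)] W.S.rhom_null _ m])
    fix g assume "g \<in> V.gens (Suc (Suc n))"
    then obtain i s where g: "g = (i, V.kap (Suc (Suc n)) s)" and s: "internal T s" "i \<le> V.len" "arc_of_side T s = V.vx i"
      using V.gens_kap[of g "Suc (Suc n)"] by auto
    show "f0 (V.dF (Suc n) (delta g)) = (\<lambda>j. 0)"
    proof
      fix j
      have 1: "f0 (delta (i', V.kap (Suc n) (V.nx s))) j = 0" if i': "V.am s i = Some i'" for i'
      proof (rule ccontr)
        assume "f0 (delta (i', V.kap (Suc n) (V.nx s))) j \<noteq> 0"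
        moreover have "(i', V.kap (Suc n) (V.nx s)) \<in> V.gens (Suc n)"
          using V.am_props[OF i'] by (intro V.kap_gens V.internal_nx s) (simp_all add: V.head_Q)
        ultimately have "CC (i', V.kap (Suc n) (V.nx s)) j \<noteq> 0" using f0(2) by simp
        from C[OF this] obtain t where t: "(V.epos t, V.kap (Suc n) (V.eside t)) = (i', V.kap (Suc n) (V.nx s))" by (elim exE conjE)
        hence "V.nx s = V.eside t" using C_hd[OF t] by (simp add: V.kap_Cons)
        thus False using V.end_not_I[of s t i] i' t by simp
      qed
      have "W.S.aact (V.nxn (Suc n) s) (f0 (delta (i, V.kap (Suc n) s))) j = 0"
      proof (rule W.aact_miss)
        fix j' assume j': "W.am (V.nxn (Suc n) s) j' = Some j"
        show "f0 (delta (i, V.kap (Suc n) s)) j' = 0"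
        proof (rule ccontr)
          assume "f0 (delta (i, V.kap (Suc n) s)) j' \<noteq> 0"
          hence "CC (i, V.kap (Suc n) s) j' \<noteq> 0" using f0(2)[OF V.kap_gens(1)[OF s]] by simp
          from C[OF this] obtain t t' where t: "(t, t') \<in> X (Suc n)"
            "(V.epos t, V.kap (Suc n) (V.eside t)) = (i, V.kap (Suc n) s)" "W.epos t' = j'" by (elim exE conjE)
          have "s = V.eside t" using C_hd[OF t(2)] by (simp add: V.kap_Cons)
          thus False using X_cases[OF t(1)] W.end_not_D[of t'] t(3) j' by simp
        qed
      qed
      thus "f0 (V.dF (Suc n) (delta g)) j = 0"
        unfolding g coef_dF[OF f0(1) s] using 1 by (simp split: option.splits)
    qed
  qed
  let ?f = "\<lambda>x\<in>carrier (P (Suc n)). f0 (\<phi> (Suc n) x)"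
  have "?f \<in> Z (Suc n)" unfolding mem_Z
  proof (intro conjI ballI)
    show "?f \<in> rhom \<Lambda> (P (Suc n)) N" by (rule rhom_cong[OF rhom_comp[OF \<phi>(1) f0(1)] P_module]) simp
    fix x assume x: "x \<in> carrier (P (Suc (Suc n)))"
    show "?f (d (Suc n) x) = (\<lambda>j. 0)"
      using rhom_closed[OF d_hom x] coc[OF rhom_closed[OF \<phi>(1) x]] by (simp add: \<phi>(2)[OF x])
  qed simp
  moreover have "\<Theta> (Suc n) ?f x = a x" if x: "x \<in> X (Suc n)" for x
  proof -
    obtain t t' where tt: "x = (t, t')" by (cases x)
    have t: "internal T (V.eside t)" "W.eside t' = V.nxn (Suc n) (V.eside t)" using X_cases x tt by auto
    note g = gen_closed[OF t(1), of "Suc n"]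
    note c = rhom_closed[OF hF(1) g] rhom_closed[OF V.dF_hom g]
    note c' = rhom_closed[OF V.dF_hom c(1)] rhom_closed[OF hF(1) c(2)]
    interpret Fn: right_module \<Lambda> "V.FM (Suc n)" by (rule V.F.right_module_M)
    have "?f (\<psi> (Suc n) (gen (Suc n) t)) = f0 (\<phi> (Suc n) (\<psi> (Suc n) (gen (Suc n) t)))"
      using rhom_closed[OF \<psi>(1) g] by simp
    also have "\<dots> = (\<lambda>j. f0 (gen (Suc n) t) j + f0 (hF n (V.dF n (gen (Suc n) t))) j)"
      unfolding hF(2)[OF g] using g c c' coc[OF c(1)] by (simp add: rhom_add[OF f0(1)] W.S.add_M)
    finally have "\<Theta> (Suc n) ?f x = f0 (gen (Suc n) t) (W.epos t') + f0 (hF n (V.dF n (gen (Suc n) t))) (W.epos t')"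
      by (simp only: tt \<Theta>_def split)
    also have "f0 (hF n (V.dF n (gen (Suc n) t))) (W.epos t') = 0"
      using coboundary_vanishes[OF rhom_comp[OF hF(1) f0(1)] t] by (simp only: gen_def)
    also have "f0 (gen (Suc n) t) (W.epos t') = CC (V.epos t, V.kap (Suc n) (V.eside t)) (W.epos t')"
      using f0(2)[OF gen_gens[OF t(1)]] by (simp only: gen_def)
    also have "\<dots> = (\<Sum>y\<in>X (Suc n). if y = x then a x else 0)" unfolding CC_def
    proof (intro sum.cong refl)
      fix y assume y: "y \<in> X (Suc n)"
      obtain u u' where uu: "y = (u, u')" by (cases y)
      have u: "W.eside u' = V.nxn (Suc n) (V.eside u)" using X_cases y uu by auto
      have "(V.epos u, V.kap (Suc n) (V.eside u)) = (V.epos t, V.kap (Suc n) (V.eside t)) \<and> W.epos u' = W.epos t' \<longleftrightarrow> u = t \<and> u' = t'"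
      proof
        assume eq: "(V.epos u, V.kap (Suc n) (V.eside u)) = (V.epos t, V.kap (Suc n) (V.eside t)) \<and> W.epos u' = W.epos t'"
        hence es: "V.eside u = V.eside t" using C_hd[OF conjunct1[OF eq]] by (simp add: V.kap_Cons)
        hence "u = t" using eq by (intro V.end_unique) auto
        moreover have "u' = t'" using eq u t(2) es by (intro W.end_unique) auto
        ultimately show "u = t \<and> u' = t'" by blast
      qed simp
      thus "(if (V.epos (fst y), V.kap (Suc n) (V.eside (fst y))) = (V.epos t, V.kap (Suc n) (V.eside t)) \<and> W.epos (snd y) = W.epos t' then a y else 0) =
          (if y = x then a x else 0)" by (simp only: uu tt fst_conv snd_conv prod.inject) simp
    qed
    also have "\<dots> = a x" using x by simp
    finally show ?thesis by (simp only: add_0_right)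
  qed
  ultimately show ?thesis by (intro bexI[of _ ?f]) blast
qed

lemma coordinates_Ext:
  assumes n: "n \<ge> 2"
  shows "coordinates (hom_space \<Lambda> sc (P (Suc n)) N) (Z (Suc n)) (B (Suc n)) (X (Suc n)) (\<Theta> (Suc n))"
proof
  show "finite (X (Suc n))" by simp
  have \<Theta>_comb: "\<Theta> (Suc n) (\<lambda>x\<in>carrier (P (Suc n)). \<lambda>j. f x j + z * g x j) x = \<Theta> (Suc n) f x + z * \<Theta> (Suc n) g x"
    if "x \<in> X (Suc n)" for f g z x
    using that rhom_closed[OF \<psi>(1) gen_closed] by (cases x) (simp add: \<Theta>_def X_def)
  have \<Theta>_null: "\<Theta> (Suc n) (\<lambda>x\<in>carrier (P (Suc n)). \<lambda>j. 0) x = 0" if "x \<in> X (Suc n)" for x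
    using that rhom_closed[OF \<psi>(1) gen_closed] by (cases x) (simp add: \<Theta>_def X_def)
  fix f assume f: "f \<in> Z (Suc n)"
  show "c \<odot>\<^bsub>hom_space \<Lambda> sc (P (Suc n)) N\<^esub> f \<in> Z (Suc n) \<and>
      (\<forall>x\<in>X (Suc n). \<Theta> (Suc n) (c \<odot>\<^bsub>hom_space \<Lambda> sc (P (Suc n)) N\<^esub> f) x = c * \<Theta> (Suc n) f x)" for c
    unfolding Z_scale[OF f] using Z_comb[OF Z_null f] by (simp add: \<Theta>_comb \<Theta>_null del: restrict_apply)
  fix g assume g: "g \<in> Z (Suc n)"
  show "f \<oplus>\<^bsub>hom_space \<Lambda> sc (P (Suc n)) N\<^esub> g \<in> Z (Suc n) \<and>
      (\<forall>x\<in>X (Suc n). \<Theta> (Suc n) (f \<oplus>\<^bsub>hom_space \<Lambda> sc (P (Suc n)) N\<^esub> g) x = \<Theta> (Suc n) f x + \<Theta> (Suc n) g x)"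
    unfolding Z_add
  proof (intro conjI ballI)
    show "(\<lambda>x\<in>carrier (P (Suc n)). \<lambda>j. f x j + 1 * g x j) \<in> Z (Suc n)" by (rule Z_comb[OF f g])
    show "\<Theta> (Suc n) (\<lambda>x\<in>carrier (P (Suc n)). \<lambda>j. f x j + 1 * g x j) x = \<Theta> (Suc n) f x + \<Theta> (Suc n) g x"
      if "x \<in> X (Suc n)" for x using \<Theta>_comb[OF that, of f 1 g] by (simp only: mult_1)
  qed
  show "\<exists>b\<in>Z (Suc n). b \<oplus>\<^bsub>hom_space \<Lambda> sc (P (Suc n)) N\<^esub> f = g"
  proof (intro bexI[OF _ Z_comb[OF g f, of "- 1"]])
    show "(\<lambda>x\<in>carrier (P (Suc n)). \<lambda>j. g x j + - 1 * f x j) \<oplus>\<^bsub>hom_space \<Lambda> sc (P (Suc n)) N\<^esub> f = g"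
      unfolding Z_add
    proof (rule extensionalityI[of _ "carrier (P (Suc n))"])
      show "g \<in> extensional (carrier (P (Suc n)))" using g by (simp add: mem_Z)
    qed (simp_all add: fun_eq_iff)
  qed
next
  show "\<exists>z\<in>Z (Suc n). \<forall>x\<in>X (Suc n). \<Theta> (Suc n) z x = a x" for a by (rule onto)
  show "B (Suc n) = {f \<in> Z (Suc n). \<forall>x\<in>X (Suc n). \<Theta> (Suc n) f x = 0}" by (rule B_eq[OF n])
qed

end

section \<open>Inverting and extending strings\<close>

context gentle
begin

lemma all_nat_cases: "(\<forall>k. R k) \<longleftrightarrow> R 0 \<and> (\<forall>k. R (Suc k))"
  by (metis not0_implies_Suc)

lemma direct_string_iff:
  assumes "u \<in> verts Q"
  shows "is_string Q I (u, map Arr as) \<longleftrightarrow> (u, as) \<in> paths Q \<and> turning as"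
proof (cases "set as \<subseteq> arcs Q")
  case False
  have "letter_arrow ` Arr ` set as = set as" by (simp add: image_image)
  thus ?thesis unfolding is_string_def paths_iff using False by simp
next
  case arcs: True
  have wv: "word_vertex Q (u, map Arr as) i = (case i of 0 \<Rightarrow> u | Suc k \<Rightarrow> head Q (as ! k))" if "i \<le> length as" for i
    using that by (cases i) simp_all
  have "(\<forall>i<length as. tail Q (as ! i) = word_vertex Q (u, map Arr as) i) \<longleftrightarrow>
      composable as \<and> (as \<noteq> [] \<longrightarrow> tail Q (hd as) = u)"
  proof -
    have "(\<forall>i. i < length as \<longrightarrow> tail Q (as ! i) = word_vertex Q (u, map Arr as) i) \<longleftrightarrow>
        (0 < length as \<longrightarrow> tail Q (as ! 0) = u) \<and> (\<forall>k. Suc k < length as \<longrightarrow> tail Q (as ! Suc k) = head Q (as ! k))"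
      unfolding all_nat_cases[of "\<lambda>i. i < length as \<longrightarrow> tail Q (as ! i) = word_vertex Q (u, map Arr as) i"]
      using wv by simp
    moreover have "(\<forall>k. Suc k < length as \<longrightarrow> tail Q (as ! Suc k) = head Q (as ! k)) \<longleftrightarrow> composable as"
      unfolding successively_conv_nth by (intro all_cong1 imp_cong refl eq_commute)
    moreover have "(0 < length as \<longrightarrow> tail Q (as ! 0) = u) \<longleftrightarrow> (as \<noteq> [] \<longrightarrow> tail Q (hd as) = u)"
      by (cases as) simp_all
    ultimately show ?thesis by blast
  qed
  moreover have "(\<forall>i. Suc i < length as \<longrightarrow> arrow_prod Q (as ! i) (as ! Suc i) \<notin> I) \<longleftrightarrow> turning as"
    unfolding turning_nth
  proof (intro all_cong1 imp_cong refl)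
    fix i assume i: "Suc i < length as"
    hence "as ! i \<in> arcs Q" "as ! Suc i \<in> arcs Q" using arcs nth_mem[of i as] nth_mem[of "Suc i" as] by auto
    thus "(arrow_prod Q (as ! i) (as ! Suc i) \<notin> I) = (as ! Suc i = gl (nx (as ! i)))"
      using arrow_prod_in_I_iff by blast
  qed
  moreover have "letter_arrow ` set (map Arr as) = set as" by (simp add: image_image)
  ultimately show ?thesis using assms arcs by (auto simp: is_string_def paths_iff)
qed

lemma turning_path: "turning (a # as) \<Longrightarrow> set (a # as) \<subseteq> arcs Q \<Longrightarrow> (head Q a, as) \<in> paths Q"
proof (induction as arbitrary: a)
  case Nil
  thus ?case by (simp add: paths_iff head_verts)
next
  case (Cons b as)
  have "b = gl (nx a)" using Cons.prems by (simp add: turning_Cons)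
  hence "head Q a = tail Q b" using composable_iff[of a b] Cons.prems by simp
  moreover have "(head Q b, as) \<in> paths Q" using Cons by (simp add: turning_Cons)
  moreover have "(tail Q b, [b]) \<in> paths Q" using Cons.prems by (simp add: paths_iff tail_verts)
  ultimately show ?case using paths_append[of "tail Q b" "[b]" as] by (simp add: pend_def)
qed

text \<open>
  The maximal direct string in \<open>\<delta>\<Lambda>\<close> is the longest turning path that
  starts with \<open>\<delta>\<close>, without its first arrow.
\<close>

lemma arrow_ideal_D:
  assumes p: "arrow_ideal_string Q I a p" and a: "a \<in> arcs Q"
  shows "\<exists>as. p = (head Q a, map Arr as) \<and> set as \<subseteq> arcs Q \<and> turning (a # as) \<and> (\<forall>b\<in>arcs Q. \<not> turning (a # as @ [b]))"
proof (cases "\<exists>b\<in>arcs Q. arrow_prod Q a b \<notin> I")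
  case True
  then obtain b as where b: "b \<in> arcs Q" "arrow_prod Q a b \<notin> I" and pe: "p = (head Q a, map Arr (b # as))"
    and st: "is_string Q I p" and mx: "\<forall>c. \<not> is_string Q I (head Q a, map Arr (b # as @ [c]))"
    using p unfolding arrow_ideal_string_def by auto
  have bg: "b = gl (nx a)" using arrow_prod_in_I_iff[OF a b(1)] b(2) by blast
  have t: "(head Q a, b # as) \<in> paths Q" "turning (b # as)"
    using st direct_string_iff[OF head_verts[OF a], of "b # as"] unfolding pe by blast+
  have "turning (a # b # as)" using t(2) bg by (simp add: turning_Cons[of a])
  moreover have "set (b # as) \<subseteq> arcs Q" using t(1) by (simp add: paths_iff)
  moreover have "\<not> turning (a # (b # as) @ [c])" if "c \<in> arcs Q" for c
  proof
    assume c: "turning (a # (b # as) @ [c])"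
    hence "(head Q a, b # as @ [c]) \<in> paths Q" using turning_path[of a "b # as @ [c]"] that calculation(2) a by simp
    moreover have "turning (b # as @ [c])"
      using c unfolding append_Cons turning_Cons[of a] by (rule conjunct1)
    ultimately show False using mx direct_string_iff[OF head_verts[OF a], of "b # as @ [c]"] by blast
  qed
  ultimately show ?thesis using pe by (intro exI[of _ "b # as"]) blast
next
  case False
  hence "p = (head Q a, [])" using p unfolding arrow_ideal_string_def by (simp only: if_False)
  moreover have "\<not> turning [a, b]" if "b \<in> arcs Q" for b
    using False that arrow_prod_in_I_iff[OF a that] by (simp add: turning_def)
  ultimately show ?thesis by (intro exI[of _ "[]"]) simp
qed

text \<open>
  Turning paths have bounded length, so a longest one exists.
\<close>

lemma arrow_ideal_exists:
  assumes a: "a \<in> arcs Q" shows "\<exists>p. arrow_ideal_string Q I a p"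
proof (cases "\<exists>b\<in>arcs Q. arrow_prod Q a b \<notin> I")
  case False
  thus ?thesis unfolding arrow_ideal_string_def by (simp only: if_False) blast
next
  case True
  then obtain b where b: "b \<in> arcs Q" "arrow_prod Q a b \<notin> I" by blast
  have bg: "b = gl (nx a)" using arrow_prod_in_I_iff[OF a b(1)] b(2) by blast
  obtain L where L: "\<And>p. turning p \<Longrightarrow> set p \<subseteq> arcs Q \<Longrightarrow> length p \<le> L" using turning_length_bounded by blast
  let ?R = "\<lambda>as. (head Q a, b # as) \<in> paths Q \<and> turning (b # as)"
  have "?R []" using b composable_iff[OF a b(1)] bg head_verts[OF a] by (simp add: paths_iff)
  moreover have "\<forall>as. ?R as \<longrightarrow> length as < Suc L" using L[of "b # _"] by (fastforce simp: paths_iff)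
  ultimately obtain as where as: "?R as" "\<And>as'. ?R as' \<Longrightarrow> length as' \<le> length as"
    using ex_has_greatest_nat[of ?R "[]" length "Suc L"] by blast
  have "\<not> is_string Q I (head Q a, map Arr (b # as @ [c]))" for c
    using as(2)[of "as @ [c]"] direct_string_iff[OF head_verts[OF a], of "b # as @ [c]"] by auto
  moreover have "is_string Q I (head Q a, map Arr (b # as))"
    using as(1) direct_string_iff[OF head_verts[OF a], of "b # as"] by blast
  ultimately have "arrow_ideal_string Q I a (head Q a, map Arr (b # as))"
    unfolding arrow_ideal_string_def using True b by auto
  thus ?thesis by blast
qed

end

context arc_string
begin

lemma inv_word_vertex: "i \<le> len \<Longrightarrow> word_vertex Q (inv_word Q v) i = vx (len - i)"
proof (cases i)
  case (Suc k)
  assume "i \<le> len"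
  hence k: "k < len" using Suc by simp
  have "letter_end Q (inv_letter l) = letter_start Q l" for l by (cases l) simp_all
  thus ?thesis using k letter_start_vx[of "len - Suc k"] by (simp add: Suc inv_word_def rev_nth)
qed (simp add: inv_word_def)

lemma inv_letters: "snd (inv_word Q v) = rev (map inv_letter letters)"
  by (simp add: inv_word_def)

lemma inv_nth: "k < len \<Longrightarrow> rev (map inv_letter letters) ! k = inv_letter (letters ! (len - Suc k))"
  by (simp add: rev_nth)

lemma inv_is_string: "is_string Q I (inv_word Q v)"
  unfolding is_string_def
proof (intro conjI allI impI)
  have 1: "letter_start Q (inv_letter l) = letter_end Q l" for l by (cases l) simp_all
  have 2: "letters_compatible Q I (inv_letter l) (inv_letter m) = letters_compatible Q I m l" for l m
    by (cases l; cases m) auto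
  have 3: "letter_arrow (inv_letter l) = letter_arrow l" for l :: "'d letter" by (cases l) simp_all
  show "fst (inv_word Q v) \<in> verts Q" using vx_verts[of len] by (simp add: inv_word_def)
  show "letter_arrow ` set (snd (inv_word Q v)) \<subseteq> arcs Q"
    using is_string by (auto simp: inv_word_def is_string_def 3)
  fix i
  show "letter_start Q (snd (inv_word Q v) ! i) = word_vertex Q (inv_word Q v) i" if "i < length (snd (inv_word Q v))"
  proof -
    have i: "i < len" using that by (simp add: inv_letters)
    have "Suc (len - Suc i) = len - i" using i by simp
    thus ?thesis using i letter_end_vx[of "len - Suc i"] by (simp add: inv_letters inv_nth 1 inv_word_vertex)
  qed
  show "letters_compatible Q I (snd (inv_word Q v) ! i) (snd (inv_word Q v) ! Suc i)" if "Suc i < length (snd (inv_word Q v))"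
  proof -
    have i: "Suc i < len" using that by (simp add: inv_letters)
    have "Suc (len - Suc (Suc i)) = len - Suc i" using i by simp
    thus ?thesis using i compatible[of "len - Suc (Suc i)"] by (simp add: inv_letters inv_nth 2)
  qed
qed

lemma inv_move: "i \<le> len \<Longrightarrow> arrow_move (rev (map inv_letter letters)) a (len - i) = map_option (\<lambda>j. len - j) (am a i)"
proof -
  assume i: "i \<le> len"
  interpret R: string T I "inv_word Q v" by unfold_locales (rule inv_is_string)
  let ?L = "rev (map inv_letter letters)"
  have len: "length (snd (inv_word Q v)) = len" by (simp add: inv_letters)
  have Ra: "R.am = arrow_move ?L" by (simp add: inv_letters)
  show ?thesis
  proof (cases "am a i")
    case (Some j)
    hence "arrow_move ?L a (len - i) = Some (len - j)"
    proof (cases rule: am_cases)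
      case 1
      have "?L ! (len - Suc i) = Inv a" using 1 inv_nth[of "len - Suc i"] by simp
      hence "R.am a (Suc (len - Suc i)) = Some (len - Suc i)"
        using 1 by (intro R.am_Inv) (simp_all add: inv_letters)
      moreover have "Suc (len - Suc i) = len - i" using 1 by simp
      ultimately show ?thesis using 1 by (simp add: Ra)
    next
      case 2
      have "?L ! (len - Suc j) = Arr a" using 2 inv_nth[of "len - Suc j"] by simp
      hence "R.am a (len - Suc j) = Some (Suc (len - Suc j))"
        using 2 by (intro R.am_Arr) (simp_all add: inv_letters)
      moreover have "Suc (len - Suc j) = len - j" using 2 by simp
      ultimately show ?thesis using 2 by (simp add: Ra)
    qed
    thus ?thesis using Some by simp
  next
    case None
    have "R.am a (len - i) = None"
    proof (rule ccontr)
      assume "R.am a (len - i) \<noteq> None"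
      then obtain k where k: "R.am a (len - i) = Some k" by blast
      thus False
      proof (cases rule: R.am_cases)
        case 1
        have i0: "i > 0" "i \<le> len" using 1(1) i by (simp_all add: inv_letters)
        have "inv_letter (letters ! (i - 1)) = Arr a" using 1(2) i0 inv_nth[of "len - i"] by (simp add: inv_letters)
        hence "letters ! (i - 1) = Inv a" by (cases "letters ! (i - 1)") simp_all
        moreover obtain m where "i = Suc m" using i0 by (cases i) simp_all
        ultimately show False using am_Inv[of m a] i0 None by simp
      next
        case 2
        have i0: "i < len" "k = len - Suc i" using 2(1,2) i by (simp_all add: inv_letters)
        have "inv_letter (letters ! i) = Inv a" using 2(3) i0 inv_nth[of k] by (simp add: inv_letters)
        hence "letters ! i = Arr a" by (cases "letters ! i") simp_all
        thus False using am_Arr[of i a] i0 None by simp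
      qed
    qed
    thus ?thesis using None by (simp add: Ra)
  qed
qed

lemma inv_arc: "arc_of_string T (inv_word Q v) (rev (map gl \<gamma>))" and inv_eside: "arc_end T (rev (map gl \<gamma>)) True = eside False"
proof -
  let ?\<gamma> = "rev (map gl \<gamma>)"
  have ne: "\<gamma> \<noteq> []" using length_arc by auto
  have nth: "?\<gamma> ! i = gl (\<gamma> ! (len - i))" if "i \<le> len" for i using that length_arc by (simp add: rev_nth)
  have gg: "gl (gl (\<gamma> ! i)) = \<gamma> ! i" if "i \<le> len" for i using gl_gl arc_sides_side arc_sides[OF that] by blast
  have sides: "set \<gamma> \<subseteq> arc_sides T" using arc by (simp add: arc_of_string_def is_arc_def)
  have step: "case rev (map inv_letter letters) ! i of Arr s \<Rightarrow> gl (?\<gamma> ! i) = s \<and> ?\<gamma> ! Suc i = nx s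
        | Inv s \<Rightarrow> gl (?\<gamma> ! i) = nx s \<and> ?\<gamma> ! Suc i = s" if i: "i < len" for i
  proof -
    let ?k = "len - Suc i"
    have k: "?k < len" "len - i = Suc ?k" using i by auto
    have "gl (?\<gamma> ! i) = \<gamma> ! Suc ?k" using nth[of i] gg[of "Suc ?k"] i k by simp
    moreover have "?\<gamma> ! Suc i = gl (\<gamma> ! ?k)" using nth[of "Suc i"] i by simp
    ultimately show ?thesis
      using letter_Arr[OF k(1)] letter_Inv[OF k(1)] by (cases "letters ! ?k") (simp_all add: inv_nth[OF i])
  qed
  have "?\<gamma> ! Suc i \<in> {nx (gl (?\<gamma> ! i)), nx (nx (gl (?\<gamma> ! i)))}" if "i < len" for i
  proof (cases "rev (map inv_letter letters) ! i")
    case (Arr s)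
    thus ?thesis using step[OF that] by simp
  next
    case (Inv s)
    have "s \<in> sides T" using Inv step[OF that] nth[of "Suc i"] that gl_arc[OF arc_sides[of "len - Suc i"]] arc_sides_side by simp
    thus ?thesis using Inv step[OF that] nx3 by simp
  qed
  hence "is_arc T ?\<gamma>" using ne sides gl_arc length_arc by (auto simp: is_arc_def)
  moreover have "arc_of_side T (hd ?\<gamma>) = vx len"
    using ne nth[of 0] length_arc arc_gl[OF arc_sides_side[OF arc_sides[of len]]] arc_vx[of len] by (simp add: hd_conv_nth)
  ultimately show "arc_of_string T (inv_word Q v) ?\<gamma>"
    using step length_arc by (simp add: arc_of_string_def inv_letters) (simp add: inv_word_def)
  show "arc_end T ?\<gamma> True = eside False"
    using ne gl_gl[OF arc_sides_side[OF arc_sides[of 0]]] by (simp add: arc_end_def last_rev hd_map hd_conv_nth)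
qed



lemma ext_letters:
  assumes as: "turning (nx (nx s) # as)" and s: "internal T s"
  defines "L \<equiv> letters @ Inv s # map Arr as"
  shows ext_move_old: "k \<le> len \<Longrightarrow> arrow_move L a k = am a k"
    and ext_move_new: "k \<le> length as \<Longrightarrow> arrow_move L a (Suc len + k) =
       (if k = 0 \<and> a = s then Some len else map_option (\<lambda>j. Suc len + j) (arrow_move (map Arr as) a k))"
proof -
  have ns: "as \<noteq> [] \<Longrightarrow> as ! 0 \<noteq> s"
  proof
    assume "as \<noteq> []" "as ! 0 = s"
    hence "s = gl (nx (nx (nx s)))" using as by (auto simp: turning_Cons hd_conv_nth)
    thus False using internal_nx3[OF s] gl_neq[of s] s by (simp add: internal_def)
  qed
  show "k \<le> len \<Longrightarrow> arrow_move L a k = am a k" by (auto simp: arrow_move_def L_def nth_append)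
  show "arrow_move L a (Suc len + k) =
       (if k = 0 \<and> a = s then Some len else map_option (\<lambda>j. Suc len + j) (arrow_move (map Arr as) a k))"
    if k: "k \<le> length as"
  proof (cases k)
    case 0
    thus ?thesis using ns by (auto simp: arrow_move_def L_def nth_append)
  next
    case (Suc m)
    have "map Arr as ! m \<noteq> Inv a" using k Suc by simp
    thus ?thesis using k Suc by (simp add: arrow_move_def L_def nth_append)
  qed
qed

lemma ext_vertex:
  fixes s :: 'd and as :: "'d list"
  defines "E \<equiv> (fst v, letters @ Inv s # map Arr as)"
  shows ext_vertex_old: "k \<le> len \<Longrightarrow> word_vertex Q E k = vx k"
    and ext_vertex_new: "word_vertex Q E (Suc len + k) = word_vertex Q (arc_of_side T s, map Arr as) k"
proof -
  show "k \<le> len \<Longrightarrow> word_vertex Q E k = vx k"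
    by (cases k; cases v) (simp_all add: E_def nth_append)
  show "word_vertex Q E (Suc len + k) = word_vertex Q (arc_of_side T s, map Arr as) k"
    by (cases k) (simp_all add: E_def nth_append tail_Q)
qed

text \<open>
  The arc of the string ends in the corner opposite to the target of \<open>s\<close>, so its last
  letter does not belong to the triangle of \<open>s\<close>, and the arrow \<open>s\<close> can be
  attached backwards.
\<close>

lemma ext_is_string:
  assumes s: "internal T s" "eside True = nx s" and as: "set as \<subseteq> arcs Q" "turning (nx (nx s) # as)"
  shows "is_string Q I (fst v, letters @ Inv s # map Arr as)"
proof -
  let ?E = "(fst v, letters @ Inv s # map Arr as)"
  have sa: "s \<in> arcs Q" "nx s \<in> arcs Q" "nx (nx s) \<in> arcs Q"
    using s(1) internal_nx[OF s(1)] by (auto simp: internal_iff)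
  have vp: "arc_of_side T s \<in> verts Q" using tail_verts[OF sa(1)] by (simp add: tail_Q)
  have pth: "(arc_of_side T s, as) \<in> paths Q"
    using turning_path[OF as(2)] as(1) sa internal_nx3[OF s(1)] by (simp add: head_Q)
  have p: "is_string Q I (arc_of_side T s, map Arr as)"
    using direct_string_iff[OF vp, of as] pth as(2) by (simp add: turning_Cons)
  have first: "as \<noteq> [] \<Longrightarrow> as ! 0 = gl s"
    using as(2) internal_nx3[OF s(1)] by (simp add: turning_Cons hd_conv_nth)
  have glen: "\<gamma> ! len \<noteq> nx s" using no_self_glue[of len] s(2) eside_True by auto
  show ?thesis unfolding is_string_def
  proof (intro conjI allI impI)
    show "fst ?E \<in> verts Q" using is_string by (simp add: is_string_def)
    show "letter_arrow ` set (snd ?E) \<subseteq> arcs Q" using is_string as(1) sa by (auto simp: is_string_def)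
    fix i
    show "letter_start Q (snd ?E ! i) = word_vertex Q ?E i" if i: "i < length (snd ?E)"
    proof -
      consider "i < len" | "i = len" | "len < i" by linarith
      thus ?thesis
      proof cases
        case 1
        thus ?thesis using letter_start_vx ext_vertex_old[of i] by (simp add: nth_append)
      next
        case 2
        have "head Q s = vx len" using arc_eside[of True] s(2) by (simp add: head_Q)
        thus ?thesis using 2 ext_vertex_old[of len] by (simp add: nth_append)
      next
        case 3
        then obtain k where ik: "i = Suc len + k" using less_imp_Suc_add by auto
        have k: "k < length as" using i ik by simp
        have "tail Q (as ! k) = word_vertex Q (arc_of_side T s, map Arr as) k"
          using p k by (auto simp: is_string_def)
        thus ?thesis using k unfolding ik ext_vertex_new by (simp add: nth_append)
      qed
    qed
    show "letters_compatible Q I (snd ?E ! i) (snd ?E ! Suc i)" if i: "Suc i < length (snd ?E)"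
    proof -
      consider "Suc i < len" | "Suc i = len" | "i = len" | "len < i" by linarith
      thus ?thesis
      proof cases
        case 1
        thus ?thesis using compatible[of i] by (simp add: nth_append)
      next
        case 2
        have il: "i < len" using 2 by simp
        have "letters_compatible Q I (letters ! i) (Inv s)"
        proof (cases "letters ! i")
          case (Arr a)
          thus ?thesis using letter_Arr[OF il Arr] glen 2 by auto
        next
          case (Inv b)
          have b: "b \<in> arcs Q" using letter_arcs[OF il] Inv by simp
          have "\<gamma> ! len = b" using letter_Inv[OF il Inv] 2 by simp
          hence "nx s = gl b" using s(2) eside_True by simp
          hence "b = gl (nx s)" using gl_gl arrow_side[OF b] by simp
          thus ?thesis using Inv arrow_prod_in_I_iff[OF sa(1) b] by simp
        qed
        thus ?thesis using 2 il by (simp add: nth_append)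
      next
        case 3
        have "as \<noteq> []" using i 3 by auto
        hence "s \<noteq> as ! 0" using first gl_neq[of s] s(1) by (auto simp: internal_def)
        thus ?thesis using 3 \<open>as \<noteq> []\<close> by (simp add: nth_append)
      next
        case 4
        then obtain k where ik: "i = Suc len + k" using less_imp_Suc_add by auto
        have k: "Suc k < length as" using i ik by simp
        have "letters_compatible Q I (map Arr as ! k) (map Arr as ! Suc k)"
          using p k unfolding is_string_def by simp
        thus ?thesis using ik k by (simp add: nth_append)
      qed
    qed
  qed
qed

text \<open>
  The arc of the direct string \<open>p\<close> starts opposite to \<open>s\<close> and turns around
  a marked point.
\<close>

lemma fan_arc:
  assumes s: "internal T s" and as: "set as \<subseteq> arcs Q" "turning (nx (nx s) # as)"
  shows "is_string Q I (arc_of_side T s, map Arr as)" "arc_of_string T (arc_of_side T s, map Arr as) (s # map nx as)"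
proof -
  have sa: "s \<in> arcs Q" "nx (nx s) \<in> arcs Q"
    using s internal_nx[OF s] by (auto simp: internal_iff)
  have vp: "arc_of_side T s \<in> verts Q" using tail_verts[OF sa(1)] by (simp add: tail_Q)
  have pth: "(arc_of_side T s, as) \<in> paths Q"
    using turning_path[OF as(2)] as(1) sa internal_nx3[OF s] by (simp add: head_Q)
  show "is_string Q I (arc_of_side T s, map Arr as)"
    using direct_string_iff[OF vp, of as] pth as(2) by (simp add: turning_Cons)
  let ?g = "s # map nx as"
  have sides: "\<And>a. a \<in> set as \<Longrightarrow> a \<in> sides T \<and> nx a \<in> arc_sides T" using as(1) arrow_side by (auto simp: arcs_Q)
  have step: "gl (?g ! i) = as ! i" if i: "i < length as" for i
  proof (cases i)
    case 0
    thus ?thesis using as(2) i internal_nx3[OF s] by (auto simp: turning_Cons hd_conv_nth)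
  next
    case (Suc k)
    thus ?thesis using as(2) i by (simp add: turning_Cons turning_nth)
  qed
  have "is_arc T ?g" unfolding is_arc_def
  proof (intro conjI allI impI)
    show "set ?g \<subseteq> arc_sides T" using sides s by (auto simp: internal_def)
    fix i assume "Suc i < length ?g"
    thus "?g ! Suc i \<in> {nx (gl (?g ! i)), nx (nx (gl (?g ! i)))}" using step[of i] by simp
  qed simp
  thus "arc_of_string T (arc_of_side T s, map Arr as) ?g" using step by (simp add: arc_of_string_def)
qed

end

section \<open>Arrow extensions\<close>

text \<open>
  The arrow \<open>s\<close> of an internal triangle is attached at the end \<open>t'\<close> of
  \<open>w\<close>, and the arrows \<open>as\<close> continue the arrow that precedes
  \<open>s\<close> in this triangle to a maximal turning path.  Thus \<open>p\<close> is the string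
  of the ideal generated by that preceding arrow.
\<close>

locale extension = W: arc_string T I w \<gamma>w
  for T :: "'d triangulation" and I :: "(('d set, 'd) path \<Rightarrow> 'k::field) set" and w \<gamma>w +
  fixes t' :: bool and s :: 'd and as :: "'d list"
  assumes s: "internal T s" and t': "W.eside t' = W.nx s"
    and as: "set as \<subseteq> arcs W.Q" "W.turning (W.nx (W.nx s) # as)"
    and maximal: "\<And>b. b \<in> arcs W.Q \<Longrightarrow> \<not> W.turning (W.nx (W.nx s) # as @ [b])"
begin

abbreviation p :: "('d set, 'd) word" where "p \<equiv> (arc_of_side T s, map Arr as)"
abbreviation \<gamma>p :: "'d list" where "\<gamma>p \<equiv> s # map W.nx as"

text \<open>
  The position in the extended string that corresponds to a position of \<open>w\<close>, which is
  traversed backwards if the extension takes place at its starting end.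
\<close>

definition pos :: "nat \<Rightarrow> nat" where "pos k = (if t' then k else W.len - k)"
definition w' :: "('d set, 'd) word" where "w' = (if t' then w else inv_word W.Q w)"
definition \<gamma>' :: "'d list" where "\<gamma>' = (if t' then \<gamma>w else rev (map W.gl \<gamma>w))"
definition ext :: "('d set, 'd) word" where "ext = (fst w', snd w' @ Inv s # map Arr as)"

lemma ext_string_eq: "ext_string W.Q w t' s p = ext"
  unfolding ext_string_def ext_def w'_def by (simp add: Let_def)

lemma pos_le: "k \<le> W.len \<Longrightarrow> pos k \<le> W.len" and pos_pos: "k \<le> W.len \<Longrightarrow> pos (pos k) = k"
  and pos_end: "pos (W.epos t') = W.len"
  unfolding pos_def by simp_all

sublocale R: arc_string T I w' \<gamma>'
proof (cases t')
  case True
  thus "arc_string T I w' \<gamma>'" unfolding w'_def \<gamma>'_def using W.arc_string_axioms by simp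
next
  case False
  have "arc_string T I (inv_word W.Q w) (rev (map W.gl \<gamma>w))"
    by unfold_locales (rule W.inv_is_string W.inv_arc)+
  thus "arc_string T I w' \<gamma>'" unfolding w'_def \<gamma>'_def using False by simp
qed

sublocale U: arc_string T I p \<gamma>p
  by unfold_locales (rule W.fan_arc[OF s as])+

lemma R_len: "R.len = W.len" and R_eside: "R.eside True = W.nx s"
  unfolding w'_def \<gamma>'_def using t' W.inv_eside by (cases t'; simp add: inv_word_def)+

lemma R_vx: "k \<le> W.len \<Longrightarrow> R.vx (pos k) = W.vx k"
  unfolding w'_def pos_def using W.inv_word_vertex[of "W.len - k"] by simp

lemma R_am: "k \<le> W.len \<Longrightarrow> R.am a (pos k) = map_option pos (W.am a k)"
proof (cases t')
  case True
  thus ?thesis unfolding w'_def pos_def[abs_def] by (simp add: option.map_ident)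
next
  case False
  assume "k \<le> W.len"
  thus ?thesis unfolding w'_def pos_def[abs_def] using False W.inv_move[of k a] by (simp add: W.inv_letters)
qed

sublocale E: string T I ext
  by unfold_locales (unfold ext_def, rule R.ext_is_string[OF s R_eside as])

lemma ext_len: "E.len = Suc W.len + length as"
  using R_len by (simp add: ext_def)

lemma ext_am_old: "k \<le> W.len \<Longrightarrow> E.am a (pos k) = map_option pos (W.am a k)"
  using R.ext_move_old[OF as(2) s, of "pos k" a] R_am[of k a] pos_le[of k] R_len by (simp add: ext_def)

lemma ext_am_new: "k \<le> U.len \<Longrightarrow> E.am a (Suc W.len + k) =
       (if k = 0 \<and> a = s then Some W.len else map_option (\<lambda>j. Suc W.len + j) (U.am a k))"
proof -
  assume "k \<le> U.len"
  hence k: "k \<le> length as" by simp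
  show ?thesis using R.ext_move_new[OF as(2) s k, of a] unfolding R_len ext_def snd_conv .
qed

lemma ext_vx_old: "k \<le> W.len \<Longrightarrow> E.vx (pos k) = W.vx k"
  using R.ext_vertex_old[of "pos k" s as] R_vx[of k] pos_le[of k] R_len by (simp add: ext_def)

lemma ext_vx_new: "E.vx (Suc W.len + k) = U.vx k"
  using R.ext_vertex_new[of s as k] R_len by (simp add: ext_def)

lemma WE: "two_monomial T I {..W.len} W.vx W.am {..E.len} E.vx E.am"
  and EU: "two_monomial T I {..E.len} E.vx E.am {..U.len} U.vx U.am"
  and UE: "two_monomial T I {..U.len} U.vx U.am {..E.len} E.vx E.am"
  by (intro two_monomial.intro W.S.monomial_axioms E.S.monomial_axioms U.S.monomial_axioms)+

abbreviation "incl \<equiv> ext_incl w t' :: (nat \<Rightarrow> 'k) \<Rightarrow> nat \<Rightarrow> 'k"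
abbreviation "proj \<equiv> ext_proj w :: (nat \<Rightarrow> 'k) \<Rightarrow> nat \<Rightarrow> 'k"

lemma incl_pos: "m \<in> carrier W.S.M \<Longrightarrow> k \<le> W.len \<Longrightarrow> incl m (pos k) = m k"
  unfolding ext_incl_def pos_def by (simp add: Let_def)

lemma incl_beyond: "m \<in> carrier W.S.M \<Longrightarrow> incl m (Suc W.len + k) = 0"
  by (simp add: ext_incl_def Let_def W.S.carrier_M)

lemma old_or_new:
  obtains k where "k \<le> W.len" "j = pos k" | k where "j = Suc W.len + k"
proof (cases "j \<le> W.len")
  case True
  thus ?thesis using that(1)[of "pos j"] pos_pos[of j] pos_le[of j] by simp
next
  case False
  thus ?thesis using that(2)[of "j - Suc W.len"] by simp
qed

lemma incl_hom: "incl \<in> rhom W.\<Lambda> W.S.M E.S.M"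
proof -
  interpret WE: two_monomial T I "{..W.len}" W.vx W.am "{..E.len}" E.vx E.am by (rule WE)
  have "lin {..W.len} (\<lambda>b. odelta (Some (pos b))) \<in> rhom W.\<Lambda> W.S.M E.S.M"
  proof (rule WE.partial_map_hom)
    show "c \<in> {..E.len} \<and> E.vx c = W.vx b" if "b \<in> {..W.len}" "Some (pos b) = Some c" for b c
      using that pos_le[of b] ext_len ext_vx_old[of b] by auto
    show "Option.bind (Some (pos b)) (E.am a) = Option.bind (W.am a b) (\<lambda>b. Some (pos b))" if "b \<in> {..W.len}" for a b
      using that ext_am_old[of b a] by (cases "W.am a b") simp_all
  qed
  moreover have "incl m = lin {..W.len} (\<lambda>b. odelta (Some (pos b))) m" if m: "m \<in> carrier W.S.M" for m
  proof
    fix j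
    show "incl m j = lin {..W.len} (\<lambda>b. odelta (Some (pos b))) m j"
    proof (cases rule: old_or_new[of j])
      case (1 k)
      have "lin {..W.len} (\<lambda>b. odelta (Some (pos b))) m j = (\<Sum>b\<in>{..W.len}. if b = k then m k else 0)"
        unfolding lin_def
      proof (intro sum.cong refl)
        fix b assume b: "b \<in> {..W.len}"
        have "pos k = pos b \<longleftrightarrow> b = k" using b 1 pos_pos[of b] pos_pos[of k] by auto
        thus "m b * odelta (Some (pos b)) j = (if b = k then m k else 0)" using 1 by (simp add: delta_def)
      qed
      thus ?thesis using 1 incl_pos[OF m] by simp
    next
      case (2 k)
      have "lin {..W.len} (\<lambda>b. odelta (Some (pos b))) m j = 0"
        unfolding lin_def
      proof (intro sum.neutral ballI)
        fix b assume "b \<in> {..W.len}"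
        hence "j \<noteq> pos b" using 2 pos_le[of b] by auto
        thus "m b * odelta (Some (pos b)) j = 0" by (simp add: delta_def)
      qed
      thus ?thesis using 2 incl_beyond[OF m] by simp
    qed
  qed
  ultimately show ?thesis by (rule rhom_cong[OF _ W.S.right_module_M])
qed

lemma incl_inj: "m \<in> carrier W.S.M \<Longrightarrow> n \<in> carrier W.S.M \<Longrightarrow> incl m = incl n \<Longrightarrow> m = n"
proof
  fix k assume m: "m \<in> carrier W.S.M" "n \<in> carrier W.S.M" "incl m = incl n"
  show "m k = n k"
  proof (cases "k \<le> W.len")
    case True
    thus ?thesis using incl_pos[OF m(1) True] incl_pos[OF m(2) True] m(3) by simp
  next
    case False
    thus ?thesis using m(1,2) by (simp add: W.S.carrier_M)
  qed
qed

lemma incl_image: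
  assumes y: "y \<in> carrier E.S.M" "proj y = (\<lambda>j. 0)"
  shows "\<exists>m\<in>carrier W.S.M. incl m = y"
proof (rule bexI)
  let ?m = "\<lambda>k. if k \<le> W.len then y (pos k) else 0"
  show m: "?m \<in> carrier W.S.M" by (simp add: W.S.carrier_M)
  show "incl ?m = y"
  proof
    fix j
    show "incl ?m j = y j"
    proof (cases rule: old_or_new[of j])
      case (1 k)
      thus ?thesis using incl_pos[OF m 1(1)] by simp
    next
      case (2 k)
      have "y j = 0" using fun_cong[OF y(2), of k] 2 by (simp add: ext_proj_def)
      thus ?thesis using incl_beyond[OF m, of k] 2 by simp
    qed
  qed
qed

lemma proj_hom: "proj \<in> rhom W.\<Lambda> E.S.M U.S.M"
proof -
  interpret EU: two_monomial T I "{..E.len}" E.vx E.am "{..U.len}" U.vx U.am by (rule EU)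
  let ?g = "\<lambda>b. if b \<le> W.len then None else Some (b - Suc W.len)"
  have "lin {..E.len} (\<lambda>b. odelta (?g b)) \<in> rhom W.\<Lambda> E.S.M U.S.M"
  proof (rule EU.partial_map_hom)
    show "c \<in> {..U.len} \<and> U.vx c = E.vx b" if b: "b \<in> {..E.len}" "?g b = Some c" for b c
    proof -
      have "b = Suc W.len + c" using b(2) by (simp split: if_splits)
      thus ?thesis using b(1) ext_len ext_vx_new[of c] by simp
    qed
    show "Option.bind (?g b) (U.am a) = Option.bind (E.am a b) ?g" if b: "b \<in> {..E.len}" for a b
    proof (cases rule: old_or_new[of b])
      case (1 k)
      have "Option.bind (E.am a b) ?g = None"
      proof (cases "W.am a k")
        case (Some j)
        thus ?thesis using 1 ext_am_old[of k a] pos_le[of j] W.am_props[OF Some] by simp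
      qed (use 1 ext_am_old[of k a] in simp)
      thus ?thesis using 1 pos_le[of k] by simp
    next
      case (2 k)
      have k: "k \<le> U.len" using b 2 ext_len by simp
      show ?thesis
      proof (cases "k = 0 \<and> a = s")
        case True
        have "U.am s 0 = None" using U.end_not_D[of False] by (simp add: arc_end_def)
        thus ?thesis using 2 True ext_am_new[OF k, of a] by simp
      next
        case False
        have "Option.bind (E.am a b) ?g = U.am a k"
          unfolding 2 ext_am_new[OF k] if_not_P[OF False] by (cases "U.am a k") simp_all
        thus ?thesis using 2 by simp
      qed
    qed
  qed
  moreover have "proj m = lin {..E.len} (\<lambda>b. odelta (?g b)) m" if m: "m \<in> carrier E.S.M" for m
  proof
    fix j
    have "lin {..E.len} (\<lambda>b. odelta (?g b)) m j = (\<Sum>b\<in>{..E.len}. if b = Suc W.len + j then m b else 0)"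
      unfolding lin_def by (intro sum.cong refl) (auto simp: odelta_def)
    also have "\<dots> = m (Suc W.len + j)" using m by (simp add: E.S.carrier_M)
    finally show "proj m j = lin {..E.len} (\<lambda>b. odelta (?g b)) m j" by (simp add: ext_proj_def)
  qed
  ultimately show ?thesis by (rule rhom_cong[OF _ E.S.right_module_M])
qed

lemma proj_surj: "m \<in> carrier U.S.M \<Longrightarrow> m \<in> proj ` carrier E.S.M"
proof (rule image_eqI)
  let ?y = "\<lambda>j. if j \<le> W.len then 0 else m (j - Suc W.len)"
  show "m = proj ?y" by (simp add: ext_proj_def)
  assume "m \<in> carrier U.S.M"
  thus "?y \<in> carrier E.S.M" unfolding U.S.carrier_M E.S.carrier_M using ext_len by simp
qed

lemma U_am: "k \<le> U.len \<Longrightarrow> U.am a k = (if k < length as \<and> as ! k = a then Some (Suc k) else None)"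
  by (auto simp: arrow_move_def)

text \<open>
  Were the last triangle internal, the path could be prolonged across it, against its maximality.
\<close>

lemma U_ends: "U.eside False = s" "\<not> internal T (U.eside True)"
proof -
  show "U.eside False = s" by (simp add: arc_end_def)
  show "\<not> internal T (U.eside True)"
  proof
    let ?b = "U.eside True"
    assume "internal T ?b"
    hence b: "?b \<in> arcs W.Q" by (simp add: W.internal_iff)
    have "?b = W.gl (W.nx (last (W.nx (W.nx s) # as)))"
      using W.internal_nx3[OF s] by (simp add: arc_end_def last_map)
    hence "W.turning ((W.nx (W.nx s) # as) @ [?b])"
      using as(2) unfolding W.turning_append by simp
    thus False using maximal[OF b] by simp
  qed
qed

lemma fan_not_I: "W.nx (W.nx s) \<notin> set as"
proof
  assume "W.nx (W.nx s) \<in> set as"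
  then obtain q r where q: "as = q @ W.nx (W.nx s) # r" by (auto simp: in_set_conv_decomp)
  have "W.turning ((W.nx (W.nx s) # q @ [W.nx (W.nx s)]) @ r)" using as(2) q by simp
  hence "W.turning (W.nx (W.nx s) # q @ [W.nx (W.nx s)])" unfolding W.turning_append by (rule conjunct1)
  moreover have "set (W.nx (W.nx s) # q) \<subseteq> arcs W.Q" using as(1) q W.internal_nx[OF s] W.internal_nx[of "W.nx s"] by (auto simp: W.internal_iff)
  ultimately show False by (rule W.turning_no_repetition)
qed

end

section \<open>The classes of arrow extensions\<close>

lemma syzygy_simps:
  "zero (syzygy M P d e n) = zero (P n)" "add (syzygy M P d e n) = add (P n)" "smult (syzygy M P d e n) = smult (P n)"
  by (simp_all add: syzygy_def)

lemma rhom_to_syzygy: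
  assumes f: "f \<in> rhom R L (P n)" and "\<And>x. x \<in> carrier L \<Longrightarrow> f x \<in> cycles M P d e n"
  shows "f \<in> rhom R L (syzygy M P d e n)"
  by (rule rhomI) (simp_all add: carrier_syzygy syzygy_simps assms rhom_add[OF f] rhom_act[OF f])

lemma rhom_from_syzygy:
  assumes f: "f \<in> rhom R L (syzygy M P d e n)" shows "f \<in> rhom R L (P n)"
proof (rule rhomI)
  show "f x \<in> carrier (P n)" if "x \<in> carrier L" for x
    using rhom_closed[OF f that] cycles_subset[of M P d e n] unfolding carrier_syzygy by (rule rev_subsetD)
  show "f (x \<oplus>\<^bsub>L\<^esub> y) = f x \<oplus>\<^bsub>P n\<^esub> f y" if "x \<in> carrier L" "y \<in> carrier L" for x y
    using rhom_add[OF f that] by (simp add: syzygy_simps)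
  show "f (r \<odot>\<^bsub>L\<^esub> x) = r \<odot>\<^bsub>P n\<^esub> f x" if "r \<in> carrier R" "x \<in> carrier L" for r x
    using rhom_act[OF f that] by (simp add: syzygy_simps)
qed

context compared
begin

abbreviation "\<Omega> n \<equiv> syzygy V.S.M P d e n"

lemma d_syzygy: "d n \<in> rhom \<Lambda> (P (Suc n)) (\<Omega> n)"
  by (rule rhom_to_syzygy[OF d_hom]) (simp flip: d_image)

text \<open>
  A cocycle vanishes on the kernel of the differential, hence factors through its image, the syzygy.
\<close>

lemma cocycle_factors:
  assumes f: "f \<in> Z (Suc n)"
  shows "\<exists>\<pi>\<in>rhom \<Lambda> (\<Omega> n) N. \<forall>x\<in>carrier (P (Suc n)). \<pi> (d n x) = f x"
proof -
  have fr: "f \<in> rhom \<Lambda> (P (Suc n)) N" and fd: "\<And>x. x \<in> carrier (P (Suc (Suc n))) \<Longrightarrow> f (d (Suc n) x) = (\<lambda>j. 0)"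
    using f by (simp_all add: mem_Z)
  interpret Pn: right_module \<Lambda> "P (Suc n)" by (rule P_module)
  interpret P0: right_module \<Lambda> "P n" by (rule P_module)
  have eq: "f x = f y" if xy: "x \<in> carrier (P (Suc n))" "y \<in> carrier (P (Suc n))" "d n x = d n y" for x y
  proof -
    have "d n (x \<ominus>\<^bsub>P (Suc n)\<^esub> y) = \<zero>\<^bsub>P n\<^esub>"
      using rhom_diff[OF d_hom P_abelian P_abelian xy(1,2)] xy(3) rhom_closed[OF d_hom xy(2)] by (simp add: P0.minus_eq P0.r_neg)
    hence "x \<ominus>\<^bsub>P (Suc n)\<^esub> y \<in> d (Suc n) ` carrier (P (Suc (Suc n)))"
      using xy unfolding d_image by (simp add: cycles_def)
    hence "f (x \<ominus>\<^bsub>P (Suc n)\<^esub> y) = (\<lambda>j. 0)" using fd by auto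
    moreover have "x = (x \<ominus>\<^bsub>P (Suc n)\<^esub> y) \<oplus>\<^bsub>P (Suc n)\<^esub> y"
      using xy by (simp add: Pn.minus_eq Pn.a_assoc Pn.l_neg)
    ultimately have "f x = (\<lambda>j. 0) \<oplus>\<^bsub>N\<^esub> f y"
      using rhom_add[OF fr, of "x \<ominus>\<^bsub>P (Suc n)\<^esub> y" y] xy by simp
    thus ?thesis by (simp add: W.S.add_M)
  qed
  (* Well-definedness is the fact eq, so any choice of preimages does. *)
  define pick where "pick = (\<lambda>y. SOME x. x \<in> carrier (P (Suc n)) \<and> d n x = y)"
  have pick: "pick y \<in> carrier (P (Suc n)) \<and> d n (pick y) = y" if "y \<in> cycles V.S.M P d e n" for y
  proof -
    have "\<exists>x. x \<in> carrier (P (Suc n)) \<and> d n x = y" using that unfolding d_image[symmetric] by blast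
    thus ?thesis unfolding pick_def by (rule someI_ex)
  qed
  have val: "f (pick (d n x)) = f x" if x: "x \<in> carrier (P (Suc n))" for x
  proof (rule eq)
    have "d n x \<in> cycles V.S.M P d e n" using x by (simp flip: d_image)
    thus "pick (d n x) \<in> carrier (P (Suc n))" "d n (pick (d n x)) = d n x" using pick by blast+
  qed (rule x)
  have "(\<lambda>y. f (pick y)) \<in> rhom \<Lambda> (\<Omega> n) N"
  proof (rule rhomI; unfold carrier_syzygy syzygy_simps)
    show "f (pick y) \<in> carrier N" if "y \<in> cycles V.S.M P d e n" for y
      using rhom_closed[OF fr] pick[OF that] by blast
    show "f (pick (y \<oplus>\<^bsub>P n\<^esub> z)) = f (pick y) \<oplus>\<^bsub>N\<^esub> f (pick z)"
      if y: "y \<in> cycles V.S.M P d e n" and z: "z \<in> cycles V.S.M P d e n" for y z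
    proof -
      note py = pick[OF y] and pz = pick[OF z]
      have "y \<oplus>\<^bsub>P n\<^esub> z = d n (pick y \<oplus>\<^bsub>P (Suc n)\<^esub> pick z)" using rhom_add[OF d_hom] py pz by simp
      hence "f (pick (y \<oplus>\<^bsub>P n\<^esub> z)) = f (pick y \<oplus>\<^bsub>P (Suc n)\<^esub> pick z)" using val py pz by simp
      thus ?thesis using rhom_add[OF fr] py pz by simp
    qed
    show "f (pick (r \<odot>\<^bsub>P n\<^esub> y)) = r \<odot>\<^bsub>N\<^esub> f (pick y)" if r: "r \<in> carrier \<Lambda>" and y: "y \<in> cycles V.S.M P d e n" for r y
    proof -
      note py = pick[OF y]
      have "r \<odot>\<^bsub>P n\<^esub> y = d n (r \<odot>\<^bsub>P (Suc n)\<^esub> pick y)" using rhom_act[OF d_hom r] py by simp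
      hence "f (pick (r \<odot>\<^bsub>P n\<^esub> y)) = f (r \<odot>\<^bsub>P (Suc n)\<^esub> pick y)" using val py Pn.act_closed[OF r] by simp
      thus ?thesis using rhom_act[OF fr r] py by simp
    qed
  qed
  thus ?thesis using val by (intro bexI[of _ "\<lambda>y. f (pick y)"]) simp_all
qed

lemma syzygy_cocycle:
  assumes \<pi>: "\<pi> \<in> rhom \<Lambda> (\<Omega> n) N"
  shows "(\<lambda>x\<in>carrier (P (Suc n)). \<pi> (d n x)) \<in> Z (Suc n)"
  unfolding mem_Z
proof (intro conjI ballI)
  show "(\<lambda>x\<in>carrier (P (Suc n)). \<pi> (d n x)) \<in> rhom \<Lambda> (P (Suc n)) N"
    by (rule rhom_cong[OF rhom_comp[OF d_syzygy \<pi>] P_module]) simp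
  fix x assume x: "x \<in> carrier (P (Suc (Suc n)))"
  interpret P0: right_module \<Lambda> "P n" by (rule P_module)
  have z: "\<zero>\<^bsub>P n\<^esub> \<in> carrier (\<Omega> n)"
    using rhom_closed[OF d_syzygy rhom_closed[OF d_hom x]] unfolding dd[OF x] .
  have twice: "\<pi> \<zero>\<^bsub>P n\<^esub> = (\<lambda>j. \<pi> \<zero>\<^bsub>P n\<^esub> j + \<pi> \<zero>\<^bsub>P n\<^esub> j)"
    using rhom_add[OF \<pi> z z] by (simp only: syzygy_simps W.S.add_M P0.l_zero P0.zero_closed)
  have "\<pi> \<zero>\<^bsub>P n\<^esub> = (\<lambda>j. 0)"
  proof
    show "\<pi> \<zero>\<^bsub>P n\<^esub> j = 0" for j using fun_cong[OF twice, of j] by (simp only: add_cancel_right_right)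
  qed
  thus "(\<lambda>x\<in>carrier (P (Suc n)). \<pi> (d n x)) (d (Suc n) x) = (\<lambda>j. 0)"
    using rhom_closed[OF d_hom x] dd[OF x] by simp
qed simp

end

text \<open>
  Any degree congruent to two modulo three is admitted, since the degree only enters through the
  side of the triangle that is reached after that many steps.
\<close>

locale realization = compared T I v w \<gamma>v \<gamma>w P d e \<phi> \<psi> hP hF + extension T I w \<gamma>w t' s as
  for T :: "'d triangulation" and I :: "(('d set, 'd) path \<Rightarrow> 'k::field) set" and v w \<gamma>v \<gamma>w
    and P :: "nat \<Rightarrow> ((('d set, 'd) path \<Rightarrow> 'k) set, 'p) module" and d e \<phi> \<psi> hP hF t' s as +
  fixes t :: bool and n :: nat
  assumes n: "n mod 3 = 2" and t: "V.eside t = s"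
    and alone: "\<And>u u'. V.eside u = s \<Longrightarrow> W.eside u' = V.nx s \<Longrightarrow> u = t \<and> u' = t'"
begin

lemma n2: "n \<ge> 2" using n by presburger

lemma nxn_n: "internal T x \<Longrightarrow> V.nxn (Suc n) x = x"
proof -
  assume x: "internal T x"
  have "Suc n = 0 + 3 * (Suc n div 3)" using n by presburger
  thus ?thesis using V.nxn_3k[OF x, of 0 "Suc n div 3"] by simp
qed

sublocale VU: compared T I v p \<gamma>v \<gamma>p P d e \<phi> \<psi> hP hF
  by unfold_locales (rule res \<phi> \<psi> hP hF; assumption?)+

lemma VE: "two_monomial T I (V.BF m) V.vF (V.mF m) {..E.len} E.vx E.am"
  and UF: "two_monomial T I {..U.len} U.vx U.am (V.BF m) V.vF (V.mF m)"
  by (intro two_monomial.intro V.F.monomial_axioms E.S.monomial_axioms U.S.monomial_axioms)+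

lemma X_fan: "x \<in> VU.X (Suc n) \<longleftrightarrow> x = (t, False)"
proof (cases x)
  case (Pair u u')
  have "u = t \<and> \<not> u'" if u: "internal T (V.eside u)" "U.eside u' = V.eside u"
  proof -
    have "\<not> u'" using u U_ends(2) by (cases u') simp_all
    moreover from this have "V.eside u = s" using u(2) U_ends(1) by simp
    ultimately show ?thesis using alone[of u t'] t' by simp
  qed
  moreover have "internal T (V.eside t)" "U.eside False = V.eside t" using s t U_ends(1) by simp_all
  ultimately show ?thesis unfolding Pair VU.X_def using nxn_n by auto
qed

text \<open>
  If the projection vanished on the generator, its cocycle would have no nonzero coordinate and the
  projection would extend to \<open>P n\<close>.  Lifting this extension to the middle term of the
  arrow extension and composing with \<open>\<sigma>\<close> yields a splitting.  But the first
  basis element of \<open>M(p)\<close> is annihilated by \<open>s\<close>, whereas none of its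
  preimages in the middle term is.
\<close>

lemma generator_survives:
  assumes \<pi>: "\<pi> \<in> rhom \<Lambda> (\<Omega> n) U.S.M" and \<sigma>: "\<sigma> \<in> rhom \<Lambda> U.S.M (\<Omega> n)"
    and split: "\<And>x. x \<in> carrier U.S.M \<Longrightarrow> \<pi> (\<sigma> x) = x"
  shows "\<pi> (d n (\<psi> (Suc n) (gen (Suc n) t))) 0 \<noteq> 0"
proof
  assume zero: "\<pi> (d n (\<psi> (Suc n) (gen (Suc n) t))) 0 = 0"
  let ?\<rho> = "\<lambda>x\<in>carrier (P (Suc n)). \<pi> (d n x)"
  have it: "internal T (V.eside t)" using s t by simp
  have \<rho>Z: "?\<rho> \<in> VU.Z (Suc n)" by (rule VU.syzygy_cocycle[OF \<pi>])
  have "VU.\<Theta> (Suc n) ?\<rho> (t, False) = 0"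
    using zero rhom_closed[OF \<psi>(1) gen_closed[OF it]] by (simp add: VU.\<Theta>_def)
  hence "?\<rho> \<in> VU.B (Suc n)" unfolding VU.B_eq[OF n2] using \<rho>Z X_fan by simp
  then obtain \<eta> where \<eta>: "\<eta> \<in> rhom \<Lambda> (P n) U.S.M" "?\<rho> = (\<lambda>x\<in>carrier (P (Suc n)). \<eta> (d n x))"
    by (rule VU.coboundary_D)
  have \<pi>\<eta>: "\<pi> y = \<eta> y" if y: "y \<in> carrier (\<Omega> n)" for y
  proof -
    obtain x where x: "x \<in> carrier (P (Suc n))" "y = d n x"
      using y unfolding carrier_syzygy d_image[symmetric] by (rule imageE)
    show ?thesis using fun_cong[OF \<eta>(2), of x] x by simp
  qed
  obtain m \<iota> g where db: "dual_basis \<Lambda> (P n) m \<iota> g" using P_dual_basis[of n] by (elim exE)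
  have "\<exists>h\<in>rhom \<Lambda> (P n) E.S.M. \<forall>x\<in>carrier (P n). proj (h x) = \<eta> x"
    by (rule dual_basis_lift[OF db P_module E.S.right_module_M U.S.right_module_M \<eta>(1) proj_hom])
      (rule proj_surj[OF rhom_closed[OF \<eta>(1)]])
  then obtain \<eta>' where \<eta>': "\<eta>' \<in> rhom \<Lambda> (P n) E.S.M" "\<And>x. x \<in> carrier (P n) \<Longrightarrow> proj (\<eta>' x) = \<eta> x" by blast
  have h: "(\<lambda>x. \<eta>' (\<sigma> x)) \<in> rhom \<Lambda> U.S.M E.S.M" by (rule rhom_comp[OF rhom_from_syzygy[OF \<sigma>] \<eta>'(1)])
  interpret UE: two_monomial T I "{..U.len}" U.vx U.am "{..E.len}" E.vx E.am by (rule UE)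
  have d0: "delta 0 \<in> carrier U.S.M" by (rule U.S.delta_closed) simp
  have "proj (\<eta>' (\<sigma> (delta 0))) = delta 0"
    using \<eta>'(2)[OF rhom_closed[OF rhom_from_syzygy[OF \<sigma>] d0]] \<pi>\<eta>[OF rhom_closed[OF \<sigma> d0]] split[OF d0] by simp
  from fun_cong[OF this, of 0] have one: "\<eta>' (\<sigma> (delta 0)) (Suc W.len) = 1"
    by (simp add: ext_proj_def)
  have sa: "s \<in> arcs V.Q" using s by (simp add: V.internal_iff)
  have "U.am s 0 = None" using U.end_not_D[of False] U_ends(1) by simp
  hence "U.S.aact s (delta 0) = (\<lambda>b. 0)" using U.S.aact_delta[of 0 s] by simp
  hence "E.S.aact s (\<eta>' (\<sigma> (delta 0))) = (\<lambda>b. 0)"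
    using UE.hom_aact[OF h sa d0] UE.hom_zero[OF h] by simp
  moreover have "E.am s (Suc W.len) = Some W.len" using ext_am_new[of 0 s] by simp
  ultimately show False using E.aact_hit[of s "Suc W.len" W.len "\<eta>' (\<sigma> (delta 0))"] one by simp
qed

text \<open>
  The cocycle is the lift \<open>g\<close> applied to the differential of a generator.  At an end of
  \<open>v\<close> only the summand remains in which an arrow acts on the value of \<open>g\<close>.
  In the extended string, the position of an end of \<open>w\<close> is the target of this arrow
  only if the arrow is the attached one, coming from the first position of \<open>p\<close>.
\<close>

lemma class_coordinates:
  assumes \<pi>: "\<pi> \<in> rhom \<Lambda> (\<Omega> n) U.S.M" and \<sigma>: "\<sigma> \<in> rhom \<Lambda> U.S.M (\<Omega> n)"
    and split: "\<And>x. x \<in> carrier U.S.M \<Longrightarrow> \<pi> (\<sigma> x) = x"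
    and g: "g \<in> rhom \<Lambda> (P (Suc n)) E.S.M" "\<And>x. x \<in> carrier (P (Suc n)) \<Longrightarrow> proj (g x) = \<pi> (d n x)"
    and \<xi>: "\<xi> \<in> Z (Suc (Suc n))" "\<And>y. y \<in> carrier (P (Suc (Suc n))) \<Longrightarrow> incl (\<xi> y) = g (d (Suc n) y)"
    and x: "x \<in> X (Suc (Suc n))"
  shows "\<Theta> (Suc (Suc n)) \<xi> x \<noteq> 0 \<longleftrightarrow> x = (t, t')"
proof -
  obtain u u' where xu: "x = (u, u')" by (cases x)
  have iu: "internal T (V.eside u)" and "W.eside u' = V.nxn (Suc (Suc n)) (V.eside u)"
    using X_cases x xu by auto
  hence u': "W.eside u' = V.nx (V.eside u)" using nxn_n[OF iu] by simp
  note G = gen_closed[OF iu, of "Suc (Suc n)"]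
  have \<xi>r: "\<xi> \<in> rhom \<Lambda> (P (Suc (Suc n))) N" using \<xi>(1) by (simp add: mem_Z)
  have \<xi>G: "\<xi> (\<psi> (Suc (Suc n)) (gen (Suc (Suc n)) u)) \<in> carrier N"
    by (rule rhom_closed[OF \<xi>r rhom_closed[OF \<psi>(1) G]])
  have h: "(\<lambda>m. g (\<psi> (Suc n) m)) \<in> rhom \<Lambda> (V.FM (Suc n)) E.S.M" by (rule rhom_comp[OF \<psi>(1) g(1)])
  let ?j = "pos (W.epos u')"
  have "\<Theta> (Suc (Suc n)) \<xi> x = incl (\<xi> (\<psi> (Suc (Suc n)) (gen (Suc (Suc n)) u))) ?j"
    using incl_pos[OF \<xi>G, of "W.epos u'"] by (simp add: \<Theta>_def xu)
  also have "\<dots> = g (\<psi> (Suc n) (V.dF (Suc n) (gen (Suc (Suc n)) u))) ?j"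
    unfolding \<xi>(2)[OF rhom_closed[OF \<psi>(1) G]] \<psi>(2)[OF G] ..
  also have "\<dots> = (- 1) ^ Suc (Suc n) * E.S.aact (V.eside u) (g (\<psi> (Suc n) (gen (Suc n) u))) ?j"
    unfolding gen_def V.hom_dF_kap[OF VE h iu epos_le(1) V.arc_eside] nxn_n[OF iu] V.end_not_D option.case by (rule add_0)
  finally have val: "\<Theta> (Suc (Suc n)) \<xi> x = (- 1) ^ Suc (Suc n) * E.S.aact (V.eside u) (g (\<psi> (Suc n) (gen (Suc n) u))) ?j" .
  show ?thesis
  proof (cases "V.eside u = s")
    case True
    hence ut: "u = t" "u' = t'" using alone[of u u'] u' by simp_all
    have "E.am s (Suc W.len) = Some ?j" using ext_am_new[of 0 s] pos_end ut(2) by simp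
    hence "E.S.aact s (g (\<psi> (Suc n) (gen (Suc n) u))) ?j = g (\<psi> (Suc n) (gen (Suc n) u)) (Suc W.len)"
      by (rule E.aact_hit)
    also have "\<dots> = proj (g (\<psi> (Suc n) (gen (Suc n) u))) 0" by (simp add: ext_proj_def)
    also have "\<dots> = \<pi> (d n (\<psi> (Suc n) (gen (Suc n) t))) 0"
      using g(2)[OF rhom_closed[OF \<psi>(1) gen_closed[OF iu]]] ut(1) by simp
    finally have "\<Theta> (Suc (Suc n)) \<xi> x \<noteq> 0"
      using generator_survives[OF \<pi> \<sigma> split] val True by simp
    thus ?thesis using ut xu by simp
  next
    case False
    have "E.S.aact (V.eside u) (g (\<psi> (Suc n) (gen (Suc n) u))) ?j = 0"
    proof (rule E.aact_miss)
      fix j assume j: "E.am (V.eside u) j = Some ?j"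
      have pj: "?j \<le> W.len" by (rule pos_le[OF epos_le(2)])
      show "g (\<psi> (Suc n) (gen (Suc n) u)) j = 0"
      proof (cases rule: old_or_new[of j])
        case (1 k)
        have "map_option pos (W.am (V.eside u) k) = Some ?j" using j unfolding 1(2) ext_am_old[OF 1(1)] .
        then obtain i where i: "W.am (V.eside u) k = Some i" "pos i = ?j"
          unfolding map_option_eq_Some by (elim exE conjE)
        have "i = pos (pos i)" using W.am_props[OF i(1)] pos_pos[of i] by (simp only:)
        also have "\<dots> = W.epos u'" unfolding i(2) by (rule pos_pos[OF epos_le(2)])
        finally have "W.am (V.eside u) k = Some (W.epos u')" using i(1) by (simp only:)
        thus ?thesis using W.end_not_I[OF u'[symmetric], of k] by (rule notE[rotated])
      next
        case (2 k)
        have "j \<le> E.len" using E.am_props[OF j] by simp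
        hence "k \<le> U.len" unfolding 2 ext_len length_map snd_conv by linarith
        from j have "map_option (\<lambda>j. Suc W.len + j) (U.am (V.eside u) k) = Some ?j"
          unfolding 2 ext_am_new[OF \<open>k \<le> U.len\<close>] using False by (simp only: simp_thms if_False)
        then obtain i where "Suc W.len + i = ?j" unfolding map_option_eq_Some by (elim exE conjE)
        hence False using pj by linarith
        thus ?thesis ..
      qed
    qed
    moreover have "x \<noteq> (t, t')"
    proof
      assume "x = (t, t')"
      hence "u = t" unfolding xu by (simp only: prod.inject)
      thus False using \<open>V.eside u \<noteq> s\<close> t by simp
    qed
    ultimately show ?thesis using val by simp
  qed
qed

text \<open>
  Projectivity gives the lift to the middle term; injectivity of the inclusion makes the restriction
  to the next syzygy a homomorphism.
\<close>

lemma pullback_exists: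
  assumes \<pi>: "\<pi> \<in> rhom \<Lambda> (\<Omega> n) U.S.M"
  shows "\<exists>\<xi>. pullback_cocycle \<Lambda> sc P d N E.S.M incl proj \<pi> n \<xi>"
proof -
  obtain m \<iota> b where db: "dual_basis \<Lambda> (P (Suc n)) m \<iota> b" using P_dual_basis[of "Suc n"] by (elim exE)
  have \<pi>d: "(\<lambda>x. \<pi> (d n x)) \<in> rhom \<Lambda> (P (Suc n)) U.S.M" by (rule rhom_comp[OF d_syzygy \<pi>])
  have "\<exists>h\<in>rhom \<Lambda> (P (Suc n)) E.S.M. \<forall>x\<in>carrier (P (Suc n)). proj (h x) = \<pi> (d n x)"
    by (rule dual_basis_lift[OF db P_module E.S.right_module_M U.S.right_module_M \<pi>d proj_hom])
      (rule proj_surj[OF rhom_closed[OF \<pi>d]])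
  then obtain g where g: "g \<in> rhom \<Lambda> (P (Suc n)) E.S.M" "\<And>x. x \<in> carrier (P (Suc n)) \<Longrightarrow> proj (g x) = \<pi> (d n x)" by blast
  have gd: "(\<lambda>y. g (d (Suc n) y)) \<in> rhom \<Lambda> (P (Suc (Suc n))) E.S.M" by (rule rhom_comp[OF d_hom g(1)])
  have "\<exists>m. m \<in> carrier N \<and> incl m = g (d (Suc n) y)" if y: "y \<in> carrier (P (Suc (Suc n)))" for y
  proof -
    from bspec[OF conjunct2[OF conjunct2[OF VU.syzygy_cocycle[OF \<pi>, unfolded VU.mem_Z]]] y]
    have "\<pi> (d n (d (Suc n) y)) = (\<lambda>j. 0)" unfolding restrict_apply'[OF rhom_closed[OF d_hom y]] .
    hence "proj (g (d (Suc n) y)) = (\<lambda>j. 0)" using g(2)[OF rhom_closed[OF d_hom y]] by simp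
    from incl_image[OF rhom_closed[OF gd y] this] show ?thesis unfolding Bex_def .
  qed
  hence "\<forall>y\<in>carrier (P (Suc (Suc n))). \<exists>m. m \<in> carrier N \<and> incl m = g (d (Suc n) y)" by (rule ballI)
  from bchoice[OF this] obtain \<xi>' where "\<forall>y\<in>carrier (P (Suc (Suc n))). \<xi>' y \<in> carrier N \<and> incl (\<xi>' y) = g (d (Suc n) y)" ..
  note \<xi>' = bspec[OF this]
  interpret P2: right_module \<Lambda> "P (Suc (Suc n))" by (rule P_module)
  let ?\<xi> = "\<lambda>y\<in>carrier (P (Suc (Suc n))). \<xi>' y"
  have r: "\<xi>' \<in> rhom \<Lambda> (P (Suc (Suc n))) N"
  proof (rule rhomI)
    fix y assume y: "y \<in> carrier (P (Suc (Suc n)))"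
    note \<xi>y = \<xi>'[OF y]
    show "\<xi>' y \<in> carrier N" using \<xi>y by blast
    show "\<xi>' (y \<oplus>\<^bsub>P (Suc (Suc n))\<^esub> z) = \<xi>' y \<oplus>\<^bsub>N\<^esub> \<xi>' z" if z: "z \<in> carrier (P (Suc (Suc n)))" for z
    proof (rule incl_inj)
      note \<xi>z = \<xi>'[OF z] and \<xi>yz = \<xi>'[OF P2.add.m_closed[OF y z]]
      show "\<xi>' (y \<oplus>\<^bsub>P (Suc (Suc n))\<^esub> z) \<in> carrier N" using \<xi>yz by blast
      show "\<xi>' y \<oplus>\<^bsub>N\<^esub> \<xi>' z \<in> carrier N" using \<xi>y \<xi>z by (simp add: W.S.M.add.m_closed)
      show "incl (\<xi>' (y \<oplus>\<^bsub>P (Suc (Suc n))\<^esub> z)) = incl (\<xi>' y \<oplus>\<^bsub>N\<^esub> \<xi>' z)"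
        using \<xi>y \<xi>z \<xi>yz rhom_add[OF gd y z] rhom_add[OF incl_hom, of "\<xi>' y" "\<xi>' z"] by simp
    qed
    show "\<xi>' (a \<odot>\<^bsub>P (Suc (Suc n))\<^esub> y) = a \<odot>\<^bsub>N\<^esub> \<xi>' y" if a: "a \<in> carrier \<Lambda>" for a
    proof (rule incl_inj)
      note \<xi>a = \<xi>'[OF P2.act_closed[OF a y]]
      show "\<xi>' (a \<odot>\<^bsub>P (Suc (Suc n))\<^esub> y) \<in> carrier N" using \<xi>a by blast
      show "a \<odot>\<^bsub>N\<^esub> \<xi>' y \<in> carrier N" using \<xi>y a by (simp add: W.S.M.act_closed)
      show "incl (\<xi>' (a \<odot>\<^bsub>P (Suc (Suc n))\<^esub> y)) = incl (a \<odot>\<^bsub>N\<^esub> \<xi>' y)"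
        using \<xi>y \<xi>a rhom_act[OF gd a y] rhom_act[OF incl_hom a, of "\<xi>' y"] by simp
    qed
  qed
  have Z\<xi>: "?\<xi> \<in> Z (Suc (Suc n))" unfolding mem_Z
  proof (intro conjI ballI)
    show "?\<xi> \<in> rhom \<Lambda> (P (Suc (Suc n))) N" by (rule rhom_cong[OF r P_module]) simp
    fix x assume x: "x \<in> carrier (P (Suc (Suc (Suc n))))"
    note dx = rhom_closed[OF d_hom x]
    have "incl (\<xi>' (d (Suc (Suc n)) x)) = incl (\<lambda>j. 0)"
    proof -
      have "abelian_group E.S.M" using E.S.right_module_M by (simp add: right_module_def)
      note 0 = rhom_zero[OF g(1) P_abelian this] rhom_zero[OF incl_hom N_abelian this]
      have "incl (\<xi>' (d (Suc (Suc n)) x)) = g (d (Suc n) (d (Suc (Suc n)) x))" using \<xi>'[OF dx] by (rule conjunct2)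
      also have "\<dots> = incl \<zero>\<^bsub>N\<^esub>" unfolding dd[OF x] 0 ..
      finally show ?thesis unfolding W.S.zero_M .
    qed
    moreover have "(\<lambda>j. 0) \<in> carrier N" unfolding W.S.carrier_M by (intro allI impI refl)
    ultimately have "\<xi>' (d (Suc (Suc n)) x) = (\<lambda>j. 0)"
      by (rule incl_inj[OF conjunct1[OF \<xi>'[OF dx]], rotated])
    thus "?\<xi> (d (Suc (Suc n)) x) = (\<lambda>j. 0)" using dx by simp
  qed simp
  have incl\<xi>: "incl (?\<xi> y) = g (d (Suc n) y)" if y: "y \<in> carrier (P (Suc (Suc n)))" for y
    unfolding restrict_apply'[OF y] using \<xi>'[OF y] by (rule conjunct2)
  have Sucs: "n + 1 = Suc n" "n + 2 = Suc (Suc n)" by simp_all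
  have "pullback_cocycle \<Lambda> sc P d N E.S.M incl proj \<pi> n ?\<xi>"
    unfolding pullback_cocycle_def Sucs
  proof (intro conjI bexI[where x = g] ballI)
    show "?\<xi> \<in> Z (Suc (Suc n))" by (rule Z\<xi>)
    show "proj (g x) = \<pi> (d n x)" if "x \<in> carrier (P (Suc n))" for x by (rule g(2)[OF that])
    show "incl (?\<xi> y) = g (d (Suc n) y)" if "y \<in> carrier (P (Suc (Suc n)))" for y by (rule incl\<xi>[OF that])
  qed (rule g(1))
  thus ?thesis by (rule exI[where x = "?\<xi>"])
qed

end

context realization
begin

text \<open>
  The chain at the end \<open>t\<close>, of length one more than the degree, has a differential that
  is up to sign the same pair in the lower degree, since no arrow acts at the end of the string.
  The paths continuing it span a copy of \<open>M(p)\<close> in the syzygy of the explicit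
  resolution, and \<open>\<sigma>\<close> is its image in the given one.  A cocycle with coordinate
  \<open>\<epsilon>\<close> at this generator, factored through the syzygy, is a retraction.
\<close>

lemma summand_exists:
  "\<exists>\<pi>\<in>rhom \<Lambda> (\<Omega> n) U.S.M. \<exists>\<sigma>\<in>rhom \<Lambda> U.S.M (\<Omega> n). \<forall>x\<in>carrier U.S.M. \<pi> (\<sigma> x) = x"
proof -
  define \<epsilon> :: 'k where "\<epsilon> = (- 1) ^ Suc n"
  have \<epsilon>\<epsilon>: "\<epsilon> * (\<epsilon> * x) = x" for x by (simp add: \<epsilon>_def del: power_Suc)
  have \<epsilon>0: "\<epsilon> \<noteq> 0" by (simp add: \<epsilon>_def)
  let ?\<delta> = "V.nx (V.nx s)"
  have it: "internal T (V.eside t)" using s t by simp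
  have pos0: "arc_of_side T s = V.vx (V.epos t)" using V.arc_eside[of t] t by simp
  have sarc: "s \<in> arcs V.Q" "?\<delta> \<in> arcs V.Q" using s V.internal_nx[OF V.internal_nx[OF s]] by (simp_all add: V.internal_iff)
  have nxn_\<delta>: "V.nxn n s = ?\<delta>"
  proof -
    have "n = 2 + 3 * (n div 3)" using n by presburger
    thus ?thesis using V.nxn_3k[OF s, of 2 "n div 3"] by (simp add: numeral_2_eq_2)
  qed
  have turn: "V.turning (?\<delta> # take k as)" for k
  proof -
    have "V.turning ((?\<delta> # take k as) @ drop k as)" using as(2) by simp
    thus ?thesis unfolding V.turning_append by (rule conjunct1)
  qed
  have sub: "set (?\<delta> # take k as) \<subseteq> arcs V.Q" for k using sarc as(1) set_take_subset[of k as] by auto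
  have hd\<delta>: "head V.Q ?\<delta> = arc_of_side T s" using V.internal_nx3[OF s] by (simp add: V.head_Q)
  have pth: "(arc_of_side T s, take k as) \<in> paths V.Q" for k
    using V.turning_path[OF turn sub, of k] unfolding hd\<delta> .

  (* The pairs b k belong both to degree n and to degree n + 1: in degree n, the last arrow of the chain
     has become the first arrow of the path. *)
  define b where "b k = (V.epos t, V.kap (Suc n) s @ take k as)" for k
  have vF_gen: "V.vF (V.epos t, V.kap (Suc n) s) = arc_of_side T s"
    unfolding V.kap_gens(2)[OF s epos_le(1) pos0] nxn_n[OF s] ..
  have b_Suc: "b k \<in> V.BF (Suc n)" for k
  proof -
    have "V.turning (take k as)" using turn[of k] by (simp add: V.turning_Cons)
    from V.gens_extend[OF V.kap_gens(1)[OF s epos_le(1) pos0, of "Suc n"], unfolded vF_gen, OF pth this]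
    show ?thesis unfolding b_def fst_conv snd_conv .
  qed
  have b_n: "b k \<in> V.BF n" for k
  proof -
    have v\<delta>: "V.vF (V.epos t, V.kap n s) = tail V.Q ?\<delta>"
      unfolding V.kap_gens(2)[OF s epos_le(1) pos0] nxn_\<delta> V.tail_Q ..
    have "(tail V.Q ?\<delta>, [?\<delta>] @ take k as) \<in> paths V.Q"
      unfolding V.paths_append using pth[of k] hd\<delta> sarc V.tail_verts[OF sarc(2)] by (simp add: V.paths_iff V.pend_def)
    thus ?thesis
      using V.gens_extend[OF V.kap_gens(1)[OF s epos_le(1) pos0, of n], of "?\<delta> # take k as"] turn[of k] v\<delta>
      by (simp add: b_def V.kap_snoc nxn_\<delta>)
  qed
  have b_step: "mF_step = b (Suc k)" if "k < length as" "mF_step = (fst (b k), snd (b k) @ [as ! k])" for k mF_step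
    using that by (simp add: b_def take_Suc_conv_app_nth)
  have vF_b: "V.vF (b k) = U.vx k" if k: "k \<le> length as" for k
  proof (cases k)
    case 0
    have "V.vF (b 0) = arc_of_side T s" unfolding b_def take_0 append_Nil2 by (rule vF_gen)
    thus ?thesis using 0 by simp
  next
    case (Suc m)
    thus ?thesis using k by (simp add: b_def V.vF_def take_Suc_conv_app_nth flip: append_assoc)
  qed
  have b_next: "(fst (b k), snd (b k) @ [a]) \<in> V.BF n \<longleftrightarrow> k < length as \<and> as ! k = a"
    if k: "k \<le> length as" and a: "a \<in> arcs V.Q" for k a
  proof
    assume "k < length as \<and> as ! k = a"
    thus "(fst (b k), snd (b k) @ [a]) \<in> V.BF n" using b_n[of "Suc k"] b_step[of k, OF _ refl] by simp
  next
    let ?q = "?\<delta> # take k as"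
    let ?y = "V.kap n s @ (?q @ [a])"
    assume "(fst (b k), snd (b k) @ [a]) \<in> V.BF n"
    hence y: "(V.epos t, ?y) \<in> V.BF n" by (simp add: b_def V.kap_snoc nxn_\<delta>)
    have "V.turning (?q @ [a])" unfolding V.turning_nth
    proof (intro allI impI)
      fix i assume i: "Suc i < length (?q @ [a])"
      have "?y ! Suc (n + i) = V.gl (V.nx (?y ! (n + i)))"
        by (rule V.BF_D(5)[OF y]) (use i in simp_all)
      moreover have "?y ! (n + j) = (?q @ [a]) ! j" for j by (simp add: nth_append)
      from this[of i] this[of "Suc i"] have "?y ! (n + i) = (?q @ [a]) ! i" "?y ! Suc (n + i) = (?q @ [a]) ! Suc i"
        by simp_all
      ultimately show "(?q @ [a]) ! Suc i = V.gl (V.nx ((?q @ [a]) ! i))" by (simp only:)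
    qed
    hence qa: "V.turning (?\<delta> # take k as @ [a])" by simp
    show "k < length as \<and> as ! k = a"
    proof (cases "k < length as")
      case False
      thus ?thesis using maximal[OF a] qa by simp
    next
      case True
      have "V.turning (?\<delta> # take k as @ [as ! k])" using turn[of "Suc k"] True by (simp add: take_Suc_conv_app_nth)
      hence "as ! k = V.gl (V.nx (last (?\<delta> # take k as)))" unfolding append_Cons[symmetric] V.turning_append by simp
      moreover have "a = V.gl (V.nx (last (?\<delta> # take k as)))" using qa unfolding append_Cons[symmetric] V.turning_append by simp
      ultimately show ?thesis using True by (simp only:)
    qed
  qed
  have dF_b: "V.dF n (delta (b k)) = (\<lambda>c. \<epsilon> * delta (b k) c)" for k
  proof -
    have "V.am s (V.epos t) = None" using V.end_not_D[of t] t by simp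
    hence "V.pF (b k) = None" by (simp add: V.pF_def b_def V.kap_Cons)
    thus ?thesis unfolding V.dF_delta[OF b_Suc] V.kF_def using b_n by (simp add: \<epsilon>_def del: power_Suc)
  qed
  have b_closed: "delta (b k) \<in> carrier (V.FM (Suc n))" for k by (rule V.F.delta_closed[OF b_Suc])
  have eb_closed: "(\<lambda>c. \<epsilon> * delta (b k) c) \<in> carrier (V.FM (Suc n))" for k
    using b_closed[of k] by (simp add: V.F.carrier_M)
  have dF_eb: "V.dF n (\<lambda>c. \<epsilon> * delta (b k) c) = delta (b k)" for k
    unfolding two_monomial.hom_scale[OF V.FF V.dF_hom b_closed] dF_b \<epsilon>\<epsilon> ..

  have tX: "(t, False) \<in> VU.X (Suc n)" unfolding X_fan ..
  obtain \<rho> where \<rho>: "\<rho> \<in> VU.Z (Suc n)" "VU.\<Theta> (Suc n) \<rho> (t, False) = \<epsilon>"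
    using VU.onto[of n "\<lambda>_. \<epsilon>"] tX by blast
  have \<rho>r: "\<rho> \<in> rhom \<Lambda> (P (Suc n)) U.S.M" using \<rho>(1) unfolding VU.mem_Z by (rule conjunct1)
  define r where "r m = \<rho> (\<psi> (Suc n) m)" for m
  have r: "r \<in> rhom \<Lambda> (V.FM (Suc n)) U.S.M" unfolding r_def[abs_def] by (rule VU.to_F[OF \<rho>r])
  have gen_b: "gen (Suc n) t = delta (b 0)" by (simp add: gen_def b_def t)
  interpret FU: two_monomial T I "V.BF (Suc n)" V.vF "V.mF (Suc n)" "{..U.len}" U.vx U.am by (rule VU.FN)
  (* The cocycle condition says that s annihilates this value, which confines it to the start of p. *)
  have r_0: "r (delta (b 0)) = (\<lambda>j. \<epsilon> * delta 0 j)"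
  proof
    fix i
    have one: "r (delta (b 0)) 0 = \<epsilon>" using \<rho>(2) by (simp add: VU.\<Theta>_def r_def gen_b)
    have zero: "r (delta (b 0)) i = 0" if "i \<noteq> 0"
    proof (rule ccontr)
      assume nz: "r (delta (b 0)) i \<noteq> 0"
      have i: "i \<le> U.len"
      proof (rule ccontr)
        assume "\<not> i \<le> U.len"
        thus False using rhom_closed[OF r b_closed[of 0]] nz unfolding U.S.carrier_M by simp
      qed
      have "U.vx i = arc_of_side T s" using FU.hom_vertex[OF r b_Suc[of 0] nz] vF_b[of 0] by simp
      hence si: "arc_of_side T s = U.vx i" ..
      show False using s i si
      proof (cases rule: U.trichotomy[case_names D I E])
        case (D j)
        have "r (V.dF (Suc n) (delta (V.epos t, V.kap (Suc (Suc n)) s))) = (\<lambda>j. 0)"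
          unfolding r_def by (rule VU.cocycle_F[OF \<rho>(1)], rule V.F.delta_closed)
            (use V.kap_gens(1)[OF s epos_le(1) pos0, of "Suc (Suc n)"] in \<open>simp add: V.gens_def\<close>)
        from fun_cong[OF this, of j]
        have "(- 1) ^ Suc (Suc n) * U.S.aact s (r (delta (V.epos t, V.kap (Suc n) s))) j = 0"
          using V.end_not_D[of t] unfolding VU.coef_dF[OF r s epos_le(1) pos0] nxn_n[OF s] t by simp
        hence "U.S.aact s (r (delta (b 0))) j = 0" by (simp add: b_def)
        thus False using U.aact_hit[OF D, of "r (delta (b 0))"] nz by simp
      next
        case (I k)
        thus False
        proof (cases rule: U.am_cases)
          case 1
          hence "?\<delta> \<in> set as" using nth_mem[of k as] by simp
          thus False using fan_not_I by simp
        next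
          case 2
          thus False by simp
        qed
      next
        case (E u)
        have "\<not> u" using E(2) U_ends(2) s by (cases u) simp_all
        thus False using E(1) that by simp
      qed
    qed
    show "r (delta (b 0)) i = \<epsilon> * delta 0 i" using one zero by (cases "i = 0") (simp_all add: delta_def)
  qed
  have r_b: "k \<le> length as \<Longrightarrow> r (delta (b k)) = (\<lambda>j. \<epsilon> * delta k j)" for k
  proof (induction k)
    case 0
    show ?case by (rule r_0)
  next
    case (Suc k)
    hence k: "k < length as" by simp
    have a: "as ! k \<in> arcs V.Q" using k as(1) nth_mem[of k as] by auto
    have "V.mF (Suc n) (as ! k) (b k) = Some (b (Suc k))"
      using b_step[OF k refl] b_Suc[of "Suc k"] by (simp add: V.mF_def)
    hence "delta (b (Suc k)) = V.F.aact (Suc n) (as ! k) (delta (b k))"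
      unfolding V.F.aact_delta[OF b_Suc] by simp
    hence "r (delta (b (Suc k))) = U.S.aact (as ! k) (r (delta (b k)))"
      using FU.hom_aact[OF r a b_closed[of k]] by simp
    also have "r (delta (b k)) = (\<lambda>j. \<epsilon> * delta k j)" using Suc by simp
    also have "U.S.aact (as ! k) (\<lambda>j. \<epsilon> * delta k j) = (\<lambda>j. \<epsilon> * U.S.aact (as ! k) (delta k) j)"
      by (simp only: U.S.aact_def lin_scale)
    also have "U.S.aact (as ! k) (delta k) = delta (Suc k)"
      using U.S.aact_delta[of k "as ! k"] U_am[of k "as ! k"] k by simp
    finally show ?case .
  qed

  define \<sigma>0 :: "(nat \<Rightarrow> 'k) \<Rightarrow> nat \<times> 'd list \<Rightarrow> 'k" where "\<sigma>0 = lin {..U.len} (\<lambda>k. odelta (Some (b k)))"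
  interpret UF: two_monomial T I "{..U.len}" U.vx U.am "V.BF n" V.vF "V.mF n" by (rule UF)
  have \<sigma>0: "\<sigma>0 \<in> rhom \<Lambda> U.S.M (V.FM n)" unfolding \<sigma>0_def
  proof (rule UF.partial_map_hom)
    fix k assume "k \<in> {..U.len}"
    hence k: "k \<le> length as" "k \<le> U.len" by simp_all
    show "c \<in> V.BF n \<and> V.vF c = U.vx k" if "Some (b k) = Some c" for c
      using that b_n[of k] vF_b[OF k(1)] by (simp only: option.inject)
    fix a assume a: "a \<in> arcs V.Q"
    show "Option.bind (Some (b k)) (V.mF n a) = Option.bind (U.am a k) (\<lambda>k. Some (b k))"
      unfolding U_am[OF k(2)] Option.bind.bind_lunit V.mF_def b_next[OF k(1) a]
      using b_step[of k, OF _ refl] by (cases "k < length as \<and> as ! k = a") auto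
  qed
  have \<sigma>0_delta: "\<sigma>0 (delta k) = delta (b k)" if "k \<in> {..U.len}" for k
    using lin_delta[OF finite_atMost that, of "\<lambda>k. odelta (Some (b k))"] by (simp add: \<sigma>0_def)
  obtain m where m: "n = Suc m" using n2 by (cases n) simp_all
  have cyc: "V.dF m (\<sigma>0 x) = (\<lambda>c. 0)" if x: "x \<in> carrier U.S.M" for x
  proof -
    interpret Um: two_monomial T I "{..U.len}" U.vx U.am "V.BF m" V.vF "V.mF m" by (rule UF)
    have \<sigma>0m: "\<sigma>0 \<in> rhom \<Lambda> U.S.M (V.FM (Suc m))" using \<sigma>0 unfolding m .
    show ?thesis
    proof (rule Um.hom_eqI[OF rhom_comp[OF \<sigma>0m V.dF_hom] V.F.rhom_null _ x])
      fix k assume k: "k \<in> {..U.len}"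
      have "V.dF m (\<sigma>0 (delta k)) = V.dF m (V.dF (Suc m) (\<lambda>c. \<epsilon> * delta (b k) c))"
        unfolding \<sigma>0_delta[OF k] using dF_eb[of k] unfolding m by (simp only:)
      thus "V.dF m (\<sigma>0 (delta k)) = (\<lambda>c. 0)" unfolding V.dF_dF .
    qed
  qed
  have \<sigma>: "(\<lambda>x. \<psi> n (\<sigma>0 x)) \<in> rhom \<Lambda> U.S.M (\<Omega> n)"
  proof (rule rhom_to_syzygy)
    show "(\<lambda>x. \<psi> n (\<sigma>0 x)) \<in> rhom \<Lambda> U.S.M (P n)" by (rule rhom_comp[OF \<sigma>0 \<psi>(1)])
    fix x assume x: "x \<in> carrier U.S.M"
    have c: "\<sigma>0 x \<in> carrier (V.FM (Suc m))" using rhom_closed[OF \<sigma>0 x] unfolding m .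
    have "d m (\<psi> (Suc m) (\<sigma>0 x)) = \<psi> m \<zero>\<^bsub>V.FM m\<^esub>"
      unfolding \<psi>(2)[OF c] cyc[OF x] V.F.zero_M ..
    also have "\<dots> = \<zero>\<^bsub>P m\<^esub>"
      by (rule rhom_zero[OF \<psi>(1) _ P_abelian]) (use V.F.right_module_M[of m] in \<open>simp add: right_module_def\<close>)
    finally show "\<psi> n (\<sigma>0 x) \<in> cycles V.S.M P d e n"
      using rhom_closed[OF \<psi>(1) c] unfolding m by (simp add: cycles_def)
  qed
  obtain \<pi> where \<pi>: "\<pi> \<in> rhom \<Lambda> (\<Omega> n) U.S.M" "\<And>x. x \<in> carrier (P (Suc n)) \<Longrightarrow> \<pi> (d n x) = \<rho> x"
    using VU.cocycle_factors[OF \<rho>(1)] by blast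
  have comp: "(\<lambda>x. \<pi> (\<psi> n (\<sigma>0 x))) \<in> rhom \<Lambda> U.S.M U.S.M" by (rule rhom_comp[OF \<sigma> \<pi>(1)])
  interpret UU: two_monomial T I "{..U.len}" U.vx U.am "{..U.len}" U.vx U.am
    by (intro two_monomial.intro U.S.monomial_axioms)
  have "\<pi> (\<psi> n (\<sigma>0 x)) = x" if x: "x \<in> carrier U.S.M" for x
  proof (rule UU.hom_eqI[OF comp rhom_id _ x])
    fix k assume k: "k \<in> {..U.len}"
    have "\<pi> (\<psi> n (\<sigma>0 (delta k))) = \<pi> (d n (\<psi> (Suc n) (\<lambda>c. \<epsilon> * delta (b k) c)))"
      unfolding \<sigma>0_delta[OF k] \<psi>(2)[OF eb_closed] dF_eb ..
    also have "\<dots> = r (\<lambda>c. \<epsilon> * delta (b k) c)"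
      unfolding r_def by (rule \<pi>(2)[OF rhom_closed[OF \<psi>(1) eb_closed]])
    also have "\<dots> = (\<lambda>j. \<epsilon> * r (delta (b k)) j)" by (rule FU.hom_scale[OF r b_closed])
    also have "\<dots> = delta k"
    proof -
      have "k \<le> length as" using k by simp
      from r_b[OF this] show ?thesis by (simp only: \<epsilon>\<epsilon>)
    qed
    finally show "\<pi> (\<psi> n (\<sigma>0 (delta k))) = delta k" .
  qed
  thus ?thesis by (intro bexI[OF bexI[OF ballI \<sigma>] \<pi>(1)])
qed

end

section \<open>Extensions of degree four and periodicity\<close>

lemma ends_paired_unique:
  assumes "ends_paired T \<gamma>v \<gamma>w"
  shows "follows_at T \<gamma>v t \<gamma>w a \<Longrightarrow> follows_at T \<gamma>v t \<gamma>w b \<Longrightarrow> a = b"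
    and "follows_at T \<gamma>v a \<gamma>w t \<Longrightarrow> follows_at T \<gamma>v b \<gamma>w t \<Longrightarrow> a = b"
proof -
  have "\<forall>a b. follows_at T \<gamma>v t \<gamma>w a \<longrightarrow> follows_at T \<gamma>v t \<gamma>w b \<longrightarrow> a = b"
    using assms unfolding ends_paired_def all_bool_eq by (cases t) auto
  thus "follows_at T \<gamma>v t \<gamma>w a \<Longrightarrow> follows_at T \<gamma>v t \<gamma>w b \<Longrightarrow> a = b" by (elim allE impE)
  have "\<forall>a b. follows_at T \<gamma>v a \<gamma>w t \<longrightarrow> follows_at T \<gamma>v b \<gamma>w t \<longrightarrow> a = b"
    using assms unfolding ends_paired_def all_bool_eq by (cases t) auto
  thus "follows_at T \<gamma>v a \<gamma>w t \<Longrightarrow> follows_at T \<gamma>v b \<gamma>w t \<Longrightarrow> a = b" by (elim allE impE)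
qed

lemma card_follows:
  assumes "ends_paired T \<gamma>v \<gamma>w"
  shows "card {(t, t'). follows_at T \<gamma>v t \<gamma>w t'} =
    (if case1 T \<gamma>v \<gamma>w then 2 else if case2 T \<gamma>v \<gamma>w then 1 else 0)"
proof -
  let ?f = "\<lambda>t t'. follows_at T \<gamma>v t \<gamma>w t'"
  have "{(t, t'). ?f t t'} = {x. x = (False, False) \<and> ?f False False} \<union> {x. x = (False, True) \<and> ?f False True} \<union>
      ({x. x = (True, False) \<and> ?f True False} \<union> {x. x = (True, True) \<and> ?f True True})" (is "_ = ?S")
  proof (rule Set.set_eqI)
    fix x show "x \<in> {(t, t'). ?f t t'} \<longleftrightarrow> x \<in> ?S" by (cases x; cases "fst x"; cases "snd x") simp_all
  qed
  thus ?thesis using assms unfolding ends_paired_def case2_def case1_def ex_bool_eq all_bool_eq Ex1_def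
    by (cases "?f False False"; cases "?f False True"; cases "?f True False"; cases "?f True True") simp_all
qed

context compared
begin

text \<open>
  Modulo three, one step around the triangle.
\<close>

lemma X_follows: "n mod 3 = 1 \<Longrightarrow> X n = {(t, t'). follows_at T \<gamma>v t \<gamma>w t'}"
proof -
  assume "n mod 3 = 1"
  hence n: "1 + 3 * (n div 3) = n" by presburger
  have "V.nxn n a = V.nx a" if "internal T a" for a
    using V.nxn_3k[OF that, of 1 "n div 3"] unfolding n by simp
  thus ?thesis unfolding X_def follows_at_def by auto
qed

text \<open>
  Since no end is matched twice, the given pair of ends is the only one that belongs to the side at
  the end \<open>t\<close>.
\<close>

lemma induced_class:
  assumes paired: "ends_paired T \<gamma>v \<gamma>w" and follows: "follows_at T \<gamma>v t \<gamma>w t'"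
  shows induced_exists: "\<exists>c. induced_at T v w P d e \<gamma>v t t' c"
    and induced_coordinates: "induced_at T v w P d e \<gamma>v t t' c \<Longrightarrow>
      \<exists>u\<in>Z 4. c = B 4 +>\<^bsub>hom_space \<Lambda> sc (P 4) N\<^esub> u \<and> (\<forall>x\<in>X 4. \<Theta> 4 u x \<noteq> 0 \<longleftrightarrow> x = (t, t'))"
proof -
  let ?s = "V.eside t" and ?\<delta> = "V.nx (V.nx (V.eside t))"
  have s: "internal T ?s" and s': "W.eside t' = V.nx ?s" using follows by (simp_all add: follows_at_def)
  have \<delta>: "?\<delta> \<in> arcs V.Q" "head V.Q ?\<delta> = arc_of_side T ?s"
    using V.internal_nx[OF V.internal_nx[OF s]] V.internal_nx3[OF s] by (simp_all add: V.internal_iff V.head_Q)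
  have alone: "u = t \<and> u' = t'" if "V.eside u = ?s" "W.eside u' = V.nx ?s" for u u'
  proof -
    have "follows_at T \<gamma>v u \<gamma>w t'" "follows_at T \<gamma>v t \<gamma>w u'" using that s s' by (simp_all add: follows_at_def)
    thus ?thesis using ends_paired_unique[OF paired] follows by blast
  qed
  have fan: "\<exists>as. p = (arc_of_side T ?s, map Arr as) \<and> realization T I v w \<gamma>v \<gamma>w P d e \<phi> \<psi> hP hF t' ?s as t 2"
    if p: "arrow_ideal_string V.Q I ?\<delta> p" for p
  proof -
    obtain as where as: "p = (head V.Q ?\<delta>, map Arr as) \<and> set as \<subseteq> arcs V.Q \<and> V.turning (?\<delta> # as) \<and>
        (\<forall>b\<in>arcs V.Q. \<not> V.turning (?\<delta> # as @ [b]))" using V.arrow_ideal_D[OF p \<delta>(1)] ..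
    have "realization T I v w \<gamma>v \<gamma>w P d e \<phi> \<psi> hP hF t' ?s as t 2"
    proof unfold_locales
      show "internal T ?s" by (rule s)
      show "W.eside t' = V.nx ?s" by (rule s')
      show "set as \<subseteq> arcs V.Q" "V.turning (?\<delta> # as)" using as by blast+
      show "\<not> V.turning (?\<delta> # as @ [b])" if "b \<in> arcs V.Q" for b using as that by blast
      show "u = t \<and> u' = t'" if "V.eside u = ?s" "W.eside u' = V.nx ?s" for u u' by (rule alone[OF that])
    qed simp_all
    moreover have "p = (arc_of_side T ?s, map Arr as)" using as unfolding \<delta>(2) by (rule conjunct1)
    ultimately show ?thesis by (intro exI[of _ as] conjI)
  qed
  have numerals: "(4::nat) = Suc (Suc 2)" by simp
  show "\<exists>c. induced_at T v w P d e \<gamma>v t t' c"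
  proof -
    obtain p where p: "arrow_ideal_string V.Q I ?\<delta> p" using V.arrow_ideal_exists[OF \<delta>(1)] ..
    obtain as where as: "p = (arc_of_side T ?s, map Arr as)" "realization T I v w \<gamma>v \<gamma>w P d e \<phi> \<psi> hP hF t' ?s as t 2"
      using fan[OF p] by (elim exE conjE)
    interpret Y: realization T I v w \<gamma>v \<gamma>w P d e \<phi> \<psi> hP hF t' ?s as t 2 by (rule as(2))
    obtain \<pi> \<sigma> where \<pi>: "\<pi> \<in> rhom \<Lambda> (\<Omega> 2) Y.U.S.M" and \<sigma>: "\<sigma> \<in> rhom \<Lambda> Y.U.S.M (\<Omega> 2)" "\<forall>x\<in>carrier Y.U.S.M. \<pi> (\<sigma> x) = x"
      using Y.summand_exists by (elim bexE)
    obtain \<xi> where \<xi>: "pullback_cocycle \<Lambda> sc P d N Y.E.S.M Y.incl Y.proj \<pi> 2 \<xi>" using Y.pullback_exists[OF \<pi>] ..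
    show ?thesis
      unfolding induced_at_def arrow_extension_class_def Let_def V.I_def[symmetric] V.string_module_S W.string_module_S
    proof (intro exI[where x = "Ext_class \<Lambda> sc P d N 4 \<xi>"] exI[where x = p] exI[where x = \<xi>] conjI refl
        bexI[where x = \<pi>] bexI[where x = \<sigma>])
      show "arrow_ideal_string V.Q I ?\<delta> p" by (rule p)
      show "is_string V.Q I (ext_string V.Q w t' ?s p)" unfolding as(1) Y.ext_string_eq by (rule Y.E.is_string)
      show "\<forall>x\<in>carrier (string_module V.Q p). \<pi> (\<sigma> x) = x" unfolding as(1) Y.U.string_module_S by (rule \<sigma>(2))
      show "pullback_cocycle \<Lambda> sc P d N (string_module V.Q (ext_string V.Q w t' ?s p)) (ext_incl w t') (ext_proj w) \<pi> 2 \<xi>"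
        unfolding as(1) Y.ext_string_eq Y.E.string_module_S by (rule \<xi>)
      show "\<sigma> \<in> rhom \<Lambda> (string_module V.Q p) (\<Omega> 2)" unfolding as(1) Y.U.string_module_S by (rule \<sigma>(1))
      show "\<pi> \<in> rhom \<Lambda> (\<Omega> 2) (string_module V.Q p)" unfolding as(1) Y.U.string_module_S by (rule \<pi>)
    qed
  qed
  show "\<exists>u\<in>Z 4. c = B 4 +>\<^bsub>hom_space \<Lambda> sc (P 4) N\<^esub> u \<and> (\<forall>x\<in>X 4. \<Theta> 4 u x \<noteq> 0 \<longleftrightarrow> x = (t, t'))"
    if c: "induced_at T v w P d e \<gamma>v t t' c"
  proof -
    obtain p \<pi> \<sigma> \<xi> where p: "arrow_ideal_string V.Q I ?\<delta> p"
      and \<pi>: "\<pi> \<in> rhom \<Lambda> (\<Omega> 2) (string_module V.Q p)" and \<sigma>: "\<sigma> \<in> rhom \<Lambda> (string_module V.Q p) (\<Omega> 2)"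
      and split: "\<forall>x\<in>carrier (string_module V.Q p). \<pi> (\<sigma> x) = x"
      and \<xi>: "pullback_cocycle \<Lambda> sc P d N (string_module V.Q (ext_string V.Q w t' ?s p)) (ext_incl w t') (ext_proj w) \<pi> 2 \<xi>"
      and c\<xi>: "c = Ext_class \<Lambda> sc P d N 4 \<xi>"
      using c unfolding induced_at_def arrow_extension_class_def Let_def V.I_def[symmetric] V.string_module_S W.string_module_S
      by (elim exE conjE bexE)
    obtain as where as: "p = (arc_of_side T ?s, map Arr as)" "realization T I v w \<gamma>v \<gamma>w P d e \<phi> \<psi> hP hF t' ?s as t 2"
      using fan[OF p] by (elim exE conjE)
    interpret Y: realization T I v w \<gamma>v \<gamma>w P d e \<phi> \<psi> hP hF t' ?s as t 2 by (rule as(2))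
    note U = as(1) Y.U.string_module_S Y.ext_string_eq Y.E.string_module_S
    have Sucs: "(2::nat) + 1 = Suc 2" "2 + 2 = Suc (Suc 2)" by simp_all
    obtain g where \<xi>Z: "\<xi> \<in> Z (Suc (Suc 2))" and g: "g \<in> rhom \<Lambda> (P (Suc 2)) Y.E.S.M"
      "\<forall>x\<in>carrier (P (Suc 2)). Y.proj (g x) = \<pi> (d 2 x)" "\<forall>y\<in>carrier (P (Suc (Suc 2))). Y.incl (\<xi> y) = g (d (Suc 2) y)"
      using \<xi> unfolding pullback_cocycle_def U Sucs by (elim conjE bexE)
    show ?thesis unfolding numerals
    proof (intro bexI[where x = \<xi>] conjI ballI)
      show "c = B (Suc (Suc 2)) +>\<^bsub>hom_space \<Lambda> sc (P (Suc (Suc 2))) N\<^esub> \<xi>"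
        unfolding c\<xi> Ext_class_def numerals ..
      show "\<Theta> (Suc (Suc 2)) \<xi> x \<noteq> 0 \<longleftrightarrow> x = (t, t')" if "x \<in> X (Suc (Suc 2))" for x
        by (rule Y.class_coordinates[OF \<pi>[unfolded U] \<sigma>[unfolded U] bspec[OF split[unfolded U]] g(1) bspec[OF g(2)] \<xi>Z bspec[OF g(3)] that])
      show "\<xi> \<in> Z (Suc (Suc 2))" by (rule \<xi>Z)
    qed
  qed
qed

abbreviation "Ext \<equiv> Ext_space \<Lambda> sc P d N"

lemma coordinates_4: "coordinates (hom_space \<Lambda> sc (P 4) N) (Z 4) (B 4) (X 4) (\<Theta> 4)"
  using coordinates_Ext[of 3] by simp

lemma Ext_periodic: "vs_isomorphic (Ext (4 + 3 * k)) (Ext 4)"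
proof -
  have "X (Suc (3 + 3 * k)) = X 4" using X_follows[of "4 + 3 * k"] X_follows[of 4] by simp
  with coordinates_Ext[of "3 + 3 * k"]
  have "coordinates (hom_space \<Lambda> sc (P (4 + 3 * k)) N) (Z (4 + 3 * k)) (B (4 + 3 * k)) (X 4) (\<Theta> (4 + 3 * k))" by simp
  from coordinates_isomorphic[OF this coordinates_4] show ?thesis unfolding Ext_space_def .
qed

lemma dim_Ext_4:
  assumes "ends_paired T \<gamma>v \<gamma>w"
  shows "has_dim (Ext 4) (if case1 T \<gamma>v \<gamma>w then 2 else if case2 T \<gamma>v \<gamma>w then 1 else 0)"
  using coordinates.has_dim_S[OF coordinates_4] card_follows[OF assms] X_follows[of 4] by (simp add: Ext_space_def)

lemma basis_case1:
  assumes paired: "ends_paired T \<gamma>v \<gamma>w" and r: "\<And>t. follows_at T \<gamma>v t \<gamma>w (t \<noteq> r)"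
    and c: "induced_at T v w P d e \<gamma>v False (False \<noteq> r) c" and c': "induced_at T v w P d e \<gamma>v True (True \<noteq> r) c'"
  shows "c \<noteq> c' \<and> is_basis (Ext 4) {c, c'}"
proof -
  obtain u where u: "u \<in> Z 4" "c = B 4 +>\<^bsub>hom_space \<Lambda> sc (P 4) N\<^esub> u" "\<forall>x\<in>X 4. \<Theta> 4 u x \<noteq> 0 \<longleftrightarrow> x = (False, False \<noteq> r)"
    using induced_coordinates[OF paired r c] by (elim bexE conjE)
  obtain u' where u': "u' \<in> Z 4" "c' = B 4 +>\<^bsub>hom_space \<Lambda> sc (P 4) N\<^esub> u'" "\<forall>x\<in>X 4. \<Theta> 4 u' x \<noteq> 0 \<longleftrightarrow> x = (True, True \<noteq> r)"
    using induced_coordinates[OF paired r c'] by (elim bexE conjE)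
  have X4: "X 4 = {(t, t'). follows_at T \<gamma>v t \<gamma>w t'}" using X_follows[of 4] by simp
  have "X 4 = {(False, False \<noteq> r), (True, True \<noteq> r)}"
  proof (rule Set.set_eqI)
    fix x :: "bool \<times> bool"
    obtain t t' where x: "x = (t, t')" by (cases x)
    have "follows_at T \<gamma>v t \<gamma>w t' \<longleftrightarrow> t' = (t \<noteq> r)"
    proof
      assume "follows_at T \<gamma>v t \<gamma>w t'"
      thus "t' = (t \<noteq> r)" by (rule ends_paired_unique(1)[OF paired _ r])
    next
      assume t': "t' = (t \<noteq> r)"
      show "follows_at T \<gamma>v t \<gamma>w t'" unfolding t' by (rule r)
    qed
    thus "x \<in> X 4 \<longleftrightarrow> x \<in> {(False, False \<noteq> r), (True, True \<noteq> r)}" unfolding X4 x by (cases t) simp_all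
  qed
  note X4 = this
  define U where "U i = (if fst i then u' else u)" for i :: "bool \<times> bool"
  have Z: "U i \<in> Z 4" if "i \<in> X 4" for i using u(1) u'(1) by (simp add: U_def)
  have D: "\<Theta> 4 (U i) x \<noteq> 0 \<longleftrightarrow> x = i" if i: "i \<in> X 4" and x: "x \<in> X 4" for i x
  proof -
    have "i = (False, False \<noteq> r) \<or> i = (True, True \<noteq> r)"
      using i unfolding X4 by (simp only: insert_iff empty_iff simp_thms)
    thus ?thesis
    proof
      assume i: "i = (False, False \<noteq> r)"
      show ?thesis unfolding i U_def fst_conv if_False by (rule bspec[OF u(3) x])
    next
      assume i: "i = (True, True \<noteq> r)"
      show ?thesis unfolding i U_def fst_conv if_True by (rule bspec[OF u'(3) x])
    qed
  qed
  let ?c = "\<lambda>i. B 4 +>\<^bsub>hom_space \<Lambda> sc (P 4) N\<^esub> U i"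
  have image: "?c ` X 4 = {c, c'}"
    unfolding X4 image_insert image_empty U_def fst_conv if_True if_False u(2) u'(2) ..
  have inj: "inj_on ?c (X 4)"
    by (rule coordinates.basis_S(2)[OF coordinates_4]) (erule Z, erule (1) D)
  have basis: "is_basis (subquotient (hom_space \<Lambda> sc (P 4) N) (Z 4) (B 4)) (?c ` X 4)"
    by (rule coordinates.basis_S(1)[OF coordinates_4]) (erule Z, erule (1) D)
  have "c \<noteq> c'"
  proof
    assume "c = c'"
    hence "?c (False, False \<noteq> r) = ?c (True, True \<noteq> r)" unfolding U_def fst_conv if_True if_False u(2) u'(2) .
    hence "(False, False \<noteq> r) = (True, True \<noteq> r)"
      by (rule inj_onD[OF inj]) (simp_all add: X4)
    thus False by (simp only: prod.inject simp_thms)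
  qed
  moreover have "is_basis (Ext 4) {c, c'}"
    using basis unfolding image Ext_space_def .
  ultimately show ?thesis ..
qed

lemma basis_case2:
  assumes paired: "ends_paired T \<gamma>v \<gamma>w" and case2: "case2 T \<gamma>v \<gamma>w" and follows: "follows_at T \<gamma>v t \<gamma>w t'"
    and c: "induced_at T v w P d e \<gamma>v t t' c"
  shows "is_basis (Ext 4) {c}"
proof -
  obtain u where u: "u \<in> Z 4" "c = B 4 +>\<^bsub>hom_space \<Lambda> sc (P 4) N\<^esub> u" "\<forall>x\<in>X 4. \<Theta> 4 u x \<noteq> 0 \<longleftrightarrow> x = (t, t')"
    using induced_coordinates[OF paired follows c] by (elim bexE conjE)
  have X4: "X 4 = {(t, t'). follows_at T \<gamma>v t \<gamma>w t'}" using X_follows[of 4] by simp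
  have "card (X 4) = 1" using card_follows[OF paired] case2 unfolding X4 by (simp add: case2_def)
  moreover have "(t, t') \<in> X 4" using follows unfolding X4 by simp
  moreover obtain y where "X 4 = {y}" using \<open>card (X 4) = 1\<close> by (rule card_1_singletonE)
  ultimately have X4: "X 4 = {(t, t')}" by simp
  have D: "\<Theta> 4 u x \<noteq> 0 \<longleftrightarrow> x = i" if "i \<in> X 4" "x \<in> X 4" for i x
  proof -
    have "i = (t, t')" using that(1) unfolding X4 by (rule singletonD)
    thus ?thesis using bspec[OF u(3) that(2)] by (simp only:)
  qed
  have image: "(\<lambda>_. B 4 +>\<^bsub>hom_space \<Lambda> sc (P 4) N\<^esub> u) ` X 4 = {c}"
    unfolding X4 image_insert image_empty u(2) ..
  have Z: "u \<in> Z 4" if "i \<in> X 4" for i :: "bool \<times> bool" by (rule u(1))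
  have "is_basis (subquotient (hom_space \<Lambda> sc (P 4) N) (Z 4) (B 4)) ((\<lambda>_. B 4 +>\<^bsub>hom_space \<Lambda> sc (P 4) N\<^esub> u) ` X 4)"
    by (rule coordinates.basis_S(1)[OF coordinates_4, of "\<lambda>_. u"]) (erule Z, erule (1) D)
  thus ?thesis unfolding image Ext_space_def .
qed

end

theorem theorem4p5:
  fixes T :: "'d triangulation"
    and v w :: "('d set, 'd) word"
    and \<gamma>v \<gamma>w :: "'d list"
    and \<Lambda> :: "(('d set, 'd) path \<Rightarrow> 'k::alg_closed_field) set ring"
    and I :: "(('d set, 'd) path \<Rightarrow> 'k) set"
    and P :: "nat \<Rightarrow> ((('d set, 'd) path \<Rightarrow> 'k) set, 'p) module"
    and d :: "nat \<Rightarrow> 'p \<Rightarrow> 'p"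
    and e :: "'p \<Rightarrow> nat \<Rightarrow> 'k"
    and Ext :: "nat \<Rightarrow> ('k, ('p \<Rightarrow> nat \<Rightarrow> 'k) set) module"
  assumes T: "ideal_triangulation T"
    and I: "I = gentle_ideal T"
    and \<Lambda>: "\<Lambda> = gentle_algebra T"
    and v: "is_string (quiver T) I v" "indecomposable \<Lambda> (string_module (quiver T) v)"
    and w: "is_string (quiver T) I w" "indecomposable \<Lambda> (string_module (quiver T) w)"
    and \<gamma>v: "arc_of_string T v \<gamma>v"
    and \<gamma>w: "arc_of_string T w \<gamma>w"
    and resolution: "projective_resolution \<Lambda> (string_module (quiver T) v) P d e"
    and Ext: "Ext = Ext_space \<Lambda> (scalar (quiver T) I) P d (string_module (quiver T) w)"
  shows
    "(ends_paired T \<gamma>v \<gamma>w \<longrightarrow>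
        has_dim (Ext 4) (if case1 T \<gamma>v \<gamma>w then 2 else if case2 T \<gamma>v \<gamma>w then 1 else 0) \<and>
        (minimal_projective_resolution \<Lambda> (string_module (quiver T) v) P d e \<longrightarrow>
           (\<forall>r. (\<forall>t. follows_at T \<gamma>v t \<gamma>w (t \<noteq> r)) \<longrightarrow>
              (\<forall>t. \<exists>c. induced_at T v w P d e \<gamma>v t (t \<noteq> r) c) \<and>
              (\<forall>c c'. induced_at T v w P d e \<gamma>v False (False \<noteq> r) c \<longrightarrow>
                      induced_at T v w P d e \<gamma>v True (True \<noteq> r) c' \<longrightarrow>
                      c \<noteq> c' \<and> is_basis (Ext 4) {c, c'})) \<and>
           (case2 T \<gamma>v \<gamma>w \<longrightarrow>
              (\<forall>t t'. follows_at T \<gamma>v t \<gamma>w t' \<longrightarrow>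
                 (\<exists>c. induced_at T v w P d e \<gamma>v t t' c) \<and>
                 (\<forall>c. induced_at T v w P d e \<gamma>v t t' c \<longrightarrow> is_basis (Ext 4) {c}))))) \<and>
     (\<forall>k. vs_isomorphic (Ext (4 + 3 * k)) (Ext 4))"
proof -
  interpret V: arc_string T I v \<gamma>v
    by unfold_locales (use T I v(1) \<gamma>v in simp_all)
  interpret pair T I v w \<gamma>v \<gamma>w
    by unfold_locales (use w(1) \<gamma>w in simp_all)
  have \<Lambda>_eq: "\<Lambda> = V.A Quot I" unfolding assms(3) gentle_algebra_def I ..
  have "resolves (V.A Quot I) V.S.M P d e"
    by (rule projective_resolution_resolves[OF resolution[unfolded \<Lambda>_eq V.string_module_S] V.S.right_module_M])
  from comparison[OF this] obtain \<phi> \<psi> hP hF where "compared T I v w \<gamma>v \<gamma>w P d e \<phi> \<psi> hP hF"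
    by (elim exE)
  then interpret C: compared T I v w \<gamma>v \<gamma>w P d e \<phi> \<psi> hP hF .
  have Ext_eq: "Ext = C.Ext" unfolding Ext \<Lambda>_eq W.string_module_S ..
  show ?thesis unfolding Ext_eq
  proof (intro conjI impI allI)
    show "has_dim (C.Ext 4) (if case1 T \<gamma>v \<gamma>w then 2 else if case2 T \<gamma>v \<gamma>w then 1 else 0)"
      if "ends_paired T \<gamma>v \<gamma>w" by (rule C.dim_Ext_4[OF that])
    show "\<exists>c. induced_at T v w P d e \<gamma>v t (t \<noteq> r) c"
      if "ends_paired T \<gamma>v \<gamma>w" "\<forall>t. follows_at T \<gamma>v t \<gamma>w (t \<noteq> r)" for r t
      by (rule C.induced_exists[OF that(1) spec[OF that(2)]])
    fix r c c'
    assume case1: "ends_paired T \<gamma>v \<gamma>w" "\<forall>t. follows_at T \<gamma>v t \<gamma>w (t \<noteq> r)"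
      "induced_at T v w P d e \<gamma>v False (False \<noteq> r) c" "induced_at T v w P d e \<gamma>v True (True \<noteq> r) c'"
    note basis = C.basis_case1[OF case1(1) spec[OF case1(2)] case1(3,4)]
    show "c \<noteq> c'" using basis by (rule conjunct1)
    show "is_basis (C.Ext 4) {c, c'}" using basis by (rule conjunct2)
  next
    show "\<exists>c. induced_at T v w P d e \<gamma>v t t' c" if "ends_paired T \<gamma>v \<gamma>w" "follows_at T \<gamma>v t \<gamma>w t'" for t t'
      by (rule C.induced_exists[OF that])
    show "is_basis (C.Ext 4) {c}"
      if "ends_paired T \<gamma>v \<gamma>w" "case2 T \<gamma>v \<gamma>w" "follows_at T \<gamma>v t \<gamma>w t'" "induced_at T v w P d e \<gamma>v t t' c" for t t' c
      by (rule C.basis_case2[OF that])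
    show "vs_isomorphic (C.Ext (4 + 3 * k)) (C.Ext 4)" for k by (rule C.Ext_periodic)
  qed
qed

end
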